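(* Let $\Omega\subset\mathbb{R}^d$ be open and let $u:\Omega\to\mathbb{R}$, $u\in L^\infty(\Omega)$, be an entropy solution of $\operatorname{div}[A(u)]=0$ in $\Omega$ such that the genuine nonlinearity condition (GN) holds. Let $\mu$ be its kinetic entropy dissipation measure and $J$ its jump set. Then $$\mu\big((\Omega\setminus\overline{J})\times\mathbb{R}\big)=0,$$ where $\overline J$ is the topological closure of $J$.
   Context: $A:\mathbb{R}\to\mathbb{R}^d$ is a given function and $a=A'$. The equation is $\operatorname{div}[A(u)]=a(u)\cdot\nabla u=0$. Entropy solution: $u\in L^\infty(\Omega)$ is an entropy solution in $\Omega$ if for every convex $\eta:\mathbb{R}\to\mathbb{R}$, with $q:\mathbb{R}\to\mathbb{R}^d$ such that $q_i'(v)=\eta'(v)a_i(v)$ for $i=1,\dots,d$, and every smooth compactly supported $\varphi\ge 0$ in $\Omega$, one has $\int_\Omega q(u)\cdot\nabla\varphi\,dx\ge 0$. (GN): $a$ is $C^1$ and there exist $\alpha\in(0,1]$ and $C>0$ such that for every $\xi\in\mathbb{R}^d$ with $|\xi|=1$ and every $\delta>0$, $|\{v\in I: |a(v)\cdot\xi|<\delta\}|\le C\delta^\alpha$, where $I$ is a closed interval containing the image of $u$. Kinetic measure: let $f(x,v)=1$ if $0<v<u(x)$, $f(x,v)=-1$ if $u(x)<v<0$, and $f(x,v)=0$ otherwise. It is known that $u$ is an entropy solution if and only if there is a nonnegative measure $\mu$ on $\Omega\times\mathbb{R}$ with $a(v)\cdot\nabla_x f=\partial_v\mu$ in the sense of distributions;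 $\mu$ is the kinetic entropy dissipation measure of $u$. Jump set: $J=\left\{x\in\Omega:\limsup_{r\to0}\frac{\mu(B_r(x)\times\mathbb{R})}{r^{d-1}}>0\right\}$. *)

theory Defs
  imports "HOL-Analysis.Analysis"
begin

section \<open>Test functions\<close>

primrec Ck :: "nat \<Rightarrow> ('a::euclidean_space \<Rightarrow> real) \<Rightarrow> bool" where
  "Ck 0 f \<longleftrightarrow> continuous_on UNIV f"
| "Ck (Suc k) f \<longleftrightarrow> (\<forall>x. f differentiable (at x)) \<and>
     (\<forall>b\<in>Basis. Ck k (\<lambda>x. frechet_derivative f (at x) b))"

definition smooth :: "('a::euclidean_space \<Rightarrow> real) \<Rightarrow> bool" where
  "smooth f \<longleftrightarrow> (\<forall>k. Ck k f)"

text \<open>Smooth functions with compact support in the open set \<open>W\<close>, extended by zero to the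
  whole space.\<close>

definition test_function :: "'a::euclidean_space set \<Rightarrow> ('a \<Rightarrow> real) \<Rightarrow> bool" where
  "test_function W \<phi> \<longleftrightarrow>
     smooth \<phi> \<and> compact (closure {x. \<phi> x \<noteq> 0}) \<and> closure {x. \<phi> x \<noteq> 0} \<subseteq> W"

definition grad :: "('a::euclidean_space \<Rightarrow> real) \<Rightarrow> 'a \<Rightarrow> 'a" where
  "grad f x = (\<Sum>b\<in>Basis. frechet_derivative f (at x) b *\<^sub>R b)"

section \<open>Entropy solutions\<close>

definition Linfty :: "'a::euclidean_space set \<Rightarrow> ('a \<Rightarrow> real) \<Rightarrow> bool" where
  "Linfty \<Omega> u \<longleftrightarrow>
     u \<in> borel_measurable (lebesgue_on \<Omega>) \<and> (\<exists>M. AE x in lebesgue_on \<Omega>. \<bar>u x\<bar> \<le> M)"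

text \<open>A convex \<open>\<eta>\<close> may fail to be differentiable on a countable set. Prescribing the derivative of
  a continuous \<open>q\<close> off this set determines \<open>q\<close> up to an additive constant, namely as a primitive
  of \<open>\<eta>' a\<close>.\<close>

definition entropy_pair ::
    "(real \<Rightarrow> 'a::euclidean_space) \<Rightarrow> (real \<Rightarrow> real) \<Rightarrow> (real \<Rightarrow> 'a) \<Rightarrow> bool" where
  "entropy_pair a \<eta> q \<longleftrightarrow> convex_on UNIV \<eta> \<and> continuous_on UNIV q \<and>
     (\<forall>v. \<eta> differentiable (at v) \<longrightarrow> (q has_vector_derivative deriv \<eta> v *\<^sub>R a v) (at v))"

definition entropy_solution ::
    "(real \<Rightarrow> 'a::euclidean_space) \<Rightarrow> 'a set \<Rightarrow> ('a \<Rightarrow> real) \<Rightarrow> bool" where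
  "entropy_solution a \<Omega> u \<longleftrightarrow> Linfty \<Omega> u \<and>
     (\<forall>\<eta> q \<phi>. entropy_pair a \<eta> q \<longrightarrow> test_function \<Omega> \<phi> \<longrightarrow> (\<forall>x. 0 \<le> \<phi> x) \<longrightarrow>
        0 \<le> (LINT x|lebesgue_on \<Omega>. q (u x) \<bullet> grad \<phi> x))"

definition genuinely_nonlinear :: "(real \<Rightarrow> 'a::euclidean_space) \<Rightarrow> real set \<Rightarrow> bool" where
  "genuinely_nonlinear a I \<longleftrightarrow> a C1_differentiable_on UNIV \<and>
     (\<exists>\<alpha> C. 0 < \<alpha> \<and> \<alpha> \<le> 1 \<and> 0 < C \<and>
        (\<forall>\<xi> \<delta>. norm \<xi> = 1 \<longrightarrow> 0 < \<delta> \<longrightarrow>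
           emeasure lborel {v\<in>I. \<bar>a v \<bullet> \<xi>\<bar> < \<delta>} \<le> ennreal (C * \<delta> powr \<alpha>)))"

section \<open>Kinetic formulation\<close>

definition kinetic_function :: "('a \<Rightarrow> real) \<Rightarrow> 'a \<Rightarrow> real \<Rightarrow> real" where
  "kinetic_function u x v =
     (if 0 < v \<and> v < u x then 1 else if u x < v \<and> v < 0 then -1 else 0)"

text \<open>\<open>\<mu>\<close> is a Borel measure on \<open>\<Omega> \<times> \<real>\<close>, finite on compact sets, such that
  \<open>a(v) \<cdot> \<nabla>\<^sub>x f = \<partial>\<^sub>v \<mu>\<close> in the sense of distributions, where \<open>f\<close> is the kinetic function of \<open>u\<close>.
  Both sides, tested against \<open>\<phi>\<close>, acquire a factor \<open>-1\<close>, which is cancelled here.\<close>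

definition kinetic_measure ::
    "(real \<Rightarrow> 'a::euclidean_space) \<Rightarrow> 'a set \<Rightarrow> ('a \<Rightarrow> real) \<Rightarrow> ('a \<times> real) measure \<Rightarrow> bool" where
  "kinetic_measure a \<Omega> u \<mu> \<longleftrightarrow>
     sets \<mu> = sets (restrict_space borel (\<Omega> \<times> UNIV)) \<and>
     (\<forall>K. compact K \<longrightarrow> K \<subseteq> \<Omega> \<times> UNIV \<longrightarrow> emeasure \<mu> K < \<infinity>) \<and>
     (\<forall>\<phi>. test_function (\<Omega> \<times> UNIV) \<phi> \<longrightarrow>
        (LINT p|lebesgue_on (\<Omega> \<times> UNIV).
           kinetic_function u (fst p) (snd p) * (a (snd p) \<bullet> grad (\<lambda>x. \<phi> (x, snd p)) (fst p)))
        = (LINT p|\<mu>. deriv (\<lambda>v. \<phi> (fst p, v)) (snd p)))"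

text \<open>For \<open>x \<in> \<Omega>\<close> with \<open>\<Omega>\<close> open, \<open>ball x r \<subseteq> \<Omega>\<close> for all small \<open>r\<close>; only these matter for the limit.\<close>

definition jump_set :: "'a::euclidean_space set \<Rightarrow> ('a \<times> real) measure \<Rightarrow> 'a set" where
  "jump_set \<Omega> \<mu> = {x\<in>\<Omega>.
     Limsup (at_right 0) (\<lambda>r. emeasure \<mu> (ball x r \<times> UNIV) / ennreal (r ^ (DIM('a) - 1))) > 0}"

end

theory Submission
  imports Defs
begin

text \<open>
  Off the closure of \<open>J\<close> the density of the dissipation vanishes at every point. Blowing up at such
  a point gives solutions of the kinetic equation on the unit ball with arbitrarily small
  dissipation. In the direction \<open>a v\<close> a mollification of the superlevel set \<open>{u > v}\<close> is almost
  constant; by genuine nonlinearity finitely many velocities from a short interval of levels span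
  all directions with polynomial bounds, so a small increase of the level pays for a translation in any
  direction. This compactness replaces velocity averaging: together with an energy estimate for
  the dissipation it drives a De Giorgi iteration, and for every level \<open>w\<close> either \<open>u \<le> w + \<delta>\<close> or
  \<open>u \<ge> w - \<delta>\<close> on a smaller ball. Hence \<open>u\<close> has a continuous representative there.

  For continuous \<open>u\<close>, testing the Kruzhkov entropies with bumps at an exterior tangent ball shows that
  \<open>a v\<close> is tangent to the boundary of \<open>{u > v}\<close> in the proximal sense, so this set and \<open>{u < v}\<close> are
  invariant under the flow of \<open>a v\<close>, and the kinetic function solves the free transport equation.
  The measure of a slab of levels is then zero: test with a ramp in \<open>v\<close> that decreases
  arbitrarily slowly.
\<close>

subsection \<open>Smooth functions\<close>

text \<open>Raising the level only shrinks a superlevel set, so every comparison is one-sided: a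
  higher level at one point or scale against a lower level at another. The estimates are therefore
  stated for \<open>ennreal\<close> of a difference, which drops the negative part, and the opposite
  bound comes from the reflection u -> -u, v -> -v. A translation by rho that raises the level by s
  costs rho * s^(-Q) times terms of size h / rho and h^(-3), where h is the width of the mollifier
  in v. With h ~ s^(Q+1) and rho ~ s^(4Q+4) this is O(s). Along s = sigma / 2^j both the level
  increase and the error sum to O(sigma), so rho can be sent to 0 at a cost proportional to sigma
  and to the measure of the superlevel set. The iteration then runs on a linear recursion whose
  factor sigma makes small. A merely continuous u gives {u > v} no normal at most boundary points.
  Touching balls exist at nearest points, and there a time step adds to the squared distance only a
  term quadratic in the step, which vanishes in the limit.\<close>

lemma Ck_Suc_imp: "Ck (Suc k) f \<Longrightarrow> Ck k f"
proof (induction k arbitrary: f)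
  case 0
  then show ?case
    by (auto intro!: continuous_at_imp_continuous_on differentiable_imp_continuous_within)
next
  case (Suc k)
  then show ?case by (metis Ck.simps(2))
qed

lemma Ck_SucI:
  assumes "\<And>x. (f has_derivative f' x) (at x)" and "\<And>b. b \<in> Basis \<Longrightarrow> Ck k (\<lambda>x. f' x b)"
  shows "Ck (Suc k) f"
proof -
  have "frechet_derivative f (at x) = f' x" for x
    using assms(1) frechet_derivative_at by metis
  then show ?thesis
    using assms by (auto simp: differentiable_def)
qed

lemma Ck_SucE:
  assumes "Ck (Suc k) f"
  obtains f' where "\<And>x. (f has_derivative f' x) (at x)" "\<And>b. b \<in> Basis \<Longrightarrow> Ck k (\<lambda>x. f' x b)"
proof
  show "(f has_derivative frechet_derivative f (at x)) (at x)" for x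
    using assms by (simp add: frechet_derivative_works)
  show "Ck k (\<lambda>x. frechet_derivative f (at x) b)" if "b \<in> Basis" for b
    using assms that by simp
qed

lemma Ck_const: "Ck k (\<lambda>x. c)"
proof (induction k arbitrary: c)
  case (Suc k)
  show ?case by (rule Ck_SucI[where f'="\<lambda>x h. 0"]) (auto simp: Suc)
qed simp

lemma Ck_add:
  assumes "Ck k f" "Ck k g"
  shows "Ck k (\<lambda>x. f x + g x)"
  using assms
proof (induction k arbitrary: f g)
  case (Suc k)
  obtain f' where f': "\<And>x. (f has_derivative f' x) (at x)" "\<And>b. b \<in> Basis \<Longrightarrow> Ck k (\<lambda>x. f' x b)"
    using Ck_SucE[OF Suc.prems(1)] by blast
  obtain g' where g': "\<And>x. (g has_derivative g' x) (at x)" "\<And>b. b \<in> Basis \<Longrightarrow> Ck k (\<lambda>x. g' x b)"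
    using Ck_SucE[OF Suc.prems(2)] by blast
  show ?case
    by (rule Ck_SucI[where f'="\<lambda>x h. f' x h + g' x h"])
       (auto intro!: has_derivative_add f' g' Suc.IH)
qed (auto intro!: continuous_intros)

lemma Ck_mult:
  assumes "Ck k f" "Ck k g"
  shows "Ck k (\<lambda>x. f x * g x)"
  using assms
proof (induction k arbitrary: f g)
  case (Suc k)
  obtain f' where f': "\<And>x. (f has_derivative f' x) (at x)" "\<And>b. b \<in> Basis \<Longrightarrow> Ck k (\<lambda>x. f' x b)"
    using Ck_SucE[OF Suc.prems(1)] by blast
  obtain g' where g': "\<And>x. (g has_derivative g' x) (at x)" "\<And>b. b \<in> Basis \<Longrightarrow> Ck k (\<lambda>x. g' x b)"
    using Ck_SucE[OF Suc.prems(2)] by blast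
  have fg: "Ck k f" "Ck k g"
    using Suc.prems Ck_Suc_imp by blast+
  show ?case
    by (rule Ck_SucI[where f'="\<lambda>x h. f x * g' x h + f' x h * g x"])
       (intro has_derivative_mult f' g' Ck_add Suc.IH fg; assumption)+
qed (auto intro!: continuous_intros)

lemma Ck_sum: "(\<And>i. i \<in> A \<Longrightarrow> Ck k (f i)) \<Longrightarrow> Ck k (\<lambda>x. \<Sum>i\<in>A. f i x)"
  by (induction A rule: infinite_finite_induct) (auto simp: Ck_const Ck_add)

lemma Ck_inner: "Ck k (\<lambda>x. (x - c) \<bullet> b)"
proof (cases k)
  case (Suc k')
  show ?thesis
    unfolding Suc by (rule Ck_SucI[where f'="\<lambda>x h. h \<bullet> b"]) (auto intro!: derivative_eq_intros Ck_const)
qed (auto intro!: continuous_intros)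

text \<open>\<open>Ck\<close> speaks of partial derivatives in basis directions only. The condition
  on \<open>L\<close> makes the chain rule produce a multiple of a single partial derivative of f,
  so that the induction closes; projections and dilations satisfy it.\<close>

lemma Ck_linear_compose:
  fixes l :: "'a::euclidean_space \<Rightarrow> 'b::euclidean_space"
  assumes "Ck k f" "\<And>x. (l has_derivative L) (at x)"
    "\<And>b. b \<in> Basis \<Longrightarrow> L b = 0 \<or> (\<exists>b'\<in>Basis. \<exists>t. L b = t *\<^sub>R b')"
  shows "Ck k (\<lambda>x. f (l x))"
  using assms(1)
proof (induction k arbitrary: f)
  case 0
  have "continuous_on UNIV l"
    using assms(2) by (auto intro!: continuous_at_imp_continuous_on has_derivative_continuous)
  then show ?case
    using 0 continuous_on_compose2[of UNIV f UNIV l] by auto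
next
  case (Suc k)
  obtain f' where f': "\<And>x. (f has_derivative f' x) (at x)" "\<And>b. b \<in> Basis \<Longrightarrow> Ck k (\<lambda>x. f' x b)"
    using Ck_SucE[OF Suc.prems(1)] by blast
  have lin: "linear (f' x)" for x
    using f'(1) has_derivative_linear by blast
  have "Ck k (\<lambda>x. f' (l x) (L b))" if "b \<in> Basis" for b
    using assms(3)[OF that]
  proof
    assume "L b = 0"
    then show ?thesis using lin by (simp add: linear_0 Ck_const)
  next
    assume "\<exists>b'\<in>Basis. \<exists>t. L b = t *\<^sub>R b'"
    then obtain b' t where "b' \<in> Basis" "L b = t *\<^sub>R b'" by blast
    then show ?thesis
      using lin by (auto simp: linear_cmul intro!: Ck_mult Ck_const Suc.IH f')
  qed
  then show ?case
    using diff_chain_at[OF assms(2) f'(1)]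
    by (intro Ck_SucI[where f'="\<lambda>x h. f' (l x) (L h)"]) (auto simp: o_def)
qed

lemma smooth_mult: "smooth f \<Longrightarrow> smooth g \<Longrightarrow> smooth (\<lambda>x. f x * g x)"
  by (simp add: smooth_def Ck_mult)

lemma smooth_fst:
  fixes f :: "'a::euclidean_space \<Rightarrow> real"
  assumes "smooth f"
  shows "smooth (\<lambda>p::'a\<times>'b::euclidean_space. f (fst p))"
proof -
  have "fst b = 0 \<or> (\<exists>b'\<in>Basis. \<exists>t. fst b = t *\<^sub>R b')" if "b \<in> Basis" for b :: "'a \<times> 'b"
    using that by (auto simp: Basis_prod_def) (metis scaleR_one)
  then show ?thesis
    using assms has_derivative_fst[OF has_derivative_ident] unfolding smooth_def
    by (intro allI Ck_linear_compose[where L=fst]) auto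
qed

lemma smooth_snd:
  fixes f :: "'b::euclidean_space \<Rightarrow> real"
  assumes "smooth f"
  shows "smooth (\<lambda>p::'a::euclidean_space\<times>'b. f (snd p))"
proof -
  have "snd b = 0 \<or> (\<exists>b'\<in>Basis. \<exists>t. snd b = t *\<^sub>R b')" if "b \<in> Basis" for b :: "'a \<times> 'b"
    using that by (auto simp: Basis_prod_def) (metis scaleR_one)
  then show ?thesis
    using assms has_derivative_snd[OF has_derivative_ident] unfolding smooth_def
    by (intro allI Ck_linear_compose[where L=snd]) auto
qed

lemma smooth_affine:
  fixes f :: "'a::euclidean_space \<Rightarrow> real"
  assumes "smooth f"
  shows "smooth (\<lambda>x. f (r *\<^sub>R (x - c)))"
proof -
  have d: "((\<lambda>x. r *\<^sub>R (x - c)) has_derivative (\<lambda>h. r *\<^sub>R h)) (at x)" for x :: 'a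
    by (auto intro!: derivative_eq_intros)
  show ?thesis
    using assms unfolding smooth_def by (intro allI Ck_linear_compose[OF _ d]) auto
qed

lemma smooth_has_derivative:
  assumes "smooth f"
  shows "(f has_derivative frechet_derivative f (at x)) (at x)"
  using assms[unfolded smooth_def, rule_format, of 1] by (simp add: frechet_derivative_works)

lemma smooth_has_real_derivative:
  fixes f :: "real \<Rightarrow> real"
  assumes "smooth f"
  shows "(f has_real_derivative deriv f x) (at x)"
proof -
  have "f differentiable (at x)"
    using smooth_has_derivative[OF assms] differentiable_def by blast
  then show ?thesis
    using DERIV_deriv_iff_real_differentiable by blast
qed

lemma smooth_continuous: "smooth f \<Longrightarrow> continuous_on A f"
  unfolding smooth_def using Ck.simps(1) continuous_on_subset by blast

lemma smooth_continuous_frechet: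
  assumes "smooth f" "b \<in> Basis"
  shows "continuous_on A (\<lambda>x. frechet_derivative f (at x) b)"
  using assms(1)[unfolded smooth_def, rule_format, of 1] assms(2) continuous_on_subset by fastforce

lemma smooth_continuous_grad:
  assumes "smooth f"
  shows "continuous_on A (grad f)"
  unfolding grad_def by (intro continuous_intros smooth_continuous_frechet assms)

lemma smooth_continuous_deriv:
  fixes f :: "real \<Rightarrow> real"
  assumes "smooth f"
  shows "continuous_on A (deriv f)"
proof -
  have "deriv f x = frechet_derivative f (at x) 1" for x
  proof -
    have "(f has_derivative (\<lambda>h. deriv f x * h)) (at x)"
      using smooth_has_real_derivative[OF assms] by (simp add: has_field_derivative_def)
    from frechet_derivative_at[OF this] show ?thesis by (metis mult.right_neutral)
  qed
  then show ?thesis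
    using smooth_continuous_frechet[OF assms, of 1 A] by simp
qed

lemma grad_inner:
  assumes "(f has_derivative f') (at x)"
  shows "grad f x \<bullet> h = f' h"
proof -
  have "linear f'" using assms has_derivative_linear by blast
  then have "f' h = (\<Sum>b\<in>Basis. f' ((h \<bullet> b) *\<^sub>R b))"
    by (metis euclidean_representation linear_sum)
  also have "\<dots> = (\<Sum>b\<in>Basis. (h \<bullet> b) * f' b)"
    using \<open>linear f'\<close> by (simp add: linear_cmul)
  finally show ?thesis
    using frechet_derivative_at[OF assms]
    by (simp add: grad_def inner_sum_left inner_commute[of h] mult.commute)
qed

lemma grad_eqI:
  assumes "(f has_derivative (\<lambda>h. g \<bullet> h)) (at x)"
  shows "grad f x = g"
  using grad_inner[OF assms] by (metis vector_eq_rdot)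

lemma has_derivative_grad:
  "smooth f \<Longrightarrow> (f has_derivative (\<lambda>h. grad f x \<bullet> h)) (at x)"
  using grad_inner[OF smooth_has_derivative] smooth_has_derivative by (metis (no_types, lifting) ext)

subsection \<open>Bump functions\<close>

text \<open>The family \<open>exp (- 1 / t) / t ^ m\<close> is closed under differentiation up to linear combinations, which
  gives smoothness by induction.\<close>

definition hh :: "nat \<Rightarrow> real \<Rightarrow> real" where
  "hh m t = (if 0 < t then exp (- 1 / t) / t ^ m else 0)"

lemma hh_nonneg: "0 \<le> hh m t"
  by (simp add: hh_def)

lemma hh_pos: "0 < t \<Longrightarrow> 0 < hh m t"
  by (simp add: hh_def)

lemma hh_eq_0: "t \<le> 0 \<Longrightarrow> hh m t = 0"
  by (simp add: hh_def)

lemma hh_0_le_1: "hh 0 t \<le> 1"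
  by (simp add: hh_def)

text \<open>A single term of the exponential series at \<open>1 / t\<close> is at most the whole
  sum.\<close>

lemma hh_le_fact: "hh m t \<le> fact m"
proof (cases "0 < t")
  case True
  have "(1/t) ^ m / fact m \<le> exp (1/t)"
  proof -
    have "(\<Sum>n\<in>{m}. inverse (fact n) *\<^sub>R (1/t)^n) \<le> exp (1/t)"
      unfolding exp_def using True
      by (intro sum_le_suminf summable_exp_generic) auto
    then show ?thesis by (simp add: field_simps)
  qed
  then have "exp (-(1/t)) * (1/t)^m \<le> fact m"
    using True by (simp add: exp_minus field_simps)
  then show ?thesis using True by (simp add: hh_def field_simps power_divide)
qed (simp add: hh_def)

lemma hh_Suc_mult: "hh m t = t * hh (Suc m) t"
  by (simp add: hh_def field_simps)

lemma hh_deriv: "(hh m has_real_derivative hh (m + 2) t - real m * hh (m + 1) t) (at t)"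
proof -
  consider "0 < t" | "t < 0" | "t = 0" by linarith
  then show ?thesis
  proof cases
    case 1
    have "((\<lambda>t. exp (- 1 / t) / t ^ m) has_real_derivative hh (m + 2) t - real m * hh (m + 1) t) (at t)"
    proof (cases m)
      case 0
      with 1 show ?thesis
        by (auto intro!: derivative_eq_intros simp: hh_def field_simps power2_eq_square)
    next
      case (Suc n)
      with 1 show ?thesis
        by (auto intro!: derivative_eq_intros simp: hh_def divide_simps)
           (cases n; simp add: algebra_simps power2_eq_square)
    qed
    then show ?thesis
      by (rule DERIV_cong_ev[THEN iffD1, rotated 3])
         (use 1 in \<open>auto simp: hh_def eventually_nhds intro!: exI[of _ "{0<..}"]\<close>)
  next
    case 2
    have "((\<lambda>t. 0) has_real_derivative 0) (at t)" by simp
    then have "(hh m has_real_derivative 0) (at t)"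
      by (rule DERIV_cong_ev[THEN iffD1, rotated 3])
         (use 2 in \<open>auto simp: hh_def eventually_nhds intro!: exI[of _ "{..<0}"]\<close>)
    then show ?thesis using 2 by (simp add: hh_def)
  next
    case 3
    have "((\<lambda>h. hh m h / h) \<longlongrightarrow> 0) (at 0)"
    proof (rule Lim_null_comparison)
      show "((\<lambda>h. fact (m + 2) * \<bar>h\<bar>) \<longlongrightarrow> (0::real)) (at 0)"
        by (auto intro!: tendsto_eq_intros)
      have "norm (hh m h / h) \<le> fact (m + 2) * \<bar>h\<bar>" for h
      proof -
        \<comment> \<open>At the origin two factors h are split off by raising the index by two. The
          remaining factor is bounded, so the difference quotient is O(|h|).\<close>
        have "hh m h = h * (h * hh (m + 2) h)"
          using hh_Suc_mult[of m h] hh_Suc_mult[of "Suc m" h] by simp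
        then have "norm (hh m h / h) = \<bar>h\<bar> * hh (m + 2) h"
          by (simp add: abs_mult hh_nonneg del: power_Suc)
        also have "\<dots> \<le> \<bar>h\<bar> * fact (m + 2)"
          by (intro mult_left_mono hh_le_fact) auto
        finally show ?thesis by (simp only: mult.commute)
      qed
      then show "\<forall>\<^sub>F h in at 0. norm (hh m h / h) \<le> fact (m + 2) * \<bar>h\<bar>" by simp
    qed
    then show ?thesis
      using 3 by (simp add: has_field_derivative_iff hh_eq_0)
  qed
qed

lemma hh_0_deriv: "(hh 0 has_real_derivative hh 2 t) (at t)"
  using hh_deriv[of 0 t] by (simp add: numeral_2_eq_2)

lemma hh_0_mono: "s \<le> t \<Longrightarrow> hh 0 s \<le> hh 0 t"
  by (rule DERIV_nonneg_imp_nondecreasing[of s t]) (use hh_0_deriv hh_nonneg in blast)+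

lemma Ck_hh: "(\<And>k. Ck k p) \<Longrightarrow> Ck k (\<lambda>x. hh m (p x))"
proof (induction k arbitrary: m)
  case 0
  have "continuous_on UNIV (hh m)"
    using hh_deriv by (intro continuous_at_imp_continuous_on) (blast intro: DERIV_isCont)
  then show ?case
    using 0[of 0] continuous_on_compose2[of UNIV "hh m" UNIV p] by auto
next
  case (Suc k)
  obtain p' where p': "\<And>x. (p has_derivative p' x) (at x)" "\<And>b. b \<in> Basis \<Longrightarrow> Ck k (\<lambda>x. p' x b)"
    using Ck_SucE[OF Suc.prems[of "Suc k"]] by blast
  show ?case
  proof (rule Ck_SucI)
    show "((\<lambda>x. hh m (p x)) has_derivative
        (\<lambda>h. (hh (m + 2) (p x) + (- real m) * hh (m + 1) (p x)) * p' x h)) (at x)" for x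
      using diff_chain_at[OF p'(1) hh_deriv[of m "p x", unfolded has_field_derivative_def]]
      by (simp add: o_def)
    show "Ck k (\<lambda>x. (hh (m + 2) (p x) + (- real m) * hh (m + 1) (p x)) * p' x b)" if "b \<in> Basis" for b
      by (intro Ck_mult Ck_add Ck_const Suc.IH Suc.prems p' that)
  qed
qed

text \<open>The squared norm keeps the function smooth at the centre. The parameter e measures the
  rise in squared distance: the value is \<open>exp (- 1)\<close> where R^2 - |x - c|^2 equals e and
  at least 3/4 where it is 4 e or more. Both serve as lower bounds later, against a gradient of size
  at most 4 R / e.\<close>

definition bump :: "'a::euclidean_space \<Rightarrow> real \<Rightarrow> real \<Rightarrow> 'a \<Rightarrow> real" where
  "bump c R e x = hh 0 ((R\<^sup>2 - (norm (x - c))\<^sup>2) / e)"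

lemma smooth_bump: "smooth (bump c R e)"
proof -
  have "Ck k (\<lambda>x::'a. (R\<^sup>2 + (-1) * (\<Sum>b\<in>Basis. ((x - c) \<bullet> b) * ((x - c) \<bullet> b))) * inverse e)" for k
    by (intro Ck_mult Ck_add Ck_const Ck_sum Ck_inner)
  then have "Ck k (\<lambda>x::'a. hh 0 ((R\<^sup>2 + (-1) * (\<Sum>b\<in>Basis. ((x - c) \<bullet> b) * ((x - c) \<bullet> b))) * inverse e))" for k
    by (rule Ck_hh)
  moreover have "bump c R e = (\<lambda>x::'a. hh 0 ((R\<^sup>2 + (-1) * (\<Sum>b\<in>Basis. ((x - c) \<bullet> b) * ((x - c) \<bullet> b))) * inverse e))"
    by (rule ext) (simp add: bump_def divide_inverse power2_norm_eq_inner euclidean_inner[of "x - c" "x - c" for x])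
  ultimately show ?thesis by (simp add: smooth_def)
qed

lemma bump_has_derivative:
  "(bump c R e has_derivative
     (\<lambda>h. (- (2 / e) * hh 2 ((R\<^sup>2 - (norm (x - c))\<^sup>2) / e)) *\<^sub>R (x - c) \<bullet> h)) (at x)"
proof -
  have *: "((\<lambda>x. (R\<^sup>2 - (norm (x - c))\<^sup>2) * inverse e) has_derivative
      (\<lambda>h. - (2 * inverse e) * ((x - c) \<bullet> h))) (at x)"
    unfolding power2_norm_eq_inner
    by (auto intro!: derivative_eq_intros ext simp: inner_commute)
  show ?thesis
    using diff_chain_at[OF * hh_0_deriv[unfolded has_field_derivative_def]]
    by (simp add: o_def bump_def[abs_def] mult_ac divide_inverse)
qed

lemma grad_bump:
  "grad (bump c R e) x = (- (2 / e) * hh 2 ((R\<^sup>2 - (norm (x - c))\<^sup>2) / e)) *\<^sub>R (x - c)"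
  by (rule grad_eqI[OF bump_has_derivative])

lemma bump_nonneg: "0 \<le> bump c R e x"
  by (simp add: bump_def hh_nonneg)

lemma bump_le_1: "bump c R e x \<le> 1"
  by (simp add: bump_def hh_0_le_1)

lemma bump_pos: "0 < e \<Longrightarrow> norm (x - c) < R \<Longrightarrow> 0 < bump c R e x"
  unfolding bump_def by (intro hh_pos divide_pos_pos) (auto simp: power_strict_mono)

lemma bump_eq_0: "0 < e \<Longrightarrow> 0 \<le> R \<Longrightarrow> R \<le> norm (x - c) \<Longrightarrow> bump c R e x = 0"
  unfolding bump_def by (intro hh_eq_0 divide_nonpos_pos) (auto simp: power_mono)

lemma grad_bump_eq_0: "0 < e \<Longrightarrow> 0 \<le> R \<Longrightarrow> R \<le> norm (x - c) \<Longrightarrow> grad (bump c R e) x = 0"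
  unfolding grad_bump by (simp add: hh_eq_0 power_mono divide_nonpos_pos)

lemma bump_support: "0 < e \<Longrightarrow> 0 \<le> R \<Longrightarrow> bump c R e x \<noteq> 0 \<Longrightarrow> x \<in> ball c R"
  using bump_eq_0[of e R x c] by (cases "R \<le> norm (x - c)") (simp_all add: dist_norm norm_minus_commute)

lemma norm_grad_bump:
  assumes "0 < e" "0 \<le> R"
  shows "norm (grad (bump c R e) x) \<le> 4 * R / e"
proof (cases "norm (x - c) \<le> R")
  case True
  have "2 / e * hh 2 ((R\<^sup>2 - (norm (x - c))\<^sup>2) / e) * norm (x - c) \<le> 2 / e * 2 * R"
    using True assms hh_le_fact[of 2] hh_nonneg
    by (intro mult_mono) (auto simp: fact_numeral)
  then show ?thesis using assms by (simp add: grad_bump hh_nonneg abs_mult)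
next
  case False
  then show ?thesis using assms by (simp add: grad_bump_eq_0)
qed

lemma test_functionI:
  assumes "smooth f" "\<And>x. f x \<noteq> 0 \<Longrightarrow> x \<in> K" "compact K" "K \<subseteq> W"
  shows "test_function W f"
proof -
  have "closure {x. f x \<noteq> 0} \<subseteq> K"
    using assms by (intro closure_minimal) (auto simp: compact_imp_closed)
  then show ?thesis
    using assms compact_closure bounded_subset[OF compact_imp_bounded[OF assms(3)]] closure_subset
    unfolding test_function_def by (metis dual_order.trans)
qed

lemma test_function_bump:
  assumes "0 < e" "0 \<le> R" "cball c R \<subseteq> W"
  shows "test_function W (bump c R e)"
  by (rule test_functionI[OF smooth_bump _ compact_cball assms(3)])
     (use bump_support[OF assms(1,2)] ball_subset_cball in blast)

lemma grad_outside_support: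
  assumes "x \<notin> closure {x. f x \<noteq> 0}"
  shows "grad f x = 0"
proof (rule grad_eqI)
  have "(f has_derivative (\<lambda>h. 0)) (at x)"
  proof (rule has_derivative_transform_within_open[where f="\<lambda>x. 0"])
    show "open (- closure {x. f x \<noteq> 0})" by (rule open_Compl) (rule closed_closure)
    show "x \<in> - closure {x. f x \<noteq> 0}" using assms by simp
    show "0 = f y" if "y \<in> - closure {x. f x \<noteq> 0}" for y
      using that closure_subset[of "{x. f x \<noteq> 0}"] by auto
  qed simp
  then show "(f has_derivative (\<lambda>h. 0 \<bullet> h)) (at x)" by simp
qed

lemma grad_test_function_outside: "test_function W f \<Longrightarrow> x \<notin> W \<Longrightarrow> grad f x = 0"
  by (rule grad_outside_support) (auto simp: test_function_def)

subsection \<open>Mollifiers\<close>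

lemma nn_integral_affine:
  fixes f :: "'a::euclidean_space \<Rightarrow> ennreal"
  assumes [measurable]: "f \<in> borel_measurable borel" and c: "c \<noteq> 0"
  shows "(\<integral>\<^sup>+x. f x \<partial>lborel) = ennreal (\<bar>c\<bar> ^ DIM('a)) * (\<integral>\<^sup>+x. f (t + c *\<^sub>R x) \<partial>lborel)"
  by (subst lborel_affine[OF c, of t]) (simp add: nn_integral_density nn_integral_distr nn_integral_cmult)

lemma integral_affine:
  fixes f :: "'a::euclidean_space \<Rightarrow> 'b::{banach, second_countable_topology}"
  assumes [measurable]: "f \<in> borel_measurable borel" and c: "c \<noteq> 0"
  shows "(LINT x|lborel. f x) = (\<bar>c\<bar> ^ DIM('a)) *\<^sub>R (LINT x|lborel. f (t + c *\<^sub>R x))"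
  by (subst lborel_affine[OF c, of t]) (simp add: integral_density integral_distr)

lemma integrable_affine:
  fixes f :: "'a::euclidean_space \<Rightarrow> 'b::{banach, second_countable_topology}"
  assumes "integrable lborel f" and c: "c \<noteq> 0"
  shows "integrable lborel (\<lambda>x. f (t + c *\<^sub>R x))"
proof -
  have [measurable]: "f \<in> borel_measurable borel" using assms by auto
  have "(\<integral>\<^sup>+x. norm (f x) \<partial>lborel) < \<infinity>" using assms(1) by (simp add: integrable_iff_bounded)
  then have "(\<integral>\<^sup>+x. norm (f (t + c *\<^sub>R x)) \<partial>lborel) < \<infinity>"
    using c by (subst (asm) nn_integral_affine[OF _ c, of _ t]) (auto simp: ennreal_mult_less_top)
  then show ?thesis by (simp add: integrable_iff_bounded)
qed

lemma nn_integral_minus: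
  fixes f :: "'a::euclidean_space \<Rightarrow> ennreal"
  assumes [measurable]: "f \<in> borel_measurable borel"
  shows "(\<integral>\<^sup>+x. f (t - x) \<partial>lborel) = (\<integral>\<^sup>+x. f x \<partial>lborel)"
  using nn_integral_affine[of f "-1" t] by simp

lemma nn_integral_plus:
  fixes f :: "'a::euclidean_space \<Rightarrow> ennreal"
  assumes [measurable]: "f \<in> borel_measurable borel"
  shows "(\<integral>\<^sup>+x. f (x + t) \<partial>lborel) = (\<integral>\<^sup>+x. f x \<partial>lborel)"
  using nn_integral_affine[of f 1 t] by (simp add: add.commute)

lemma integral_minus:
  fixes f :: "'a::euclidean_space \<Rightarrow> 'b::{banach, second_countable_topology}"
  assumes [measurable]: "f \<in> borel_measurable borel"
  shows "(LINT x|lborel. f (t - x)) = (LINT x|lborel. f x)"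
  using integral_affine[of f "-1" t] by simp

lemma integrable_bounded_support:
  fixes f :: "'a::euclidean_space \<Rightarrow> 'b::{banach, second_countable_topology}"
  assumes "f \<in> borel_measurable borel" "\<And>x. norm (f x) \<le> B" "\<And>x. x \<notin> ball c r \<Longrightarrow> f x = 0"
  shows "integrable lborel f"
  by (rule integrableI_bounded_set[where A="ball c r" and B=B])
     (use assms emeasure_lborel_ball_finite[of c r] in auto)

definition bmass :: "'a::euclidean_space itself \<Rightarrow> real" where
  "bmass _ = (LINT z|lborel. bump (0::'a) 1 1 z)"

text \<open>With e equal to the square of the radius the bump depends on z / \<rho> only, so this is
  the standard mollifier of unit mass at scale \<rho>.\<close>

definition kern :: "real \<Rightarrow> 'a::euclidean_space \<Rightarrow> real" where
  "kern \<rho> z = bump 0 \<rho> (\<rho>\<^sup>2) z / (\<rho> ^ DIM('a) * bmass TYPE('a))"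

lemma borel_measurable_bump [measurable]: "bump c R e \<in> borel_measurable borel"
  by (intro borel_measurable_continuous_onI smooth_continuous smooth_bump)

lemma bump_integrable: "0 < e \<Longrightarrow> 0 \<le> R \<Longrightarrow> integrable lborel (bump c R e)"
  by (rule integrable_bounded_support[where B=1 and c=c and r=R])
     (use bump_support[of e R c] in \<open>auto simp: bump_nonneg bump_le_1\<close>)

lemma bmass_pos: "0 < bmass TYPE('a::euclidean_space)"
proof -
  have "(LINT z|lborel. bump (0::'a) 1 1 z) \<noteq> 0"
  proof
    assume "(LINT z|lborel. bump (0::'a) 1 1 z) = 0"
    then have "AE z in lborel. bump (0::'a) 1 1 z = 0"
      by (subst (asm) integral_nonneg_eq_0_iff_AE) (auto simp: bump_integrable bump_nonneg)
    then have "AE z::'a in lborel. z \<notin> ball 0 1"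
      by eventually_elim (use bump_pos[of 1 _ "0::'a" 1] in force)
    then have "emeasure lborel (ball (0::'a) 1) = 0"
      by (subst (asm) AE_iff_measurable[of "ball 0 1"]) auto
    then show False
      using content_ball_gt_0_iff[of "0::'a" 1] by (simp add: measure_def)
  qed
  moreover have "0 \<le> (LINT z|lborel. bump (0::'a) 1 1 z)"
    by (intro Bochner_Integration.integral_nonneg) (simp add: bump_nonneg)
  ultimately show ?thesis by (simp add: bmass_def)
qed

lemma kern_nonneg: "0 \<le> \<rho> \<Longrightarrow> 0 \<le> kern \<rho> (z::'a::euclidean_space)"
  using bmass_pos[where 'a='a] by (simp add: kern_def bump_nonneg)

lemma kern_le: "0 < \<rho> \<Longrightarrow> kern \<rho> (z::'a::euclidean_space) \<le> 1 / (\<rho> ^ DIM('a) * bmass TYPE('a))"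
  using bmass_pos[where 'a='a] by (simp add: kern_def divide_right_mono bump_le_1)

lemma kern_eq_0: "0 < \<rho> \<Longrightarrow> \<rho> \<le> norm z \<Longrightarrow> kern \<rho> z = 0"
  by (simp add: kern_def bump_eq_0)

lemma borel_measurable_kern [measurable]: "kern \<rho> \<in> borel_measurable borel"
  unfolding kern_def[abs_def] by measurable

lemma kern_integrable: "0 < \<rho> \<Longrightarrow> integrable lborel (kern \<rho> :: 'a::euclidean_space \<Rightarrow> real)"
  unfolding kern_def[abs_def] by (intro integrable_divide bump_integrable) auto

lemma integral_kern:
  assumes "0 < \<rho>"
  shows "(LINT z|lborel. kern \<rho> (z::'a::euclidean_space)) = 1"
proof -
  have "(LINT z|lborel. bump 0 \<rho> (\<rho>\<^sup>2) (z::'a)) = \<rho> ^ DIM('a) * (LINT z|lborel. bump 0 \<rho> (\<rho>\<^sup>2) (\<rho> *\<^sub>R z::'a))"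
    using assms by (subst integral_affine[where t=0 and c=\<rho>]) auto
  also have "(\<lambda>z. bump 0 \<rho> (\<rho>\<^sup>2) (\<rho> *\<^sub>R z::'a)) = bump 0 1 1"
    using assms by (auto simp: bump_def fun_eq_iff power_mult_distrib field_simps)
       (simp add: diff_divide_distrib)
  finally show ?thesis
    using assms bmass_pos[where 'a='a] by (simp add: kern_def[abs_def] bmass_def)
qed

lemma nn_integral_kern:
  assumes "0 < \<rho>"
  shows "(\<integral>\<^sup>+z. ennreal (kern \<rho> (z::'a::euclidean_space)) \<partial>lborel) = 1"
  using assms by (simp add: nn_integral_eq_integral kern_integrable kern_nonneg integral_kern)

lemma nn_integral_kern_shift:
  assumes "0 < \<rho>"
  shows "(\<integral>\<^sup>+x. ennreal (kern \<rho> (x - y::'a::euclidean_space)) \<partial>lborel) = 1"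
    and "(\<integral>\<^sup>+y. ennreal (kern \<rho> (x - y::'a::euclidean_space)) \<partial>lborel) = 1"
  using nn_integral_plus[of "\<lambda>z. ennreal (kern \<rho> z)" "-y"] nn_integral_minus[of "\<lambda>z. ennreal (kern \<rho> z)" x]
    nn_integral_kern[OF assms, where 'a='a] by auto

definition gkern :: "real \<Rightarrow> 'a::euclidean_space \<Rightarrow> 'a" where
  "gkern \<rho> z = (1 / (\<rho> ^ DIM('a) * bmass TYPE('a))) *\<^sub>R grad (bump 0 \<rho> (\<rho>\<^sup>2)) z"

lemma kern_has_derivative: "(kern \<rho> has_derivative (\<lambda>h. gkern \<rho> z \<bullet> h)) (at z)"
proof -
  have "(bump 0 \<rho> (\<rho>\<^sup>2) has_derivative (\<lambda>h. grad (bump 0 \<rho> (\<rho>\<^sup>2)) z \<bullet> h)) (at z)"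
    by (rule has_derivative_grad[OF smooth_bump])
  from has_derivative_mult_right[OF this, of "1 / (\<rho> ^ DIM('a) * bmass TYPE('a))"]
  show ?thesis
    by (simp add: kern_def[abs_def] gkern_def)
qed

lemma continuous_on_gkern: "continuous_on A (gkern \<rho>)"
  unfolding gkern_def[abs_def] by (intro continuous_intros smooth_continuous_grad smooth_bump)

lemma borel_measurable_gkern [measurable]: "gkern \<rho> \<in> borel_measurable borel"
  by (intro borel_measurable_continuous_onI continuous_on_gkern)

lemma norm_gkern_le:
  assumes "0 < \<rho>"
  shows "norm (gkern \<rho> (z::'a::euclidean_space)) \<le> 4 / (\<rho> ^ Suc DIM('a) * bmass TYPE('a))"
proof -
  have "norm (gkern \<rho> z) = (1 / (\<rho> ^ DIM('a) * bmass TYPE('a))) * norm (grad (bump 0 \<rho> (\<rho>\<^sup>2)) z)"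
    using assms bmass_pos[where 'a='a] by (simp add: gkern_def)
  also have "\<dots> \<le> (1 / (\<rho> ^ DIM('a) * bmass TYPE('a))) * (4 * \<rho> / \<rho>\<^sup>2)"
    using assms bmass_pos[where 'a='a] by (intro mult_left_mono norm_grad_bump) auto
  also have "\<dots> = 4 / (\<rho> ^ Suc DIM('a) * bmass TYPE('a))"
    using assms by (simp add: power2_eq_square field_simps)
  finally show ?thesis .
qed

lemma gkern_eq_0: "0 < \<rho> \<Longrightarrow> \<rho> \<le> norm z \<Longrightarrow> gkern \<rho> z = 0"
  by (simp add: gkern_def grad_bump_eq_0)

text \<open>The gradient of \<open>kern \<rho>\<close> has size at most 4 / (\<rho>^(d+1) * bmass)
  on a ball of volume proportional to \<rho>^d; its L1 norm is thus at most this constant divided by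
  \<rho>.\<close>

definition gconst :: "'a::euclidean_space itself \<Rightarrow> real" where
  "gconst _ = 4 * unit_ball_vol (real DIM('a)) / bmass TYPE('a)"

lemma gconst_nonneg: "0 \<le> gconst TYPE('a::euclidean_space)"
  using bmass_pos[where 'a='a] by (simp add: gconst_def)

lemma nn_integral_gkern:
  assumes "0 < \<rho>"
  shows "(\<integral>\<^sup>+z. ennreal (norm (gkern \<rho> (z::'a::euclidean_space))) \<partial>lborel) \<le> ennreal (gconst TYPE('a) / \<rho>)"
proof -
  let ?B = "4 / (\<rho> ^ Suc DIM('a) * bmass TYPE('a))"
  have B: "0 \<le> ?B" using assms bmass_pos[where 'a='a] by simp
  have "(\<integral>\<^sup>+z. ennreal (norm (gkern \<rho> (z::'a))) \<partial>lborel)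
      \<le> (\<integral>\<^sup>+z. ennreal ?B * indicator (ball 0 \<rho>) (z::'a) \<partial>lborel)"
  proof (intro nn_integral_mono)
    fix z :: 'a
    show "ennreal (norm (gkern \<rho> z)) \<le> ennreal ?B * indicator (ball 0 \<rho>) z"
      using norm_gkern_le[OF assms, of z] gkern_eq_0[OF assms, of z]
      by (cases "norm z < \<rho>") (auto intro!: ennreal_leI)
  qed
  also have "\<dots> = ennreal ?B * emeasure lborel (ball (0::'a) \<rho>)"
    by (rule nn_integral_cmult_indicator) simp
  also have "\<dots> = ennreal (?B * (unit_ball_vol (real DIM('a)) * \<rho> ^ DIM('a)))"
    using assms B by (subst ennreal_mult) (auto simp: emeasure_ball ennreal_mult)
  also have "?B * (unit_ball_vol (real DIM('a)) * \<rho> ^ DIM('a)) = gconst TYPE('a) / \<rho>"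
    using assms by (simp add: gconst_def field_simps)
  finally show ?thesis .
qed

lemma nn_integral_gkern_shift:
  assumes "0 < \<rho>"
  shows "(\<integral>\<^sup>+x. ennreal (norm (gkern \<rho> (x - y::'a::euclidean_space))) \<partial>lborel) \<le> ennreal (gconst TYPE('a) / \<rho>)"
    and "(\<integral>\<^sup>+y. ennreal (norm (gkern \<rho> (x - y::'a::euclidean_space))) \<partial>lborel) \<le> ennreal (gconst TYPE('a) / \<rho>)"
  using nn_integral_plus[of "\<lambda>z. ennreal (norm (gkern \<rho> z))" "-y"]
    nn_integral_minus[of "\<lambda>z. ennreal (norm (gkern \<rho> z))" x]
    nn_integral_gkern[OF assms, where 'a='a] by auto

lemma smooth_kern_shift: "smooth (\<lambda>y. kern \<rho> (x - y))"
proof -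
  have "(\<lambda>y. kern \<rho> (x - y)) = (\<lambda>y. bump x \<rho> (\<rho>\<^sup>2) y * (1 / (\<rho> ^ DIM('a) * bmass TYPE('a))))"
    by (auto simp: kern_def bump_def norm_minus_commute)
  moreover have "smooth (\<lambda>y::'a. (1 / (\<rho> ^ DIM('a) * bmass TYPE('a))))"
    by (simp add: smooth_def Ck_const)
  ultimately show ?thesis
    by (simp only: smooth_mult[OF smooth_bump])
qed

lemma grad_kern_shift: "grad (\<lambda>y. kern \<rho> (x - y)) y = - gkern \<rho> (x - y)"
proof (rule grad_eqI)
  have "((\<lambda>y. x - y) has_derivative (\<lambda>h. - h)) (at y)" by (auto intro!: derivative_eq_intros)
  from diff_chain_at[OF this kern_has_derivative]
  show "((\<lambda>y. kern \<rho> (x - y)) has_derivative (\<lambda>h. - gkern \<rho> (x - y) \<bullet> h)) (at y)"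
    by (simp add: o_def)
qed

lemma grad_mult:
  assumes "smooth f" "smooth g"
  shows "grad (\<lambda>x. f x * g x) x = f x *\<^sub>R grad g x + g x *\<^sub>R grad f x"
proof (rule grad_eqI)
  show "((\<lambda>x. f x * g x) has_derivative (\<lambda>h. (f x *\<^sub>R grad g x + g x *\<^sub>R grad f x) \<bullet> h)) (at x)"
    using has_derivative_mult[OF has_derivative_grad[OF assms(1)] has_derivative_grad[OF assms(2)], of x]
    by (simp add: inner_add_left mult.commute)
qed

lemma grad_eq_deriv:
  fixes f :: "real \<Rightarrow> real"
  assumes "smooth f"
  shows "grad f x = deriv f x"
proof (rule grad_eqI)
  show "(f has_derivative (\<bullet>) (deriv f x)) (at x)"
    using smooth_has_real_derivative[OF assms] by (simp add: has_field_derivative_def inner_real_def[abs_def])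
qed

lemma deriv_kern_shift_le:
  assumes "0 < h"
  shows "\<bar>deriv (\<lambda>w. kern h (v - w)) w\<bar> \<le> 4 / bmass TYPE(real) / h\<^sup>2 * indicator {v - h..v + h} w"
proof -
  have "deriv (\<lambda>w. kern h (v - w)) w = - gkern h (v - w)"
    using grad_kern_shift[of h v w] grad_eq_deriv[OF smooth_kern_shift[of h v]] by simp
  then show ?thesis
    using norm_gkern_le[OF assms, of "v - w"] gkern_eq_0[OF assms, of "v - w"] assms
    by (auto simp: indicator_def power2_eq_square field_simps split: if_splits)
qed

subsection \<open>The kinetic equation and its smoothing estimate\<close>

text \<open>No integrability is assumed: the Bochner integral of a non-integrable function is
  0.\<close>

lemma norm_integral_le_nn:
  fixes f :: "'a \<Rightarrow> 'b::{banach, second_countable_topology}"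
  shows "ennreal (norm (integral\<^sup>L M f)) \<le> (\<integral>\<^sup>+x. ennreal (norm (f x)) \<partial>M)"
proof (cases "integrable M f")
  case True
  then show ?thesis by (rule integral_norm_bound_ennreal)
qed (simp add: not_integrable_integral_eq)

text \<open>The entropy flux of an entropy with derivative \<zeta>. The integral starts at minus
  infinity, whereas the kinetic function counts from 0; the difference is a constant vector, which
  is invisible to a test gradient (\<open>integral_grad_test\<close>).\<close>

definition flux :: "(real \<Rightarrow> 'a::euclidean_space) \<Rightarrow> (real \<Rightarrow> real) \<Rightarrow> real \<Rightarrow> 'a" where
  "flux a \<zeta> s = (LINT w|lborel. (if w < s then \<zeta> w *\<^sub>R a w else 0))"

text \<open>The kinetic equation at unit scale, tested with products only. The measure lives on the
  whole space and is finite; outside the ball it is unconstrained.\<close>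

definition kinetic_on ::
    "(real \<Rightarrow> 'a::euclidean_space) \<Rightarrow> real set \<Rightarrow> real \<Rightarrow> ('a \<Rightarrow> real) \<Rightarrow> ('a \<times> real) measure \<Rightarrow> bool" where
  "kinetic_on a I D u \<mu> \<longleftrightarrow> u \<in> borel_measurable borel \<and> range u \<subseteq> I \<and>
     sets \<mu> = sets borel \<and> finite_measure \<mu> \<and>
     (\<forall>\<phi> \<zeta>. test_function (ball 0 D) \<phi> \<longrightarrow> test_function UNIV \<zeta> \<longrightarrow>
        (LINT y|lborel. flux a \<zeta> (u y) \<bullet> grad \<phi> y)
          = (LINT p|\<mu>. \<phi> (fst p) * deriv \<zeta> (snd p)))"

text \<open>A smoothed indicator of s > v: \<open>U h v (u x)\<close> is the mollification in v of
  the indicator of v < u x, equal to 0 for \<open>u x \<le> v - h\<close> and to 1 for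
  \<open>v + h \<le> u x\<close>.\<close>

definition U :: "real \<Rightarrow> real \<Rightarrow> real \<Rightarrow> real" where
  "U h v s = (LINT w|lborel. (if w < s then kern h (v - w) else 0))"

lemma integrable_U: "0 < h \<Longrightarrow> integrable lborel (\<lambda>w. if w < s then kern h (v - w :: real) else 0)"
  by (rule integrable_bounded_support[where B="1 / (h ^ DIM(real) * bmass TYPE(real))" and c=v and r=h])
     (use kern_le[of h "v - w" for w] kern_nonneg[of h "v - w" for w] kern_eq_0[of h "v - w" for w]
        bmass_pos[where 'a=real] in
      \<open>auto simp: dist_real_def\<close>)

lemma U_nonneg: "0 < h \<Longrightarrow> 0 \<le> U h v s"
  unfolding U_def by (intro Bochner_Integration.integral_nonneg) (simp add: kern_nonneg)

lemma U_eq: "U h v s = (LINT w|lborel. (if v - s < w then kern h w else 0))"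
  unfolding U_def
  by (subst integral_minus[of _ v, symmetric]) (auto intro!: Bochner_Integration.integral_cong)

lemma U_le_1:
  assumes "0 < h"
  shows "U h v s \<le> 1"
proof -
  have "U h v s \<le> (LINT w|lborel. kern h (w::real))"
    unfolding U_eq
    by (intro integral_mono' kern_integrable assms) (use assms in \<open>auto simp: kern_nonneg\<close>)
  then show ?thesis using integral_kern[OF assms, where 'a=real] by simp
qed

lemma U_antimono:
  assumes "0 < h" "v \<le> v'"
  shows "U h v' s \<le> U h v s"
proof -
  have "integrable lborel (\<lambda>w. if v - s < w then kern h (w::real) else 0)"
    by (rule Bochner_Integration.integrable_bound[OF kern_integrable[OF assms(1)]]) auto
  then show ?thesis
    unfolding U_eq using assms by (intro integral_mono') (auto simp: kern_nonneg)
qed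

lemma U_eq_0: "0 < h \<Longrightarrow> s \<le> v - h \<Longrightarrow> U h v s = 0"
  unfolding U_def using kern_eq_0[of h "v - w" for w] by (intro integral_eq_zero_AE) auto

lemma U_eq_1: 
  assumes "0 < h" "v + h \<le> s"
  shows "U h v s = 1"
proof -
  have "(\<lambda>w. if v - s < w then kern h (w::real) else 0) = kern h"
    using assms kern_eq_0[of h "w::real" for w] by (auto simp: fun_eq_iff)
  then show ?thesis unfolding U_eq using integral_kern[OF assms(1)] by simp
qed

lemma borel_measurable_U [measurable]: "U h v \<in> borel_measurable borel"
  unfolding U_def[abs_def] by measurable

definition conv :: "('a::euclidean_space \<Rightarrow> real) \<Rightarrow> real \<Rightarrow> 'a \<Rightarrow> real" where
  "conv b \<rho> x = (LINT y|lborel. b y * kern \<rho> (x - y))"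

text \<open>The derivative of \<open>conv b \<rho>\<close> in direction e, written with the
  derivative already on the kernel; \<open>conv_increment\<close> makes the connection.\<close>

definition gconv :: "('a::euclidean_space \<Rightarrow> real) \<Rightarrow> real \<Rightarrow> 'a \<Rightarrow> 'a \<Rightarrow> real" where
  "gconv b \<rho> e x = (LINT y|lborel. b y * (e \<bullet> gkern \<rho> (x - y)))"

lemma borel_measurable_gconv [measurable]:
  assumes [measurable]: "b \<in> borel_measurable borel"
  shows "gconv b \<rho> e \<in> borel_measurable borel"
  unfolding gconv_def[abs_def] by measurable

lemma borel_measurable_conv [measurable]:
  assumes [measurable]: "b \<in> borel_measurable borel"
  shows "conv b \<rho> \<in> borel_measurable borel"
  unfolding conv_def[abs_def] by measurable

lemma integrable_conv:
  fixes b :: "'a::euclidean_space \<Rightarrow> real"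
  assumes [measurable]: "b \<in> borel_measurable borel" and "\<And>y. \<bar>b y\<bar> \<le> 1" "0 < \<rho>"
  shows "integrable lborel (\<lambda>y. b y * kern \<rho> (x - y))"
proof (rule integrable_bounded_support[where c=x and r=\<rho>])
  show "norm (b y * kern \<rho> (x - y)) \<le> 1 * (1 / (\<rho> ^ DIM('a) * bmass TYPE('a)))" for y
    unfolding real_norm_def abs_mult
    using assms kern_le[of \<rho> "x - y"] kern_nonneg[of \<rho> "x - y"] by (intro mult_mono) auto
qed (use assms kern_eq_0[of \<rho> "x - y" for y] in \<open>auto simp: dist_norm\<close>)

lemma kern_increment:
  "kern \<rho> (x + w - y) - kern \<rho> (x - y)
     = (LINT \<tau>|lborel. indicator {0..1} \<tau> *\<^sub>R (w \<bullet> gkern \<rho> (x + \<tau> *\<^sub>R w - y)))"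
proof -
  have d: "((\<lambda>\<tau>. x + \<tau> *\<^sub>R w - y) has_derivative (\<lambda>h. h *\<^sub>R w)) (at \<tau>)" for \<tau>
    by (auto intro!: derivative_eq_intros)
  have "((\<lambda>\<tau>. kern \<rho> (x + \<tau> *\<^sub>R w - y)) has_vector_derivative w \<bullet> gkern \<rho> (x + \<tau> *\<^sub>R w - y)) (at \<tau>)" for \<tau>
    using diff_chain_at[OF d kern_has_derivative]
    by (simp add: o_def has_vector_derivative_def inner_commute)
  then have "(LINT \<tau>|lborel. indicator {0..1} \<tau> *\<^sub>R (w \<bullet> gkern \<rho> (x + \<tau> *\<^sub>R w - y)))
      = kern \<rho> (x + 1 *\<^sub>R w - y) - kern \<rho> (x + 0 *\<^sub>R w - y)"
    by (intro integral_FTC_Icc)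
       (auto intro!: continuous_intros continuous_on_compose2[OF continuous_on_gkern[of UNIV]]
          intro: has_vector_derivative_at_within)
  then show ?thesis by simp
qed

text \<open>The fundamental theorem is applied to the kernel along the segment from x to x + w, and
  Fubini moves the integral over the segment outside.\<close>

lemma conv_increment:
  fixes b :: "'a::euclidean_space \<Rightarrow> real"
  assumes [measurable]: "b \<in> borel_measurable borel" and b: "\<And>y. \<bar>b y\<bar> \<le> 1" and \<rho>: "0 < \<rho>"
  shows "ennreal \<bar>conv b \<rho> (x + w) - conv b \<rho> x\<bar>
           \<le> (\<integral>\<^sup>+\<tau>. indicator {0..1} \<tau> * ennreal \<bar>gconv b \<rho> w (x + \<tau> *\<^sub>R w)\<bar> \<partial>lborel)"
proof -
  let ?f = "\<lambda>y \<tau>. b y * (indicator {0..1} \<tau> * (w \<bullet> gkern \<rho> (x + \<tau> *\<^sub>R w - y)))"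
  let ?B = "norm w * (4 / (\<rho> ^ Suc DIM('a) * bmass TYPE('a)))"
  have B: "\<bar>w \<bullet> gkern \<rho> z\<bar> \<le> ?B" for z
    using Cauchy_Schwarz_ineq2[of w "gkern \<rho> z"] norm_gkern_le[OF \<rho>, of z]
    by (meson mult_left_mono norm_ge_zero order_trans)
  have "integrable (lborel \<Otimes>\<^sub>M lborel) (\<lambda>(y, \<tau>). ?f y \<tau>)"
    unfolding lborel_prod
  proof (rule integrable_bounded_support[where B="?B" and c="(x, 0)" and r="norm w + \<rho> + 2"])
    show "norm (case p of (y, \<tau>) \<Rightarrow> ?f y \<tau>) \<le> ?B" for p
    proof -
      have "\<bar>b y\<bar> * (indicator {0..1} \<tau> * \<bar>w \<bullet> gkern \<rho> z\<bar>) \<le> 1 * (1 * ?B)" for y \<tau> z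
        using b B by (intro mult_mono) (auto simp: indicator_def)
      then show ?thesis by (cases p) (auto simp: abs_mult)
    qed
    show "(case p of (y, \<tau>) \<Rightarrow> ?f y \<tau>) = 0" if "p \<notin> ball (x, 0) (norm w + \<rho> + 2)" for p
    proof (cases p)
      case (Pair y \<tau>)
      show ?thesis
      proof (cases "0 \<le> \<tau> \<and> \<tau> \<le> 1")
        case True
        have "norm ((x, 0) - p) \<le> norm (x - y) + \<bar>\<tau>\<bar>"
          using norm_Pair_le[of "x - y" "-\<tau>"] by (simp add: Pair)
        then have "norm w + \<rho> \<le> norm (x - y)"
          using that True by (simp add: dist_norm)
        moreover have "norm (x - y) \<le> norm (x + \<tau> *\<^sub>R w - y) + norm (\<tau> *\<^sub>R w)"
          using norm_triangle_ineq4[of "x + \<tau> *\<^sub>R w - y" "\<tau> *\<^sub>R w"] by (simp add: algebra_simps)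
        moreover have "norm (\<tau> *\<^sub>R w) \<le> norm w"
          using True by (simp add: mult_left_le_one_le)
        ultimately show ?thesis
          using gkern_eq_0[OF \<rho>, of "x + \<tau> *\<^sub>R w - y"] Pair by auto
      qed (auto simp: Pair)
    qed
  qed (unfold borel_prod[symmetric], measurable)
  note I = this
  have "conv b \<rho> (x + w) - conv b \<rho> x = (LINT y|lborel. b y * (kern \<rho> (x + w - y) - kern \<rho> (x - y)))"
    unfolding conv_def using integrable_conv[OF assms] by (simp add: right_diff_distrib)
  also have "\<dots> = (LINT y|lborel. LINT \<tau>|lborel. ?f y \<tau>)"
    by (simp add: kern_increment)
  also have "\<dots> = (LINT \<tau>|lborel. LINT y|lborel. ?f y \<tau>)"
    using lborel_pair.Fubini_integral[OF I] by simp
  also have "\<dots> = (LINT \<tau>|lborel. indicator {0..1} \<tau> * gconv b \<rho> w (x + \<tau> *\<^sub>R w))"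
  proof (rule Bochner_Integration.integral_cong)
    fix \<tau> :: real
    have "?f y \<tau> = indicator {0..1} \<tau> * (b y * (w \<bullet> gkern \<rho> (x + \<tau> *\<^sub>R w - y)))" for y by simp
    then show "(LINT y|lborel. ?f y \<tau>) = indicator {0..1} \<tau> * gconv b \<rho> w (x + \<tau> *\<^sub>R w)"
      unfolding gconv_def by (simp only: integral_mult_right_zero)
  qed simp
  finally have "ennreal \<bar>conv b \<rho> (x + w) - conv b \<rho> x\<bar>
      \<le> (\<integral>\<^sup>+\<tau>. ennreal (norm (indicator {0..1} \<tau> * gconv b \<rho> w (x + \<tau> *\<^sub>R w))) \<partial>lborel)"
    using norm_integral_le_nn[of lborel "\<lambda>\<tau>. indicator {0..1} \<tau> * gconv b \<rho> w (x + \<tau> *\<^sub>R w)"] by simp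
  also have "\<dots> = (\<integral>\<^sup>+\<tau>. indicator {0..1} \<tau> * ennreal \<bar>gconv b \<rho> w (x + \<tau> *\<^sub>R w)\<bar> \<partial>lborel)"
    by (intro nn_integral_cong) (simp add: abs_mult ennreal_mult ennreal_indicator)
  finally show ?thesis .
qed

lemma gconv_scale: "gconv b \<rho> (t *\<^sub>R e) x = t * gconv b \<rho> e x"
  unfolding gconv_def by (simp add: mult.left_commute)

text \<open>By translation invariance every point of the segment contributes the same L1 norm of
  \<open>gconv\<close>. The pointwise variant \<open>conv_increment_sup\<close> needs the bound
  along the whole segment instead.\<close>

lemma conv_increment_L1:
  fixes b :: "'a::euclidean_space \<Rightarrow> real"
  assumes [measurable]: "b \<in> borel_measurable borel" and b: "\<And>y. \<bar>b y\<bar> \<le> 1" and \<rho>: "0 < \<rho>"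
  shows "(\<integral>\<^sup>+x. ennreal \<bar>conv b \<rho> (x + t *\<^sub>R e) - conv b \<rho> x\<bar> \<partial>lborel)
           \<le> ennreal \<bar>t\<bar> * (\<integral>\<^sup>+x. ennreal \<bar>gconv b \<rho> e x\<bar> \<partial>lborel)"
proof -
  let ?g = "\<lambda>x. ennreal \<bar>gconv b \<rho> e x\<bar>"
  have "(\<integral>\<^sup>+x. ennreal \<bar>conv b \<rho> (x + t *\<^sub>R e) - conv b \<rho> x\<bar> \<partial>lborel)
      \<le> (\<integral>\<^sup>+x. \<integral>\<^sup>+\<tau>. indicator {0..1} \<tau> * (ennreal \<bar>t\<bar> * ?g (x + \<tau> *\<^sub>R (t *\<^sub>R e))) \<partial>lborel \<partial>lborel)"
    using conv_increment[OF assms, of _ "t *\<^sub>R e"]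
    by (intro nn_integral_mono) (simp add: gconv_scale abs_mult ennreal_mult)
  also have "\<dots> = (\<integral>\<^sup>+\<tau>. \<integral>\<^sup>+x. indicator {0..1} \<tau> * (ennreal \<bar>t\<bar> * ?g (x + \<tau> *\<^sub>R (t *\<^sub>R e))) \<partial>lborel \<partial>lborel)"
    by (rule lborel_pair.Fubini') measurable
  also have "\<dots> = (\<integral>\<^sup>+\<tau>. indicator {0..1} (\<tau>::real) * (ennreal \<bar>t\<bar> * (\<integral>\<^sup>+x. ?g x \<partial>lborel)) \<partial>lborel)"
    using nn_integral_plus[of ?g] by (intro nn_integral_cong) (simp add: nn_integral_cmult)
  also have "\<dots> = ennreal \<bar>t\<bar> * (\<integral>\<^sup>+x. ?g x \<partial>lborel)"
    by (simp add: nn_integral_multc)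
  finally show ?thesis .
qed

lemma conv_increment_sup:
  fixes b :: "'a::euclidean_space \<Rightarrow> real"
  assumes "b \<in> borel_measurable borel" and b: "\<And>y. \<bar>b y\<bar> \<le> 1" and \<rho>: "0 < \<rho>"
    and E: "\<And>\<tau>. \<tau> \<in> {0..1} \<Longrightarrow> ennreal \<bar>gconv b \<rho> e (x + \<tau> *\<^sub>R (t *\<^sub>R e))\<bar> \<le> ennreal E" and "0 \<le> E"
  shows "\<bar>conv b \<rho> (x + t *\<^sub>R e) - conv b \<rho> x\<bar> \<le> \<bar>t\<bar> * E"
proof -
  have "ennreal \<bar>conv b \<rho> (x + t *\<^sub>R e) - conv b \<rho> x\<bar>
      \<le> (\<integral>\<^sup>+\<tau>. indicator {0..1} \<tau> * ennreal \<bar>gconv b \<rho> (t *\<^sub>R e) (x + \<tau> *\<^sub>R (t *\<^sub>R e))\<bar> \<partial>lborel)"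
    by (rule conv_increment[OF assms(1-3)])
  also have "\<dots> \<le> (\<integral>\<^sup>+\<tau>. indicator {0..1} (\<tau>::real) * ennreal (\<bar>t\<bar> * E) \<partial>lborel)"
    using E assms(5)
    by (intro nn_integral_mono)
       (auto simp: gconv_scale abs_mult ennreal_mult indicator_def intro!: mult_left_mono)
  also have "\<dots> = ennreal (\<bar>t\<bar> * E)" by (simp add: nn_integral_multc)
  finally show ?thesis using assms(5) by simp
qed

text \<open>Nondegeneracy enters through \<open>gn\<close> only: every interval of length \<open>s\<close> contains a velocity that is
  transversal to \<open>\<xi>\<close> by a power of \<open>s\<close>.\<close>

locale gn_flux =
  fixes a :: "real \<Rightarrow> 'a::euclidean_space" and al be La c :: real and P :: nat
  assumes al_be: "al \<le> be" and La: "1 \<le> La" and c_pos: "0 < c"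
    and cont_a: "continuous_on UNIV a"
    and norm_a: "v \<in> {al - 3..be + 3} \<Longrightarrow> norm (a v) \<le> La"
    and lip_a: "v \<in> {al - 3..be + 3} \<Longrightarrow> w \<in> {al - 3..be + 3} \<Longrightarrow> norm (a v - a w) \<le> La * \<bar>v - w\<bar>"
    and gn: "al \<le> w \<Longrightarrow> w + s \<le> be \<Longrightarrow> 0 < s \<Longrightarrow> s \<le> 1 \<Longrightarrow> norm \<xi> = 1 \<Longrightarrow>
               \<exists>v\<in>{w..w + s}. c * s ^ P \<le> \<bar>a v \<bullet> \<xi>\<bar>"
begin

section \<open>Spanning all directions by velocities of nearby levels\<close>

text \<open>Take \<xi> orthogonal to the velocities found so far; \<open>gn\<close> yields in the
  next piece of the interval a velocity whose component along \<xi> is at least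
  \<open>c * s ^ P\<close>. Its coefficient in the expansion of z is read off from the product with
  \<xi>, and removing that part enlarges the norm at most by the factor
  \<open>1 + La / (c * s ^ P)\<close>, once per dimension.\<close>

lemma spanning_aux:
  assumes s: "0 < s" "s \<le> 1" and w: "al \<le> w"
  shows "n \<le> DIM('a) \<Longrightarrow> w + real n * s \<le> be \<Longrightarrow>
    \<exists>v S. subspace S \<and> dim S = n \<and> (\<forall>i<n. v i \<in> {w + real i * s..w + real (Suc i) * s}) \<and>
      (\<forall>z\<in>S. \<exists>t. z = (\<Sum>i<n. t i *\<^sub>R a (v i)) \<and>
         (\<forall>i<n. \<bar>t i\<bar> \<le> (1 + La / (c * s ^ P)) ^ n / (c * s ^ P) * norm z))"
proof (induction n)
  case 0
  show ?case by (intro exI[of _ "\<lambda>_. w"] exI[of _ "{0}"]) auto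
next
  case (Suc n)
  let ?d = "c * s ^ P"
  let ?B = "1 + La / ?d"
  have d: "0 < ?d" using c_pos s by simp
  have B: "1 \<le> ?B" using d La by simp
  obtain v S where S: "subspace S" "dim S = n" and v: "\<forall>i<n. v i \<in> {w + real i * s..w + real (Suc i) * s}"
    and rep: "\<forall>z\<in>S. \<exists>t. z = (\<Sum>i<n. t i *\<^sub>R a (v i)) \<and> (\<forall>i<n. \<bar>t i\<bar> \<le> ?B ^ n / ?d * norm z)"
    using Suc s by (auto simp: algebra_simps)
  obtain x where x: "x \<noteq> 0" "\<And>y. y \<in> span S \<Longrightarrow> orthogonal x y"
    using orthogonal_to_subspace_exists[of S] S Suc.prems by auto
  define \<xi> where "\<xi> = x /\<^sub>R norm x"
  have \<xi>: "norm \<xi> = 1" "\<And>y. y \<in> S \<Longrightarrow> y \<bullet> \<xi> = 0"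
    using x span_base by (auto simp: \<xi>_def orthogonal_def inner_commute)
  have "al \<le> w + real n * s" "(w + real n * s) + s \<le> be"
    using w s Suc.prems by (auto simp: algebra_simps intro: add_increasing2)
  from gn[OF this s \<xi>(1)] obtain vn where vn: "vn \<in> {w + real n * s..w + real n * s + s}" "?d \<le> \<bar>a vn \<bullet> \<xi>\<bar>"
    by blast
  have "vn \<in> {al - 3..be + 3}"
    using vn \<open>al \<le> w + real n * s\<close> \<open>(w + real n * s) + s \<le> be\<close> by auto
  then have an: "norm (a vn) \<le> La" by (rule norm_a)
  have spS: "span S = S" using S(1) span_eq_iff by blast
  have "a vn \<notin> S" using \<xi>(2)[of "a vn"] vn d by auto
  then have "a vn \<notin> span S" by (simp only: spS not_False_eq_True)
  then have dim: "dim (span (insert (a vn) S)) = Suc n"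
    using S by (simp add: dim_insert)
  let ?v = "v(n := vn)"
  have "\<exists>t. z = (\<Sum>i<Suc n. t i *\<^sub>R a (?v i)) \<and> (\<forall>i<Suc n. \<bar>t i\<bar> \<le> ?B ^ Suc n / ?d * norm z)"
    if z: "z \<in> span (insert (a vn) S)" for z
  proof -
    obtain k where k: "z - k *\<^sub>R a vn \<in> S"
      using z unfolding span_insert spS by blast
    then have "z \<bullet> \<xi> = k * (a vn \<bullet> \<xi>)"
      using \<xi>(2) by (force simp: inner_diff_left)
    then have "\<bar>k\<bar> * ?d \<le> \<bar>z \<bullet> \<xi>\<bar>"
      using vn by (simp add: abs_mult mult_left_mono)
    also have "\<dots> \<le> norm z"
      using Cauchy_Schwarz_ineq2[of z \<xi>] \<xi> by simp
    finally have kb: "\<bar>k\<bar> \<le> norm z / ?d" using d by (simp add: pos_le_divide_eq)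
    have "norm (z - k *\<^sub>R a vn) \<le> norm z + \<bar>k\<bar> * norm (a vn)"
      using norm_triangle_ineq4[of z "k *\<^sub>R a vn"] by simp
    also have "\<dots> \<le> norm z + norm z / ?d * La"
      using kb an d by (intro add_left_mono mult_mono) auto
    also have "\<dots> = ?B * norm z" by (simp add: algebra_simps)
    finally have nb: "norm (z - k *\<^sub>R a vn) \<le> ?B * norm z" .
    obtain t where t: "z - k *\<^sub>R a vn = (\<Sum>i<n. t i *\<^sub>R a (v i))"
      "\<forall>i<n. \<bar>t i\<bar> \<le> ?B ^ n / ?d * norm (z - k *\<^sub>R a vn)"
      using rep k by blast
    have "z = (\<Sum>i<Suc n. (t(n := k)) i *\<^sub>R a (?v i))"
      using t(1) by (simp add: algebra_simps)
    moreover have "\<bar>(t(n := k)) i\<bar> \<le> ?B ^ Suc n / ?d * norm z" if "i < Suc n" for i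
    proof (cases "i = n")
      case True
      have "norm z / ?d \<le> ?B ^ Suc n / ?d * norm z"
        using mult_right_mono[OF divide_right_mono[OF one_le_power[OF B, of "Suc n"], of ?d], of "norm z"] d
        by (simp del: power_Suc)
      then show ?thesis using kb True by simp
    next
      case False
      then have "\<bar>t i\<bar> \<le> ?B ^ n / ?d * norm (z - k *\<^sub>R a vn)" using t(2) that by simp
      also have "\<dots> \<le> ?B ^ n / ?d * (?B * norm z)"
        using nb d B by (intro mult_left_mono) auto
      finally show ?thesis using False by (simp add: mult_ac)
    qed
    ultimately show ?thesis by (intro exI[of _ "t(n := k)"]) blast
  qed
  moreover have "\<forall>i<Suc n. ?v i \<in> {w + real i * s..w + real (Suc i) * s}"
    using v vn by (auto simp: less_Suc_eq algebra_simps)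
  ultimately show ?case
    using dim by (intro exI[of _ ?v] exI[of _ "span (insert (a vn) S)"]) (simp add: subspace_span)
qed

text \<open>In \<open>spanning_aux\<close> the factor s^(-P) occurs once per dimension in the power
  and once more in the quotient. \<open>spanc\<close> collects the rest; its powers of the dimension
  arise from cutting an interval of length s into as many pieces.\<close>

definition Q :: nat where "Q = P * Suc DIM('a)"

definition spanc :: real where
  "spanc = (1 + La / c * real DIM('a) ^ P) ^ DIM('a) * real DIM('a) ^ P / c"

lemma spanc_pos: "0 < spanc"
  using c_pos La unfolding spanc_def by (intro divide_pos_pos mult_pos_pos zero_less_power add_pos_nonneg) auto

text \<open>The interval is cut into equal pieces, one per dimension. The order of the levels is
  recorded because \<open>chain\<close> may only go upwards.\<close>

lemma spanning:
  assumes s: "0 < s" "s \<le> 1" and w: "al \<le> w" "w + s \<le> be"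
  obtains v where "\<And>i. i < DIM('a) \<Longrightarrow> v i \<in> {w..w + s}" "\<And>i j. i < j \<Longrightarrow> j < DIM('a) \<Longrightarrow> v i \<le> v j"
    "\<And>z. \<exists>t. z = (\<Sum>i<DIM('a). t i *\<^sub>R a (v i)) \<and> (\<forall>i<DIM('a). \<bar>t i\<bar> \<le> spanc / s ^ Q * norm z)"
proof -
  let ?d = "DIM('a)"
  let ?s = "s / real ?d"
  have d1: "1 \<le> real ?d" using DIM_positive[where 'a='a] by simp
  then have s': "0 < ?s" "?s \<le> 1" using s d1 by (auto simp: field_simps intro: order_trans[OF _ d1])
  have "w + real ?d * ?s \<le> be" using w d1 by simp
  then obtain v S where S: "subspace S" "dim S = ?d"
    and v: "\<forall>i<?d. v i \<in> {w + real i * ?s..w + real (Suc i) * ?s}"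
    and rep: "\<forall>z\<in>S. \<exists>t. z = (\<Sum>i<?d. t i *\<^sub>R a (v i)) \<and>
         (\<forall>i<?d. \<bar>t i\<bar> \<le> (1 + La / (c * ?s ^ P)) ^ ?d / (c * ?s ^ P) * norm z)"
    using spanning_aux[OF s' w(1), of ?d] by auto
  have "S = UNIV" using S by (metis dim_eq_full span_eq_iff)
  have K: "(1 + La / (c * ?s ^ P)) ^ ?d / (c * ?s ^ P) \<le> spanc / s ^ Q"
  proof -
    have sP: "0 < s ^ P" "s ^ P \<le> 1" using s by (auto simp: power_le_one)
    have dP: "0 < real ?d ^ P" using d1 by simp
    have sQ: "s ^ Q = s ^ P * (s ^ P) ^ ?d" by (simp add: Q_def power_add power_mult)
    have e: "La / (c * ?s ^ P) = La / c * real ?d ^ P / s ^ P"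
      by (simp add: power_divide)
    have "1 + La / (c * ?s ^ P) \<le> (1 + La / c * real ?d ^ P) / s ^ P"
      unfolding e using sP by (simp add: add_divide_distrib)
    then have "(1 + La / (c * ?s ^ P)) ^ ?d \<le> ((1 + La / c * real ?d ^ P) / s ^ P) ^ ?d"
      using La c_pos s' by (intro power_mono) auto
    then have "(1 + La / (c * ?s ^ P)) ^ ?d / (c * ?s ^ P) \<le> ((1 + La / c * real ?d ^ P) / s ^ P) ^ ?d / (c * ?s ^ P)"
      using c_pos s' by (intro divide_right_mono) auto
    also have "\<dots> = spanc / s ^ Q"
      unfolding spanc_def sQ by (simp add: power_divide field_simps)
    finally show ?thesis .
  qed
  show ?thesis
  proof (rule that)
    show "v i \<in> {w..w + s}" if "i < ?d" for i
    proof -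
      have "0 \<le> real i * ?s" "real (Suc i) * ?s \<le> real ?d * ?s"
        using that s'(1) by (intro mult_nonneg_nonneg mult_right_mono; simp)+
      moreover have "real ?d * ?s = s" using d1 by simp
      ultimately show ?thesis using v that by fastforce
    qed
    show "v i \<le> v j" if "i < j" "j < ?d" for i j
    proof -
      have "v i \<le> w + real (Suc i) * ?s" using v that by auto
      also have "\<dots> \<le> w + real j * ?s"
        using that s' by (intro add_left_mono mult_right_mono) auto
      also have "\<dots> \<le> v j" using v that by auto
      finally show ?thesis .
    qed
    show "\<exists>t. z = (\<Sum>i<?d. t i *\<^sub>R a (v i)) \<and> (\<forall>i<?d. \<bar>t i\<bar> \<le> spanc / s ^ Q * norm z)" for z
    proof -
      obtain t where t: "z = (\<Sum>i<?d. t i *\<^sub>R a (v i))"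
         "\<forall>i<?d. \<bar>t i\<bar> \<le> (1 + La / (c * ?s ^ P)) ^ ?d / (c * ?s ^ P) * norm z"
        using rep \<open>S = UNIV\<close> by blast
      have "(1 + La / (c * ?s ^ P)) ^ ?d / (c * ?s ^ P) * norm z \<le> spanc / s ^ Q * norm z"
        by (rule mult_right_mono[OF K norm_ge_zero])
      then show ?thesis using t by (intro exI[of _ t]) (auto intro: order_trans)
    qed
  qed
qed

section \<open>Mollified solutions along characteristics\<close>

lemma borel_measurable_a [measurable]: "a \<in> borel_measurable borel"
  by (rule borel_measurable_continuous_onI[OF cont_a])

text \<open>The kernel lives on |v - w| \<le> h, where replacing \<open>a w\<close> by
  \<open>a v\<close> costs \<open>La * h\<close> by the Lipschitz bound. The margin 3 around the
  range of u leaves room for such windows.\<close>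

lemma flux_mollified:
  assumes h: "0 < h" and v: "al - 3 \<le> v - h" "v + h \<le> be + 3"
  shows "norm (flux a (\<lambda>w. kern h (v - w)) s) \<le> La * U h v s"
    and "norm (U h v s *\<^sub>R a v - flux a (\<lambda>w. kern h (v - w)) s) \<le> La * h * U h v s"
proof -
  let ?k = "\<lambda>w. if w < s then kern h (v - w) else 0"
  let ?f = "\<lambda>w. if w < s then kern h (v - w) *\<^sub>R a w else 0"
  have k: "w \<in> {al - 3..be + 3} \<and> \<bar>v - w\<bar> \<le> h" if "kern h (v - w) \<noteq> 0" for w
    using that v kern_eq_0[OF h, of "v - w"] by (cases "h \<le> \<bar>v - w\<bar>") auto
  have b: "norm (?f w) \<le> La * ?k w" for w
    using norm_a[of w] k[of w] kern_nonneg[of h "v - w"] h by (cases "kern h (v - w) = 0") auto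
  have I: "integrable lborel ?f"
  proof (rule Bochner_Integration.integrable_bound[where f="\<lambda>w. La * ?k w"])
    show "AE w in lborel. norm (?f w) \<le> norm (La * ?k w)"
      using order_trans[OF b abs_ge_self] by (intro AE_I2) (simp only: real_norm_def)
  qed (use integrable_U[OF h] in auto)
  have "norm (flux a (\<lambda>w. kern h (v - w)) s) \<le> (LINT w|lborel. La * ?k w)"
    unfolding flux_def
    by (rule order_trans[OF integral_norm_bound integral_mono])
       (use I integrable_U[OF h] b in auto)
  then show "norm (flux a (\<lambda>w. kern h (v - w)) s) \<le> La * U h v s" by (simp add: U_def)
  have eq: "U h v s *\<^sub>R a v - flux a (\<lambda>w. kern h (v - w)) s = (LINT w|lborel. ?k w *\<^sub>R a v - ?f w)"
    unfolding flux_def U_def using I integrable_U[OF h] by simp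
  have "norm (LINT w|lborel. ?k w *\<^sub>R a v - ?f w) \<le> (LINT w|lborel. La * h * ?k w)"
  proof (rule order_trans[OF integral_norm_bound integral_mono])
    show "norm (?k w *\<^sub>R a v - ?f w) \<le> La * h * ?k w" for w
    proof (cases "w < s \<and> kern h (v - w) \<noteq> 0")
      case True
      then have "norm (a v - a w) \<le> La * h"
        using lip_a[of v w] k[of w] v h La
        by (auto intro!: order_trans[OF lip_a] mult_left_mono)
      then have "kern h (v - w) * norm (a v - a w) \<le> kern h (v - w) * (La * h)"
        using kern_nonneg[of h "v - w"] h by (intro mult_left_mono) auto
      moreover have "norm (kern h (v - w) *\<^sub>R a v - kern h (v - w) *\<^sub>R a w) = kern h (v - w) * norm (a v - a w)"
        using kern_nonneg[of h "v - w"] h by (simp flip: scaleR_diff_right)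
      ultimately show ?thesis using True by (simp add: mult_ac)
    qed auto
  qed (use I integrable_U[OF h] in auto)
  also have "(LINT w|lborel. La * h * ?k w) = La * h * U h v s"
    unfolding U_def by (rule integral_mult_right_zero)
  finally show "norm (U h v s *\<^sub>R a v - flux a (\<lambda>w. kern h (v - w)) s) \<le> La * h * U h v s"
    unfolding eq .
qed

lemma borel_measurable_flux [measurable]:
  assumes [measurable]: "\<zeta> \<in> borel_measurable borel"
  shows "flux a \<zeta> \<in> borel_measurable borel"
  unfolding flux_def[abs_def] by measurable

lemma test_function_kern: "0 < h \<Longrightarrow> test_function UNIV (\<lambda>w. kern h (v - w :: real))"
  by (rule test_functionI[where K="cball v h", OF smooth_kern_shift])
     (use kern_eq_0[of h "v - w" for w] in \<open>force simp: dist_real_def\<close>)+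

text \<open>The derivative of a mollification in the characteristic direction: the velocity is frozen at
  the centre \<open>v\<close> of the \<open>v\<close>-mollifier, at the price of the commutator term with \<open>gkern\<close>.\<close>

lemma gconv_bound:
  assumes kin: "kinetic_on a {al..be} D u \<mu>"
    and h: "0 < h" and v: "al - 3 \<le> v - h" "v + h \<le> be + 3" and \<rho>: "0 < \<rho>"
    and \<psi>: "smooth \<psi>" "\<And>y. 0 \<le> \<psi> y" "\<And>y. \<psi> y \<le> 1" "\<And>y. norm (grad \<psi> y) \<le> L"
    and tf: "test_function (ball 0 D) (\<lambda>y. \<psi> y * kern \<rho> (x - y))"
  shows "ennreal \<bar>gconv (\<lambda>y. \<psi> y * U h v (u y)) \<rho> (a v) x\<bar>
     \<le> (\<integral>\<^sup>+y. ennreal (La * h * (\<psi> y * U h v (u y) * norm (gkern \<rho> (x - y)))) \<partial>lborel)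
       + (\<integral>\<^sup>+y. ennreal (La * (norm (grad \<psi> y) * U h v (u y) * kern \<rho> (x - y))) \<partial>lborel)
       + (\<integral>\<^sup>+p. ennreal (\<psi> (fst p) * kern \<rho> (x - fst p) *
             (4 / bmass TYPE(real) / h\<^sup>2 * indicator {v - h..v + h} (snd p))) \<partial>\<mu>)"
proof -
  let ?k = "\<lambda>y. kern \<rho> (x - y)" and ?g = "\<lambda>y. gkern \<rho> (x - y)"
  let ?\<zeta> = "\<lambda>w. kern h (v - w)" and ?U = "\<lambda>y. U h v (u y)"
  let ?F = "\<lambda>y. flux a ?\<zeta> (u y)"
  have [measurable]: "u \<in> borel_measurable borel" using kin by (simp add: kinetic_on_def)
  have [measurable]: "\<psi> \<in> borel_measurable borel" "grad \<psi> \<in> borel_measurable borel"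
    using \<psi> by (auto intro!: borel_measurable_continuous_onI smooth_continuous smooth_continuous_grad)
  note U01 = U_nonneg[OF h, of v] U_le_1[OF h, of v]
  have F: "norm (?F y) \<le> La * ?U y" "norm (?U y *\<^sub>R a v - ?F y) \<le> La * h * ?U y" for y
    using flux_mollified[OF h v] by auto
  have F1: "norm (?F y) \<le> La" for y
  proof -
    have "La * ?U y \<le> La * 1" using U01(2) La by (intro mult_left_mono) auto
    then show ?thesis using F(1)[of y] by linarith
  qed
  have k0: "?k y = 0" "?g y = 0" if "y \<notin> ball x \<rho>" for y
    using that kern_eq_0[OF \<rho>, of "x - y"] gkern_eq_0[OF \<rho>, of "x - y"] by (auto simp: dist_norm)
  let ?G = "4 / (\<rho> ^ Suc DIM('a) * bmass TYPE('a))" and ?K = "1 / (\<rho> ^ DIM('a) * bmass TYPE('a))"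
  have gb: "norm (?g y) \<le> ?G" and kb: "\<bar>?k y\<bar> \<le> ?K" for y
    using norm_gkern_le[OF \<rho>] kern_le[OF \<rho>, of "x - y"] kern_nonneg[of \<rho> "x - y"] \<rho> by auto
  have L0: "0 \<le> L" using \<psi>(4) norm_ge_zero order_trans by blast
  have I1: "integrable lborel (\<lambda>y. (\<psi> y *\<^sub>R ?F y) \<bullet> ?g y)"
  proof (rule integrable_bounded_support[where B="La * ?G" and c=x and r=\<rho>])
    show "norm ((\<psi> y *\<^sub>R ?F y) \<bullet> ?g y) \<le> La * ?G" for y
    proof -
      have "\<bar>(\<psi> y *\<^sub>R ?F y) \<bullet> ?g y\<bar> \<le> norm (\<psi> y *\<^sub>R ?F y) * norm (?g y)"
        by (rule Cauchy_Schwarz_ineq2)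
      also have "\<dots> \<le> (1 * La) * ?G"
        unfolding norm_scaleR using \<psi> F1 gb La by (intro mult_mono) auto
      finally show ?thesis by simp
    qed
  qed (auto simp: k0)
  have I2: "integrable lborel (\<lambda>y. ?k y * (?F y \<bullet> grad \<psi> y))"
  proof (rule integrable_bounded_support[where B="?K * (La * L)" and c=x and r=\<rho>])
    show "norm (?k y * (?F y \<bullet> grad \<psi> y)) \<le> ?K * (La * L)" for y
    proof -
      have "\<bar>?F y \<bullet> grad \<psi> y\<bar> \<le> norm (?F y) * norm (grad \<psi> y)"
        by (rule Cauchy_Schwarz_ineq2)
      also have "\<dots> \<le> La * L"
        using \<psi> F1 La by (intro mult_mono) auto
      finally show ?thesis unfolding real_norm_def abs_mult using kb[of y] order_trans[OF abs_ge_zero kb[of y]]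
        by (intro mult_mono) auto
    qed
  qed (auto simp: k0)
  have I3: "integrable lborel (\<lambda>y. \<psi> y * ((?U y *\<^sub>R a v - ?F y) \<bullet> ?g y))"
  proof (rule integrable_bounded_support[where B="(La * h) * ?G" and c=x and r=\<rho>])
    show "norm (\<psi> y * ((?U y *\<^sub>R a v - ?F y) \<bullet> ?g y)) \<le> (La * h) * ?G" for y
    proof -
      have "norm (?U y *\<^sub>R a v - ?F y) \<le> La * h"
      proof -
        have "La * h * ?U y \<le> La * h * 1" using U01(2) La h by (intro mult_left_mono) auto
        then show ?thesis using F(2)[of y] by linarith
      qed
      then have "\<bar>(?U y *\<^sub>R a v - ?F y) \<bullet> ?g y\<bar> \<le> (La * h) * ?G"
        by (intro order_trans[OF Cauchy_Schwarz_ineq2] mult_mono gb) (use La h in auto)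
      then show ?thesis
        using mult_left_le_one_le[OF abs_ge_zero \<psi>(2,3)[of y], of "(?U y *\<^sub>R a v - ?F y) \<bullet> ?g y"] \<psi>(2)[of y]
        by (simp add: abs_mult)
    qed
  qed (auto simp: k0)
  have sm: "smooth ?k" by (rule smooth_kern_shift)
  \<comment> \<open>The equation is tested with the spatial kernel times the cut-off \<psi> and with
    \<open>?\<zeta>\<close> in the level. The product rule separates the derivative of the mollified
    flux from the cut-off term; afterwards the flux is exchanged for \<open>U * a v\<close>, which
    leaves the commutator.\<close>
  have "(LINT y|lborel. ?F y \<bullet> grad (\<lambda>y. \<psi> y * ?k y) y)
      = (LINT p|\<mu>. \<psi> (fst p) * ?k (fst p) * deriv ?\<zeta> (snd p))"
    using kin tf test_function_kern[OF h] unfolding kinetic_on_def by blast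
  moreover have "?F y \<bullet> grad (\<lambda>y. \<psi> y * ?k y) y = ?k y * (?F y \<bullet> grad \<psi> y) - (\<psi> y *\<^sub>R ?F y) \<bullet> ?g y" for y
    by (simp add: grad_mult[OF \<psi>(1) sm] grad_kern_shift inner_diff_right algebra_simps)
  ultimately have eq1: "(LINT y|lborel. (\<psi> y *\<^sub>R ?F y) \<bullet> ?g y)
      = (LINT y|lborel. ?k y * (?F y \<bullet> grad \<psi> y)) - (LINT p|\<mu>. \<psi> (fst p) * ?k (fst p) * deriv ?\<zeta> (snd p))"
    using I1 I2 by simp
  have "gconv (\<lambda>y. \<psi> y * ?U y) \<rho> (a v) x
      = (LINT y|lborel. \<psi> y * ((?U y *\<^sub>R a v - ?F y) \<bullet> ?g y) + (\<psi> y *\<^sub>R ?F y) \<bullet> ?g y)"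
    unfolding gconv_def by (intro Bochner_Integration.integral_cong) (auto simp: algebra_simps inner_diff_left)
  also have "\<dots> = (LINT y|lborel. \<psi> y * ((?U y *\<^sub>R a v - ?F y) \<bullet> ?g y))
      + ((LINT y|lborel. ?k y * (?F y \<bullet> grad \<psi> y)) - (LINT p|\<mu>. \<psi> (fst p) * ?k (fst p) * deriv ?\<zeta> (snd p)))"
    using I1 I3 eq1 by simp
  finally have eq: "\<bar>gconv (\<lambda>y. \<psi> y * ?U y) \<rho> (a v) x\<bar>
      \<le> norm (LINT y|lborel. \<psi> y * ((?U y *\<^sub>R a v - ?F y) \<bullet> ?g y))
        + norm (LINT y|lborel. ?k y * (?F y \<bullet> grad \<psi> y))
        + norm (LINT p|\<mu>. \<psi> (fst p) * ?k (fst p) * deriv ?\<zeta> (snd p))"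
    by simp
  have "ennreal \<bar>gconv (\<lambda>y. \<psi> y * ?U y) \<rho> (a v) x\<bar>
      \<le> ennreal (norm (LINT y|lborel. \<psi> y * ((?U y *\<^sub>R a v - ?F y) \<bullet> ?g y)))
        + ennreal (norm (LINT y|lborel. ?k y * (?F y \<bullet> grad \<psi> y)))
        + ennreal (norm (LINT p|\<mu>. \<psi> (fst p) * ?k (fst p) * deriv ?\<zeta> (snd p)))"
    using ennreal_leI[OF eq] by (simp add: ennreal_plus)
  also have "\<dots> \<le> (\<integral>\<^sup>+y. ennreal (norm (\<psi> y * ((?U y *\<^sub>R a v - ?F y) \<bullet> ?g y))) \<partial>lborel)
      + (\<integral>\<^sup>+y. ennreal (norm (?k y * (?F y \<bullet> grad \<psi> y))) \<partial>lborel)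
      + (\<integral>\<^sup>+p. ennreal (norm (\<psi> (fst p) * ?k (fst p) * deriv ?\<zeta> (snd p))) \<partial>\<mu>)"
    by (intro add_mono norm_integral_le_nn)
  also have "\<dots> \<le> (\<integral>\<^sup>+y. ennreal (La * h * (\<psi> y * ?U y * norm (?g y))) \<partial>lborel)
       + (\<integral>\<^sup>+y. ennreal (La * (norm (grad \<psi> y) * ?U y * ?k y)) \<partial>lborel)
       + (\<integral>\<^sup>+p. ennreal (\<psi> (fst p) * ?k (fst p) *
             (4 / bmass TYPE(real) / h\<^sup>2 * indicator {v - h..v + h} (snd p))) \<partial>\<mu>)"
  proof (intro add_mono nn_integral_mono ennreal_leI)
    fix y
    have "\<bar>(?U y *\<^sub>R a v - ?F y) \<bullet> ?g y\<bar> \<le> (La * h * ?U y) * norm (?g y)"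
      by (rule order_trans[OF Cauchy_Schwarz_ineq2 mult_right_mono[OF F(2)]]) simp
    from mult_left_mono[OF this \<psi>(2)[of y]]
    show "norm (\<psi> y * ((?U y *\<^sub>R a v - ?F y) \<bullet> ?g y)) \<le> La * h * (\<psi> y * ?U y * norm (?g y))"
      using \<psi>(2)[of y] by (simp add: abs_mult mult_ac)
  next
    fix y
    have "\<bar>?F y \<bullet> grad \<psi> y\<bar> \<le> (La * ?U y) * norm (grad \<psi> y)"
      by (rule order_trans[OF Cauchy_Schwarz_ineq2 mult_right_mono[OF F(1)]]) simp
    from mult_left_mono[OF this kern_nonneg[of \<rho> "x - y"]]
    show "norm (?k y * (?F y \<bullet> grad \<psi> y)) \<le> La * (norm (grad \<psi> y) * ?U y * ?k y)"
      using kern_nonneg[of \<rho> "x - y"] \<rho> by (simp add: abs_mult mult_ac)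
  next
    fix p :: "'a \<times> real"
    show "norm (\<psi> (fst p) * ?k (fst p) * deriv ?\<zeta> (snd p))
      \<le> \<psi> (fst p) * ?k (fst p) * (4 / bmass TYPE(real) / h\<^sup>2 * indicator {v - h..v + h} (snd p))"
      using mult_left_mono[OF deriv_kern_shift_le[OF h, of v "snd p"], of "\<psi> (fst p) * ?k (fst p)"]
        \<psi>(2)[of "fst p"] kern_nonneg[of \<rho> "x - fst p"] \<rho> by (simp add: abs_mult)
  qed
  finally show ?thesis .
qed

end

lemma conv_mono:
  assumes "b \<in> borel_measurable borel" "b' \<in> borel_measurable borel"
    and "\<And>y. \<bar>b y\<bar> \<le> 1" "\<And>y. \<bar>b' y\<bar> \<le> 1" and "0 < \<rho>" and "\<And>y. b y \<le> b' y"
  shows "conv b \<rho> x \<le> conv b' \<rho> x"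
  unfolding conv_def
  using assms by (intro integral_mono integrable_conv mult_right_mono kern_nonneg) auto

lemma conv_nonneg: "0 < \<rho> \<Longrightarrow> (\<And>y. 0 \<le> b y) \<Longrightarrow> 0 \<le> conv b \<rho> x"
  unfolding conv_def by (intro Bochner_Integration.integral_nonneg) (simp add: kern_nonneg)

subsection \<open>The energy estimate\<close>

lemma smooth_hh_affine: "smooth (\<lambda>v::real. hh m ((v - w) * r))"
proof -
  have "Ck k (\<lambda>v::real. (v - w) \<bullet> r)" for k by (rule Ck_inner)
  then have *: "Ck k (\<lambda>v::real. (v - w) * r)" for k by (simp add: inner_real_def)
  show ?thesis unfolding smooth_def by (rule allI) (rule Ck_hh[OF *])
qed

text \<open>The first factor increases for ever, on the scale h, and its derivative stays positive
  on every bounded range of levels above w. The second factor only makes the support compact; its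
  slope is O(1 / T), so that against a finite measure it disappears as T grows.\<close>

definition ramp :: "real \<Rightarrow> real \<Rightarrow> real \<Rightarrow> real \<Rightarrow> real" where
  "ramp w h T v = hh 0 ((v - w) * inverse h) * hh 0 ((v - (w + T)) * (- inverse T))"

lemma ramp_bounds: "0 \<le> ramp w h T v" "ramp w h T v \<le> 1"
  unfolding ramp_def by (auto simp: hh_nonneg hh_0_le_1 mult_le_one)

lemma ramp_support:
  assumes "0 < h" "0 < T" "ramp w h T v \<noteq> 0"
  shows "v \<in> {w..w + T}"
proof -
  have "0 < (v - w) * inverse h" "0 < (v - (w + T)) * (- inverse T)"
    using assms(3) unfolding ramp_def by (metis hh_eq_0 mult_zero_left mult_zero_right not_le)+
  then show ?thesis using assms by (auto simp: zero_less_mult_iff mult_less_0_iff)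
qed

lemma test_function_ramp: "0 < h \<Longrightarrow> 0 < T \<Longrightarrow> test_function UNIV (ramp w h T)"
  unfolding ramp_def[abs_def]
  by (rule test_functionI[where K="{w..w + T}", OF smooth_mult[OF smooth_hh_affine smooth_hh_affine]])
     (use ramp_support[of h T w, unfolded ramp_def] in auto)

lemma deriv_ramp:
  "deriv (ramp w h T) v = inverse h * hh 2 ((v - w) * inverse h) * hh 0 ((v - (w + T)) * (- inverse T))
     - inverse T * (hh 0 ((v - w) * inverse h) * hh 2 ((v - (w + T)) * (- inverse T)))"
proof (rule DERIV_imp_deriv)
  have d: "((\<lambda>v. hh 0 ((v - w) * r)) has_real_derivative hh 2 ((v - w) * r) * r) (at v)" for w r
    by (rule DERIV_chain2[OF hh_0_deriv]) (auto intro!: derivative_eq_intros)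
  show "(ramp w h T has_real_derivative inverse h * hh 2 ((v - w) * inverse h) * hh 0 ((v - (w + T)) * (- inverse T))
     - inverse T * (hh 0 ((v - w) * inverse h) * hh 2 ((v - (w + T)) * (- inverse T)))) (at v)"
    unfolding ramp_def[abs_def] by (rule derivative_eq_intros d refl)+ (simp add: algebra_simps)
qed

text \<open>The term with factor \<open>inverse T\<close> is at most 2 / T because
  \<open>hh 2\<close> is bounded by 2. For the second bound, \<open>hh 2 t\<close> is at least
  exp(-1) / t^2 for t \<ge> 1, here with t \<le> m / h, and the outer factor is at least
  \<open>hh 0 (1 / 2)\<close>, which is exp(-2), as long as v stays in the lower half of the
  ramp.\<close>

lemma deriv_ramp_ge:
  assumes h: "0 < h" and T: "0 < T"
  shows "- (2 / T) \<le> deriv (ramp w h T) v"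
    and "w + h \<le> v \<Longrightarrow> v \<le> w + m \<Longrightarrow> 2 * m \<le> T \<Longrightarrow> exp (-3) / m\<^sup>2 * h - 2 / T \<le> deriv (ramp w h T) v"
proof -
  let ?t = "(v - w) * inverse h" and ?r = "(v - (w + T)) * (- inverse T)"
  have "hh 0 ?t * hh 2 ?r \<le> 1 * 2"
    using hh_le_fact[of 2 ?r] by (intro mult_mono hh_0_le_1 hh_nonneg) auto
  then have "inverse T * (hh 0 ?t * hh 2 ?r) \<le> inverse T * 2"
    using T by (intro mult_left_mono) auto
  then have neg: "inverse T * (hh 0 ?t * hh 2 ?r) \<le> 2 / T" by (simp add: field_simps)
  have "0 \<le> inverse h * hh 2 ?t * hh 0 ?r" using h by (simp add: hh_nonneg)
  then show "- (2 / T) \<le> deriv (ramp w h T) v" using neg unfolding deriv_ramp by linarith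
  assume v: "w + h \<le> v" "v \<le> w + m" and m: "2 * m \<le> T"
  have m0: "0 < m" using v h by linarith
  have "exp (-3) / m\<^sup>2 * h = inverse h * (exp (-1) * (inverse (m * inverse h))\<^sup>2) * exp (-2)"
    using h m0 by (simp add: field_simps power2_eq_square flip: exp_add)
  also have "\<dots> \<le> inverse h * hh 2 ?t * hh 0 ?r"
  proof (intro mult_mono)
    have t: "1 \<le> ?t" using v h by (simp add: field_simps)
    have tm: "?t \<le> m * inverse h" using v h by (intro mult_right_mono) auto
    have "exp (-1) * (inverse (m * inverse h))\<^sup>2 \<le> exp (- 1 / ?t) * (inverse ?t)\<^sup>2"
    proof (rule mult_mono)
      show "exp (-1) \<le> exp (- 1 / ?t)" using t by (simp add: divide_le_eq)
      have "inverse (m * inverse h) \<le> inverse ?t" using t tm by (intro le_imp_inverse_le) auto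
      then show "(inverse (m * inverse h))\<^sup>2 \<le> (inverse ?t)\<^sup>2" using h m0 by (intro power_mono) auto
    qed auto
    also have "\<dots> = hh 2 ?t" using t by (simp add: hh_def field_simps power_inverse)
    finally show "exp (-1) * (inverse (m * inverse h))\<^sup>2 \<le> hh 2 ?t" .
    have "1 / 2 \<le> ?r" using v m T by (simp add: field_simps)
    then have "hh 0 (1/2) \<le> hh 0 ?r" by (rule hh_0_mono)
    then show "exp (-2) \<le> hh 0 ?r" by (simp add: hh_def)
  qed (use h in \<open>auto simp: hh_nonneg\<close>)
  finally show "exp (-3) / m\<^sup>2 * h - 2 / T \<le> deriv (ramp w h T) v" 
    using neg unfolding deriv_ramp by linarith
qed

lemma borel_measurable_deriv_smooth:
  fixes f :: "real \<Rightarrow> real"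
  shows "smooth f \<Longrightarrow> deriv f \<in> borel_measurable borel"
  by (intro borel_measurable_continuous_onI smooth_continuous_deriv)

lemma test_function_deriv_bounded:
  fixes f :: "real \<Rightarrow> real"
  assumes "test_function UNIV f"
  obtains B where "\<And>v. \<bar>deriv f v\<bar> \<le> B"
proof -
  let ?K = "closure {x. f x \<noteq> 0}"
  have sm: "smooth f" and K: "compact ?K" using assms by (auto simp: test_function_def)
  have "bounded (deriv f ` ?K)"
    by (intro compact_imp_bounded compact_continuous_image smooth_continuous_deriv sm K)
  then obtain B where B: "\<And>v. v \<in> ?K \<Longrightarrow> \<bar>deriv f v\<bar> \<le> B"
    unfolding bounded_iff by auto
  have "\<bar>deriv f v\<bar> \<le> \<bar>B\<bar>" for v
  proof (cases "v \<in> ?K")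
    case True
    then show ?thesis using B[of v] by linarith
  next
    case False
    then show ?thesis using grad_outside_support[of v f] grad_eq_deriv[OF sm, of v] by simp
  qed
  then show ?thesis by (rule that)
qed

context gn_flux
begin

text \<open>The ramp starts at w, so points with u \<le> w carry no flux. This puts the superlevel
  set on the right-hand side of the energy estimate.\<close>

lemma flux_ramp:
  assumes "0 < h" "0 < T" "al \<le> w" "s \<in> {al..be}"
  shows "norm (flux a (ramp w h T) s) \<le> La * (be - al) * indicator {w<..} s"
proof (cases "w < s")
  case True
  let ?f = "\<lambda>v. if v < s then ramp w h T v *\<^sub>R a v else 0"
  have "norm (flux a (ramp w h T) s) \<le> (LINT v|lborel. La * indicator {w..s} v)"
  proof -
    have b: "norm (?f v) \<le> La * indicator {w..s} v" for v
    proof (cases "v < s \<and> ramp w h T v \<noteq> 0")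
      case True
      then have "w \<le> v" using ramp_support[OF assms(1,2), of w v] by auto
      then have "ramp w h T v * norm (a v) \<le> 1 * La"
        using True assms ramp_bounds[of w h T v] by (intro mult_mono norm_a) auto
      then show ?thesis using True \<open>w \<le> v\<close> ramp_bounds[of w h T v] by (simp add: indicator_def)
    qed (use La in \<open>auto simp: indicator_def\<close>)
    have I: "integrable lborel (\<lambda>v. La * indicator {w..s} v)"
      by (intro integrable_mult_right integrable_real_indicator) (auto simp: emeasure_lborel_Icc_eq)
    have [measurable]: "ramp w h T \<in> borel_measurable borel"
      using test_function_ramp[OF assms(1,2)]
      by (intro borel_measurable_continuous_onI smooth_continuous) (simp add: test_function_def)
    have "integrable lborel ?f"
    proof (rule Bochner_Integration.integrable_bound[OF I])
      show "AE v in lborel. norm (?f v) \<le> norm (La * indicator {w..s} v)"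
        using order_trans[OF b abs_ge_self] by (intro AE_I2) (simp only: real_norm_def)
    qed measurable
    then show ?thesis unfolding flux_def
      by (intro order_trans[OF integral_norm_bound integral_mono]) (use I b in auto)
  qed
  also have "\<dots> = La * (s - w)" using True by simp
  also have "\<dots> \<le> La * (be - al)" using La assms by (intro mult_left_mono) auto
  finally show ?thesis using True by simp
next
  case False
  have "v < s \<longrightarrow> ramp w h T v = 0" for v
    using ramp_support[OF assms(1,2), of w v] False by force
  then have "flux a (ramp w h T) s = (LINT v|(lborel::real measure). 0)"
    unfolding flux_def by (intro Bochner_Integration.integral_cong) auto
  then show ?thesis using La al_be by simp
qed

text \<open>\<open>La * (be - al)\<close> bounds the flux, 8 comes from the gradient bound 4 R2 with
  R2 \<le> 2, exp 4 is the inverse of the bump value exp(-1) times the ramp constant exp(-3), and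
  the square is that of the range of levels in \<open>deriv_ramp_ge\<close>.\<close>

definition cacc :: real where
  "cacc = La * (be - al) * 8 * exp 4 * (be - al + 2)\<^sup>2"

lemma cacc_nonneg: "0 \<le> cacc"
  using La al_be by (simp add: cacc_def)

text \<open>Test with a bump in space times a ramp in the level. The measure sees the positive
  derivative of the ramp, the other side sees the gradient of the bump only where u > w. The
  dissipation above \<open>w + h\<close> is thus paid for by the superlevel set in a larger
  ball.\<close>

lemma caccioppoli:
  assumes kin: "kinetic_on a {al..be} D u \<mu>"
    and R: "0 < R" "R < R2" "R2 \<le> 2" "R2 < D" and w: "al \<le> w" "w \<le> be" and h: "0 < h"
  shows "measure \<mu> (ball 0 R \<times> {w + h..be + 2})
     \<le> cacc / (h * (R2\<^sup>2 - R\<^sup>2)) * measure lborel {y\<in>ball 0 R2. w < u y}"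
proof -
  interpret finite_measure \<mu> using kin by (simp add: kinetic_on_def)
  have [measurable]: "u \<in> borel_measurable borel" using kin by (simp add: kinetic_on_def)
  have u: "u y \<in> {al..be}" for y using kin unfolding kinetic_on_def by blast
  have [measurable_cong]: "sets \<mu> = sets (borel \<Otimes>\<^sub>M borel)"
    using kin unfolding kinetic_on_def borel_prod by blast
  \<comment> \<open>The length needed to reach level \<open>be + 2\<close> from any admissible w;
    later only windows v - h..v + h with \<open>v \<le> be\<close> and h \<le> 1 are
    inserted.\<close>
  let ?m = "be - al + 2"
  let ?e = "R2\<^sup>2 - R\<^sup>2"
  let ?\<psi> = "bump (0::'a) R2 ?e"
  let ?S = "{y\<in>ball 0 R2. w < u y}"
  let ?A = "ball (0::'a) R \<times> {w + h..be + 2}"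
  let ?cH = "exp (-3) / ?m\<^sup>2 * h"
  let ?X = "La * (be - al) * (4 * R2 / ?e) * measure lborel ?S"
  have m: "0 < ?m" using al_be by simp
  have e: "0 < ?e" using R by (simp add: power_strict_mono)
  have [measurable]: "?S \<in> sets borel" by measurable
  have finS: "emeasure lborel ?S < \<infinity>"
    by (rule le_less_trans[OF emeasure_mono emeasure_lborel_ball_finite[of 0 R2]]) auto
  have A [measurable]: "?A \<in> sets \<mu>" by measurable
  have key: "exp (-1) * ?cH * measure \<mu> ?A \<le> ?X + 2 / T * measure \<mu> (space \<mu>)" if T: "2 * ?m \<le> T" for T
  proof -
    have T0: "0 < T" by (rule less_le_trans[OF _ T]) (use m in simp)
    let ?\<zeta> = "ramp w h T"
    have tf: "test_function (ball 0 D) ?\<psi>"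
      using R e by (intro test_function_bump) auto
    have eq: "(LINT y|lborel. flux a ?\<zeta> (u y) \<bullet> grad ?\<psi> y) = (LINT p|\<mu>. ?\<psi> (fst p) * deriv ?\<zeta> (snd p))"
      using kin tf test_function_ramp[OF h T0] unfolding kinetic_on_def by blast
    have sm\<zeta>: "smooth ?\<zeta>" using test_function_ramp[OF h T0] by (simp add: test_function_def)
    have [measurable]: "deriv ?\<zeta> \<in> borel_measurable borel"
      by (rule borel_measurable_deriv_smooth[OF sm\<zeta>])
    obtain B where B: "\<And>v. \<bar>deriv ?\<zeta> v\<bar> \<le> B"
      using test_function_deriv_bounded[OF test_function_ramp[OF h T0]] by blast
    have I: "integrable \<mu> (\<lambda>p. ?\<psi> (fst p) * deriv ?\<zeta> (snd p))"
    proof (rule integrable_const_bound[where B=B])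
      show "AE p in \<mu>. norm (?\<psi> (fst p) * deriv ?\<zeta> (snd p)) \<le> B"
      proof (intro AE_I2)
        fix p :: "'a \<times> real"
        have "\<bar>?\<psi> (fst p)\<bar> * \<bar>deriv ?\<zeta> (snd p)\<bar> \<le> 1 * B"
          using B bump_le_1[of 0 R2 ?e "fst p"] by (intro mult_mono) (auto simp: bump_nonneg)
        then show "norm (?\<psi> (fst p) * deriv ?\<zeta> (snd p)) \<le> B" by (simp add: abs_mult)
      qed
    qed measurable
    have "exp (-1) * ?cH * measure \<mu> ?A - 2 / T * measure \<mu> (space \<mu>)
        = (LINT p|\<mu>. exp (-1) * ?cH * indicator ?A p - 2 / T)"
      using A by (subst Bochner_Integration.integral_diff) (auto simp: less_top[symmetric])
    also have "\<dots> \<le> (LINT p|\<mu>. ?\<psi> (fst p) * deriv ?\<zeta> (snd p))"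
    proof (rule integral_mono[OF _ I])
      show "integrable \<mu> (\<lambda>p. exp (-1) * ?cH * indicator ?A p - 2 / T)"
        using A by (intro Bochner_Integration.integrable_diff integrable_mult_right) (auto simp: less_top[symmetric])
      fix p :: "'a \<times> real"
      have b: "0 \<le> ?\<psi> (fst p)" "?\<psi> (fst p) \<le> 1" by (auto simp: bump_nonneg bump_le_1)
      have T2: "?\<psi> (fst p) * (2 / T) \<le> 2 / T" using b T0 by (intro mult_left_le_one_le) auto
      show "exp (-1) * ?cH * indicator ?A p - 2 / T \<le> ?\<psi> (fst p) * deriv ?\<zeta> (snd p)"
      proof (cases "p \<in> ?A")
        case True
        then have "norm (fst p) < R" "w + h \<le> snd p" "snd p \<le> w + ?m" using w by auto
        have "1 \<le> (R2\<^sup>2 - (norm (fst p))\<^sup>2) / ?e"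
          using \<open>norm (fst p) < R\<close> e power_mono[of "norm (fst p)" R 2] by (simp add: field_simps)
        then have "hh 0 1 \<le> ?\<psi> (fst p)" unfolding bump_def by (intro hh_0_mono) simp
        then have p1: "exp (-1) \<le> ?\<psi> (fst p)" by (simp add: hh_def)
        have "?cH - 2 / T \<le> deriv ?\<zeta> (snd p)"
          by (rule deriv_ramp_ge(2)[OF h T0]) (use \<open>w + h \<le> snd p\<close> \<open>snd p \<le> w + ?m\<close> T in auto)
        then have "?\<psi> (fst p) * (?cH - 2 / T) \<le> ?\<psi> (fst p) * deriv ?\<zeta> (snd p)"
          using b by (intro mult_left_mono)
        moreover have "exp (-1) * ?cH \<le> ?\<psi> (fst p) * ?cH"
          using p1 h by (intro mult_right_mono) auto
        ultimately show ?thesis using True T2 unfolding right_diff_distrib by simp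
      next
        case False
        have "?\<psi> (fst p) * (- (2 / T)) \<le> ?\<psi> (fst p) * deriv ?\<zeta> (snd p)"
          using b deriv_ramp_ge(1)[OF h T0] by (intro mult_left_mono)
        then show ?thesis using False T2 by simp
      qed
    qed
    also have "\<dots> = (LINT y|lborel. flux a ?\<zeta> (u y) \<bullet> grad ?\<psi> y)" by (simp add: eq)
    also have "\<dots> \<le> (LINT y|lborel. La * (be - al) * (4 * R2 / ?e) * indicator ?S y)"
    proof (rule integral_mono')
      show "integrable lborel (\<lambda>y. La * (be - al) * (4 * R2 / ?e) * indicator ?S y)"
        using finS by (intro integrable_mult_right) simp
      fix y
      show "0 \<le> La * (be - al) * (4 * R2 / ?e) * indicator ?S y"
        using La al_be R e by simp
      have F: "norm (flux a ?\<zeta> (u y)) \<le> La * (be - al) * indicator {w<..} (u y)"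
        by (rule flux_ramp[OF h T0 w(1) u])
      have G: "norm (grad ?\<psi> y) \<le> 4 * R2 / ?e * indicator (ball 0 R2) y"
        using norm_grad_bump[of ?e R2 0 y] grad_bump_eq_0[of ?e R2 y 0] e R
        by (cases "norm y < R2") auto
      have "flux a ?\<zeta> (u y) \<bullet> grad ?\<psi> y \<le> norm (flux a ?\<zeta> (u y)) * norm (grad ?\<psi> y)"
        by (rule norm_cauchy_schwarz)
      also have "\<dots> \<le> (La * (be - al) * indicator {w<..} (u y)) * (4 * R2 / ?e * indicator (ball 0 R2) y)"
        using La al_be by (intro mult_mono F G) auto
      also have "\<dots> = La * (be - al) * (4 * R2 / ?e) * indicator ?S y"
        by (auto simp: indicator_def)
      finally show "flux a ?\<zeta> (u y) \<bullet> grad ?\<psi> y \<le> La * (be - al) * (4 * R2 / ?e) * indicator ?S y" .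
    qed
    also have "\<dots> = ?X" using finS by simp
    finally show ?thesis by simp
  qed
  \<comment> \<open>Here the total mass of \<mu> leaves the estimate: it carries the factor 2 / T,
    and T tends to infinity.\<close>
  have "exp (-1) * ?cH * measure \<mu> ?A \<le> ?X"
  proof (rule tendsto_lowerbound)
    show "((\<lambda>T. ?X + 2 / T * measure \<mu> (space \<mu>)) \<longlongrightarrow> ?X) at_top"
    proof -
      have "((\<lambda>T. ?X + 2 * inverse T * measure \<mu> (space \<mu>)) \<longlongrightarrow> ?X + 2 * 0 * measure \<mu> (space \<mu>)) at_top"
        by (intro tendsto_intros tendsto_inverse_0_at_top filterlim_ident)
      then show ?thesis by (simp add: divide_inverse)
    qed
    show "\<forall>\<^sub>F T in at_top. exp (-1) * ?cH * measure \<mu> ?A \<le> ?X + 2 / T * measure \<mu> (space \<mu>)"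
      using eventually_ge_at_top[of "2 * ?m"] by eventually_elim (rule key)
  qed simp
  then have "measure \<mu> ?A \<le> ?X / (exp (-1) * ?cH)"
    using h m by (subst pos_le_divide_eq) (auto simp: mult.commute)
  also have "\<dots> = La * (be - al) * (4 * R2) * (exp 1 * exp 3) * ?m\<^sup>2 / (h * ?e) * measure lborel ?S"
    using h m e by (simp add: exp_minus field_simps)
  also have "\<dots> \<le> cacc / (h * ?e) * measure lborel ?S"
  proof -
    have "La * (be - al) * (4 * R2) * (exp 1 * exp 3) * ?m\<^sup>2 \<le> La * (be - al) * 8 * (exp 1 * exp 3) * ?m\<^sup>2"
      using La al_be R by (intro mult_right_mono mult_left_mono) auto
    also have "\<dots> = cacc" by (simp add: cacc_def flip: exp_add)
    finally show ?thesis using h e by (intro mult_right_mono divide_right_mono) auto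
  qed
  finally show ?thesis .
qed

section \<open>The L1 norm of the characteristic derivative, and changes of direction\<close>

lemma test_function_bump_kern:
  assumes "0 < e" "0 \<le> R" "R < D"
  shows "test_function (ball 0 D) (\<lambda>y. bump 0 R e y * kern \<rho> (x - y :: 'a))"
proof (rule test_functionI[OF smooth_mult[OF smooth_bump smooth_kern_shift] _ compact_cball[of 0 R]])
  show "y \<in> cball 0 R" if "bump 0 R e y * kern \<rho> (x - y) \<noteq> 0" for y :: 'a
    using bump_support[OF assms(1,2), of 0 y] that by auto
  show "cball 0 R \<subseteq> ball (0::'a) D"
    using assms by auto
qed

text \<open>\<open>gconv_bound\<close> is integrated in x. By Fubini the kernels contribute 1 and
  \<open>gconst / \<rho>\<close>, and what remains lives where u > v - h, or in the window of levels
  for the measure.\<close>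

lemma gconv_L1:
  assumes kin: "kinetic_on a {al..be} D u \<mu>"
    and h: "0 < h" and v: "al - 3 \<le> v - h" "v + h \<le> be + 3" and \<rho>: "0 < \<rho>"
    and R: "0 < e" "0 < R" "R < D"
    and b_def: "b = (\<lambda>y. bump 0 R e y * U h v (u y))"
  shows "(\<integral>\<^sup>+x. ennreal \<bar>gconv b \<rho> (a v) x\<bar> \<partial>lborel)
     \<le> ennreal (La * h * gconst TYPE('a) / \<rho> + La * (4 * R / e)) * emeasure lborel {y\<in>ball 0 R. v - h < u y}
       + ennreal (4 / bmass TYPE(real) / h\<^sup>2) * emeasure \<mu> (ball 0 R \<times> {v - h..v + h})"
proof -
  interpret finite_measure \<mu> using kin by (simp add: kinetic_on_def)
  have [measurable]: "u \<in> borel_measurable borel" using kin by (simp add: kinetic_on_def)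
  have [measurable_cong]: "sets \<mu> = sets (borel \<Otimes>\<^sub>M borel)"
    using kin unfolding kinetic_on_def borel_prod by blast
  interpret P: pair_sigma_finite lborel \<mu> ..
  let ?\<psi> = "bump (0::'a) R e"
  let ?S = "{y\<in>ball 0 R. v - h < u y}" and ?L = "4 * R / e" and ?C1 = "4 / bmass TYPE(real) / h\<^sup>2"
  have [measurable]: "?S \<in> sets borel" by measurable
  have [measurable]: "?\<psi> \<in> borel_measurable borel" "grad ?\<psi> \<in> borel_measurable borel"
    by (auto intro!: borel_measurable_continuous_onI smooth_continuous smooth_continuous_grad smooth_bump)
  have kn: "0 \<le> kern \<rho> z" for z :: 'a using \<rho> by (simp add: kern_nonneg)
  have L0: "0 \<le> ?L" using R by simp
  have C1: "0 \<le> ?C1" using bmass_pos[where 'a=real] by (simp add: less_imp_le)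
  let ?f1 = "\<lambda>x y. ennreal (La * h * (?\<psi> y * U h v (u y) * norm (gkern \<rho> (x - y))))"
  let ?f2 = "\<lambda>x y. ennreal (La * (norm (grad ?\<psi> y) * U h v (u y) * kern \<rho> (x - y)))"
  let ?f3 = "\<lambda>x p. ennreal (?\<psi> (fst p) * kern \<rho> (x - fst p) * (?C1 * indicator {v - h..v + h} (snd p)))"
  have \<psi>b: "?\<psi> y * U h v (u y) \<le> indicator ?S y" and \<psi>n: "0 \<le> ?\<psi> y * U h v (u y)" for y
    using bump_le_1[of 0 R e y] U_le_1[OF h, of v "u y"] U_nonneg[OF h, of v "u y"]
      bump_nonneg[of 0 R e y] bump_eq_0[of e R y 0] U_eq_0[OF h, of "u y" v] R
    by (auto simp: indicator_def mult_le_one)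
  have gb: "norm (grad ?\<psi> y) * U h v (u y) \<le> ?L * indicator ?S y" for y
  proof (cases "y \<in> ?S")
    case True
    have "norm (grad ?\<psi> y) * U h v (u y) \<le> ?L * 1"
      using R U_le_1[OF h] U_nonneg[OF h] by (intro mult_mono norm_grad_bump) auto
    then show ?thesis using True by simp
  next
    case False
    then show ?thesis using grad_bump_eq_0[of e R y 0] U_eq_0[OF h, of "u y" v] R by (auto simp: not_less)
  qed
  have "(\<integral>\<^sup>+x. ennreal \<bar>gconv b \<rho> (a v) x\<bar> \<partial>lborel)
      \<le> (\<integral>\<^sup>+x. (\<integral>\<^sup>+y. ?f1 x y \<partial>lborel) + (\<integral>\<^sup>+y. ?f2 x y \<partial>lborel) + (\<integral>\<^sup>+p. ?f3 x p \<partial>\<mu>) \<partial>lborel)"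
    unfolding b_def
    by (intro nn_integral_mono gconv_bound[OF kin h v \<rho> smooth_bump bump_nonneg bump_le_1, where L="?L"]
        norm_grad_bump test_function_bump_kern) (use R in auto)
  also have "\<dots> = (\<integral>\<^sup>+x. \<integral>\<^sup>+y. ?f1 x y \<partial>lborel \<partial>lborel) + (\<integral>\<^sup>+x. \<integral>\<^sup>+y. ?f2 x y \<partial>lborel \<partial>lborel)
      + (\<integral>\<^sup>+x. \<integral>\<^sup>+p. ?f3 x p \<partial>\<mu> \<partial>lborel)"
    by (simp add: nn_integral_add)
  also have "\<dots> \<le> ennreal (La * h * gconst TYPE('a) / \<rho>) * emeasure lborel ?S
      + ennreal (La * ?L) * emeasure lborel ?S + ennreal ?C1 * emeasure \<mu> (ball 0 R \<times> {v - h..v + h})"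
  proof (intro add_mono)
    have "(\<integral>\<^sup>+x. \<integral>\<^sup>+y. ?f1 x y \<partial>lborel \<partial>lborel) = (\<integral>\<^sup>+y. \<integral>\<^sup>+x. ?f1 x y \<partial>lborel \<partial>lborel)"
      by (rule lborel_pair.Fubini'[symmetric]) measurable
    also have "\<dots> \<le> (\<integral>\<^sup>+y. ennreal (La * h * gconst TYPE('a) / \<rho>) * indicator ?S y \<partial>lborel)"
    proof (rule nn_integral_mono)
      fix y
      let ?k = "La * h * (?\<psi> y * U h v (u y))"
      have k: "0 \<le> ?k" "?k \<le> La * h * indicator ?S y" using La h \<psi>n[of y] \<psi>b[of y] by auto
      have "(\<integral>\<^sup>+x. ?f1 x y \<partial>lborel) = (\<integral>\<^sup>+x. ennreal ?k * ennreal (norm (gkern \<rho> (x - y))) \<partial>lborel)"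
        by (intro nn_integral_cong) (simp flip: ennreal_mult'' add: mult.assoc)
      also have "\<dots> = ennreal ?k * (\<integral>\<^sup>+x. ennreal (norm (gkern \<rho> (x - y))) \<partial>lborel)"
        by (rule nn_integral_cmult) measurable
      also have "\<dots> \<le> ennreal (La * h * indicator ?S y) * ennreal (gconst TYPE('a) / \<rho>)"
        by (intro mult_mono nn_integral_gkern_shift \<rho> ennreal_leI k) auto
      also have "\<dots> = ennreal (La * h * gconst TYPE('a) / \<rho>) * indicator ?S y"
        using La h \<rho> gconst_nonneg[where 'a='a] by (auto simp: indicator_def simp flip: ennreal_mult)
      finally show "(\<integral>\<^sup>+x. ?f1 x y \<partial>lborel) \<le> ennreal (La * h * gconst TYPE('a) / \<rho>) * indicator ?S y" .
    qed
    also have "\<dots> = ennreal (La * h * gconst TYPE('a) / \<rho>) * emeasure lborel ?S"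
      by (rule nn_integral_cmult_indicator) simp
    finally show "(\<integral>\<^sup>+x. \<integral>\<^sup>+y. ?f1 x y \<partial>lborel \<partial>lborel) \<le> ennreal (La * h * gconst TYPE('a) / \<rho>) * emeasure lborel ?S" .
  next
    have "(\<integral>\<^sup>+x. \<integral>\<^sup>+y. ?f2 x y \<partial>lborel \<partial>lborel) = (\<integral>\<^sup>+y. \<integral>\<^sup>+x. ?f2 x y \<partial>lborel \<partial>lborel)"
      by (rule lborel_pair.Fubini'[symmetric]) measurable
    also have "\<dots> \<le> (\<integral>\<^sup>+y. ennreal (La * ?L) * indicator ?S y \<partial>lborel)"
    proof (rule nn_integral_mono)
      fix y
      let ?k = "La * (norm (grad ?\<psi> y) * U h v (u y))"
      have k: "0 \<le> ?k" "?k \<le> La * (?L * indicator ?S y)"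
        using La gb[of y] U_nonneg[OF h] by (auto intro!: mult_left_mono simp del: times_divide_eq_left)
      have "(\<integral>\<^sup>+x. ?f2 x y \<partial>lborel) = (\<integral>\<^sup>+x. ennreal ?k * ennreal (kern \<rho> (x - y)) \<partial>lborel)"
        using kn
        by (intro nn_integral_cong) (subst ennreal_mult''[symmetric]; simp add: mult.assoc)
      also have "\<dots> = ennreal ?k * (\<integral>\<^sup>+x. ennreal (kern \<rho> (x - y)) \<partial>lborel)"
        by (rule nn_integral_cmult) measurable
      also have "\<dots> \<le> ennreal (La * (?L * indicator ?S y))"
        unfolding nn_integral_kern_shift[OF \<rho>] using k by (simp add: ennreal_leI)
      also have "\<dots> = ennreal (La * ?L) * indicator ?S y"
        by (auto simp: indicator_def)
      finally show "(\<integral>\<^sup>+x. ?f2 x y \<partial>lborel) \<le> ennreal (La * ?L) * indicator ?S y" .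
    qed
    also have "\<dots> = ennreal (La * ?L) * emeasure lborel ?S"
      by (rule nn_integral_cmult_indicator) simp
    finally show "(\<integral>\<^sup>+x. \<integral>\<^sup>+y. ?f2 x y \<partial>lborel \<partial>lborel) \<le> ennreal (La * ?L) * emeasure lborel ?S" .
  next
    have "(\<integral>\<^sup>+x. \<integral>\<^sup>+p. ?f3 x p \<partial>\<mu> \<partial>lborel) = (\<integral>\<^sup>+p. \<integral>\<^sup>+x. ?f3 x p \<partial>lborel \<partial>\<mu>)"
      by (rule P.Fubini'[symmetric]) measurable
    also have "\<dots> \<le> (\<integral>\<^sup>+p. ennreal ?C1 * indicator (ball 0 R \<times> {v - h..v + h}) p \<partial>\<mu>)"
    proof (rule nn_integral_mono)
      fix p :: "'a \<times> real"
      let ?k = "?\<psi> (fst p) * (?C1 * indicator {v - h..v + h} (snd p))"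
      have "?\<psi> (fst p) \<le> indicator (ball 0 R) (fst p)"
        using bump_le_1[of 0 R e "fst p"] bump_eq_0[of e R "fst p" 0] R by (auto simp: indicator_def)
      then have "?k \<le> indicator (ball 0 R) (fst p) * (?C1 * indicator {v - h..v + h} (snd p))"
        using C1 by (intro mult_right_mono) auto
      also have "\<dots> = ?C1 * indicator (ball 0 R \<times> {v - h..v + h}) p"
        by (cases p) (auto simp: indicator_def)
      finally have k: "0 \<le> ?k" "?k \<le> ?C1 * indicator (ball 0 R \<times> {v - h..v + h}) p"
        using C1 bump_nonneg[of 0 R e "fst p"] by (auto simp del: times_divide_eq_left divide_divide_eq_left)
      have "(\<integral>\<^sup>+x. ?f3 x p \<partial>lborel) = (\<integral>\<^sup>+x. ennreal ?k * ennreal (kern \<rho> (x - fst p)) \<partial>lborel)"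
        using kn by (intro nn_integral_cong) (subst ennreal_mult''[symmetric]; simp add: mult_ac)
      also have "\<dots> = ennreal ?k * (\<integral>\<^sup>+x. ennreal (kern \<rho> (x - fst p)) \<partial>lborel)"
        by (rule nn_integral_cmult) measurable
      also have "\<dots> \<le> ennreal (?C1 * indicator (ball 0 R \<times> {v - h..v + h}) p)"
        unfolding nn_integral_kern_shift[OF \<rho>] using k by (simp add: ennreal_leI)
      also have "\<dots> = ennreal ?C1 * indicator (ball 0 R \<times> {v - h..v + h}) p"
        by (auto simp: indicator_def)
      finally show "(\<integral>\<^sup>+x. ?f3 x p \<partial>lborel) \<le> ennreal ?C1 * indicator (ball 0 R \<times> {v - h..v + h}) p" .
    qed
    also have "\<dots> = ennreal ?C1 * emeasure \<mu> (ball 0 R \<times> {v - h..v + h})"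
      by (rule nn_integral_cmult_indicator) measurable
    finally show "(\<integral>\<^sup>+x. \<integral>\<^sup>+p. ?f3 x p \<partial>\<mu> \<partial>lborel) \<le> ennreal ?C1 * emeasure \<mu> (ball 0 R \<times> {v - h..v + h})" .
  qed
  also have "ennreal (La * h * gconst TYPE('a) / \<rho>) * emeasure lborel ?S + ennreal (La * ?L) * emeasure lborel ?S
      = ennreal (La * h * gconst TYPE('a) / \<rho> + La * ?L) * emeasure lborel ?S"
  proof -
    have "0 \<le> La * h * gconst TYPE('a) / \<rho>"
      using La h \<rho> gconst_nonneg[where 'a='a] by auto
    moreover have "0 \<le> La * ?L" by (rule mult_nonneg_nonneg[OF _ L0]) (use La in simp)
    ultimately show ?thesis by (simp only: ennreal_plus distrib_right)
  qed
  finally show ?thesis .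
qed

text \<open>Moving in the direction \<open>a (v i)\<close> is almost free at level \<open>v i\<close>, and raising the level only
  decreases the function.\<close>

lemma chain:
  fixes G :: "real \<Rightarrow> 'a \<Rightarrow> real"
    and v t :: "nat \<Rightarrow> real"
  assumes mono: "\<And>v v' x. v \<le> v' \<Longrightarrow> G v' x \<le> G v x"
    and v: "\<And>i j. i < j \<Longrightarrow> j < n \<Longrightarrow> v i \<le> v j"
  shows "(\<And>i. i < n \<Longrightarrow> lo \<le> v i) \<Longrightarrow> (\<And>i. i < n \<Longrightarrow> v i \<le> hi) \<Longrightarrow> lo \<le> hi \<Longrightarrow>
    G hi (x + (\<Sum>i<n. t i *\<^sub>R a (v i)))
      \<le> G lo x + (\<Sum>i<n. \<bar>G (v i) (x + (\<Sum>j<i. t j *\<^sub>R a (v j)) + t i *\<^sub>R a (v i)) - G (v i) (x + (\<Sum>j<i. t j *\<^sub>R a (v j)))\<bar>)"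
  using v
proof (induction n arbitrary: hi)
  case 0
  then show ?case using mono by simp
next
  case (Suc n)
  let ?y = "x + (\<Sum>i<n. t i *\<^sub>R a (v i))"
  have "G hi (?y + t n *\<^sub>R a (v n)) \<le> G (v n) (?y + t n *\<^sub>R a (v n))"
    using mono Suc.prems by simp
  moreover have "G (v n) ?y \<le> G lo x + (\<Sum>i<n. \<bar>G (v i) (x + (\<Sum>j<i. t j *\<^sub>R a (v j)) + t i *\<^sub>R a (v i)) - G (v i) (x + (\<Sum>j<i. t j *\<^sub>R a (v j)))\<bar>)"
    by (rule Suc.IH) (use Suc.prems in auto)
  ultimately show ?case unfolding sum.lessThan_Suc add.assoc by linarith
qed

end

subsection \<open>Decay of superlevel sets\<close>

definition cut :: "('a::euclidean_space \<Rightarrow> real) \<Rightarrow> real \<Rightarrow> real \<Rightarrow> real \<Rightarrow> 'a \<Rightarrow> real" where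
  "cut u R e w y = bump 0 R e y * indicator {w<..} (u y)"

lemma cut_nonneg: "0 \<le> cut u R e w y"
  by (simp add: cut_def bump_nonneg)

lemma cut_le_1: "cut u R e w y \<le> 1"
  by (simp add: cut_def bump_le_1 indicator_def)

lemma abs_cut: "\<bar>cut u R e w y\<bar> \<le> 1"
  using cut_nonneg[of u R e w y] cut_le_1[of u R e w y] by simp

lemma borel_measurable_cut [measurable]:
  assumes [measurable]: "u \<in> borel_measurable borel"
  shows "cut u R e w \<in> borel_measurable borel"
  unfolding cut_def[abs_def] by measurable

lemma cut_mono: "w \<le> w' \<Longrightarrow> cut u R e w' y \<le> cut u R e w y"
  by (simp add: cut_def indicator_def bump_nonneg)

context gn_flux
begin

text \<open>The exponent in the coupling \<open>\<rho> = s ^ Suc N\<close>. A translation by \<rho>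
  has spanning coefficients of order \<rho> / s^Q and the dissipation term is of order h^(-3) with h
  ~ s^(Q+1); as 4 Q + 4 - Q - 3 (Q + 1) = 1, the total cost is linear in s.\<close>

definition N :: nat where "N = 4 * Q + 3"

text \<open>The power \<open>2 ^ Q\<close> is there because only half of s is spent on spanning,
  \<open>2 ^ Suc N\<close> because translations up to the next coarser scale occur, 32 comes from
  the gradient of the cut-off, and 3456 is 2 * 12^3 with 12 from the choice of h in
  \<open>level_step'\<close>.\<close>

definition stepc :: real where
  "stepc = real DIM('a) * spanc * 2 ^ Q * 2 ^ Suc N *
     (La * gconst TYPE('a) + 32 * La + 3456 * (4 / bmass TYPE(real)) * cacc)"

lemma stepc_nonneg: "0 \<le> stepc"
  using La spanc_pos gconst_nonneg[where 'a='a] cacc_nonneg bmass_pos[where 'a=real]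
  by (simp add: stepc_def less_imp_le)

text \<open>The dissipation term of \<open>gconv_L1\<close> is absorbed by the energy estimate
  between the radii R and R''. That estimate starts at \<open>w + h\<close>, and the window reaches
  down to \<open>v - h\<close>; hence \<open>w + 2 * h \<le> v\<close>.\<close>

lemma gconv_level:
  assumes kin: "kinetic_on a {al..be} D u \<mu>"
    and R: "1 / 2 \<le> R'" "R' < R''" "R'' \<le> 2" "R'' < D"
    and R_def: "R = (R' + R'') / 2" and e_def: "e = (R\<^sup>2 - R'\<^sup>2) / 4"
    and w: "al \<le> w" and h: "0 < h" "h \<le> 1" and \<rho>: "0 < \<rho>" and v: "w + 2 * h \<le> v" "v \<le> be"
  shows "(\<integral>\<^sup>+x. ennreal \<bar>gconv (\<lambda>y. bump 0 R e y * U h v (u y)) \<rho> (a v) x\<bar> \<partial>lborel)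
     \<le> ennreal ((La * h * gconst TYPE('a) / \<rho> + 32 * La / (R'' - R') +
          2 * (4 / bmass TYPE(real)) * cacc / (h ^ 3 * (R'' - R'))) * measure lborel {y\<in>ball 0 R''. w < u y})"
proof -
  interpret finite_measure \<mu> using kin by (simp add: kinetic_on_def)
  have [measurable]: "u \<in> borel_measurable borel" using kin by (simp add: kinetic_on_def)
  have [measurable_cong]: "sets \<mu> = sets (borel \<Otimes>\<^sub>M borel)"
    using kin unfolding kinetic_on_def borel_prod by blast
  let ?C1 = "4 / bmass TYPE(real)"
  let ?\<tau> = "R'' - R'"
  let ?S = "{y\<in>ball 0 R''. w < u y}"
  let ?l = "measure lborel ?S"
  have C1: "0 \<le> ?C1" using bmass_pos[where 'a=real] by (simp add: less_imp_le)
  have \<tau>: "0 < ?\<tau>" using R by simp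
  have R0: "0 < R" "R < R''" "R' < R" using R R_def by auto
  have eR: "R\<^sup>2 - R'\<^sup>2 = ?\<tau> / 2 * (R + R')"
    unfolding R_def by (simp add: power2_eq_square field_simps)
  have e4: "?\<tau> / 8 * R \<le> e"
  proof -
    have "?\<tau> / 2 * R \<le> ?\<tau> / 2 * (R + R')" using \<tau> R by (intro mult_left_mono) auto
    then show ?thesis unfolding e_def eR by simp
  qed
  have e: "0 < e" using e4 \<tau> R0 by (meson divide_pos_pos less_le_trans mult_pos_pos zero_less_numeral)
  have Lb: "4 * R / e \<le> 32 / ?\<tau>"
  proof -
    have "4 * R / e \<le> 4 * R / (?\<tau> / 8 * R)" using e4 R0 \<tau> by (intro divide_left_mono mult_pos_pos e) auto
    also have "\<dots> = 32 / ?\<tau>" using R0 by simp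
    finally show ?thesis .
  qed
  have eR2: "?\<tau> / 2 \<le> R''\<^sup>2 - R\<^sup>2"
  proof -
    have "R''\<^sup>2 - R\<^sup>2 = ?\<tau> / 2 * (R'' + R)"
      unfolding R_def by (simp add: power2_eq_square field_simps)
    moreover have "?\<tau> / 2 * 1 \<le> ?\<tau> / 2 * (R'' + R)"
      using \<tau> R R0 by (intro mult_left_mono) auto
    ultimately show ?thesis by simp
  qed
  have finS: "emeasure lborel ?S < \<infinity>"
    by (rule le_less_trans[OF emeasure_mono emeasure_lborel_ball_finite[of 0 R'']]) auto
  have l: "emeasure lborel ?S = ennreal ?l" using finS by (simp add: emeasure_eq_ennreal_measure)
  have "(\<integral>\<^sup>+x. ennreal \<bar>gconv (\<lambda>y. bump 0 R e y * U h v (u y)) \<rho> (a v) x\<bar> \<partial>lborel)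
      \<le> ennreal (La * h * gconst TYPE('a) / \<rho> + La * (4 * R / e)) * emeasure lborel {y\<in>ball 0 R. v - h < u y}
       + ennreal (?C1 / h\<^sup>2) * emeasure \<mu> (ball 0 R \<times> {v - h..v + h})"
    using R R0 e h v w by (intro gconv_L1[OF kin h(1) _ _ \<rho>]) auto
  also have "\<dots> \<le> ennreal (La * h * gconst TYPE('a) / \<rho> + La * (32 / ?\<tau>)) * ennreal ?l
      + ennreal (?C1 / h\<^sup>2) * ennreal (cacc / (h * (?\<tau> / 2)) * ?l)"
  proof (rule add_mono[OF mult_mono[OF ennreal_leI[OF add_left_mono]] mult_left_mono])
    show "La * (4 * R / e) \<le> La * (32 / ?\<tau>)" using Lb La by (intro mult_left_mono) auto
    show "emeasure lborel {y\<in>ball 0 R. v - h < u y} \<le> ennreal ?l"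
      unfolding l[symmetric] using R0 v h by (intro emeasure_mono) auto
    have "emeasure \<mu> (ball 0 R \<times> {v - h..v + h}) \<le> emeasure \<mu> (ball 0 R \<times> {w + h..be + 2})"
      using v h by (intro emeasure_mono) auto
    also have "\<dots> = ennreal (measure \<mu> (ball 0 R \<times> {w + h..be + 2}))"
      by (rule emeasure_eq_measure)
    also have "\<dots> \<le> ennreal (cacc / (h * (R''\<^sup>2 - R\<^sup>2)) * ?l)"
      by (intro ennreal_leI caccioppoli[OF kin]) (use R R0 w v h in auto)
    also have "\<dots> \<le> ennreal (cacc / (h * (?\<tau> / 2)) * ?l)"
      using eR2 h \<tau> cacc_nonneg by (intro ennreal_leI mult_right_mono divide_left_mono mult_left_mono mult_pos_pos) auto
    finally show "emeasure \<mu> (ball 0 R \<times> {v - h..v + h}) \<le> ennreal (cacc / (h * (?\<tau> / 2)) * ?l)" .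
  qed auto
  also have "\<dots> = ennreal ((La * h * gconst TYPE('a) / \<rho> + La * (32 / ?\<tau>)) * ?l
      + (?C1 / h\<^sup>2) * (cacc / (h * (?\<tau> / 2)) * ?l))"
  proof -
    have 1: "0 \<le> La * h * gconst TYPE('a) / \<rho> + La * (32 / ?\<tau>)"
      using La h \<rho> \<tau> gconst_nonneg[where 'a='a] by simp
    have 2: "0 \<le> ?C1 / h\<^sup>2" using C1 by (rule divide_nonneg_nonneg) simp
    have 3: "0 \<le> cacc / (h * (?\<tau> / 2)) * ?l" using cacc_nonneg h \<tau> by simp
    have "ennreal (La * h * gconst TYPE('a) / \<rho> + La * (32 / ?\<tau>)) * ennreal ?l
      = ennreal ((La * h * gconst TYPE('a) / \<rho> + La * (32 / ?\<tau>)) * ?l)"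
      using 1 by (rule ennreal_mult[symmetric]) simp
    moreover have "ennreal (?C1 / h\<^sup>2) * ennreal (cacc / (h * (?\<tau> / 2)) * ?l)
      = ennreal ((?C1 / h\<^sup>2) * (cacc / (h * (?\<tau> / 2)) * ?l))"
      using 2 3 by (rule ennreal_mult[symmetric])
    moreover have "0 \<le> (La * h * gconst TYPE('a) / \<rho> + La * (32 / ?\<tau>)) * ?l" using 1 by simp
    moreover have "0 \<le> (?C1 / h\<^sup>2) * (cacc / (h * (?\<tau> / 2)) * ?l)" using 2 3 by (rule mult_nonneg_nonneg)
    ultimately show ?thesis by (simp only: ennreal_plus)
  qed
  also have "(La * h * gconst TYPE('a) / \<rho> + La * (32 / ?\<tau>)) * ?l + (?C1 / h\<^sup>2) * (cacc / (h * (?\<tau> / 2)) * ?l)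
      = (La * h * gconst TYPE('a) / \<rho> + 32 * La / ?\<tau> + 2 * ?C1 * cacc / (h ^ 3 * ?\<tau>)) * ?l"
    using h by (simp add: power2_eq_square power3_eq_cube algebra_simps)
  finally show ?thesis .
qed

text \<open>Sharp and smoothed superlevel sets may be exchanged when the level is moved by h in the
  right direction.\<close>

lemma conv_cut_U:
  assumes [measurable]: "u \<in> borel_measurable borel" and "0 < h" "0 < \<rho>"
  shows "v + h \<le> w \<Longrightarrow> conv (cut u R e w) \<rho> x \<le> conv (\<lambda>y. bump 0 R e y * U h v (u y)) \<rho> x"
    and "w \<le> v - h \<Longrightarrow> conv (\<lambda>y. bump 0 R e y * U h v (u y)) \<rho> x \<le> conv (cut u R e w) \<rho> x"
    and "v \<le> v' \<Longrightarrow> conv (\<lambda>y. bump 0 R e y * U h v' (u y)) \<rho> x \<le> conv (\<lambda>y. bump 0 R e y * U h v (u y)) \<rho> x"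
proof -
  have b: "\<bar>bump 0 R e y * U h v (u y)\<bar> \<le> 1" for y v
    using bump_nonneg[of 0 R e y] bump_le_1[of 0 R e y] U_nonneg[OF \<open>0 < h\<close>, of v "u y"] U_le_1[OF \<open>0 < h\<close>, of v "u y"]
    by (simp add: abs_mult mult_le_one)
  show "conv (cut u R e w) \<rho> x \<le> conv (\<lambda>y. bump 0 R e y * U h v (u y)) \<rho> x" if "v + h \<le> w"
    using that assms(2,3) U_eq_1[of h v] U_nonneg[of h]
    by (intro conv_mono abs_cut b) (auto simp: cut_def indicator_def bump_nonneg intro!: mult_left_mono)
  show "conv (\<lambda>y. bump 0 R e y * U h v (u y)) \<rho> x \<le> conv (cut u R e w) \<rho> x" if "w \<le> v - h"
  proof (intro conv_mono abs_cut b)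
    show "bump 0 R e y * U h v (u y) \<le> cut u R e w y" for y
      using that U_eq_0[of h "u y" v] U_le_1[of h v "u y"] assms(2)
      by (cases "w < u y") (auto simp: cut_def bump_nonneg intro: mult_left_le)
  qed (use assms in auto)
  show "conv (\<lambda>y. bump 0 R e y * U h v' (u y)) \<rho> x \<le> conv (\<lambda>y. bump 0 R e y * U h v (u y)) \<rho> x" if "v \<le> v'"
    using that assms by (intro conv_mono b mult_left_mono U_antimono) (auto simp: bump_nonneg)
qed

text \<open>The translation by z is decomposed along velocities of increasing levels and carried out
  by \<open>chain\<close>. The increase s is spent as follows: 2 h before the lowest level, s / 2 on
  the levels of the velocities, h after the highest; h \<le> s / 6 makes this fit.\<close>

lemma level_step:
  assumes kin: "kinetic_on a {al..be} D u \<mu>"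
    and R: "1 / 2 \<le> R'" "R' < R''" "R'' \<le> 2" "R'' < D"
    and R_def: "R = (R' + R'') / 2" and e_def: "e = (R\<^sup>2 - R'\<^sup>2) / 4"
    and w: "al \<le> w" and s: "0 < s" "s \<le> 1" and h: "0 < h" "h \<le> s / 6" and \<rho>: "0 < \<rho>"
    and z: "norm z \<le> Z"
  shows "(\<integral>\<^sup>+x. ennreal (conv (cut u R e (w + s)) \<rho> (x + z) - conv (cut u R e w) \<rho> x) \<partial>lborel)
     \<le> ennreal (real DIM('a) * (spanc / (s / 2) ^ Q * Z) * ((La * h * gconst TYPE('a) / \<rho> + 32 * La / (R'' - R') +
          2 * (4 / bmass TYPE(real)) * cacc / (h ^ 3 * (R'' - R'))) * measure lborel {y\<in>ball 0 R''. w < u y}))"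
proof -
  have [measurable]: "u \<in> borel_measurable borel" using kin by (simp add: kinetic_on_def)
  have u: "u y \<in> {al..be}" for y using kin unfolding kinetic_on_def by blast
  show ?thesis
  proof (cases "w + 2 * h + s / 2 \<le> be")
    case False
    \<comment> \<open>Near the top of the range no room for spanning is left, but then no value of u
      exceeds \<open>w + s\<close>.\<close>
    have "be < w + s" using False h by linarith
    then have "cut u R e (w + s) y = 0" for y
      using u[of y] by (auto simp: cut_def indicator_def)
    then have "conv (cut u R e (w + s)) \<rho> x = 0" for x by (simp add: conv_def)
    moreover have "0 \<le> conv (cut u R e w) \<rho> x" for x
      by (rule conv_nonneg[OF \<rho> cut_nonneg])
    ultimately show ?thesis by (simp add: ennreal_neg)
  next
    case True
    let ?G = "\<lambda>v. conv (\<lambda>y. bump 0 R e y * U h v (u y)) \<rho>"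
    let ?E = "(La * h * gconst TYPE('a) / \<rho> + 32 * La / (R'' - R') +
          2 * (4 / bmass TYPE(real)) * cacc / (h ^ 3 * (R'' - R'))) * measure lborel {y\<in>ball 0 R''. w < u y}"
    have E0: "0 \<le> ?E"
      using La h \<rho> R cacc_nonneg gconst_nonneg[where 'a='a] bmass_pos[where 'a=real]
      by (intro mult_nonneg_nonneg add_nonneg_nonneg) auto
    have T0: "0 \<le> spanc / (s / 2) ^ Q * Z"
      using spanc_pos s order_trans[OF norm_ge_zero z] by (intro mult_nonneg_nonneg) auto
    obtain v where v: "\<And>i. i < DIM('a) \<Longrightarrow> v i \<in> {w + 2 * h..w + 2 * h + s / 2}"
        "\<And>i j. i < j \<Longrightarrow> j < DIM('a) \<Longrightarrow> v i \<le> v j"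
        "\<And>z. \<exists>t. z = (\<Sum>i<DIM('a). t i *\<^sub>R a (v i)) \<and> (\<forall>i<DIM('a). \<bar>t i\<bar> \<le> spanc / (s / 2) ^ Q * norm z)"
      using spanning[of "s / 2" "w + 2 * h"] s h w True by auto
    obtain t where t: "z = (\<Sum>i<DIM('a). t i *\<^sub>R a (v i))" "\<And>i. i < DIM('a) \<Longrightarrow> \<bar>t i\<bar> \<le> spanc / (s / 2) ^ Q * norm z"
      using v(3)[of z] by blast
    let ?y = "\<lambda>i. \<Sum>j<i. t j *\<^sub>R a (v j)"
    let ?d = "\<lambda>i x. ennreal \<bar>?G (v i) (x + t i *\<^sub>R a (v i)) - ?G (v i) x\<bar>"
    have b: "\<bar>bump 0 R e y * U h v (u y)\<bar> \<le> 1" for y :: 'a and v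
      using bump_nonneg[of 0 R e y] bump_le_1[of 0 R e y] U_nonneg[OF h(1), of v "u y"] U_le_1[OF h(1), of v "u y"]
      by (simp add: abs_mult mult_le_one)
    have "(\<integral>\<^sup>+x. ennreal (conv (cut u R e (w + s)) \<rho> (x + z) - conv (cut u R e w) \<rho> x) \<partial>lborel)
        \<le> (\<integral>\<^sup>+x. (\<Sum>i<DIM('a). ?d i (x + ?y i)) \<partial>lborel)"
    proof (rule nn_integral_mono)
      fix x :: 'a
      have "conv (cut u R e (w + s)) \<rho> (x + z) \<le> ?G (w + 2 * h + s / 2) (x + z)"
        using h s \<rho> by (intro conv_cut_U(1)) auto
      also have "\<dots> \<le> ?G (w + 2 * h) x + (\<Sum>i<DIM('a). \<bar>?G (v i) (x + ?y i + t i *\<^sub>R a (v i)) - ?G (v i) (x + ?y i)\<bar>)"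
        unfolding t(1) 
      proof (rule chain[OF _ v(2)])
        show "?G v' x \<le> ?G v x" if "v \<le> v'" for v v' x
          using that h \<rho> by (intro conv_cut_U(3)) auto
      qed (use v(1) s in auto)
      also have "?G (w + 2 * h) x \<le> conv (cut u R e w) \<rho> x"
        using h s \<rho> by (intro conv_cut_U(2)) auto
      finally have "conv (cut u R e (w + s)) \<rho> (x + z) - conv (cut u R e w) \<rho> x
          \<le> (\<Sum>i<DIM('a). \<bar>?G (v i) (x + ?y i + t i *\<^sub>R a (v i)) - ?G (v i) (x + ?y i)\<bar>)" by simp
      then show "ennreal (conv (cut u R e (w + s)) \<rho> (x + z) - conv (cut u R e w) \<rho> x)
          \<le> (\<Sum>i<DIM('a). ?d i (x + ?y i))"
        by (simp add: ennreal_leI sum_ennreal)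
    qed
    also have "\<dots> = (\<Sum>i<DIM('a). \<integral>\<^sup>+x. ?d i (x + ?y i) \<partial>lborel)"
      by (rule nn_integral_sum) measurable
    also have "\<dots> = (\<Sum>i<DIM('a). \<integral>\<^sup>+x. ?d i x \<partial>lborel)"
      by (intro sum.cong refl nn_integral_plus) measurable
    also have "\<dots> \<le> (\<Sum>i<DIM('a). ennreal (spanc / (s / 2) ^ Q * Z * ?E))"
    proof (rule sum_mono)
      fix i assume "i \<in> {..<DIM('a)}"
      then have i: "i < DIM('a)" by simp
      have "(\<integral>\<^sup>+x. ?d i x \<partial>lborel) \<le> ennreal \<bar>t i\<bar> * (\<integral>\<^sup>+x. ennreal \<bar>gconv (\<lambda>y. bump 0 R e y * U h (v i) (u y)) \<rho> (a (v i)) x\<bar> \<partial>lborel)"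
        by (rule conv_increment_L1[OF _ b \<rho>]) measurable
      also have "\<dots> \<le> ennreal (spanc / (s / 2) ^ Q * Z) * ennreal ?E"
      proof (intro mult_mono ennreal_leI)
        have "spanc / (s / 2) ^ Q * norm z \<le> spanc / (s / 2) ^ Q * Z"
          using spanc_pos s z by (intro mult_left_mono) auto
        then show "\<bar>t i\<bar> \<le> spanc / (s / 2) ^ Q * Z" using t(2)[OF i] by linarith
        show "(\<integral>\<^sup>+x. ennreal \<bar>gconv (\<lambda>y. bump 0 R e y * U h (v i) (u y)) \<rho> (a (v i)) x\<bar> \<partial>lborel) \<le> ennreal ?E"
          by (rule gconv_level[OF kin R R_def e_def w h(1) _ \<rho>]) (use v(1)[OF i] s h True in auto)
      qed auto
      also have "\<dots> = ennreal (spanc / (s / 2) ^ Q * Z * ?E)"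
        using T0 E0 by (rule ennreal_mult[symmetric])
      finally show "(\<integral>\<^sup>+x. ?d i x \<partial>lborel) \<le> ennreal (spanc / (s / 2) ^ Q * Z * ?E)" .
    qed
    also have "\<dots> = ennreal (real DIM('a) * (spanc / (s / 2) ^ Q * Z) * ?E)"
      using mult_nonneg_nonneg[OF T0 E0] by (simp add: ennreal_of_nat_eq_real_of_nat mult.assoc flip: ennreal_mult)
    finally show ?thesis .
  qed
qed

text \<open>With h = s^(Q+1) / 12 and \<open>\<rho> = s ^ Suc N\<close> each of the three error
  terms, multiplied by the spanning coefficients, becomes O(s).\<close>

lemma level_step':
  assumes kin: "kinetic_on a {al..be} D u \<mu>"
    and R: "1 / 2 \<le> R'" "R' < R''" "R'' \<le> 2" "R'' < D"
    and R_def: "R = (R' + R'') / 2" and e_def: "e = (R\<^sup>2 - R'\<^sup>2) / 4"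
    and w: "al \<le> w" and s: "0 < s" "s \<le> 1" and \<rho>: "\<rho> = s ^ Suc N"
    and z: "norm z \<le> 2 ^ Suc N * \<rho>"
  shows "(\<integral>\<^sup>+x. ennreal (conv (cut u R e (w + s)) \<rho> (x + z) - conv (cut u R e w) \<rho> x) \<partial>lborel)
     \<le> ennreal (stepc * s / (R'' - R') * measure lborel {y\<in>ball 0 R''. w < u y})"
proof -
  let ?h = "s ^ Suc Q / 12" and ?\<tau> = "R'' - R'" and ?l = "measure lborel {y\<in>ball 0 R''. w < u y}"
  let ?C1 = "4 / bmass TYPE(real)" and ?g = "gconst TYPE('a)"
  have C1: "0 \<le> ?C1" using bmass_pos[where 'a=real] by (simp add: less_imp_le)
  have \<tau>: "0 < ?\<tau>" "?\<tau> \<le> 2" using R by auto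
  have h: "0 < ?h" using s by simp
  have "s ^ Suc Q \<le> s" using s by (simp add: mult_left_le power_le_one)
  then have h6: "?h \<le> s / 6" using s by simp
  have \<rho>0: "0 < \<rho>" using s \<rho> by simp
  let ?E = "La * ?h * ?g / \<rho> + 32 * La / ?\<tau> + 2 * ?C1 * cacc / (?h ^ 3 * ?\<tau>)"
  have key: "\<rho> / s ^ Q * ?E \<le> (La * ?g + 32 * La + 3456 * ?C1 * cacc) * (s / ?\<tau>)"
  proof -
    have sQ: "0 < s ^ Q" using s by simp
    \<comment> \<open>Of the exponent 4 Q + 4 the part Q pays for the spanning coefficients, 3 Q + 3
      cancels h^3, and one factor s is left as gain.\<close>
    have \<rho>2: "\<rho> = s * s ^ Q * (s ^ Q) ^ 3 * s ^ 3"
      unfolding \<rho> N_def by (simp add: power_add power_mult eval_nat_numeral mult_ac)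
    have "\<rho> / s ^ Q * (La * ?h * ?g / \<rho>) = La * ?g * (s / 12)"
      using sQ \<rho>0 by simp
    also have "\<dots> \<le> La * ?g * (s / ?\<tau>)"
      using \<tau> s La gconst_nonneg[where 'a='a] by (intro mult_left_mono divide_left_mono) auto
    finally have 1: "\<rho> / s ^ Q * (La * ?h * ?g / \<rho>) \<le> La * ?g * (s / ?\<tau>)" .
    have "(s ^ Q) ^ 3 * s ^ 3 \<le> 1" using s by (intro mult_le_one power_le_one) auto
    then have "s * ((s ^ Q) ^ 3 * s ^ 3) \<le> s" using s by (intro mult_left_le) auto
    then have "\<rho> / s ^ Q \<le> s" unfolding \<rho>2 using sQ by (simp add: mult_ac)
    then have 2: "\<rho> / s ^ Q * (32 * La / ?\<tau>) \<le> s * (32 * La / ?\<tau>)"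
      using La \<tau> by (intro mult_right_mono) auto
    have 3: "\<rho> / s ^ Q * (2 * ?C1 * cacc / (?h ^ 3 * ?\<tau>)) = 3456 * ?C1 * cacc * (s / ?\<tau>)"
    proof -
      have *: "s * k * (2 * C * c / (k / 1728 * t)) = 3456 * C * c * (s / t)" if "k \<noteq> 0" for k t C c :: real
        using that by (simp add: divide_simps)
      have hk: "?h ^ 3 = (s ^ Q) ^ 3 * s ^ 3 / 1728"
        by (simp add: power_divide power_mult_distrib mult.commute)
      moreover have r: "\<rho> / s ^ Q = s * ((s ^ Q) ^ 3 * s ^ 3)"
        unfolding \<rho>2 using sQ by (simp add: mult_ac)
      moreover have "(s ^ Q) ^ 3 * s ^ 3 \<noteq> 0" using s by simp
      ultimately show ?thesis unfolding hk r by (intro *)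
    qed
    have "\<rho> / s ^ Q * ?E = \<rho> / s ^ Q * (La * ?h * ?g / \<rho>) + \<rho> / s ^ Q * (32 * La / ?\<tau>)
        + \<rho> / s ^ Q * (2 * ?C1 * cacc / (?h ^ 3 * ?\<tau>))" by (simp only: distrib_left)
    also have "\<dots> \<le> La * ?g * (s / ?\<tau>) + s * (32 * La / ?\<tau>) + 3456 * ?C1 * cacc * (s / ?\<tau>)"
      using 1 2 3 by linarith
    also have "\<dots> = (La * ?g + 32 * La + 3456 * ?C1 * cacc) * (s / ?\<tau>)"
    proof -
      have "s * (32 * La / ?\<tau>) = 32 * La * (s / ?\<tau>)" by simp
      then show ?thesis by (simp only: distrib_right)
    qed
    finally show ?thesis .
  qed
  have "(\<integral>\<^sup>+x. ennreal (conv (cut u R e (w + s)) \<rho> (x + z) - conv (cut u R e w) \<rho> x) \<partial>lborel)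
     \<le> ennreal (real DIM('a) * (spanc / (s / 2) ^ Q * (2 ^ Suc N * \<rho>)) * (?E * ?l))"
    by (rule level_step[OF kin R R_def e_def w s h h6 \<rho>0 z])
  also have "real DIM('a) * (spanc / (s / 2) ^ Q * (2 ^ Suc N * \<rho>)) * (?E * ?l)
      = real DIM('a) * spanc * 2 ^ Q * 2 ^ Suc N * (\<rho> / s ^ Q * ?E) * ?l"
    by (simp add: power_divide mult_ac del: power_Suc)
  also have "ennreal \<dots> \<le> ennreal (real DIM('a) * spanc * 2 ^ Q * 2 ^ Suc N * 
      ((La * ?g + 32 * La + 3456 * ?C1 * cacc) * (s / ?\<tau>)) * ?l)"
    by (intro ennreal_leI mult_right_mono mult_left_mono key) (use spanc_pos in auto)
  also have "real DIM('a) * spanc * 2 ^ Q * 2 ^ Suc N * ((La * ?g + 32 * La + 3456 * ?C1 * cacc) * (s / ?\<tau>)) * ?l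
      = stepc * s / ?\<tau> * ?l"
    unfolding stepc_def by (simp only: mult.assoc times_divide_eq_right)
  finally show ?thesis .
qed

end

section \<open>Mollification as an average of translates\<close>

text \<open>On the right \<open>ennreal\<close> drops the negative part of f; a non-integrable f has
  integral 0 on the left.\<close>

lemma integral_le_nn_integral:
  fixes f :: "'a \<Rightarrow> real"
  shows "ennreal (integral\<^sup>L M f) \<le> (\<integral>\<^sup>+x. ennreal (f x) \<partial>M)"
proof (cases "integrable M f")
  case True
  have "integral\<^sup>L M f \<le> integral\<^sup>L M (\<lambda>x. max 0 (f x))"
    using True by (intro integral_mono) auto
  then have "ennreal (integral\<^sup>L M f) \<le> ennreal (integral\<^sup>L M (\<lambda>x. max 0 (f x)))"
    by (rule ennreal_leI)
  also have "\<dots> = (\<integral>\<^sup>+x. ennreal (max 0 (f x)) \<partial>M)"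
    using True by (intro nn_integral_eq_integral[symmetric]) auto
  also have "\<dots> = (\<integral>\<^sup>+x. ennreal (f x) \<partial>M)"
    by (intro nn_integral_cong) (auto simp: max_def ennreal_neg)
  finally show ?thesis .
qed (simp add: not_integrable_integral_eq)

lemma conv_eq: 
  fixes b :: "'a::euclidean_space \<Rightarrow> real"
  assumes [measurable]: "b \<in> borel_measurable borel"
  shows "conv b \<rho> x = (LINT z|lborel. b (x - z) * kern \<rho> z)"
  unfolding conv_def by (subst integral_minus[of _ x, symmetric]) auto

lemma conv_bounds:
  fixes b :: "'a::euclidean_space \<Rightarrow> real"
  assumes [measurable]: "b \<in> borel_measurable borel" and "\<And>y. 0 \<le> b y" "\<And>y. b y \<le> 1" "0 < \<rho>"
  shows "0 \<le> conv b \<rho> x" "conv b \<rho> x \<le> 1"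
proof -
  have b: "\<bar>b y\<bar> \<le> 1" for y using assms(2,3)[of y] by simp
  show "0 \<le> conv b \<rho> x" by (rule conv_nonneg[OF assms(4,2)])
  have "conv b \<rho> x \<le> conv (\<lambda>_. 1) \<rho> x"
    by (rule conv_mono) (use assms b in auto)
  also have "\<dots> = 1"
    by (subst conv_eq) (auto simp: integral_kern assms(4))
  finally show "conv b \<rho> x \<le> 1" .
qed

lemma integrable_conv':
  fixes b :: "'a::euclidean_space \<Rightarrow> real"
  assumes [measurable]: "b \<in> borel_measurable borel" and "\<And>y. \<bar>b y\<bar> \<le> 1" "0 < \<rho>"
  shows "integrable lborel (\<lambda>z. b (x - z) * kern \<rho> z)"
proof (rule Bochner_Integration.integrable_bound[OF kern_integrable[OF assms(3)]])
  show "AE z in lborel. norm (b (x - z) * kern \<rho> z) \<le> norm (kern \<rho> z)"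
    using assms(2) by (intro AE_I2) (auto simp: abs_mult intro: mult_left_le_one_le)
qed auto

lemma conv_nn:
  fixes b :: "'a::euclidean_space \<Rightarrow> real"
  assumes [measurable]: "b \<in> borel_measurable borel" and b: "\<And>y. 0 \<le> b y" "\<And>y. b y \<le> 1"
    and \<rho>: "0 < \<rho>"
  shows "ennreal (conv b \<rho> x) = (\<integral>\<^sup>+z. ennreal (b (x - z)) * ennreal (kern \<rho> z) \<partial>lborel)"
proof -
  have "\<bar>b y\<bar> \<le> 1" for y using b[of y] by simp
  then have "ennreal (conv b \<rho> x) = (\<integral>\<^sup>+z. ennreal (b (x - z) * kern \<rho> z) \<partial>lborel)"
    using b \<rho> by (subst conv_eq) (auto intro!: nn_integral_eq_integral[symmetric] integrable_conv' simp: kern_nonneg)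
  then show ?thesis using b by (simp add: ennreal_mult')
qed

text \<open>This is the device for changing scale: a twice mollified function can be read as a
  mollification of either of the two simple ones.\<close>

lemma conv_commute:
  fixes b :: "'a::euclidean_space \<Rightarrow> real"
  assumes [measurable]: "b \<in> borel_measurable borel" and b: "\<And>y. 0 \<le> b y" "\<And>y. b y \<le> 1"
    and \<rho>: "0 < \<rho>" "0 < \<sigma>"
  shows "conv (conv b \<rho>) \<sigma> x = conv (conv b \<sigma>) \<rho> x"
proof -
  have *: "ennreal (conv (conv b r) s x)
      = (\<integral>\<^sup>+z. \<integral>\<^sup>+y. ennreal (b (x - z - y)) * ennreal (kern r y) * ennreal (kern s z) \<partial>lborel \<partial>lborel)"
    if "0 < r" "0 < s" for r s
    using that b conv_bounds[OF assms(1-3)]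
    by (subst conv_nn) (auto simp: conv_nn nn_integral_multc)
  have "ennreal (conv (conv b \<rho>) \<sigma> x) = ennreal (conv (conv b \<sigma>) \<rho> x)"
    unfolding *[OF \<rho>] *[OF \<rho>(2,1)]
    by (subst lborel_pair.Fubini') (auto intro!: nn_integral_cong simp: algebra_simps)
  moreover have "0 \<le> conv (conv b \<rho>) \<sigma> x" by (rule conv_nonneg[OF \<rho>(2)]) (rule conv_nonneg[OF \<rho>(1) b(1)])
  moreover have "0 \<le> conv (conv b \<sigma>) \<rho> x" by (rule conv_nonneg[OF \<rho>(1)]) (rule conv_nonneg[OF \<rho>(2) b(1)])
  ultimately show ?thesis by simp
qed

text \<open>A mollification averages translates with a weight of mass one, and the positive part of
  a difference is convex. A bound uniform in the translation therefore survives the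
  averaging.\<close>

lemma conv_diff_le:
  fixes A B :: "'a::euclidean_space \<Rightarrow> real"
  assumes [measurable]: "A \<in> borel_measurable borel" "B \<in> borel_measurable borel"
    and b: "\<And>y. \<bar>A y\<bar> \<le> 1" "\<And>y. \<bar>B y\<bar> \<le> 1" and \<rho>: "0 < \<rho>"
    and X: "\<And>z. norm z \<le> \<rho> \<Longrightarrow> (\<integral>\<^sup>+x. ennreal (A (x + z) - B x) \<partial>lborel) \<le> X"
  shows "(\<integral>\<^sup>+x. ennreal (A x - conv B \<rho> x) \<partial>lborel) \<le> X"
    and "(\<integral>\<^sup>+x. ennreal (conv A \<rho> x - B x) \<partial>lborel) \<le> X"
proof -
  have kX: "(\<integral>\<^sup>+z. ennreal (kern \<rho> z) * Y z \<partial>lborel) \<le> X" if "\<And>z. norm z \<le> \<rho> \<Longrightarrow> Y z \<le> X" for Y :: "'a \<Rightarrow> ennreal"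
  proof -
    have "(\<integral>\<^sup>+z. ennreal (kern \<rho> z) * Y z \<partial>lborel) \<le> (\<integral>\<^sup>+z. ennreal (kern \<rho> (z::'a)) * X \<partial>lborel)"
    proof (rule nn_integral_mono)
      show "ennreal (kern \<rho> z) * Y z \<le> ennreal (kern \<rho> z) * X" for z
        using that[of z] kern_eq_0[OF \<rho>, of z] by (cases "norm z \<le> \<rho>") (auto intro: mult_left_mono)
    qed
    also have "\<dots> = X" by (simp add: nn_integral_multc nn_integral_kern[OF \<rho>])
    finally show ?thesis .
  qed
  have kn: "0 \<le> kern \<rho> z" for z :: 'a using \<rho> by (simp add: kern_nonneg)
  have "(\<integral>\<^sup>+x. ennreal (A x - conv B \<rho> x) \<partial>lborel)
      \<le> (\<integral>\<^sup>+x. \<integral>\<^sup>+z. ennreal (kern \<rho> z) * ennreal (A x - B (x - z)) \<partial>lborel \<partial>lborel)"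
  proof (rule nn_integral_mono)
    fix x
    have "A x - conv B \<rho> x = (LINT z|lborel. A x * kern \<rho> z - B (x - z) * kern \<rho> z)"
      using integral_kern[OF \<rho>, where 'a='a] kern_integrable[OF \<rho>, where 'a='a] b \<rho>
      by (subst Bochner_Integration.integral_diff) (auto simp: conv_eq intro: integrable_conv')
    also have "\<dots> = (LINT z|lborel. kern \<rho> z * (A x - B (x - z)))"
      by (simp add: algebra_simps)
    finally show "ennreal (A x - conv B \<rho> x) \<le> (\<integral>\<^sup>+z. ennreal (kern \<rho> z) * ennreal (A x - B (x - z)) \<partial>lborel)"
      using integral_le_nn_integral[of lborel "\<lambda>z. kern \<rho> z * (A x - B (x - z))"] kn by (simp add: ennreal_mult')
  qed
  also have "\<dots> = (\<integral>\<^sup>+z. \<integral>\<^sup>+x. ennreal (kern \<rho> z) * ennreal (A x - B (x - z)) \<partial>lborel \<partial>lborel)"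
    by (rule lborel_pair.Fubini') measurable
  also have "\<dots> = (\<integral>\<^sup>+z. ennreal (kern \<rho> z) * (\<integral>\<^sup>+x. ennreal (A (x + z) - B x) \<partial>lborel) \<partial>lborel)"
  proof (rule nn_integral_cong)
    fix z :: 'a
    have "(\<integral>\<^sup>+x. ennreal (A x - B (x - z)) \<partial>lborel) = (\<integral>\<^sup>+x. ennreal (A (x + z) - B x) \<partial>lborel)"
      using nn_integral_plus[of "\<lambda>x. ennreal (A x - B (x - z))" z] by simp
    then show "(\<integral>\<^sup>+x. ennreal (kern \<rho> z) * ennreal (A x - B (x - z)) \<partial>lborel)
        = ennreal (kern \<rho> z) * (\<integral>\<^sup>+x. ennreal (A (x + z) - B x) \<partial>lborel)"
      by (simp add: nn_integral_cmult)
  qed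
  also have "\<dots> \<le> X" by (rule kX[OF X])
  finally show "(\<integral>\<^sup>+x. ennreal (A x - conv B \<rho> x) \<partial>lborel) \<le> X" .
  have "(\<integral>\<^sup>+x. ennreal (conv A \<rho> x - B x) \<partial>lborel)
      \<le> (\<integral>\<^sup>+x. \<integral>\<^sup>+z. ennreal (kern \<rho> z) * ennreal (A (x - z) - B x) \<partial>lborel \<partial>lborel)"
  proof (rule nn_integral_mono)
    fix x
    have "conv A \<rho> x - B x = (LINT z|lborel. A (x - z) * kern \<rho> z - B x * kern \<rho> z)"
      using integral_kern[OF \<rho>, where 'a='a] kern_integrable[OF \<rho>, where 'a='a] b \<rho>
      by (subst Bochner_Integration.integral_diff) (auto simp: conv_eq intro: integrable_conv')
    also have "\<dots> = (LINT z|lborel. kern \<rho> z * (A (x - z) - B x))"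
      by (simp add: algebra_simps)
    finally show "ennreal (conv A \<rho> x - B x) \<le> (\<integral>\<^sup>+z. ennreal (kern \<rho> z) * ennreal (A (x - z) - B x) \<partial>lborel)"
      using integral_le_nn_integral[of lborel "\<lambda>z. kern \<rho> z * (A (x - z) - B x)"] kn by (simp add: ennreal_mult')
  qed
  also have "\<dots> = (\<integral>\<^sup>+z. \<integral>\<^sup>+x. ennreal (kern \<rho> z) * ennreal (A (x - z) - B x) \<partial>lborel \<partial>lborel)"
    by (rule lborel_pair.Fubini') measurable
  also have "\<dots> = (\<integral>\<^sup>+z. ennreal (kern \<rho> z) * (\<integral>\<^sup>+x. ennreal (A (x + (- z)) - B x) \<partial>lborel) \<partial>lborel)"
    by (simp add: nn_integral_cmult)
  also have "\<dots> \<le> X" by (rule kX[OF X]) simp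
  finally show "(\<integral>\<^sup>+x. ennreal (conv A \<rho> x - B x) \<partial>lborel) \<le> X" .
qed

lemma measure_less:
  assumes "emeasure M S < ennreal e"
  shows "measure M S < e"
proof -
  have "emeasure M S = ennreal (measure M S)"
    using assms by (intro emeasure_eq_ennreal_measure) auto
  then show ?thesis using assms by (simp add: ennreal_less_iff)
qed

text \<open>A is approximated from inside by a compact K, and K from outside by an open set, which
  contains all small translates of K. A translate thus loses little of K, and K little of A.\<close>

lemma translation_overlap:
  fixes A :: "'a::euclidean_space set"
  assumes A: "A \<in> sets borel" "bounded A" and \<epsilon>: "0 < \<epsilon>"
  obtains \<delta> where "0 < \<delta>" "\<And>z. norm z < \<delta> \<Longrightarrow> measure lborel A - \<epsilon> \<le> measure lborel {x\<in>A. x - z \<in> A}"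
proof -
  obtain r where r: "A \<subseteq> cball 0 r" using bounded_subset_ballD[OF A(2), of 0] ball_subset_cball by blast
  have fin: "emeasure lborel S < \<infinity>" if "S \<subseteq> cball (0::'a) r'" for S r'
    by (rule le_less_trans[OF emeasure_mono[OF that] emeasure_lborel_cball_finite]) simp
  obtain V where V: "open V" "cball 0 r - A \<subseteq> V" "emeasure lborel (V - (cball 0 r - A)) < ennreal (\<epsilon> / 3)"
    using outer_regular_lborel[of "cball 0 r - A" "\<epsilon> / 3"] A \<epsilon> by auto
  define K where "K = cball 0 r - V"
  have K: "compact K" "K \<subseteq> A" using V by (auto simp: K_def intro: compact_diff)
  have Kb [measurable]: "K \<in> sets borel" using K(1) by (rule borel_compact)
  have "emeasure lborel (A - K) \<le> emeasure lborel (V - (cball 0 r - A))"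
    using r V(1) A by (intro emeasure_mono) (auto simp: K_def)
  then have "emeasure lborel (A - K) < ennreal (\<epsilon> / 3)" using V(3) by simp
  then have "measure lborel (A - K) < \<epsilon> / 3" by (rule measure_less)
  moreover have "measure lborel (A - K) = measure lborel A - measure lborel K"
    using A K fin[OF r] by (intro measure_Diff) auto
  ultimately have AK: "measure lborel A - \<epsilon> / 3 < measure lborel K" by simp
  obtain O' where O: "open O'" "K \<subseteq> O'" "emeasure lborel (O' - K) < ennreal (\<epsilon> / 3)"
    using outer_regular_lborel[of K "\<epsilon> / 3"] \<epsilon> by auto
  obtain \<delta> where \<delta>: "0 < \<delta>" "(\<Union>x\<in>K. ball x \<delta>) \<subseteq> O'"
    using compact_subset_open_imp_ball_epsilon_subset[OF K(1) O(1,2)] by blast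
  show ?thesis
  proof (rule that[OF \<delta>(1)])
    fix z :: 'a assume z: "norm z < \<delta>"
    let ?K' = "(+) z ` K"
    have K': "compact ?K'" using K by (simp add: compact_translation)
    have K'b [measurable]: "?K' \<in> sets borel" using K' by (rule borel_compact)
    have mK': "measure lborel ?K' = measure lborel K"
      using measure_translation[of z K] by simp
    have finK: "emeasure lborel K < \<infinity>" "emeasure lborel ?K' < \<infinity>"
      using emeasure_bounded_finite[OF compact_imp_bounded] K(1) K' by auto
    have sub: "?K' \<subseteq> O'"
      using \<delta>(2) z by (force simp: dist_norm)
    have "emeasure lborel (?K' - K) \<le> emeasure lborel (O' - K)"
      using sub O(1) by (intro emeasure_mono) auto
    then have "emeasure lborel (?K' - K) < ennreal (\<epsilon> / 3)" using O(3) by simp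
    then have 1: "measure lborel (?K' - K) < \<epsilon> / 3" by (rule measure_less)
    have "measure lborel (?K' - ?K' \<inter> K) = measure lborel ?K' - measure lborel (?K' \<inter> K)"
      using finK by (intro measure_Diff) auto
    moreover have "?K' - ?K' \<inter> K = ?K' - K" by blast
    ultimately have "measure lborel A - \<epsilon> \<le> measure lborel (?K' \<inter> K)"
      using 1 mK' AK \<epsilon> by simp
    also have "\<dots> \<le> measure lborel {x\<in>A. x - z \<in> A}"
    proof (rule measure_mono_fmeasurable)
      show "?K' \<inter> K \<subseteq> {x\<in>A. x - z \<in> A}" using K by auto
      have [measurable]: "A \<in> sets borel" by (rule A)
      have "{x\<in>A. x - z \<in> A} \<in> sets borel" by measurable
      then show "{x\<in>A. x - z \<in> A} \<in> fmeasurable lborel"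
        using fin[of "{x\<in>A. x - z \<in> A}" r] r by (intro fmeasurableI) auto
    qed auto
    finally show "measure lborel A - \<epsilon> \<le> measure lborel {x\<in>A. x - z \<in> A}" .
  qed
qed

lemma ennreal_diff_triangle: "ennreal (a - c) \<le> ennreal (a - b) + ennreal (b - c)"
proof (cases "0 \<le> a - b \<and> 0 \<le> b - c")
  case True
  then show ?thesis by (simp flip: ennreal_plus)
next
  case False
  then show ?thesis by (auto simp: not_le ennreal_neg intro!: ennreal_leI)
qed

text \<open>The integral is the average over z of the measure of the overlap of A with its translate
  by z. This lower bound is all that is needed of the convergence of mollifications at small
  scales.\<close>

lemma conv_indicator_overlap:
  fixes A :: "'a::euclidean_space set"
  assumes A: "A \<in> sets borel" "bounded A" and \<epsilon>: "0 < \<epsilon>"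
  obtains \<delta> where "0 < \<delta>" "\<And>\<rho>. 0 < \<rho> \<Longrightarrow> \<rho> < \<delta> \<Longrightarrow>
    ennreal (measure lborel A - \<epsilon>) \<le> (\<integral>\<^sup>+x. indicator A x * ennreal (conv (indicator A) \<rho> x) \<partial>lborel)"
proof -
  obtain \<delta> where \<delta>: "0 < \<delta>" "\<And>z. norm z < \<delta> \<Longrightarrow> measure lborel A - \<epsilon> \<le> measure lborel {x\<in>A. x - z \<in> A}"
    using translation_overlap[OF assms] by blast
  have [measurable]: "A \<in> sets borel" by (rule A)
  have fin: "emeasure lborel {x\<in>A. x - z \<in> A} < \<infinity>" for z
    by (rule emeasure_bounded_finite[OF bounded_subset[OF A(2)]]) auto
  show ?thesis
  proof (rule that[OF \<delta>(1)])
    fix \<rho> assume \<rho>: "0 < \<rho>" "\<rho> < \<delta>"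
    have "ennreal (measure lborel A - \<epsilon>) = (\<integral>\<^sup>+z. ennreal (kern \<rho> (z::'a)) * ennreal (measure lborel A - \<epsilon>) \<partial>lborel)"
      by (simp add: nn_integral_multc nn_integral_kern \<rho>)
    also have "\<dots> \<le> (\<integral>\<^sup>+z. ennreal (kern \<rho> z) * emeasure lborel {x\<in>A. x - z \<in> A} \<partial>lborel)"
    proof (rule nn_integral_mono)
      fix z :: 'a
      show "ennreal (kern \<rho> z) * ennreal (measure lborel A - \<epsilon>) \<le> ennreal (kern \<rho> z) * emeasure lborel {x\<in>A. x - z \<in> A}"
      proof (cases "norm z < \<delta>")
        case True
        have "emeasure lborel {x\<in>A. x - z \<in> A} = ennreal (measure lborel {x\<in>A. x - z \<in> A})"
          using fin[of z] by (intro emeasure_eq_ennreal_measure) auto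
        then show ?thesis using \<delta>(2)[OF True] by (auto intro!: mult_left_mono ennreal_leI)
      next
        case False
        then show ?thesis using kern_eq_0[OF \<rho>(1), of z] \<rho> by simp
      qed
    qed
    also have "\<dots> = (\<integral>\<^sup>+z. \<integral>\<^sup>+x. indicator A x * (ennreal (indicator A (x - z)) * ennreal (kern \<rho> z)) \<partial>lborel \<partial>lborel)"
    proof (rule nn_integral_cong)
      fix z :: 'a
      have "emeasure lborel {x\<in>A. x - z \<in> A} = (\<integral>\<^sup>+x. indicator {x\<in>A. x - z \<in> A} x \<partial>lborel)"
        by simp
      also have "\<dots> = (\<integral>\<^sup>+x. indicator A x * ennreal (indicator A (x - z)) \<partial>lborel)"
        by (intro nn_integral_cong) (auto simp: indicator_def)
      finally have "ennreal (kern \<rho> z) * emeasure lborel {x\<in>A. x - z \<in> A}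
          = (\<integral>\<^sup>+x. ennreal (kern \<rho> z) * (indicator A x * ennreal (indicator A (x - z))) \<partial>lborel)"
        by (simp add: nn_integral_cmult)
      then show "ennreal (kern \<rho> z) * emeasure lborel {x\<in>A. x - z \<in> A}
          = (\<integral>\<^sup>+x. indicator A x * (ennreal (indicator A (x - z)) * ennreal (kern \<rho> z)) \<partial>lborel)"
        by (simp add: mult_ac)
    qed
    also have "\<dots> = (\<integral>\<^sup>+x. \<integral>\<^sup>+z. indicator A x * (ennreal (indicator A (x - z)) * ennreal (kern \<rho> z)) \<partial>lborel \<partial>lborel)"
      by (rule lborel_pair.Fubini') measurable
    also have "\<dots> = (\<integral>\<^sup>+x. indicator A x * ennreal (conv (indicator A) \<rho> x) \<partial>lborel)"
      using \<rho> by (intro nn_integral_cong) (simp add: conv_nn nn_integral_cmult)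
    finally show "ennreal (measure lborel A - \<epsilon>) \<le> (\<integral>\<^sup>+x. indicator A x * ennreal (conv (indicator A) \<rho> x) \<partial>lborel)" .
  qed
qed

section \<open>From fine scales to coarse ones\<close>

context gn_flux
begin

text \<open>One step goes from scale j + 1 to scale j and costs \<open>2 * stepc * s j\<close>;
  since the \<open>s j\<close> form a geometric series, the bound does not depend on the number n of
  steps.\<close>

lemma telescope:
  assumes kin: "kinetic_on a {al..be} D u \<mu>"
    and R: "1 / 2 \<le> R'" "R' < R''" "R'' \<le> 2" "R'' < D"
    and R_def: "R = (R' + R'') / 2" and e_def: "e = (R\<^sup>2 - R'\<^sup>2) / 4"
    and w: "al \<le> w" and \<sigma>: "0 < \<sigma>" "\<sigma> \<le> 1"
  shows "(\<integral>\<^sup>+x. ennreal (conv (cut u R e (w + 4 * \<sigma>)) ((\<sigma> / 2 ^ n) ^ Suc N) x - conv (cut u R e w) (\<sigma> ^ Suc N) x) \<partial>lborel)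
     \<le> ennreal (4 * stepc * \<sigma> / (R'' - R') * measure lborel {y\<in>ball 0 R''. w < u y})"
proof -
  have [measurable]: "u \<in> borel_measurable borel" using kin by (simp add: kinetic_on_def)
  let ?\<tau> = "R'' - R'"
  let ?l = "measure lborel {y\<in>ball 0 R''. w < u y}"
  define s where "s j = \<sigma> / 2 ^ j" for j :: nat
  define \<rho> where "\<rho> j = s j ^ Suc N" for j
  \<comment> \<open>Each step raises the level by \<open>s j + s (Suc j)\<close>, which is 3/2 of
    \<open>s j\<close>; the levels therefore climb from w towards \<open>w + 3 * \<sigma>\<close>
    and stay below \<open>w + 4 * \<sigma>\<close>.\<close>
  define W where "W j = w + 3 * \<sigma> - 3 * s j" for j
  define g where "g j = conv (cut u R e (W j)) (\<rho> j)" for j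
  have s: "0 < s j" "s j \<le> 1" "s (Suc j) = s j / 2" for j
  proof -
    have "s j \<le> \<sigma>" unfolding s_def using \<sigma> by (simp add: divide_le_eq mult_left_le)
    then show "s j \<le> 1" using \<sigma> by linarith
    show "0 < s j" "s (Suc j) = s j / 2" using \<sigma> by (auto simp: s_def)
  qed
  have \<rho>: "0 < \<rho> j" for j using s by (simp add: \<rho>_def)
  have \<rho>S: "\<rho> j = 2 ^ Suc N * \<rho> (Suc j)" for j
    by (simp add: \<rho>_def s(3) power_divide field_simps)
  have WS: "W (Suc j) = W j + s j + s (Suc j)" for j by (simp add: W_def s(3))
  have Ww: "w \<le> W j" for j
  proof -
    have "s j \<le> \<sigma>" unfolding s_def using \<sigma> by (simp add: divide_le_eq mult_left_le)
    then show ?thesis by (simp add: W_def)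
  qed
  have gm: "\<bar>conv (cut u R e v) r x\<bar> \<le> 1" if "0 < r" for v r x
    using conv_bounds[of "cut u R e v" r x] that by (simp add: cut_nonneg cut_le_1)
  have lm: "measure lborel {y\<in>ball 0 R''. v < u y} \<le> ?l" if "w \<le> v" for v
  proof (rule measure_mono_fmeasurable)
    show "{y\<in>ball 0 R''. w < u y} \<in> fmeasurable lborel"
    proof (rule fmeasurableI)
      show "emeasure lborel {y\<in>ball 0 R''. w < u y} < \<infinity>"
        by (rule emeasure_bounded_finite[OF bounded_subset[OF bounded_ball[of 0 R'']]]) auto
    qed measurable
  qed (use that in auto)
  have X: "ennreal (stepc * r / ?\<tau> * measure lborel {y\<in>ball 0 R''. v < u y}) \<le> ennreal (stepc * r / ?\<tau> * ?l)"
    if "w \<le> v" "0 < r" for v r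
    using that stepc_nonneg R by (intro ennreal_leI mult_left_mono lm) auto
  have step: "(\<integral>\<^sup>+x. ennreal (g (Suc j) x - g j x) \<partial>lborel) \<le> ennreal (2 * stepc * s j / ?\<tau> * ?l)" for j
  proof -
    let ?A = "conv (cut u R e (W (Suc j))) (\<rho> (Suc j))" and ?B = "conv (cut u R e (W j + s j)) (\<rho> (Suc j))"
    let ?A2 = "conv (cut u R e (W j + s j)) (\<rho> j)" and ?B2 = "conv (cut u R e (W j)) (\<rho> j)"
    have W1: "w \<le> W j + s j" using Ww[of j] s(1)[of j] by linarith
    have 1: "(\<integral>\<^sup>+x. ennreal (?A x - conv ?B (\<rho> j) x) \<partial>lborel) \<le> ennreal (stepc * s (Suc j) / ?\<tau> * ?l)"
    proof (rule conv_diff_le(1)[of ?A ?B "\<rho> j"])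
      fix z :: 'a assume "norm z \<le> \<rho> j"
      then have z: "norm z \<le> 2 ^ Suc N * \<rho> (Suc j)" by (simp only: \<rho>S[of j])
      show "(\<integral>\<^sup>+x. ennreal (?A (x + z) - ?B x) \<partial>lborel) \<le> ennreal (stepc * s (Suc j) / ?\<tau> * ?l)"
        unfolding WS
        by (rule order_trans[OF level_step'[OF kin R R_def e_def _ s(1,2) _ z] X])
           (use w W1 s(1) in \<open>auto simp: \<rho>_def simp del: power_Suc\<close>)
    qed (use \<rho> gm[OF \<rho>] in auto)
    have 2: "(\<integral>\<^sup>+x. ennreal (conv ?A2 (\<rho> (Suc j)) x - ?B2 x) \<partial>lborel) \<le> ennreal (stepc * s j / ?\<tau> * ?l)"
    proof (rule conv_diff_le(2)[of ?A2 ?B2 "\<rho> (Suc j)"])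
      fix z :: 'a assume "norm z \<le> \<rho> (Suc j)"
      also have "\<rho> (Suc j) \<le> 2 ^ Suc N * \<rho> j"
      proof -
        have "\<rho> (Suc j) \<le> \<rho> j" unfolding \<rho>_def
          using s(1)[of j] s(3)[of j] by (intro power_mono) auto
        also have "1 * \<rho> j \<le> 2 ^ Suc N * \<rho> j" using \<rho>[of j] one_le_power[of "2::real" "Suc N"] by (intro mult_right_mono) auto
        finally show ?thesis by simp
      qed
      finally have z: "norm z \<le> 2 ^ Suc N * \<rho> j" .
      show "(\<integral>\<^sup>+x. ennreal (?A2 (x + z) - ?B2 x) \<partial>lborel) \<le> ennreal (stepc * s j / ?\<tau> * ?l)"
        by (rule order_trans[OF level_step'[OF kin R R_def e_def _ s(1,2) _ z] X])
           (use w Ww[of j] s(1) in \<open>auto simp: \<rho>_def simp del: power_Suc\<close>)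
    qed (use \<rho> gm[OF \<rho>] in auto)
    \<comment> \<open>The intermediate function at level \<open>W j + s j\<close> is mollified at
      both scales. The first half step compares it with the finer mollification, the second with the
      coarser one.\<close>
    have c: "conv ?B (\<rho> j) x = conv ?A2 (\<rho> (Suc j)) x" for x
      by (rule conv_commute) (auto simp: cut_nonneg cut_le_1 \<rho>)
    have "(\<integral>\<^sup>+x. ennreal (g (Suc j) x - g j x) \<partial>lborel)
        \<le> (\<integral>\<^sup>+x. ennreal (?A x - conv ?B (\<rho> j) x) + ennreal (conv ?A2 (\<rho> (Suc j)) x - ?B2 x) \<partial>lborel)"
      unfolding g_def c[symmetric] by (intro nn_integral_mono ennreal_diff_triangle)
    also have "\<dots> = (\<integral>\<^sup>+x. ennreal (?A x - conv ?B (\<rho> j) x) \<partial>lborel) + (\<integral>\<^sup>+x. ennreal (conv ?A2 (\<rho> (Suc j)) x - ?B2 x) \<partial>lborel)"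
      by (rule nn_integral_add) measurable
    also have "\<dots> \<le> ennreal (stepc * s (Suc j) / ?\<tau> * ?l) + ennreal (stepc * s j / ?\<tau> * ?l)"
      by (rule add_mono[OF 1 2])
    also have "\<dots> = ennreal (stepc * s (Suc j) / ?\<tau> * ?l + stepc * s j / ?\<tau> * ?l)"
      using stepc_nonneg R s(1)[of j] s(1)[of "Suc j"] by (intro ennreal_plus[symmetric]) auto
    also have "\<dots> \<le> ennreal (2 * stepc * s j / ?\<tau> * ?l)"
    proof (rule ennreal_leI)
      have double: "2 * stepc * s j / ?\<tau> * ?l = stepc * s j / ?\<tau> * ?l + stepc * s j / ?\<tau> * ?l" by simp
      have "stepc * s (Suc j) / ?\<tau> * ?l \<le> stepc * s j / ?\<tau> * ?l"
        using stepc_nonneg R s(1)[of j] by (intro mult_right_mono divide_right_mono mult_left_mono) (auto simp: s(3))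
      then show "stepc * s (Suc j) / ?\<tau> * ?l + stepc * s j / ?\<tau> * ?l \<le> 2 * stepc * s j / ?\<tau> * ?l"
        unfolding double by (rule add_right_mono)
    qed
    finally show ?thesis .
  qed
  have tel: "(\<integral>\<^sup>+x. ennreal (g n x - g 0 x) \<partial>lborel) \<le> ennreal (2 * stepc * (2 * \<sigma> - 2 * s n) / ?\<tau> * ?l)" for n
  proof (induction n)
    case 0
    then show ?case by (simp add: s_def)
  next
    case (Suc n)
    have sn: "s n \<le> \<sigma>" unfolding s_def using \<sigma> by (simp add: divide_le_eq mult_left_le)
    have "(\<integral>\<^sup>+x. ennreal (g (Suc n) x - g 0 x) \<partial>lborel)
        \<le> (\<integral>\<^sup>+x. ennreal (g (Suc n) x - g n x) + ennreal (g n x - g 0 x) \<partial>lborel)"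
      by (intro nn_integral_mono ennreal_diff_triangle)
    also have "\<dots> = (\<integral>\<^sup>+x. ennreal (g (Suc n) x - g n x) \<partial>lborel) + (\<integral>\<^sup>+x. ennreal (g n x - g 0 x) \<partial>lborel)"
      unfolding g_def by (rule nn_integral_add) measurable
    also have "\<dots> \<le> ennreal (2 * stepc * s n / ?\<tau> * ?l) + ennreal (2 * stepc * (2 * \<sigma> - 2 * s n) / ?\<tau> * ?l)"
      by (rule add_mono[OF step Suc])
    also have "\<dots> = ennreal (2 * stepc * s n / ?\<tau> * ?l + 2 * stepc * (2 * \<sigma> - 2 * s n) / ?\<tau> * ?l)"
      using stepc_nonneg R s(1)[of n] sn by (intro ennreal_plus[symmetric]) auto
    also have "2 * stepc * s n / ?\<tau> * ?l + 2 * stepc * (2 * \<sigma> - 2 * s n) / ?\<tau> * ?l = 2 * stepc * (2 * \<sigma> - 2 * s (Suc n)) / ?\<tau> * ?l"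
    proof -
      have *: "2 * c * x / t * l + 2 * c * (2 * \<sigma> - 2 * x) / t * l = 2 * c * (2 * \<sigma> - 2 * (x / 2)) / t * l"
        for c x t l :: real
      proof -
        have "2 * c * x / t * l + 2 * c * (2 * \<sigma> - 2 * x) / t * l = (2 * c * x + 2 * c * (2 * \<sigma> - 2 * x)) / t * l"
          by (simp only: add_divide_distrib distrib_right)
        also have "2 * c * x + 2 * c * (2 * \<sigma> - 2 * x) = 2 * c * (2 * \<sigma> - 2 * (x / 2))"
          by (simp add: algebra_simps)
        finally show ?thesis .
      qed
      show ?thesis unfolding s(3) by (rule *)
    qed
    finally show ?case .
  qed
  have "(\<integral>\<^sup>+x. ennreal (conv (cut u R e (w + 4 * \<sigma>)) ((\<sigma> / 2 ^ n) ^ Suc N) x - conv (cut u R e w) (\<sigma> ^ Suc N) x) \<partial>lborel)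
      \<le> (\<integral>\<^sup>+x. ennreal (g n x - g 0 x) \<partial>lborel)"
  proof (intro nn_integral_mono ennreal_leI diff_mono)
    fix x
    show "conv (cut u R e (w + 4 * \<sigma>)) ((\<sigma> / 2 ^ n) ^ Suc N) x \<le> g n x"
      unfolding g_def \<rho>_def s_def[symmetric]
    proof (rule conv_mono)
      have "W n \<le> w + 4 * \<sigma>" using s(1)[of n] \<sigma> by (simp add: W_def)
      then show "cut u R e (w + 4 * \<sigma>) y \<le> cut u R e (W n) y" for y by (rule cut_mono)
    qed (use s(1)[of n] in \<open>auto simp: abs_cut\<close>)
    show "g 0 x \<le> conv (cut u R e w) (\<sigma> ^ Suc N) x"
      by (simp add: g_def \<rho>_def W_def s_def)
  qed
  also have "\<dots> \<le> ennreal (2 * stepc * (2 * \<sigma> - 2 * s n) / ?\<tau> * ?l)" by (rule tel)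
  also have "\<dots> \<le> ennreal (4 * stepc * \<sigma> / ?\<tau> * ?l)"
  proof (intro ennreal_leI mult_right_mono divide_right_mono)
    have "2 * stepc * (2 * \<sigma> - 2 * s n) \<le> 2 * stepc * (2 * \<sigma>)"
      using stepc_nonneg s(1)[of n] by (intro mult_left_mono) auto
    then show "2 * stepc * (2 * \<sigma> - 2 * s n) \<le> 4 * stepc * \<sigma>" by simp
  qed (use R in auto)
  finally show ?thesis .
qed

text \<open>On the exceptional set A the coarse mollification is at most 5/8, while the fine one
  dominates 3/4 of the mollified indicator of A, whose integral over A is almost the measure of A.
  By \<open>telescope\<close> the gap 1/8 can persist only on a set of measure 8 times its
  error.\<close>

lemma level_decay:
  assumes kin: "kinetic_on a {al..be} D u \<mu>"
    and R: "1 / 2 \<le> R'" "R' < R''" "R'' \<le> 2" "R'' < D"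
    and R_def: "R = (R' + R'') / 2" and e_def: "e = (R\<^sup>2 - R'\<^sup>2) / 4"
    and w: "al \<le> w" and \<sigma>: "0 < \<sigma>" "\<sigma> \<le> 1"
  shows "measure lborel {x\<in>ball 0 R'. w + 4 * \<sigma> < u x \<and> conv (cut u R e w) (\<sigma> ^ Suc N) x \<le> 5 / 8}
     \<le> 32 * stepc * \<sigma> / (R'' - R') * measure lborel {y\<in>ball 0 R''. w < u y}"
proof -
  have [measurable]: "u \<in> borel_measurable borel" using kin by (simp add: kinetic_on_def)
  let ?E = "4 * stepc * \<sigma> / (R'' - R') * measure lborel {y\<in>ball 0 R''. w < u y}"
  let ?g = "conv (cut u R e w) (\<sigma> ^ Suc N)"
  define A where "A = {x\<in>ball 0 R'. w + 4 * \<sigma> < u x \<and> ?g x \<le> 5 / 8}"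
  have [measurable]: "A \<in> sets borel" unfolding A_def by measurable
  have bA: "bounded A" by (rule bounded_subset[OF bounded_ball[of 0 R']]) (auto simp: A_def)
  have finA: "emeasure lborel A = ennreal (measure lborel A)"
    using emeasure_bounded_finite[OF bA] by (intro emeasure_eq_ennreal_measure) auto
  have R0: "R' < R" "0 < R'" using R R_def by auto
  have e: "0 < e" unfolding e_def using R0 by (simp add: power_strict_mono)
  have E0: "0 \<le> ?E" using stepc_nonneg R \<sigma> by simp
  have g0: "0 \<le> ?g x" for x using \<sigma> by (intro conv_nonneg cut_nonneg) simp
  have \<psi>: "3 / 4 \<le> bump 0 R e y" if "norm y < R'" for y :: 'a
  proof -
    have "4 \<le> (R\<^sup>2 - (norm y)\<^sup>2) / e"
    proof -
      have "(norm y)\<^sup>2 \<le> R'\<^sup>2" using that by (intro power_mono) auto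
      then have "4 * e \<le> R\<^sup>2 - (norm y)\<^sup>2" unfolding e_def by simp
      then show ?thesis using e by (simp add: pos_le_divide_eq)
    qed
    then have "hh 0 4 \<le> bump 0 R e y" unfolding bump_def by (intro hh_0_mono) simp
    moreover have "1 + (- (1 / 4)) \<le> exp (- (1 / 4) :: real)" by (rule exp_ge_add_one_self)
    ultimately show ?thesis by (simp add: hh_def)
  qed
  have main: "3 / 4 * (measure lborel A - \<epsilon>) \<le> 5 / 8 * measure lborel A + ?E" if \<epsilon>: "0 < \<epsilon>" for \<epsilon>
  proof (cases "0 \<le> measure lborel A - \<epsilon>")
    case False
    then have "3 / 4 * (measure lborel A - \<epsilon>) \<le> 0" by simp
    also have "0 \<le> 5 / 8 * measure lborel A + ?E" using E0 by (intro add_nonneg_nonneg) auto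
    finally show ?thesis .
  next
    case True
    obtain \<delta> where \<delta>: "0 < \<delta>" "\<And>\<rho>. 0 < \<rho> \<Longrightarrow> \<rho> < \<delta> \<Longrightarrow>
      ennreal (measure lborel A - \<epsilon>) \<le> (\<integral>\<^sup>+x. indicator A x * ennreal (conv (indicator A) \<rho> x) \<partial>lborel)"
      using conv_indicator_overlap[OF _ bA \<epsilon>] by auto
    obtain n where n: "(1 / 2) ^ n < \<delta>" using real_arch_pow_inv[OF \<delta>(1), of "1/2"] by auto
    define \<rho> where "\<rho> = (\<sigma> / 2 ^ n) ^ Suc N"
    have s: "0 < \<sigma> / 2 ^ n" "\<sigma> / 2 ^ n \<le> (1 / 2) ^ n"
      using \<sigma> by (auto simp: power_divide divide_right_mono)
    have "(1/2::real) ^ n \<le> 1" by (simp add: power_le_one)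
    then have s1: "\<sigma> / 2 ^ n \<le> 1" using s by linarith
    have \<rho>: "0 < \<rho>" "\<rho> < \<delta>"
    proof -
      show "0 < \<rho>" unfolding \<rho>_def by (rule zero_less_power[OF s(1)])
      have "\<rho> \<le> \<sigma> / 2 ^ n" unfolding \<rho>_def power_Suc
        using s s1 by (intro mult_left_le power_le_one) auto
      then show "\<rho> < \<delta>" using s n by linarith
    qed
    let ?q = "conv (cut u R e (w + 4 * \<sigma>)) \<rho>"
    have q: "3 / 4 * conv (indicator A) \<rho> x \<le> ?q x" for x
    proof -
      have "3 / 4 * conv (indicator A) \<rho> x = conv (\<lambda>y. 3 / 4 * indicator A y) \<rho> x"
        by (simp add: conv_def mult.assoc flip: integral_mult_right_zero)
      also have "\<dots> \<le> ?q x"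
      proof (rule conv_mono)
        show "3 / 4 * indicator A y \<le> cut u R e (w + 4 * \<sigma>) y" for y
          using \<psi>[of y] cut_nonneg[of u R e "w + 4 * \<sigma>" y] by (auto simp: indicator_def cut_def A_def)
      qed (use \<rho> in \<open>auto simp: abs_cut indicator_def\<close>)
      finally show ?thesis .
    qed
    have "ennreal (3 / 4 * (measure lborel A - \<epsilon>)) = ennreal (3 / 4) * ennreal (measure lborel A - \<epsilon>)"
      using True by (intro ennreal_mult) auto
    also have "\<dots> \<le> ennreal (3 / 4) * (\<integral>\<^sup>+x. indicator A x * ennreal (conv (indicator A) \<rho> x) \<partial>lborel)"
      by (intro mult_left_mono \<delta>(2) \<rho>) auto
    also have "\<dots> = (\<integral>\<^sup>+x. indicator A x * (ennreal (3 / 4) * ennreal (conv (indicator A) \<rho> x)) \<partial>lborel)"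
      by (subst nn_integral_cmult[symmetric]) (auto simp: mult_ac)
    also have "\<dots> \<le> (\<integral>\<^sup>+x. ennreal (5 / 8) * indicator A x + ennreal (?q x - ?g x) \<partial>lborel)"
    proof (rule nn_integral_mono)
      fix x
      show "indicator A x * (ennreal (3 / 4) * ennreal (conv (indicator A) \<rho> x)) \<le> ennreal (5 / 8) * indicator A x + ennreal (?q x - ?g x)"
      proof (cases "x \<in> A")
        case True
        then have "?g x \<le> 5 / 8" by (simp add: A_def)
        have "ennreal (3 / 4) * ennreal (conv (indicator A) \<rho> x) = ennreal (3 / 4 * conv (indicator A) \<rho> x)"
          by (rule ennreal_mult'[symmetric]) simp
        also have "\<dots> \<le> ennreal (?q x - 0)" using q by (simp add: ennreal_leI)
        also have "\<dots> \<le> ennreal (?q x - ?g x) + ennreal (?g x - 0)" by (rule ennreal_diff_triangle)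
        also have "\<dots> \<le> ennreal (?q x - ?g x) + ennreal (5 / 8)"
          using \<open>?g x \<le> 5 / 8\<close> by (intro add_left_mono ennreal_leI) simp
        finally show ?thesis using True by (simp add: add.commute)
      qed simp
    qed
    also have "\<dots> = ennreal (5 / 8) * emeasure lborel A + (\<integral>\<^sup>+x. ennreal (?q x - ?g x) \<partial>lborel)"
      by (subst nn_integral_add) (auto simp: nn_integral_cmult_indicator)
    also have "\<dots> \<le> ennreal (5 / 8) * ennreal (measure lborel A) + ennreal ?E"
      unfolding \<rho>_def finA by (intro add_left_mono telescope[OF kin R R_def e_def w \<sigma>])
    also have "\<dots> = ennreal (5 / 8 * measure lborel A + ?E)"
    proof -
      have "ennreal (5 / 8) * ennreal (measure lborel A) = ennreal (5 / 8 * measure lborel A)"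
        by (rule ennreal_mult[symmetric]) auto
      moreover have "0 \<le> 5 / 8 * measure lborel A" by simp
      ultimately show ?thesis using E0 by (simp only: ennreal_plus)
    qed
    finally show ?thesis
      using E0 by (subst (asm) ennreal_le_iff) auto
  qed
  have "3 / 4 * measure lborel A \<le> 5 / 8 * measure lborel A + ?E"
  proof (rule field_le_epsilon)
    fix \<epsilon> :: real assume "0 < \<epsilon>"
    then show "3 / 4 * measure lborel A \<le> 5 / 8 * measure lborel A + ?E + \<epsilon>"
      using main[of \<epsilon>] by (simp add: algebra_simps)
  qed
  then have "measure lborel A \<le> 8 * ?E" by linarith
  then show ?thesis unfolding A_def by (simp add: mult.assoc)
qed

section \<open>The iteration in shrinking balls\<close>

text \<open>A crude bound by the supremum of the kernel. If the superlevel set is small enough, the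
  mollification stays below 5/8 everywhere, and \<open>level_decay\<close> bounds the entire next
  superlevel set.\<close>

lemma conv_cut_le:
  fixes u :: "'a \<Rightarrow> real"
  assumes [measurable]: "u \<in> borel_measurable borel" and "0 < e" "0 \<le> R" "R \<le> R''" "0 < \<rho>"
  shows "conv (cut u R e w) \<rho> x \<le> measure lborel {y\<in>ball 0 R''. w < u y} / (\<rho> ^ DIM('a) * bmass TYPE('a))"
proof -
  let ?S = "{y\<in>ball 0 R''. w < u y}" and ?K = "1 / (\<rho> ^ DIM('a) * bmass TYPE('a))"
  have fin: "emeasure lborel ?S < \<infinity>"
    by (rule emeasure_bounded_finite[OF bounded_subset[OF bounded_ball[of 0 R'']]]) auto
  have K: "0 \<le> ?K" using bmass_pos[where 'a='a] assms(5) by simp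
  have "conv (cut u R e w) \<rho> x \<le> (LINT y|lborel. ?K * indicator ?S y)"
    unfolding conv_def
  proof (rule integral_mono')
    show "integrable lborel (\<lambda>y. ?K * indicator ?S y)"
      using fin by (intro integrable_mult_right integrable_real_indicator) auto
    show "0 \<le> ?K * indicator ?S y" for y using K by simp
    show "cut u R e w y * kern \<rho> (x - y) \<le> ?K * indicator ?S y" for y
    proof (cases "y \<in> ?S")
      case True
      have "cut u R e w y * kern \<rho> (x - y) \<le> 1 * ?K"
        using kern_le[OF assms(5), of "x - y"] kern_nonneg[of \<rho> "x - y"] assms(5)
        by (intro mult_mono cut_le_1) auto
      then show ?thesis using True by simp
    next
      case False
      then have "cut u R e w y = 0"
        using bump_eq_0[of e R y 0] assms by (auto simp: cut_def)
      then show ?thesis using False by simp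
    qed
  qed
  also have "\<dots> = measure lborel ?S / (\<rho> ^ DIM('a) * bmass TYPE('a))" using fin by simp
  finally show ?thesis .
qed

text \<open>De Giorgi iteration: radii shrink to \<open>1 / 2\<close> while the levels increase to \<open>w + \<delta>\<close>, the energy estimate
  controls the dissipation at each level by the measure of the previous superlevel set.\<close>

lemma de_giorgi:
  assumes \<delta>: "0 < \<delta>"
  obtains \<kappa> where "0 < \<kappa>"
    "\<And>D u \<mu> w. kinetic_on a {al..be} D u \<mu> \<Longrightarrow> 1 < D \<Longrightarrow> al \<le> w \<Longrightarrow>
       measure lborel {y\<in>ball 0 1. w < u y} \<le> \<kappa> \<Longrightarrow>
       emeasure lborel {y\<in>ball 0 (1 / 2). w + \<delta> < u y} = 0"
proof -
  \<comment> \<open>The kernel at scale \<sigma>^(N+1) has supremum 1 / (\<sigma>^n * bmass). The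
    threshold \<open>c1 * \<sigma> ^ n\<close> is thus exactly what makes \<open>conv_cut_le\<close>
    yield 5/8.\<close>
  define n where "n = Suc N * DIM('a)"
  define c1 where "c1 = 5 / 8 * bmass TYPE('a)"
  \<comment> \<open>The bound \<delta> / 6 keeps the total increase of levels, 16/3 of
    \<open>\<sigma>0\<close>, below \<delta>. The last bound makes the factor of the recursion at
    most (1/4)^n, the rate at which the threshold shrinks when \<sigma> is divided by 4.\<close>
  define \<sigma>0 where "\<sigma>0 = min 1 (min (\<delta> / 6) ((1 / 4) ^ n / (128 * stepc + 1)))"
  define \<sigma> where "\<sigma> k = \<sigma>0 / 4 ^ k" for k :: nat
  have n: "1 \<le> n" using DIM_positive[where 'a='a] by (simp add: n_def Suc_le_eq)
  have c1: "0 < c1" using bmass_pos[where 'a='a] by (simp add: c1_def)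
  have st: "0 < 128 * stepc + 1" using stepc_nonneg by linarith
  have \<sigma>0: "0 < \<sigma>0" "\<sigma>0 \<le> 1" "\<sigma>0 \<le> \<delta> / 6" "128 * stepc * \<sigma>0 \<le> (1 / 4) ^ n"
  proof -
    show "0 < \<sigma>0" "\<sigma>0 \<le> 1" using \<delta> st by (auto simp: \<sigma>0_def)
    show "\<sigma>0 \<le> \<delta> / 6" unfolding \<sigma>0_def by (intro min.coboundedI2 min.cobounded1)
    have "\<sigma>0 \<le> (1 / 4) ^ n / (128 * stepc + 1)"
      unfolding \<sigma>0_def by (intro min.coboundedI2 min.cobounded2)
    then have "\<sigma>0 * (128 * stepc + 1) \<le> (1 / 4) ^ n" using st by (simp add: pos_le_divide_eq)
    then show "128 * stepc * \<sigma>0 \<le> (1 / 4) ^ n" using \<open>0 < \<sigma>0\<close> by (simp add: algebra_simps)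
  qed
  have \<sigma>: "0 < \<sigma> k" "\<sigma> k \<le> \<sigma>0" "\<sigma> (Suc k) = \<sigma> k / 4" for k
    using \<sigma>0 by (auto simp: \<sigma>_def divide_le_eq mult_left_le)
  show ?thesis
  proof (rule that[of "c1 * \<sigma>0 ^ n"])
    show "0 < c1 * \<sigma>0 ^ n" using c1 \<sigma>0 by simp
    fix D u and \<mu> :: "('a \<times> real) measure" and w
    assume kin: "kinetic_on a {al..be} D u \<mu>" and D: "1 < D" and w: "al \<le> w"
      and start: "measure lborel {y\<in>ball 0 1. w < u y} \<le> c1 * \<sigma>0 ^ n"
    have [measurable]: "u \<in> borel_measurable borel" using kin by (simp add: kinetic_on_def)
    define R :: "nat \<Rightarrow> real" where "R k = 1 / 2 + 1 / 2 / 2 ^ k" for k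
    define W where "W k = w + 16 / 3 * (\<sigma>0 - \<sigma> k)" for k
    define l where "l k = measure lborel {y\<in>ball 0 (R k). W k < u y}" for k
    have R: "1 / 2 < R k" "R k \<le> 1" "R (Suc k) < R k" "R k - R (Suc k) = 1 / 4 / 2 ^ k" for k
    proof -
      have "(1::real) / 2 / 2 ^ k \<le> 1 / 2" by (simp add: divide_le_eq)
      then show "R k \<le> 1" unfolding R_def by linarith
      show "1 / 2 < R k" by (simp add: R_def)
      show "R k - R (Suc k) = 1 / 4 / 2 ^ k" by (simp add: R_def field_simps)
      moreover have "(0::real) < 1 / 4 / 2 ^ k" by simp
      ultimately show "R (Suc k) < R k" by linarith
    qed
    have W: "W (Suc k) = W k + 4 * \<sigma> k" "w \<le> W k" for k
    proof -
      show "W (Suc k) = W k + 4 * \<sigma> k" unfolding W_def \<sigma>(3) by (simp add: field_simps)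
      show "w \<le> W k" using \<sigma>(2)[of k] by (simp add: W_def)
    qed
    have l: "l k \<le> c1 * \<sigma> k ^ n" for k
    proof (induction k)
      case 0
      then show ?case using start by (simp add: l_def R_def W_def \<sigma>_def)
    next
      case (Suc k)
      let ?R = "(R (Suc k) + R k) / 2" and ?e = "(((R (Suc k) + R k) / 2)\<^sup>2 - (R (Suc k))\<^sup>2) / 4"
      have \<sigma>1: "\<sigma> k \<le> 1" using \<sigma>(2)[of k] \<sigma>0(2) by linarith
      have e: "0 < ?e"
      proof -
        have "R (Suc k) < ?R" "0 \<le> R (Suc k)" using R(1)[of "Suc k"] R(3)[of k] by auto
        then show ?thesis by (simp add: power_strict_mono)
      qed
      have g: "conv (cut u ?R ?e (W k)) (\<sigma> k ^ Suc N) x \<le> 5 / 8" for x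
      proof -
        have "conv (cut u ?R ?e (W k)) (\<sigma> k ^ Suc N) x \<le> l k / ((\<sigma> k ^ Suc N) ^ DIM('a) * bmass TYPE('a))"
          unfolding l_def
          by (rule conv_cut_le[OF _ e]) (use R(1)[of "Suc k"] R(1,3)[of k] \<sigma>(1)[of k] in auto)
        also have "\<dots> \<le> c1 * \<sigma> k ^ n / ((\<sigma> k ^ Suc N) ^ DIM('a) * bmass TYPE('a))"
          using Suc.IH \<sigma>(1)[of k] bmass_pos[where 'a='a] by (intro divide_right_mono) (auto simp: less_imp_le)
        also have "\<dots> = 5 / 8"
          unfolding n_def power_mult using \<sigma>(1)[of k] bmass_pos[where 'a='a]
          by (simp add: c1_def del: power_Suc)
        finally show ?thesis .
      qed
      have "l (Suc k) = measure lborel {x\<in>ball 0 (R (Suc k)). W k + 4 * \<sigma> k < u x \<and>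
          conv (cut u ?R ?e (W k)) (\<sigma> k ^ Suc N) x \<le> 5 / 8}"
        unfolding l_def W(1) using g by simp
      also have "\<dots> \<le> 32 * stepc * \<sigma> k / (R k - R (Suc k)) * measure lborel {y\<in>ball 0 (R k). W k < u y}"
        by (rule level_decay[OF kin _ _ _ _ refl refl])
           (use R(1)[of "Suc k"] R(2,3)[of k] D W(2)[of k] w \<sigma>(1)[of k] \<sigma>1 in auto)
      also have "\<dots> = 128 * stepc * (2 ^ k * \<sigma> k) * l k"
        unfolding l_def R(4) by simp
      also have "\<dots> \<le> 128 * stepc * \<sigma>0 * (c1 * \<sigma> k ^ n)"
      \<comment> \<open>The radii lose a factor 2 per step, which puts 2^k into the recursion;
        \<open>\<sigma> k\<close> loses a factor 4 and absorbs it.\<close>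
      proof (intro mult_mono)
        have "2 ^ k * \<sigma> k = \<sigma>0 / 2 ^ k"
          by (simp add: \<sigma>_def field_simps flip: power_mult_distrib)
        also have "\<dots> \<le> \<sigma>0" using \<sigma>0 by (simp add: divide_le_eq mult_left_le)
        finally show "2 ^ k * \<sigma> k \<le> \<sigma>0" .
      qed (use stepc_nonneg \<sigma>0 Suc.IH \<sigma>(1)[of k] in \<open>auto simp: l_def\<close>)
      also have "\<dots> \<le> (1 / 4) ^ n * (c1 * \<sigma> k ^ n)"
        using \<sigma>0(4) c1 \<sigma>(1)[of k] by (intro mult_right_mono) auto
      also have "\<dots> = c1 * \<sigma> (Suc k) ^ n"
        by (simp add: \<sigma>(3) power_divide)
      finally show ?case .
    qed
    let ?S = "{y\<in>ball 0 (1 / 2). w + \<delta> < u y}"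
    have fin: "emeasure lborel ?S < \<infinity>"
      by (rule emeasure_bounded_finite[OF bounded_subset[OF bounded_ball[of 0 1]]]) auto
    have "measure lborel ?S \<le> c1 * (1 / 4) ^ k" for k
    proof -
      have "measure lborel ?S \<le> l k"
        unfolding l_def
      proof (rule measure_mono_fmeasurable)
        have "W k \<le> w + \<delta>" using \<sigma>0(3) \<sigma>(1)[of k] \<delta> by (simp add: W_def)
        then show "?S \<subseteq> {y\<in>ball 0 (R k). W k < u y}" using R(1)[of k] by auto
        show "{y\<in>ball 0 (R k). W k < u y} \<in> fmeasurable lborel"
        proof (rule fmeasurableI)
          show "emeasure lborel {y\<in>ball 0 (R k). W k < u y} < \<infinity>"
            by (rule emeasure_bounded_finite[OF bounded_subset[OF bounded_ball[of 0 "R k"]]]) auto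
        qed measurable
      qed measurable
      also have "\<dots> \<le> c1 * \<sigma> k ^ n" by (rule l)
      also have "\<dots> \<le> c1 * (1 / 4) ^ k"
      proof (intro mult_left_mono)
        have \<sigma>1: "\<sigma> k \<le> 1" using \<sigma>(2)[of k] \<sigma>0(2) by linarith
        have "\<sigma> k ^ n \<le> \<sigma> k ^ 1" using \<sigma>(1)[of k] \<sigma>1 n by (intro power_decreasing) auto
        also have "\<dots> \<le> (1 / 4) ^ k" using \<sigma>0 by (simp add: \<sigma>_def power_divide divide_right_mono)
        finally show "\<sigma> k ^ n \<le> (1 / 4) ^ k" .
      qed (use c1 in simp)
      finally show ?thesis .
    qed
    moreover have "(\<lambda>k. c1 * (1 / 4) ^ k) \<longlonglongrightarrow> c1 * 0"
      by (intro tendsto_intros LIMSEQ_power_zero) simp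
    ultimately have "measure lborel ?S \<le> c1 * 0"
      by (intro LIMSEQ_le_const) auto
    then have "measure lborel ?S = 0" by (intro antisym) simp_all
    moreover have "emeasure lborel ?S = ennreal (measure lborel ?S)"
      using fin by (intro emeasure_eq_ennreal_measure) auto
    ultimately show "emeasure lborel ?S = 0" by simp
  qed
qed

section \<open>Comparison of averages at unit distance\<close>

text \<open>With \<psi> = 1 the cut-off term is absent. The measure enters through its total mass
  and the supremum of the kernel, which is affordable here since \<rho> is fixed before the mass is
  made small.\<close>

lemma gconv_sup:
  fixes x :: 'a
  assumes kin: "kinetic_on a {al..be} D u \<mu>"
    and h: "0 < h" and v: "al - 3 \<le> v - h" "v + h \<le> be + 3" and \<rho>: "0 < \<rho>" and x: "norm x + \<rho> < D"
  shows "ennreal \<bar>gconv (\<lambda>y. U h v (u y)) \<rho> (a v) x\<bar>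
     \<le> ennreal (La * h * gconst TYPE('a) / \<rho> +
          4 / bmass TYPE(real) / h\<^sup>2 / (\<rho> ^ DIM('a) * bmass TYPE('a)) * measure \<mu> (space \<mu>))"
proof -
  interpret finite_measure \<mu> using kin by (simp add: kinetic_on_def)
  let ?C1 = "4 / bmass TYPE(real) / h\<^sup>2" and ?K = "1 / (\<rho> ^ DIM('a) * bmass TYPE('a))"
  have C1: "0 \<le> ?C1" using bmass_pos[where 'a=real] by (simp add: less_imp_le)
  have K: "0 \<le> ?K" using bmass_pos[where 'a='a] \<rho> by simp
  have sm: "smooth (\<lambda>y::'a. 1)" by (simp add: smooth_def Ck_const)
  have g1: "grad (\<lambda>y::'a. 1) y = 0" for y by (rule grad_eqI) simp
  have tf: "test_function (ball 0 D) (\<lambda>y. 1 * kern \<rho> (x - y))"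
  proof (rule test_functionI[OF smooth_mult[OF sm smooth_kern_shift] _ compact_cball[of x \<rho>]])
    show "y \<in> cball x \<rho>" if "1 * kern \<rho> (x - y) \<noteq> 0" for y
      using that kern_eq_0[OF \<rho>, of "x - y"] by (cases "\<rho> \<le> norm (x - y)") (auto simp: dist_norm)
    show "cball x \<rho> \<subseteq> ball 0 D"
    proof
      fix y assume "y \<in> cball x \<rho>"
      then have "norm (x - y) \<le> \<rho>" by (simp add: dist_norm)
      moreover have "norm y \<le> norm x + norm (x - y)" using norm_triangle_sub[of y x] by (simp add: norm_minus_commute)
      ultimately show "y \<in> ball 0 D" using x by simp
    qed
  qed
  have "ennreal \<bar>gconv (\<lambda>y. 1 * U h v (u y)) \<rho> (a v) x\<bar>
     \<le> (\<integral>\<^sup>+y. ennreal (La * h * (1 * U h v (u y) * norm (gkern \<rho> (x - y)))) \<partial>lborel)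
       + (\<integral>\<^sup>+y. ennreal (La * (norm (grad (\<lambda>y::'a. 1) y) * U h v (u y) * kern \<rho> (x - y))) \<partial>lborel)
       + (\<integral>\<^sup>+p. ennreal (1 * kern \<rho> (x - fst p) * (?C1 * indicator {v - h..v + h} (snd p))) \<partial>\<mu>)"
    by (rule gconv_bound[OF kin h v \<rho> sm _ _ _ tf, where L=0]) (auto simp: g1)
  also have "\<dots> \<le> ennreal (La * h) * ennreal (gconst TYPE('a) / \<rho>) + 0 + ennreal (?K * ?C1) * emeasure \<mu> (space \<mu>)"
  proof (intro add_mono)
    have "(\<integral>\<^sup>+y. ennreal (La * h * (1 * U h v (u y) * norm (gkern \<rho> (x - y)))) \<partial>lborel)
        \<le> (\<integral>\<^sup>+y. ennreal (La * h) * ennreal (norm (gkern \<rho> (x - y))) \<partial>lborel)"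
    proof (rule nn_integral_mono)
      fix y
      have "La * h * (1 * U h v (u y) * norm (gkern \<rho> (x - y))) \<le> La * h * norm (gkern \<rho> (x - y))"
        using La h U_le_1[OF h] U_nonneg[OF h] by (intro mult_left_mono) (auto intro: mult_left_le_one_le)
      then show "ennreal (La * h * (1 * U h v (u y) * norm (gkern \<rho> (x - y)))) \<le> ennreal (La * h) * ennreal (norm (gkern \<rho> (x - y)))"
        by (subst ennreal_mult''[symmetric]) (auto intro: ennreal_leI)
    qed
    also have "\<dots> = ennreal (La * h) * (\<integral>\<^sup>+y. ennreal (norm (gkern \<rho> (x - y))) \<partial>lborel)"
      by (rule nn_integral_cmult) measurable
    also have "\<dots> \<le> ennreal (La * h) * ennreal (gconst TYPE('a) / \<rho>)"
      by (intro mult_left_mono nn_integral_gkern_shift \<rho>) auto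
    finally show "(\<integral>\<^sup>+y. ennreal (La * h * (1 * U h v (u y) * norm (gkern \<rho> (x - y)))) \<partial>lborel)
      \<le> ennreal (La * h) * ennreal (gconst TYPE('a) / \<rho>)" .
    show "(\<integral>\<^sup>+y. ennreal (La * (norm (grad (\<lambda>y::'a. 1) y) * U h v (u y) * kern \<rho> (x - y))) \<partial>lborel) \<le> 0"
      by (simp add: g1)
    have "(\<integral>\<^sup>+p. ennreal (1 * kern \<rho> (x - fst p) * (?C1 * indicator {v - h..v + h} (snd p))) \<partial>\<mu>)
       \<le> (\<integral>\<^sup>+p. ennreal (?K * ?C1) \<partial>\<mu>)"
    proof (intro nn_integral_mono ennreal_leI)
      fix p :: "'a \<times> real"
      have "?C1 * indicator {v - h..v + h} (snd p) \<le> ?C1"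
        using C1 by (simp add: indicator_def)
      then show "1 * kern \<rho> (x - fst p) * (?C1 * indicator {v - h..v + h} (snd p)) \<le> ?K * ?C1"
        using kern_le[OF \<rho>, of "x - fst p"] C1 K by (intro mult_mono) auto
    qed
    also have "\<dots> = ennreal (?K * ?C1) * emeasure \<mu> (space \<mu>)" by simp
    finally show "(\<integral>\<^sup>+p. ennreal (1 * kern \<rho> (x - fst p) * (?C1 * indicator {v - h..v + h} (snd p))) \<partial>\<mu>)
       \<le> ennreal (?K * ?C1) * emeasure \<mu> (space \<mu>)" .
  qed
  also have "\<dots> = ennreal (La * h * gconst TYPE('a) / \<rho> + ?C1 / (\<rho> ^ DIM('a) * bmass TYPE('a)) * measure \<mu> (space \<mu>))"
  proof -
    have 1: "ennreal (La * h) * ennreal (gconst TYPE('a) / \<rho>) = ennreal (La * h * gconst TYPE('a) / \<rho>)"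
      using La h \<rho> gconst_nonneg[where 'a='a] by (subst ennreal_mult[symmetric]) auto
    have "ennreal (?K * ?C1) * emeasure \<mu> (space \<mu>) = ennreal (?K * ?C1) * ennreal (measure \<mu> (space \<mu>))"
      by (simp only: emeasure_eq_measure)
    also have "\<dots> = ennreal (?K * ?C1 * measure \<mu> (space \<mu>))"
      using mult_nonneg_nonneg[OF K C1] by (rule ennreal_mult[symmetric]) simp
    also have "\<dots> = ennreal (?C1 / (\<rho> ^ DIM('a) * bmass TYPE('a)) * measure \<mu> (space \<mu>))" by (simp add: mult_ac)
    finally have 2: "ennreal (?K * ?C1) * emeasure \<mu> (space \<mu>) = ennreal (?C1 / (\<rho> ^ DIM('a) * bmass TYPE('a)) * measure \<mu> (space \<mu>))" .
    have "0 \<le> La * h * gconst TYPE('a) / \<rho>" using La h \<rho> gconst_nonneg[where 'a='a] by simp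
    moreover have "0 \<le> ?C1 / (\<rho> ^ DIM('a) * bmass TYPE('a)) * measure \<mu> (space \<mu>)"
      using C1 bmass_pos[where 'a='a] \<rho> by (intro mult_nonneg_nonneg divide_nonneg_nonneg[OF C1]) auto
    ultimately show ?thesis unfolding 1 2 add_0_right by (rule ennreal_plus[symmetric])
  qed
  finally show ?thesis by simp
qed

text \<open>The pointwise counterpart of \<open>level_step\<close>, over distances up to 1. The
  intermediate points of the chain may lie as far out as the sum of the spanning coefficients times
  \<open>La\<close>, so the equation must hold on a correspondingly large ball.\<close>

lemma macro_step:
  fixes z :: 'a
  assumes kin: "kinetic_on a {al..be} D u \<mu>"
    and w: "al \<le> w" and s: "0 < s" "s \<le> 1" and h: "0 < h" "h \<le> s / 6" and \<rho>: "0 < \<rho>"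
    and z: "norm z \<le> 1" and D: "real DIM('a) * (spanc / (s / 2) ^ Q) * La + \<rho> < D"
    and E_def: "E = La * h * gconst TYPE('a) / \<rho> +
          4 / bmass TYPE(real) / h\<^sup>2 / (\<rho> ^ DIM('a) * bmass TYPE('a)) * measure \<mu> (space \<mu>)"
  shows "conv (\<lambda>y. indicator {w + s<..} (u y)) \<rho> z
     \<le> conv (\<lambda>y. indicator {w<..} (u y)) \<rho> 0 + real DIM('a) * (spanc / (s / 2) ^ Q * E)"
proof -
  have [measurable]: "u \<in> borel_measurable borel" using kin by (simp add: kinetic_on_def)
  have u: "u y \<in> {al..be}" for y using kin unfolding kinetic_on_def by blast
  let ?T = "spanc / (s / 2) ^ Q"
  have T0: "0 \<le> ?T" using spanc_pos s by simp
  have E0: "0 \<le> E"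
    unfolding E_def using La h \<rho> gconst_nonneg[where 'a='a] bmass_pos[where 'a='a] bmass_pos[where 'a=real]
    by (intro add_nonneg_nonneg mult_nonneg_nonneg divide_nonneg_nonneg) auto
  have U01: "\<bar>U h v r\<bar> \<le> 1" for v r using U_nonneg[OF h(1), of v r] U_le_1[OF h(1), of v r] by simp
  have i01: "\<bar>indicator S r :: real\<bar> \<le> 1" for S and r :: real by (simp add: indicator_def)
  show ?thesis
  proof (cases "w + 2 * h + s / 2 \<le> be")
    case False
    then have "indicator {w + s<..} (u y) = (0::real)" for y
      using u[of y] h by (auto simp: indicator_def)
    then have "conv (\<lambda>y. indicator {w + s<..} (u y)) \<rho> z = 0" by (simp add: conv_def)
    moreover have "0 \<le> conv (\<lambda>y. indicator {w<..} (u y)) \<rho> 0" by (rule conv_nonneg[OF \<rho>]) simp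
    moreover have "0 \<le> real DIM('a) * (?T * E)" by (intro mult_nonneg_nonneg T0 E0) simp
    ultimately show ?thesis by linarith
  next
    case True
    let ?G = "\<lambda>v. conv (\<lambda>y. U h v (u y)) \<rho>"
    obtain v where v: "\<And>i. i < DIM('a) \<Longrightarrow> v i \<in> {w + 2 * h..w + 2 * h + s / 2}"
        "\<And>i j. i < j \<Longrightarrow> j < DIM('a) \<Longrightarrow> v i \<le> v j"
        "\<And>z. \<exists>t. z = (\<Sum>i<DIM('a). t i *\<^sub>R a (v i)) \<and> (\<forall>i<DIM('a). \<bar>t i\<bar> \<le> ?T * norm z)"
      using spanning[of "s / 2" "w + 2 * h"] s h w True by auto
    obtain t where t: "z = (\<Sum>i<DIM('a). t i *\<^sub>R a (v i))" "\<And>i. i < DIM('a) \<Longrightarrow> \<bar>t i\<bar> \<le> ?T * norm z"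
      using v(3)[of z] by blast
    have tT: "\<bar>t i\<bar> \<le> ?T" if "i < DIM('a)" for i
      using t(2)[OF that] mult_left_mono[OF z T0] by linarith
    have va: "v i \<in> {al - 3..be + 3}" "v i - h \<ge> al - 3" "v i + h \<le> be + 3" if "i < DIM('a)" for i
      using v(1)[OF that] w h s True by auto
    have ta: "norm (t i *\<^sub>R a (v i)) \<le> ?T * La" if "i < DIM('a)" for i
      unfolding norm_scaleR using tT[OF that] norm_a[OF va(1)[OF that]] T0 by (intro mult_mono) auto
    let ?y = "\<lambda>i. \<Sum>j<i. t j *\<^sub>R a (v j)"
    have step: "\<bar>?G (v i) (?y i + t i *\<^sub>R a (v i)) - ?G (v i) (?y i)\<bar> \<le> ?T * E" if i: "i < DIM('a)" for i
    proof -
      have "\<bar>?G (v i) (?y i + t i *\<^sub>R a (v i)) - ?G (v i) (?y i)\<bar> \<le> \<bar>t i\<bar> * E"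
      proof (rule conv_increment_sup[OF _ U01 \<rho> _ E0])
        fix \<tau> :: real assume \<tau>: "\<tau> \<in> {0..1}"
        have "norm (?y i) \<le> (\<Sum>j<i. ?T * La)"
          by (rule order_trans[OF norm_sum sum_mono]) (use ta i in auto)
        then have "norm (?y i) \<le> real i * (?T * La)" by simp
        moreover have "norm (\<tau> *\<^sub>R (t i *\<^sub>R a (v i))) \<le> 1 * (?T * La)"
          unfolding norm_scaleR[of \<tau>] using \<tau> ta[OF i] by (intro mult_mono) auto
        moreover have "norm (?y i + \<tau> *\<^sub>R (t i *\<^sub>R a (v i))) \<le> norm (?y i) + norm (\<tau> *\<^sub>R (t i *\<^sub>R a (v i)))"
          by (rule norm_triangle_ineq)
        ultimately have "norm (?y i + \<tau> *\<^sub>R (t i *\<^sub>R a (v i))) \<le> (real i + 1) * (?T * La)"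
          unfolding distrib_right by linarith
        also have "\<dots> \<le> real DIM('a) * (?T * La)"
          using i La by (intro mult_right_mono mult_nonneg_nonneg T0) auto
        finally have "norm (?y i + \<tau> *\<^sub>R (t i *\<^sub>R a (v i))) + \<rho> < D" using D by (simp add: mult.assoc)
        from gconv_sup[OF kin h(1) va(2,3)[OF i] \<rho> this]
        show "ennreal \<bar>gconv (\<lambda>y. U h (v i) (u y)) \<rho> (a (v i)) (?y i + \<tau> *\<^sub>R (t i *\<^sub>R a (v i)))\<bar> \<le> ennreal E"
          unfolding E_def .
      qed measurable
      also have "\<dots> \<le> ?T * E" using tT[OF i] E0 by (intro mult_right_mono) auto
      finally show ?thesis .
    qed
    have "conv (\<lambda>y. indicator {w + s<..} (u y)) \<rho> z \<le> ?G (w + 2 * h + s / 2) z"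
    proof (intro conv_mono i01 U01)
      show "indicator {w + s<..} (u y) \<le> U h (w + 2 * h + s / 2) (u y)" for y
        using h s U_eq_1[OF h(1), of "w + 2 * h + s / 2" "u y"] U_nonneg[OF h(1), of "w + 2 * h + s / 2" "u y"]
        by (auto simp: indicator_def)
    qed (use \<rho> in auto)
    also have "\<dots> = ?G (w + 2 * h + s / 2) (0 + (\<Sum>i<DIM('a). t i *\<^sub>R a (v i)))"
      using t(1) by simp
    also have "\<dots> \<le> ?G (w + 2 * h) 0 + (\<Sum>i<DIM('a). \<bar>?G (v i) (0 + ?y i + t i *\<^sub>R a (v i)) - ?G (v i) (0 + ?y i)\<bar>)"
    proof (rule chain[OF _ v(2)])
      show "?G v' x \<le> ?G v x" if "v \<le> v'" for v v' x
        using that h \<rho> by (intro conv_mono U01 U_antimono) auto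
    qed (use v(1) s in auto)
    also have "?G (w + 2 * h) 0 \<le> conv (\<lambda>y. indicator {w<..} (u y)) \<rho> 0"
    proof (intro conv_mono i01 U01)
      show "U h (w + 2 * h) (u y) \<le> indicator {w<..} (u y)" for y
        using h U_eq_0[OF h(1), of "u y" "w + 2 * h"] U_le_1[OF h(1), of "w + 2 * h" "u y"]
        by (auto simp: indicator_def)
    qed (use \<rho> in auto)
    also have "(\<Sum>i<DIM('a). \<bar>?G (v i) (0 + ?y i + t i *\<^sub>R a (v i)) - ?G (v i) (0 + ?y i)\<bar>) \<le> (\<Sum>i<DIM('a). ?T * E)"
      by (rule sum_mono) (use step in simp)
    finally show ?thesis by simp
  qed
qed

text \<open>An average of at most 1/2 at the origin spreads by \<open>macro_step\<close> to averages
  of at most 5/8 all over the unit ball. Then \<open>level_decay\<close> has no exception, and a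
  small \<sigma> brings the superlevel set below the threshold of \<open>de_giorgi\<close>. Every
  small \<rho> is allowed so that one scale can serve both u and its reflection.\<close>

lemma upper_bound_from_average:
  assumes \<delta>: "0 < \<delta>"
  obtains \<rho>0 where "0 < \<rho>0"
    "\<And>\<rho>. 0 < \<rho> \<Longrightarrow> \<rho> \<le> \<rho>0 \<Longrightarrow> \<exists>\<epsilon>>0. \<exists>D0>2. \<forall>D u \<mu> w. D0 \<le> D \<longrightarrow> kinetic_on a {al..be} D u \<mu> \<longrightarrow>
       measure \<mu> (space \<mu>) \<le> \<epsilon> \<longrightarrow> al \<le> w \<longrightarrow> conv (\<lambda>y. indicator {w<..} (u y)) \<rho> 0 \<le> 1 / 2 \<longrightarrow>
       emeasure lborel {y\<in>ball 0 (1 / 2). w + \<delta> < u y} = 0"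
proof -
  obtain \<kappa> where \<kappa>: "0 < \<kappa>" "\<And>D u \<mu> w. kinetic_on a {al..be} D u \<mu> \<Longrightarrow> 1 < D \<Longrightarrow> al \<le> w \<Longrightarrow>
       measure lborel {y\<in>ball 0 1. w < u y} \<le> \<kappa> \<Longrightarrow> emeasure lborel {y\<in>ball 0 (1 / 2). w + \<delta> / 2 < u y} = 0"
    using de_giorgi[of "\<delta> / 2"] \<delta> by auto
  \<comment> \<open>The increase \<delta> of the level is shared out: s \<le> \<delta> / 4 for the
    spreading of averages, \<open>4 * \<sigma>\<close> \<le> \<delta> / 4 for
    \<open>level_decay\<close>, and \<delta> / 2 for the iteration.\<close>
  define s where "s = min 1 (\<delta> / 4)"
  have s: "0 < s" "s \<le> 1" "s \<le> \<delta> / 4" using \<delta> unfolding s_def by auto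
  define V where "V = measure lborel (ball (0::'a) 2)"
  define \<sigma>0 where "\<sigma>0 = min 1 (min (\<delta> / 16) (\<kappa> / (32 * stepc * V + 1)))"
  have sV: "0 \<le> 32 * stepc * V" using stepc_nonneg by (simp add: V_def)
  have \<sigma>0: "0 < \<sigma>0" "\<sigma>0 \<le> 1" "\<sigma>0 \<le> \<delta> / 16" "\<sigma>0 \<le> \<kappa> / (32 * stepc * V + 1)"
  proof -
    have "0 < \<kappa> / (32 * stepc * V + 1)" using \<kappa>(1) sV by (intro divide_pos_pos) linarith+
    then show "0 < \<sigma>0" using \<delta> by (simp add: \<sigma>0_def)
    show "\<sigma>0 \<le> 1" "\<sigma>0 \<le> \<delta> / 16" "\<sigma>0 \<le> \<kappa> / (32 * stepc * V + 1)"
      unfolding \<sigma>0_def by (rule min.cobounded1, intro min.coboundedI2 min.cobounded1, intro min.coboundedI2 min.cobounded2)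
  qed
  define T where "T = real DIM('a) * (spanc / (s / 2) ^ Q)"
  have T0: "0 < T" using spanc_pos s by (simp add: T_def)
  show ?thesis
  proof (rule that[of "\<sigma>0 ^ Suc N"])
    show "0 < \<sigma>0 ^ Suc N" using \<sigma>0 by simp
    fix \<rho> :: real assume \<rho>: "0 < \<rho>" "\<rho> \<le> \<sigma>0 ^ Suc N"
    \<comment> \<open>The scale of the averages has to coincide with the one coupled to \<sigma> in
      \<open>level_decay\<close>.\<close>
    define \<sigma> where "\<sigma> = root (Suc N) \<rho>"
    have \<sigma>: "0 < \<sigma>" "\<sigma> ^ Suc N = \<rho>" using \<rho> by (auto simp: \<sigma>_def real_root_pow_pos simp del: power_Suc)
    have \<sigma>le: "\<sigma> \<le> \<sigma>0"
      using \<rho>(2) \<sigma>(2) power_mono_iff[of \<sigma> \<sigma>0 "Suc N"] \<sigma>(1) \<sigma>0(1) by auto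
    have \<rho>1: "\<rho> \<le> 1" using \<rho>(2) \<sigma>0 power_le_one[of \<sigma>0 "Suc N"] by linarith
    have g0: "0 \<le> gconst TYPE('a)" by (rule gconst_nonneg)
    \<comment> \<open>This h and, below, \<epsilon> make the two error terms of
      \<open>macro_step\<close> at most 1/16 each, and 1/2 + 1/16 + 1/16 = 5/8.\<close>
    define h where "h = min (s / 6) (\<rho> / (16 * T * La * (gconst TYPE('a) + 1)))"
    have den: "0 < 16 * T * La * (gconst TYPE('a) + 1)" using T0 La g0 by (intro mult_pos_pos) auto
    have h: "0 < h" "h \<le> s / 6" 
    proof -
      show "0 < h" unfolding h_def min_less_iff_conj using s divide_pos_pos[OF \<rho>(1) den] by simp
      show "h \<le> s / 6" unfolding h_def by (rule min.cobounded1)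
    qed
    have h2: "h \<le> \<rho> / (16 * T * La * (gconst TYPE('a) + 1))" unfolding h_def by (rule min.cobounded2)
    have e1: "T * (La * h * gconst TYPE('a) / \<rho>) \<le> 1 / 16"
    proof -
      have "h * (16 * T * La * (gconst TYPE('a) + 1)) \<le> \<rho>" using h2 den by (simp add: pos_le_divide_eq)
      moreover have "h * (16 * T * La * gconst TYPE('a)) \<le> h * (16 * T * La * (gconst TYPE('a) + 1))"
        using h T0 La by (intro mult_left_mono) auto
      ultimately have "16 * (T * (La * h * gconst TYPE('a))) \<le> \<rho>" by (simp add: mult_ac)
      then show ?thesis using \<rho>(1) by (simp add: field_simps)
    qed
    define K where "K = 4 / bmass TYPE(real) / h\<^sup>2 / (\<rho> ^ DIM('a) * bmass TYPE('a))"
    have K: "0 < K" unfolding K_def using h \<rho> bmass_pos[where 'a='a] bmass_pos[where 'a=real] by simp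
    define \<epsilon> where "\<epsilon> = 1 / (16 * T * K)"
    have \<epsilon>: "0 < \<epsilon>" unfolding \<epsilon>_def using T0 K by simp
    \<comment> \<open>\<open>macro_step\<close> needs more than \<open>T * La + \<rho>\<close> with
      \<rho> \<le> 1, and \<open>level_decay\<close> is applied between the radii 1 and 2.\<close>
    define D0 where "D0 = T * La + 3"
    have D0: "2 < D0" using T0 La by (simp add: D0_def add_pos_pos)
    show "\<exists>\<epsilon>>0. \<exists>D0>2. \<forall>D u \<mu> w. D0 \<le> D \<longrightarrow> kinetic_on a {al..be} D u \<mu> \<longrightarrow>
       measure \<mu> (space \<mu>) \<le> \<epsilon> \<longrightarrow> al \<le> w \<longrightarrow> conv (\<lambda>y. indicator {w<..} (u y)) \<rho> 0 \<le> 1 / 2 \<longrightarrow>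
       emeasure lborel {y\<in>ball 0 (1 / 2). w + \<delta> < u y} = 0"
    proof (intro exI conjI allI impI)
      fix D u w and \<mu> :: "('a \<times> real) measure"
      assume D: "D0 \<le> D" and kin: "kinetic_on a {al..be} D u \<mu>" and \<mu>: "measure \<mu> (space \<mu>) \<le> \<epsilon>"
        and w: "al \<le> w" and half: "conv (\<lambda>y. indicator {w<..} (u y)) \<rho> 0 \<le> 1 / 2"
      have [measurable]: "u \<in> borel_measurable borel" using kin by (simp add: kinetic_on_def)
      have e2: "T * (K * measure \<mu> (space \<mu>)) \<le> 1 / 16"
      proof -
        have "T * (K * measure \<mu> (space \<mu>)) \<le> T * (K * \<epsilon>)"
          using \<mu> T0 K by (intro mult_left_mono) auto
        also have "\<dots> = 1 / 16" using T0 K by (simp add: \<epsilon>_def)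
        finally show ?thesis .
      qed
      have avg: "conv (\<lambda>y. indicator {w + s<..} (u y)) \<rho> z \<le> 5 / 8" if z: "norm z \<le> 1" for z
      proof -
        have "conv (\<lambda>y. indicator {w + s<..} (u y)) \<rho> z
          \<le> conv (\<lambda>y. indicator {w<..} (u y)) \<rho> 0 + real DIM('a) * (spanc / (s / 2) ^ Q *
              (La * h * gconst TYPE('a) / \<rho> + K * measure \<mu> (space \<mu>)))"
          unfolding K_def
          by (rule macro_step[OF kin w s(1,2) h \<rho>(1) z _ refl]) (use D \<rho>1 in \<open>simp add: D0_def T_def\<close>)
        also have "real DIM('a) * (spanc / (s / 2) ^ Q * (La * h * gconst TYPE('a) / \<rho> + K * measure \<mu> (space \<mu>)))
          = T * (La * h * gconst TYPE('a) / \<rho>) + T * (K * measure \<mu> (space \<mu>))"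
          by (simp only: distrib_left mult.assoc T_def)
        finally show ?thesis using e1 e2 half by linarith
      qed
      let ?R = "(1 + 2) / 2 :: real" and ?e = "(((1 + 2) / 2)\<^sup>2 - 1\<^sup>2) / 4 :: real"
      have cavg: "conv (cut u ?R ?e (w + s)) (\<sigma> ^ Suc N) x \<le> 5 / 8" if "x \<in> ball 0 1" for x
      proof -
        have "conv (cut u ?R ?e (w + s)) \<rho> x \<le> conv (\<lambda>y. indicator {w + s<..} (u y)) \<rho> x"
          by (rule conv_mono) (use \<rho>(1) in \<open>auto simp: cut_def indicator_def bump_le_1 bump_nonneg\<close>)
        also have "\<dots> \<le> 5 / 8" using avg that by simp
        finally show ?thesis unfolding \<sigma>(2) .
      qed
      have "measure lborel {x\<in>ball 0 1. w + s + 4 * \<sigma> < u x}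
          = measure lborel {x\<in>ball 0 1. w + s + 4 * \<sigma> < u x \<and> conv (cut u ?R ?e (w + s)) (\<sigma> ^ Suc N) x \<le> 5 / 8}"
        using cavg by (intro arg_cong[where f="measure lborel"]) auto
      also have "\<dots> \<le> 32 * stepc * \<sigma> / (2 - 1) * measure lborel {y\<in>ball 0 2. w + s < u y}"
        by (rule level_decay[OF kin _ _ _ _ refl refl])
           (use D D0 w s \<sigma>(1) \<sigma>le \<sigma>0(2) in auto)
      also have "\<dots> \<le> 32 * stepc * \<sigma> * V"
      proof -
        have "measure lborel {y\<in>ball 0 2. w + s < u y} \<le> V"
          unfolding V_def using emeasure_lborel_ball_finite[of "0::'a" 2]
            by (intro measure_mono_fmeasurable fmeasurableI) auto
        then show ?thesis using stepc_nonneg \<sigma>(1) by (simp add: mult_left_mono)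
      qed
      also have "\<dots> = \<sigma> * (32 * stepc * V)" by simp
      also have "\<dots> \<le> (\<kappa> / (32 * stepc * V + 1)) * (32 * stepc * V)"
        using \<sigma>le \<sigma>0(4) sV by (intro mult_right_mono) auto
      also have "\<dots> \<le> \<kappa>"
      proof -
        have "\<kappa> * (32 * stepc * V) \<le> \<kappa> * (32 * stepc * V + 1)" using \<kappa>(1) by (intro mult_left_mono) auto
        moreover have "0 < 32 * stepc * V + 1" using sV by linarith
        ultimately show ?thesis by (simp add: pos_divide_le_eq)
      qed
      finally have m: "measure lborel {x\<in>ball 0 1. w + s + 4 * \<sigma> < u x} \<le> \<kappa>" .
      have z: "emeasure lborel {y\<in>ball 0 (1 / 2). w + s + 4 * \<sigma> + \<delta> / 2 < u y} = 0"
        by (rule \<kappa>(2)[OF kin _ _ m]) (use D D0 w s \<sigma>(1) in auto)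
      have "{y\<in>ball 0 (1 / 2). w + \<delta> < u y} \<subseteq> {y\<in>ball 0 (1 / 2). w + s + 4 * \<sigma> + \<delta> / 2 < u y}"
        using s(3) \<sigma>le \<sigma>0(3) by auto
      then show "emeasure lborel {y\<in>ball 0 (1 / 2). w + \<delta> < u y} = 0"
        by (rule emeasure_eq_0[OF _ z, rotated]) measurable
    qed (use \<epsilon> D0 in auto)
  qed
qed

end

subsection \<open>Small dissipation implies small oscillation\<close>

lemma test_function_bounds:
  fixes \<phi> :: "'a::euclidean_space \<Rightarrow> real"
  assumes "test_function W \<phi>"
  obtains r B where "0 < r" "0 \<le> B" "\<And>y. y \<notin> ball 0 r \<Longrightarrow> \<phi> y = 0" "\<And>y. y \<notin> ball 0 r \<Longrightarrow> grad \<phi> y = 0"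
    "\<And>y. \<bar>\<phi> y\<bar> \<le> B" "\<And>y. norm (grad \<phi> y) \<le> B"
proof -
  let ?K = "closure {x. \<phi> x \<noteq> 0}"
  have sm: "smooth \<phi>" and K: "compact ?K" using assms by (auto simp: test_function_def)
  obtain r where r: "0 < r" "?K \<subseteq> ball 0 r"
    using bounded_subset_ballD[OF compact_imp_bounded[OF K], of 0] by blast
  have "bounded (grad \<phi> ` ?K)" "bounded (\<phi> ` ?K)"
    by (intro compact_imp_bounded compact_continuous_image smooth_continuous_grad smooth_continuous sm K)+
  then obtain B1 B2 where B: "\<And>y. y \<in> ?K \<Longrightarrow> norm (grad \<phi> y) \<le> B1" "\<And>y. y \<in> ?K \<Longrightarrow> \<bar>\<phi> y\<bar> \<le> B2"
    unfolding bounded_iff by (auto simp only: ball_simps real_norm_def)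
  have out: "\<phi> y = 0 \<and> grad \<phi> y = 0" if "y \<notin> ?K" for y
    using that grad_outside_support[OF that] closure_subset[of "{x. \<phi> x \<noteq> 0}"] by blast
  show ?thesis
  proof (rule that[of r "max \<bar>B1\<bar> \<bar>B2\<bar>"])
    show "\<bar>\<phi> y\<bar> \<le> max \<bar>B1\<bar> \<bar>B2\<bar>" for y
    proof (cases "y \<in> ?K")
      case True
      show ?thesis using B(2)[OF True] by linarith
    next
      case False
      then show ?thesis using out[of y] by simp
    qed
    show "norm (grad \<phi> y) \<le> max \<bar>B1\<bar> \<bar>B2\<bar>" for y
    proof (cases "y \<in> ?K")
      case True
      show ?thesis using B(1)[OF True] by linarith
    next
      case False
      then show ?thesis using out[of y] by simp
    qed
    show "\<phi> y = 0" "grad \<phi> y = 0" if "y \<notin> ball 0 r" for y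
      using out[of y] r(2) that by blast+
  qed (use r in auto)
qed

lemma test_function_smooth: "test_function W \<phi> \<Longrightarrow> smooth \<phi>"
  by (simp add: test_function_def)

lemma borel_measurable_smooth: "smooth \<phi> \<Longrightarrow> \<phi> \<in> borel_measurable borel"
  by (intro borel_measurable_continuous_onI smooth_continuous)

lemma borel_measurable_grad: "smooth \<phi> \<Longrightarrow> grad \<phi> \<in> borel_measurable borel"
  by (intro borel_measurable_continuous_onI smooth_continuous_grad)

lemma integrable_grad_test:
  assumes "test_function W \<phi>"
  shows "integrable lborel (grad \<phi>)"
proof -
  obtain r B where "\<And>y. y \<notin> ball 0 r \<Longrightarrow> grad \<phi> y = 0" "\<And>y. norm (grad \<phi> y) \<le> B"
    by (rule test_function_bounds[OF assms]) (rule that; assumption)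
  then show ?thesis
    by (intro integrable_bounded_support borel_measurable_grad test_function_smooth[OF assms])
qed

text \<open>The increments of \<phi> along b integrate to zero by translation invariance. Written as
  an integral of the derivative along a segment, they give by Fubini the integral in
  question.\<close>

lemma integral_grad_test:
  fixes \<phi> :: "'a::euclidean_space \<Rightarrow> real"
  assumes tf: "test_function W \<phi>"
  shows "(LINT y|lborel. b \<bullet> grad \<phi> y) = 0"
proof -
  have sm: "smooth \<phi>" by (rule test_function_smooth[OF tf])
  have [measurable]: "\<phi> \<in> borel_measurable borel" "grad \<phi> \<in> borel_measurable borel"
    by (auto intro: borel_measurable_smooth borel_measurable_grad sm)
  obtain r B where r: "0 < r" and B0: "0 \<le> B" and o: "\<And>y. y \<notin> ball 0 r \<Longrightarrow> \<phi> y = 0" "\<And>y. y \<notin> ball 0 r \<Longrightarrow> grad \<phi> y = 0"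
    and B: "\<And>y. \<bar>\<phi> y\<bar> \<le> B" "\<And>y. norm (grad \<phi> y) \<le> B"
    by (rule test_function_bounds[OF tf]) (rule that; assumption)
  let ?f = "\<lambda>y \<tau>. indicator {0..1} \<tau> * (b \<bullet> grad \<phi> (y + \<tau> *\<^sub>R b))"
  have inc: "\<phi> (y + b) - \<phi> y = (LINT \<tau>|lborel. ?f y \<tau>)" for y
  proof -
    have d: "((\<lambda>\<tau>. y + \<tau> *\<^sub>R b) has_derivative (\<lambda>h. h *\<^sub>R b)) (at \<tau>)" for \<tau>
      by (auto intro!: derivative_eq_intros)
    have "((\<lambda>\<tau>. \<phi> (y + \<tau> *\<^sub>R b)) has_vector_derivative b \<bullet> grad \<phi> (y + \<tau> *\<^sub>R b)) (at \<tau>)" for \<tau>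
      using diff_chain_at[OF d has_derivative_grad[OF sm]]
      by (simp add: o_def has_vector_derivative_def inner_commute)
    then have "(LINT \<tau>|lborel. indicator {0..1} \<tau> *\<^sub>R (b \<bullet> grad \<phi> (y + \<tau> *\<^sub>R b)))
        = \<phi> (y + 1 *\<^sub>R b) - \<phi> (y + 0 *\<^sub>R b)"
      by (intro integral_FTC_Icc)
         (auto intro!: continuous_intros continuous_on_compose2[OF smooth_continuous_grad[OF sm, of UNIV]]
            intro: has_vector_derivative_at_within)
    then show ?thesis by simp
  qed
  have bg: "\<bar>b \<bullet> grad \<phi> z\<bar> \<le> norm b * B" for z
    using Cauchy_Schwarz_ineq2[of b "grad \<phi> z"] mult_left_mono[OF B(2)[of z] norm_ge_zero[of b]] by linarith
  have I: "integrable (lborel \<Otimes>\<^sub>M lborel) (\<lambda>(y, \<tau>). ?f y \<tau>)"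
    unfolding lborel_prod
  proof (rule integrable_bounded_support[where B="norm b * B" and c="0" and r="r + norm b + 2"])
    show "norm (case p of (y, \<tau>) \<Rightarrow> ?f y \<tau>) \<le> norm b * B" for p
      using bg B0 by (cases p) (auto simp: abs_mult indicator_def)
    show "(case p of (y, \<tau>) \<Rightarrow> ?f y \<tau>) = 0" if "p \<notin> ball 0 (r + norm b + 2)" for p
    proof (cases p)
      case (Pair y \<tau>)
      show ?thesis
      proof (cases "0 \<le> \<tau> \<and> \<tau> \<le> 1")
        case True
        have "norm p \<le> norm y + \<bar>\<tau>\<bar>" using norm_Pair_le[of y \<tau>] by (simp add: Pair)
        then have "r + norm b \<le> norm y" using that True by simp
        moreover have "norm (\<tau> *\<^sub>R b) \<le> norm b" using True by (simp add: mult_left_le_one_le)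
        moreover have "norm y \<le> norm (y + \<tau> *\<^sub>R b) + norm (\<tau> *\<^sub>R b)"
          using norm_triangle_ineq4[of "y + \<tau> *\<^sub>R b" "\<tau> *\<^sub>R b"] by simp
        ultimately show ?thesis using o(2)[of "y + \<tau> *\<^sub>R b"] Pair by simp
      qed (auto simp: Pair)
    qed
  qed (unfold borel_prod[symmetric], measurable)
  have "integrable lborel \<phi>" by (rule integrable_bounded_support[where B=B and c=0 and r=r]) (use B o in auto)
  from integrable_affine[OF this, of 1 b] have I2: "integrable lborel (\<lambda>y. \<phi> (y + b))" by (simp add: add.commute)
  have "(LINT y|lborel. \<phi> (y + b) - \<phi> y) = 0"
    using I2 \<open>integrable lborel \<phi>\<close> integral_affine[of \<phi> 1 b] by (simp add: add.commute)
  then have "0 = (LINT y|lborel. LINT \<tau>|lborel. ?f y \<tau>)" by (simp add: inc)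
  also have "\<dots> = (LINT \<tau>|lborel. LINT y|lborel. ?f y \<tau>)"
    using lborel_pair.Fubini_integral[OF I] by simp
  also have "\<dots> = (LINT \<tau>|lborel. indicator {0..1} (\<tau>::real) * (LINT y|lborel. b \<bullet> grad \<phi> y))"
  proof (rule Bochner_Integration.integral_cong)
    fix \<tau> :: real
    have "(LINT y|lborel. b \<bullet> grad \<phi> (y + \<tau> *\<^sub>R b)) = (LINT y|lborel. b \<bullet> grad \<phi> y)"
      using integral_affine[of "\<lambda>y. b \<bullet> grad \<phi> y" 1 "\<tau> *\<^sub>R b"] by (simp add: add.commute)
    then show "(LINT y|lborel. ?f y \<tau>) = indicator {0..1} \<tau> * (LINT y|lborel. b \<bullet> grad \<phi> y)"
      by simp
  qed simp
  also have "\<dots> = (LINT y|lborel. b \<bullet> grad \<phi> y)" by simp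
  finally show ?thesis by simp
qed

lemma test_scaleR_bound:
  fixes a :: "real \<Rightarrow> 'a::euclidean_space"
  assumes "test_function W \<zeta>" "continuous_on UNIV a"
  obtains r C where "0 \<le> C" "\<And>w. w \<notin> ball 0 r \<Longrightarrow> \<zeta> w *\<^sub>R a w = 0" "\<And>w. norm (\<zeta> w *\<^sub>R a w) \<le> C"
proof -
  obtain r B where r: "0 < r" "0 \<le> B" "\<And>y. y \<notin> ball 0 r \<Longrightarrow> \<zeta> y = 0" "\<And>y. \<bar>\<zeta> y\<bar> \<le> B"
    by (rule test_function_bounds[OF assms(1)]) (rule that; assumption)
  have "bounded (a ` cball 0 r)"
    using assms(2) by (intro compact_imp_bounded compact_continuous_image) (auto intro: continuous_on_subset)
  then obtain C where "\<forall>x\<in>a ` cball 0 r. norm x \<le> C" unfolding bounded_iff by blast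
  then have C: "norm (a w) \<le> C" if "w \<in> cball 0 r" for w using that by blast
  show ?thesis
  proof (rule that[of "B * \<bar>C\<bar>" r])
    show "norm (\<zeta> w *\<^sub>R a w) \<le> B * \<bar>C\<bar>" for w
    proof (cases "w \<in> ball 0 r")
      case True
      then have "norm (a w) \<le> \<bar>C\<bar>" using C[of w] by (auto intro: order_trans)
      then show ?thesis using r(2,4) by (auto intro!: mult_mono)
    qed (use r in auto)
  qed (use r in auto)
qed

lemma integrable_test_scaleR:
  fixes a :: "real \<Rightarrow> 'a::euclidean_space"
  assumes "test_function W \<zeta>" "continuous_on UNIV a"
  shows "integrable lborel (\<lambda>w. \<zeta> w *\<^sub>R a w)"
proof -
  have [measurable]: "a \<in> borel_measurable borel" by (rule borel_measurable_continuous_onI[OF assms(2)])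
  have [measurable]: "\<zeta> \<in> borel_measurable borel"
    by (intro borel_measurable_smooth test_function_smooth[OF assms(1)])
  obtain r C where "0 \<le> C" "\<And>w. w \<notin> ball 0 r \<Longrightarrow> \<zeta> w *\<^sub>R a w = 0" "\<And>w. norm (\<zeta> w *\<^sub>R a w) \<le> C"
    by (rule test_scaleR_bound[OF assms]) (rule that; assumption)
  then show ?thesis
    by (intro integrable_bounded_support[where B=C and c=0 and r=r]) auto
qed

text \<open>The reflected flux is a constant vector minus the flux for \<open>\<zeta> (- w)\<close>,
  and the constant is annihilated by the test gradient. Reflecting \<zeta> changes the sign of its
  derivative as well; the two signs cancel, so the dissipation remains a nonnegative
  measure.\<close>

lemma kinetic_on_reflect:
  fixes a :: "real \<Rightarrow> 'a::euclidean_space"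
  assumes kin: "kinetic_on a I D u \<mu>" and a: "continuous_on UNIV a"
  shows "kinetic_on (\<lambda>v. a (- v)) (uminus ` I) D (\<lambda>x. - u x) (distr \<mu> borel (\<lambda>p. (fst p, - snd p)))"
proof -
  interpret finite_measure \<mu> using kin by (simp add: kinetic_on_def)
  have [measurable]: "u \<in> borel_measurable borel" using kin by (simp add: kinetic_on_def)
  have [measurable_cong]: "sets \<mu> = sets borel" using kin by (simp add: kinetic_on_def)
  have [measurable]: "a \<in> borel_measurable borel" by (rule borel_measurable_continuous_onI[OF a])
  have m [measurable]: "(\<lambda>p::'a \<times> real. (fst p, - snd p)) \<in> borel \<rightarrow>\<^sub>M borel"
    by (intro borel_measurable_continuous_onI continuous_intros)
  have m': "(\<lambda>p::'a \<times> real. (fst p, - snd p)) \<in> \<mu> \<rightarrow>\<^sub>M borel"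
    using m by (simp cong: measurable_cong_sets)
  let ?\<mu> = "distr \<mu> borel (\<lambda>p. (fst p, - snd p))"
  have "(LINT y|lborel. flux (\<lambda>v. a (- v)) \<zeta> (- u y) \<bullet> grad \<phi> y) = (LINT p|?\<mu>. \<phi> (fst p) * deriv \<zeta> (snd p))"
    if \<phi>: "test_function (ball 0 D) \<phi>" and \<zeta>: "test_function UNIV \<zeta>" for \<phi> \<zeta>
  proof -
    let ?\<zeta> = "\<lambda>w. \<zeta> (- w)"
    have sm: "smooth \<zeta>" "smooth \<phi>" using \<phi> \<zeta> by (auto simp: test_function_smooth)
    have sm': "smooth ?\<zeta>" using smooth_affine[OF sm(1), of "-1" 0] by simp
    have [measurable]: "\<phi> \<in> borel_measurable borel" "grad \<phi> \<in> borel_measurable borel" "\<zeta> \<in> borel_measurable borel"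
      "deriv \<zeta> \<in> borel_measurable borel"
      using sm by (auto intro: borel_measurable_smooth borel_measurable_grad borel_measurable_deriv_smooth)
    obtain r B where r: "\<And>y. y \<notin> ball 0 r \<Longrightarrow> \<zeta> y = 0"
      by (rule test_function_bounds[OF \<zeta>]) (rule that; assumption)
    have \<zeta>': "test_function UNIV ?\<zeta>"
    proof (rule test_functionI[OF sm' _ compact_cball[of 0 r]])
      show "w \<in> cball 0 r" if "\<zeta> (- w) \<noteq> 0" for w using r[of "-w"] that by (cases "- w \<in> ball 0 r") auto
    qed simp
    have dz: "deriv ?\<zeta> w = - deriv \<zeta> (- w)" for w
      by (rule DERIV_imp_deriv) (use DERIV_chain2[OF smooth_has_real_derivative[OF sm(1)], of uminus "-1" w UNIV] in \<open>simp add: DERIV_minus\<close>)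
    have I: "integrable lborel (\<lambda>w. \<zeta> (- w) *\<^sub>R a w)" by (rule integrable_test_scaleR[OF \<zeta>' a])
    let ?C = "LINT w|lborel. \<zeta> (- w) *\<^sub>R a w"
    have I1: "integrable lborel (\<lambda>w. if w < s then \<zeta> (- w) *\<^sub>R a w else 0)" for s
      by (rule Bochner_Integration.integrable_bound[OF I]) auto
    have fl: "flux (\<lambda>v. a (- v)) \<zeta> (- s) = ?C - flux a ?\<zeta> s" for s
    proof -
      have "flux (\<lambda>v. a (- v)) \<zeta> (- s) = (LINT w|lborel. (if s < w then \<zeta> (- w) *\<^sub>R a w else 0))"
        unfolding flux_def by (subst integral_minus[of _ 0, symmetric]) (auto intro!: Bochner_Integration.integral_cong)
      also have "\<dots> = (LINT w|lborel. \<zeta> (- w) *\<^sub>R a w - (if w < s then \<zeta> (- w) *\<^sub>R a w else 0))"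
        \<comment> \<open>The integrands differ only at w = s, where one inequality is strict on
          either side.\<close>
        by (rule integral_cong_AE) (use AE_lborel_singleton[of s] in auto)
      also have "\<dots> = ?C - flux a ?\<zeta> s" unfolding flux_def using I I1 by simp
      finally show ?thesis .
    qed
    let ?K = "LINT w|lborel. norm (\<zeta> (- w) *\<^sub>R a w)"
    have fb: "norm (flux a ?\<zeta> s) \<le> ?K" for s
      unfolding flux_def
      by (rule order_trans[OF integral_norm_bound integral_mono[OF integrable_norm[OF I1] integrable_norm[OF I]]]) auto
    have [measurable]: "flux a ?\<zeta> \<in> borel_measurable borel" unfolding flux_def[abs_def] by measurable
    have Ig: "integrable lborel (grad \<phi>)" by (rule integrable_grad_test[OF \<phi>])
    have If: "integrable lborel (\<lambda>y. flux a ?\<zeta> (u y) \<bullet> grad \<phi> y)"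
    proof (rule Bochner_Integration.integrable_bound[of lborel "\<lambda>y. ?K *\<^sub>R grad \<phi> y"])
      have "\<bar>flux a ?\<zeta> (u y) \<bullet> grad \<phi> y\<bar> \<le> norm (?K *\<^sub>R grad \<phi> y)" for y
        using order_trans[OF Cauchy_Schwarz_ineq2 mult_right_mono[OF fb[of "u y"] norm_ge_zero]] by simp
      then show "AE y in lborel. norm (flux a ?\<zeta> (u y) \<bullet> grad \<phi> y) \<le> norm (?K *\<^sub>R grad \<phi> y)" by simp
    qed (use Ig in auto)
    have "(LINT y|lborel. flux (\<lambda>v. a (- v)) \<zeta> (- u y) \<bullet> grad \<phi> y)
        = (LINT y|lborel. ?C \<bullet> grad \<phi> y - flux a ?\<zeta> (u y) \<bullet> grad \<phi> y)"
      by (simp add: fl inner_diff_left)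
    also have "\<dots> = (LINT y|lborel. ?C \<bullet> grad \<phi> y) - (LINT y|lborel. flux a ?\<zeta> (u y) \<bullet> grad \<phi> y)"
      using Ig If by simp
    also have "\<dots> = - (LINT p|\<mu>. \<phi> (fst p) * deriv ?\<zeta> (snd p))"
      using kin \<phi> \<zeta>' integral_grad_test[OF \<phi>] unfolding kinetic_on_def by simp
    also have "\<dots> = (LINT p|\<mu>. \<phi> (fst p) * deriv \<zeta> (- snd p))" by (simp add: dz)
    also have "\<dots> = (LINT p|?\<mu>. \<phi> (fst p) * deriv \<zeta> (snd p))"
    proof (subst integral_distr[OF m'])
      show "(\<lambda>p. \<phi> (fst p) * deriv \<zeta> (snd p)) \<in> borel_measurable borel"
        unfolding borel_prod[symmetric] by measurable
    qed simp
    finally show ?thesis .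
  qed
  moreover have "finite_measure ?\<mu>" by (rule finite_measure_distr[OF m'])
  ultimately show ?thesis
    using kin unfolding kinetic_on_def by auto
qed

context gn_flux
begin

lemma reflected: "gn_flux (\<lambda>v. a (- v)) (- be) (- al) La c P"
proof
  show "continuous_on UNIV (\<lambda>v. a (- v))"
    by (rule continuous_on_compose2[OF cont_a]) (auto intro: continuous_intros)
  show "\<exists>v\<in>{w..w + s}. c * s ^ P \<le> \<bar>a (- v) \<bullet> \<xi>\<bar>"
    if "- be \<le> w" "w + s \<le> - al" "0 < s" "s \<le> 1" "norm \<xi> = 1" for w s \<xi>
  proof -
    have "\<exists>v\<in>{- w - s..- w - s + s}. c * s ^ P \<le> \<bar>a v \<bullet> \<xi>\<bar>"
      by (rule gn) (use that in auto)
    then obtain v where "v \<in> {- w - s..- w - s + s}" "c * s ^ P \<le> \<bar>a v \<bullet> \<xi>\<bar>" by blast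
    then show ?thesis by (intro bexI[of _ "- v"]) auto
  qed
  show "norm (a (- v) - a (- w)) \<le> La * \<bar>v - w\<bar>"
    if "v \<in> {- be - 3..- al + 3}" "w \<in> {- be - 3..- al + 3}" for v w
    using lip_a[of "- v" "- w"] that by (auto simp: abs_minus_commute)
qed (use al_be La c_pos norm_a in auto)

text \<open>The averages at the origin of u > w and of u \<le> w add up to 1. Either the first is at
  most 1/2, or the second is, and it dominates the average of the reflected superlevel set.\<close>

lemma dichotomy:
  assumes \<delta>: "0 < \<delta>"
  obtains \<epsilon> D where "0 < \<epsilon>" "2 < D"
    "\<And>u \<mu> w. kinetic_on a {al..be} D u \<mu> \<Longrightarrow> measure \<mu> (space \<mu>) \<le> \<epsilon> \<Longrightarrow> w \<in> {al..be} \<Longrightarrow>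
       emeasure lborel {y\<in>ball 0 (1 / 2). w + \<delta> < u y} = 0 \<or> emeasure lborel {y\<in>ball 0 (1 / 2). u y < w - \<delta>} = 0"
proof -
  interpret R: gn_flux "\<lambda>v. a (- v)" "- be" "- al" La c P by (rule reflected)
  obtain \<rho>1 where \<rho>1: "0 < \<rho>1"
    "\<And>\<rho>. 0 < \<rho> \<Longrightarrow> \<rho> \<le> \<rho>1 \<Longrightarrow> \<exists>\<epsilon>>0. \<exists>D0>2. \<forall>D u \<mu> w. D0 \<le> D \<longrightarrow> kinetic_on a {al..be} D u \<mu> \<longrightarrow>
       measure \<mu> (space \<mu>) \<le> \<epsilon> \<longrightarrow> al \<le> w \<longrightarrow> conv (\<lambda>y. indicator {w<..} (u y)) \<rho> 0 \<le> 1 / 2 \<longrightarrow>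
       emeasure lborel {y\<in>ball 0 (1 / 2). w + \<delta> < u y} = 0"
    by (rule upper_bound_from_average[OF \<delta>]) blast
  obtain \<rho>2 where \<rho>2: "0 < \<rho>2"
    "\<And>\<rho>. 0 < \<rho> \<Longrightarrow> \<rho> \<le> \<rho>2 \<Longrightarrow> \<exists>\<epsilon>>0. \<exists>D0>2. \<forall>D u \<mu> w. D0 \<le> D \<longrightarrow> kinetic_on (\<lambda>v. a (- v)) {- be..- al} D u \<mu> \<longrightarrow>
       measure \<mu> (space \<mu>) \<le> \<epsilon> \<longrightarrow> - be \<le> w \<longrightarrow> conv (\<lambda>y. indicator {w<..} (u y)) \<rho> 0 \<le> 1 / 2 \<longrightarrow>
       emeasure lborel {y\<in>ball 0 (1 / 2). w + \<delta> < u y} = 0"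
    by (rule R.upper_bound_from_average[OF \<delta>]) blast
  define \<rho> where "\<rho> = min \<rho>1 \<rho>2"
  have \<rho>: "0 < \<rho>" "\<rho> \<le> \<rho>1" "\<rho> \<le> \<rho>2" using \<rho>1(1) \<rho>2(1) by (auto simp: \<rho>_def)
  obtain \<epsilon>1 D1 where 1: "0 < \<epsilon>1" "2 < D1" "\<And>D u \<mu> w. D1 \<le> D \<Longrightarrow> kinetic_on a {al..be} D u \<mu> \<Longrightarrow>
       measure \<mu> (space \<mu>) \<le> \<epsilon>1 \<Longrightarrow> al \<le> w \<Longrightarrow> conv (\<lambda>y. indicator {w<..} (u y)) \<rho> 0 \<le> 1 / 2 \<Longrightarrow>
       emeasure lborel {y\<in>ball 0 (1 / 2). w + \<delta> < u y} = 0"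
    using \<rho>1(2)[OF \<rho>(1,2)] by blast
  obtain \<epsilon>2 D2 where 2: "0 < \<epsilon>2" "2 < D2" "\<And>D u \<mu> w. D2 \<le> D \<Longrightarrow> kinetic_on (\<lambda>v. a (- v)) {- be..- al} D u \<mu> \<Longrightarrow>
       measure \<mu> (space \<mu>) \<le> \<epsilon>2 \<Longrightarrow> - be \<le> w \<Longrightarrow> conv (\<lambda>y. indicator {w<..} (u y)) \<rho> 0 \<le> 1 / 2 \<Longrightarrow>
       emeasure lborel {y\<in>ball 0 (1 / 2). w + \<delta> < u y} = 0"
    using \<rho>2(2)[OF \<rho>(1,3)] by blast
  show ?thesis
  proof (rule that[of "min \<epsilon>1 \<epsilon>2" "max D1 D2"])
    fix u and \<mu> :: "('a \<times> real) measure" and w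
    assume kin: "kinetic_on a {al..be} (max D1 D2) u \<mu>" and \<mu>: "measure \<mu> (space \<mu>) \<le> min \<epsilon>1 \<epsilon>2" and w: "w \<in> {al..be}"
    have [measurable]: "u \<in> borel_measurable borel" using kin by (simp add: kinetic_on_def)
    show "emeasure lborel {y\<in>ball 0 (1 / 2). w + \<delta> < u y} = 0 \<or> emeasure lborel {y\<in>ball 0 (1 / 2). u y < w - \<delta>} = 0"
    proof (cases "conv (\<lambda>y. indicator {w<..} (u y)) \<rho> 0 \<le> 1 / 2")
      case True
      then show ?thesis using 1(3)[OF _ kin] \<mu> w by auto
    next
      case False
      let ?\<mu> = "distr \<mu> borel (\<lambda>p. (fst p, - snd p))"
      have kin': "kinetic_on (\<lambda>v. a (- v)) {- be..- al} (max D1 D2) (\<lambda>x. - u x) ?\<mu>"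
        using kinetic_on_reflect[OF kin cont_a] by simp
      have i1: "\<bar>indicator S r :: real\<bar> \<le> 1" for S and r :: real by (simp add: indicator_def)
      have i2: "indicator {- w<..} (- u y) \<le> 1 - (indicator {w<..} (u y) :: real)" for y
        by (auto simp: indicator_def)
      have "conv (\<lambda>y. indicator {- w<..} (- u y)) \<rho> 0 \<le> conv (\<lambda>y. 1 - indicator {w<..} (u y)) \<rho> 0"
        by (intro conv_mono i1 i2 \<rho>) (auto simp: indicator_def)
      also have "\<dots> = conv (\<lambda>y. 1) \<rho> (0::'a) - conv (\<lambda>y. indicator {w<..} (u y)) \<rho> 0"
        unfolding conv_def left_diff_distrib
        by (intro Bochner_Integration.integral_diff integrable_conv i1 \<rho>) auto
      also have "conv (\<lambda>y. 1) \<rho> (0::'a) \<le> 1" by (rule conv_bounds) (use \<rho> in auto)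
      finally have "conv (\<lambda>y. indicator {- w<..} (- u y)) \<rho> 0 \<le> 1 / 2" using False by simp
      moreover have "measure ?\<mu> (space ?\<mu>) \<le> \<epsilon>2"
      proof -
        have s: "sets \<mu> = sets borel" using kin by (simp add: kinetic_on_def)
        then have "space \<mu> = UNIV" using sets_eq_imp_space_eq[OF s] by simp
        moreover have "(\<lambda>p::'a \<times> real. (fst p, - snd p)) \<in> \<mu> \<rightarrow>\<^sub>M borel"
          unfolding measurable_cong_sets[OF s refl]
          by (intro borel_measurable_continuous_onI continuous_intros)
        ultimately have "measure ?\<mu> (space ?\<mu>) = measure \<mu> (space \<mu>)"
          by (subst measure_distr) auto
        then show ?thesis using \<mu> by simp
      qed
      ultimately have "emeasure lborel {y\<in>ball 0 (1 / 2). - w + \<delta> < - u y} = 0"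
        by (intro 2(3)[OF _ kin']) (use w in auto)
      moreover have "{y\<in>ball 0 (1 / 2). - w + \<delta> < - u y} = {y\<in>ball 0 (1 / 2). u y < w - \<delta>}" by auto
      ultimately show ?thesis by simp
    qed
  qed (use 1 2 in auto)
qed

end

section \<open>Blow-up at a point of vanishing density\<close>

text \<open>The counterpart of \<open>kinetic_on\<close> before rescaling: the measure lives on
  \<Omega> times the line and may be infinite near the boundary of \<Omega>.\<close>

definition kinetic_global ::
    "(real \<Rightarrow> 'a::euclidean_space) \<Rightarrow> real set \<Rightarrow> 'a set \<Rightarrow> ('a \<Rightarrow> real) \<Rightarrow> ('a \<times> real) measure \<Rightarrow> bool" where
  "kinetic_global a I \<Omega> u \<mu> \<longleftrightarrow> u \<in> borel_measurable borel \<and> range u \<subseteq> I \<and>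
     sets \<mu> = sets (restrict_space borel (\<Omega> \<times> UNIV)) \<and>
     (\<forall>\<phi> \<zeta>. test_function \<Omega> \<phi> \<longrightarrow> test_function UNIV \<zeta> \<longrightarrow>
        (LINT y|lborel. flux a \<zeta> (u y) \<bullet> grad \<phi> y) = (LINT p|\<mu>. \<phi> (fst p) * deriv \<zeta> (snd p)))"

lemma test_function_affine:
  fixes \<phi> :: "'a::euclidean_space \<Rightarrow> real"
  assumes \<phi>: "test_function (ball 0 D) \<phi>" and r: "0 < r"
  shows "test_function (ball x0 (D * r)) (\<lambda>y. \<phi> ((1 / r) *\<^sub>R (y - x0)))"
    and "grad (\<lambda>y. \<phi> ((1 / r) *\<^sub>R (y - x0))) y = (1 / r) *\<^sub>R grad \<phi> ((1 / r) *\<^sub>R (y - x0))"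
proof -
  let ?K = "closure {x. \<phi> x \<noteq> 0}" and ?g = "\<lambda>x. x0 + r *\<^sub>R x"
  have sm: "smooth \<phi>" and K: "compact ?K" "?K \<subseteq> ball 0 D" using \<phi> by (auto simp: test_function_def)
  show "test_function (ball x0 (D * r)) (\<lambda>y. \<phi> ((1 / r) *\<^sub>R (y - x0)))"
  proof (rule test_functionI[OF smooth_affine[OF sm]])
    show "compact (?g ` ?K)" by (intro compact_continuous_image K continuous_intros)
    show "?g ` ?K \<subseteq> ball x0 (D * r)"
      using K(2) r by (auto simp: dist_norm mult.commute)
    fix y assume "\<phi> ((1 / r) *\<^sub>R (y - x0)) \<noteq> 0"
    then have "(1 / r) *\<^sub>R (y - x0) \<in> ?K" by (intro subsetD[OF closure_subset]) simp
    moreover have "y = ?g ((1 / r) *\<^sub>R (y - x0))" using r by simp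
    ultimately show "y \<in> ?g ` ?K" by (rule rev_image_eqI)
  qed
  have d: "((\<lambda>y. (1 / r) *\<^sub>R (y - x0)) has_derivative (\<lambda>h. (1 / r) *\<^sub>R h)) (at y)"
    by (auto intro!: derivative_eq_intros)
  show "grad (\<lambda>y. \<phi> ((1 / r) *\<^sub>R (y - x0))) y = (1 / r) *\<^sub>R grad \<phi> ((1 / r) *\<^sub>R (y - x0))"
    by (rule grad_eqI) (use diff_chain_at[OF d has_derivative_grad[OF sm]] in \<open>simp add: o_def\<close>)
qed

lemma test_function_mono: "test_function V \<phi> \<Longrightarrow> V \<subseteq> W \<Longrightarrow> test_function W \<phi>"
  by (auto simp: test_function_def)

text \<open>The change of variables contributes r^d and the gradient r^(-1), which fixes the weight
  r^(1-d); levels are not rescaled. The total mass becomes the density quotient of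
  \<open>jump_set\<close>, up to the factor D in the radius.\<close>

definition rescaled :: "('a::euclidean_space \<times> real) measure \<Rightarrow> 'a \<Rightarrow> real \<Rightarrow> real \<Rightarrow> ('a \<times> real) measure" where
  "rescaled \<mu> x0 r D = distr (density \<mu> (\<lambda>p. ennreal (indicator (ball x0 (D * r) \<times> UNIV) p / r ^ (DIM('a) - 1))))
     borel (\<lambda>p. ((1 / r) *\<^sub>R (fst p - x0), snd p))"

lemma rescale:
  fixes a :: "real \<Rightarrow> 'a::euclidean_space"
  assumes kin: "kinetic_global a I \<Omega> u \<mu>" and r: "0 < r" and B: "ball x0 (D * r) \<subseteq> \<Omega>"
    and fin: "emeasure \<mu> (ball x0 (D * r) \<times> UNIV) < \<infinity>" and a: "continuous_on UNIV a"
  shows "kinetic_on a I D (\<lambda>x. u (x0 + r *\<^sub>R x)) (rescaled \<mu> x0 r D)"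
    and "measure (rescaled \<mu> x0 r D) (space (rescaled \<mu> x0 r D)) = measure \<mu> (ball x0 (D * r) \<times> UNIV) / r ^ (DIM('a) - 1)"
proof -
  have sets: "sets \<mu> = sets (restrict_space borel (\<Omega> \<times> UNIV))" using kin by (simp add: kinetic_global_def)
  have [measurable]: "u \<in> borel_measurable borel" using kin by (simp add: kinetic_global_def)
  have [measurable]: "a \<in> borel_measurable borel" by (rule borel_measurable_continuous_onI[OF a])
  let ?B = "ball x0 (D * r) \<times> (UNIV :: real set)"
  let ?S = "\<lambda>p::'a \<times> real. ((1 / r) *\<^sub>R (fst p - x0), snd p)"
  let ?k = "1 / r ^ (DIM('a) - 1)"
  have meas: "f \<in> \<mu> \<rightarrow>\<^sub>M N" if "f \<in> borel \<rightarrow>\<^sub>M N" for f and N :: "'b measure"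
    using measurable_restrict_space1[OF that] measurable_cong_sets[OF sets refl] by blast
  have meas2: "f \<in> \<mu> \<rightarrow>\<^sub>M N" if "f \<in> borel \<rightarrow>\<^sub>M N" for f and N :: "('a \<times> real) measure"
    using measurable_restrict_space1[OF that] measurable_cong_sets[OF sets refl] by blast
  have open_B: "open ?B" by (intro open_Times) auto
  have B_sets: "?B \<in> sets \<mu>"
    unfolding sets sets_restrict_space using B open_B by (intro image_eqI[of _ _ ?B]) auto
  have ind: "(\<lambda>p. indicator ?B p / r ^ (DIM('a) - 1) :: real) \<in> borel_measurable \<mu>"
    using B_sets by measurable
  have Sb: "?S \<in> borel \<rightarrow>\<^sub>M borel"
    by (intro borel_measurable_continuous_onI continuous_intros)
  have S: "?S \<in> density \<mu> (\<lambda>p. ennreal (indicator ?B p / r ^ (DIM('a) - 1))) \<rightarrow>\<^sub>M borel"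
    using meas2[OF Sb] by simp
  have "emeasure (rescaled \<mu> x0 r D) (space (rescaled \<mu> x0 r D))
      = (\<integral>\<^sup>+p. ennreal (indicator ?B p / r ^ (DIM('a) - 1)) \<partial>\<mu>)"
    unfolding rescaled_def using S ind
    by (subst emeasure_distr) (auto simp: emeasure_density space_density cong: nn_integral_cong_simp)
  also have "\<dots> = (\<integral>\<^sup>+p. ennreal ?k * indicator ?B p \<partial>\<mu>)"
    by (intro nn_integral_cong) (auto simp: indicator_def)
  also have "\<dots> = ennreal ?k * emeasure \<mu> ?B" by (rule nn_integral_cmult_indicator[OF B_sets])
  also have "\<dots> = ennreal (measure \<mu> ?B / r ^ (DIM('a) - 1))"
    using fin r by (simp add: emeasure_eq_ennreal_measure ennreal_mult'' flip: ennreal_mult')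
  finally have em: "emeasure (rescaled \<mu> x0 r D) (space (rescaled \<mu> x0 r D)) = ennreal (measure \<mu> ?B / r ^ (DIM('a) - 1))" .
  then show "measure (rescaled \<mu> x0 r D) (space (rescaled \<mu> x0 r D)) = measure \<mu> ?B / r ^ (DIM('a) - 1)"
    using r by (simp add: measure_def)
  have "finite_measure (rescaled \<mu> x0 r D)" by (rule finite_measureI) (simp add: em)
  moreover have "(LINT y|lborel. flux a \<zeta> (u (x0 + r *\<^sub>R y)) \<bullet> grad \<phi> y)
      = (LINT p|rescaled \<mu> x0 r D. \<phi> (fst p) * deriv \<zeta> (snd p))"
    if \<phi>: "test_function (ball 0 D) \<phi>" and \<zeta>: "test_function UNIV \<zeta>" for \<phi> \<zeta>
  proof -
    have sm: "smooth \<zeta>" "smooth \<phi>" using \<phi> \<zeta> by (auto simp: test_function_smooth)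
    have [measurable]: "\<phi> \<in> borel_measurable borel" "grad \<phi> \<in> borel_measurable borel" "\<zeta> \<in> borel_measurable borel"
      "deriv \<zeta> \<in> borel_measurable borel"
      using sm by (auto intro: borel_measurable_smooth borel_measurable_grad borel_measurable_deriv_smooth)
    have [measurable]: "flux a \<zeta> \<in> borel_measurable borel" unfolding flux_def[abs_def] by measurable
    let ?\<phi> = "\<lambda>y. \<phi> ((1 / r) *\<^sub>R (y - x0))"
    note tf = test_function_affine[OF \<phi> r, of x0]
    have d1: "r ^ DIM('a) = r * r ^ (DIM('a) - 1)"
      using DIM_positive[where 'a='a] by (cases "DIM('a)") auto
    have "(LINT y|lborel. flux a \<zeta> (u y) \<bullet> grad ?\<phi> y)
        = r ^ DIM('a) * (LINT x|lborel. flux a \<zeta> (u (x0 + r *\<^sub>R x)) \<bullet> ((1 / r) *\<^sub>R grad \<phi> x))"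
      unfolding tf(2) using r by (subst integral_affine[of _ r x0]) auto
    also have "\<dots> = r ^ (DIM('a) - 1) * (LINT x|lborel. flux a \<zeta> (u (x0 + r *\<^sub>R x)) \<bullet> grad \<phi> x)"
      using r by (simp add: d1)
    finally have 1: "(LINT y|lborel. flux a \<zeta> (u y) \<bullet> grad ?\<phi> y)
        = r ^ (DIM('a) - 1) * (LINT x|lborel. flux a \<zeta> (u (x0 + r *\<^sub>R x)) \<bullet> grad \<phi> x)" .
    have 2: "(LINT y|lborel. flux a \<zeta> (u y) \<bullet> grad ?\<phi> y) = (LINT p|\<mu>. ?\<phi> (fst p) * deriv \<zeta> (snd p))"
      using kin test_function_mono[OF tf(1) B] \<zeta> unfolding kinetic_global_def by blast
    have mg: "(\<lambda>p::'a \<times> real. \<phi> (fst p) * deriv \<zeta> (snd p)) \<in> borel_measurable borel"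
      unfolding borel_prod[symmetric] by measurable
    have "(LINT p|rescaled \<mu> x0 r D. \<phi> (fst p) * deriv \<zeta> (snd p))
        = (LINT p|density \<mu> (\<lambda>p. ennreal (indicator ?B p / r ^ (DIM('a) - 1))). ?\<phi> (fst p) * deriv \<zeta> (snd p))"
      unfolding rescaled_def by (subst integral_distr[OF S mg]) simp
    also have "\<dots> = (LINT p|\<mu>. (indicator ?B p / r ^ (DIM('a) - 1)) *\<^sub>R (?\<phi> (fst p) * deriv \<zeta> (snd p)))"
    proof (rule integral_density)
      show "(\<lambda>p. ?\<phi> (fst p) * deriv \<zeta> (snd p)) \<in> borel_measurable \<mu>"
        using meas2[OF Sb] measurable_compose[OF meas2[OF Sb] mg] by simp
    qed (use ind r in auto)
    also have "\<dots> = (LINT p|\<mu>. ?k * (?\<phi> (fst p) * deriv \<zeta> (snd p)))"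
    proof (rule Bochner_Integration.integral_cong[OF refl])
      fix p :: "'a \<times> real"
      have "?\<phi> (fst p) = 0" if "fst p \<notin> ball x0 (D * r)"
      proof (rule ccontr)
        assume "?\<phi> (fst p) \<noteq> 0"
        then have "fst p \<in> closure {y. ?\<phi> y \<noteq> 0}" using closure_subset[of "{y. ?\<phi> y \<noteq> 0}"] by blast
        then show False using tf(1) that unfolding test_function_def by blast
      qed
      then show "(indicator ?B p / r ^ (DIM('a) - 1)) *\<^sub>R (?\<phi> (fst p) * deriv \<zeta> (snd p)) = ?k * (?\<phi> (fst p) * deriv \<zeta> (snd p))"
        by (cases "fst p \<in> ball x0 (D * r)") (auto simp: indicator_def mem_Times_iff)
    qed
    also have "\<dots> = ?k * (r ^ (DIM('a) - 1) * (LINT x|lborel. flux a \<zeta> (u (x0 + r *\<^sub>R x)) \<bullet> grad \<phi> x))"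
      using 1 2 by simp
    finally show ?thesis using r by simp
  qed
  ultimately show "kinetic_on a I D (\<lambda>x. u (x0 + r *\<^sub>R x)) (rescaled \<mu> x0 r D)"
    using kin unfolding kinetic_on_def kinetic_global_def by (auto simp: rescaled_def)
qed

lemma null_rescale:
  fixes x0 :: "'a::euclidean_space"
  assumes r: "0 < r" and [measurable]: "Measurable.pred borel P"
    and z: "emeasure lborel {y\<in>ball 0 s. P (x0 + r *\<^sub>R y)} = 0"
  shows "AE y in lborel. y \<in> ball x0 (r * s) \<longrightarrow> \<not> P y"
proof -
  have "emeasure lborel {y\<in>ball x0 (r * s). P y} = (\<integral>\<^sup>+y. indicator {y\<in>ball x0 (r * s). P y} y \<partial>lborel)" by simp
  also have "\<dots> = ennreal (\<bar>r\<bar> ^ DIM('a)) * (\<integral>\<^sup>+y. indicator {y\<in>ball x0 (r * s). P y} (x0 + r *\<^sub>R y) \<partial>lborel)"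
    using r by (intro nn_integral_affine) auto
  also have "(\<integral>\<^sup>+y. indicator {y\<in>ball x0 (r * s). P y} (x0 + r *\<^sub>R y) \<partial>lborel)
      = (\<integral>\<^sup>+y. indicator {y\<in>ball 0 s. P (x0 + r *\<^sub>R y)} y \<partial>lborel)"
    using r by (intro nn_integral_cong) (auto simp: indicator_def dist_norm)
  also have "\<dots> = 0" using z by simp
  finally have "emeasure lborel {y\<in>ball x0 (r * s). P y} = 0" by simp
  then show ?thesis
    by (subst AE_iff_measurable[of "{y\<in>ball x0 (r * s). P y}"]) auto
qed

context gn_flux
begin

text \<open>A vanishing density makes the dissipation of some blow-up small enough for
  \<open>dichotomy\<close>, at all levels simultaneously. The critical level, where the alternative
  switches from a lower to an upper bound, is the value k.\<close>

lemma small_oscillation: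
  fixes x0 :: 'a
  assumes kin: "kinetic_global a {al..be} \<Omega> u \<mu>" and \<Omega>: "open \<Omega>" "x0 \<in> \<Omega>"
    and lim: "\<not> Limsup (at_right 0) (\<lambda>r. emeasure \<mu> (ball x0 r \<times> UNIV) / ennreal (r ^ (DIM('a) - 1))) > 0"
    and \<delta>: "0 < \<delta>"
  obtains r k where "0 < r" "AE y in lborel. y \<in> ball x0 r \<longrightarrow> \<bar>u y - k\<bar> \<le> \<delta>"
proof -
  obtain \<epsilon> D where \<epsilon>: "0 < \<epsilon>" and D: "2 < D" and dich:
    "\<And>u \<mu> w. kinetic_on a {al..be} D u \<mu> \<Longrightarrow> measure \<mu> (space \<mu>) \<le> \<epsilon> \<Longrightarrow> w \<in> {al..be} \<Longrightarrow>
       emeasure lborel {y\<in>ball 0 (1 / 2). w + \<delta> / 2 < u y} = 0 \<or> emeasure lborel {y\<in>ball 0 (1 / 2). u y < w - \<delta> / 2} = 0"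
    by (rule dichotomy[OF half_gt_zero[OF \<delta>]]) (rule that; assumption)
  let ?d = "DIM('a) - 1"
  \<comment> \<open>The blow-up radius is r but the mass is taken on the ball of radius R = D r;
    passing from R^(d-1) to r^(d-1) costs this power of D.\<close>
  define \<epsilon>' where "\<epsilon>' = \<epsilon> / D ^ ?d"
  have \<epsilon>': "0 < \<epsilon>'" using \<epsilon> D by (simp add: \<epsilon>'_def)
  have "Limsup (at_right 0) (\<lambda>r. emeasure \<mu> (ball x0 r \<times> UNIV) / ennreal (r ^ ?d)) < ennreal \<epsilon>'"
    using lim \<epsilon>' by (simp add: not_less)
  then have ev1: "\<forall>\<^sub>F r in at_right 0. emeasure \<mu> (ball x0 r \<times> UNIV) / ennreal (r ^ ?d) < ennreal \<epsilon>'"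
    by (rule Limsup_lessD)
  obtain e where e: "0 < e" "ball x0 e \<subseteq> \<Omega>" using \<Omega> open_contains_ball by blast
  have ev2: "\<forall>\<^sub>F r in at_right (0::real). r \<in> {0<..<e}"
    by (rule eventually_at_right_real[OF e(1)])
  obtain R where R: "emeasure \<mu> (ball x0 R \<times> UNIV) / ennreal (R ^ ?d) < ennreal \<epsilon>'" "R < e" "0 < R"
    using eventually_happens'[OF _ eventually_conj[OF ev1 ev2]] by auto
  define r where "r = R / D"
  have r: "0 < r" "D * r = R" using R D by (auto simp: r_def)
  have Rd: "0 < R ^ ?d" using R by simp
  have fin: "emeasure \<mu> (ball x0 R \<times> UNIV) < \<infinity>"
  proof (rule ccontr)
    assume "\<not> ?thesis"
    then have "emeasure \<mu> (ball x0 R \<times> UNIV) = \<infinity>" by (simp add: less_top[symmetric])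
    then show False using R(1) Rd by (simp add: ennreal_top_divide)
  qed
  have mb: "measure \<mu> (ball x0 R \<times> UNIV) / R ^ ?d < \<epsilon>'"
  proof -
    have "emeasure \<mu> (ball x0 R \<times> UNIV) = ennreal (measure \<mu> (ball x0 R \<times> UNIV))"
      using fin by (intro emeasure_eq_ennreal_measure) auto
    then have "ennreal (measure \<mu> (ball x0 R \<times> UNIV) / R ^ ?d) < ennreal \<epsilon>'"
      using R(1) Rd by (simp add: divide_ennreal)
    then show ?thesis using R(3) by (subst (asm) ennreal_less_iff) auto
  qed
  have BR: "ball x0 (D * r) \<subseteq> \<Omega>" using e R r by auto
  note K = rescale[OF kin r(1) BR _ cont_a]
  let ?u = "\<lambda>x. u (x0 + r *\<^sub>R x)"
  have kin': "kinetic_on a {al..be} D ?u (rescaled \<mu> x0 r D)" by (rule K(1)) (use fin r in simp)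
  have small: "measure (rescaled \<mu> x0 r D) (space (rescaled \<mu> x0 r D)) \<le> \<epsilon>"
  proof -
    have "measure (rescaled \<mu> x0 r D) (space (rescaled \<mu> x0 r D)) = measure \<mu> (ball x0 R \<times> UNIV) / r ^ ?d"
      using K(2) fin r by simp
    also have "\<dots> = measure \<mu> (ball x0 R \<times> UNIV) / R ^ ?d * D ^ ?d"
      using D by (simp add: r_def power_divide)
    also have "\<dots> \<le> \<epsilon>' * D ^ ?d" using mb D by (intro mult_right_mono) auto
    also have "\<dots> = \<epsilon>" using D by (simp add: \<epsilon>'_def)
    finally show ?thesis .
  qed
  have [measurable]: "u \<in> borel_measurable borel" using kin by (simp add: kinetic_global_def)
  have u: "u y \<in> {al..be}" for y using kin unfolding kinetic_global_def by blast
  have alt: "(AE y in lborel. y \<in> ball x0 (r * (1 / 2)) \<longrightarrow> \<not> w + \<delta> / 2 < u y) \<or>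
      (AE y in lborel. y \<in> ball x0 (r * (1 / 2)) \<longrightarrow> \<not> u y < w - \<delta> / 2)" if w: "w \<in> {al..be}" for w
    using dich[OF kin' small w]
  proof
    assume "emeasure lborel {y\<in>ball 0 (1 / 2). w + \<delta> / 2 < u (x0 + r *\<^sub>R y)} = 0"
    then show ?thesis by (intro disjI1 null_rescale[OF r(1)]) auto
  next
    assume "emeasure lborel {y\<in>ball 0 (1 / 2). u (x0 + r *\<^sub>R y) < w - \<delta> / 2} = 0"
    then show ?thesis by (intro disjI2 null_rescale[OF r(1)]) auto
  qed
  let ?B = "ball x0 (r * (1 / 2))"
  \<comment> \<open>The levels at which the lower bound holds. Its supremum m is nearly attained,
    which gives u \<ge> m - \<delta>; the level m + \<delta> / 2 is outside, which gives u \<le> m +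
    \<delta>, trivially so if that level exceeds \<open>be\<close>.\<close>
  define L where "L = {w\<in>{al..be}. AE y in lborel. y \<in> ?B \<longrightarrow> \<not> u y < w - \<delta> / 2}"
  have alL: "al \<in> L"
  proof -
    have "\<not> u y < al - \<delta> / 2" for y using u[of y] \<delta> by auto
    then show ?thesis using al_be by (simp add: L_def)
  qed
  have bdd: "bdd_above L" by (intro bdd_aboveI[of _ be]) (auto simp: L_def)
  define m where "m = Sup L"
  have m: "al \<le> m" unfolding m_def by (rule cSup_upper[OF alL bdd])
  obtain w1 where w1: "w1 \<in> L" "m - \<delta> / 2 < w1"
    using less_cSup_iff[of L "m - \<delta> / 2"] alL bdd \<delta> by (auto simp: m_def)
  have low: "AE y in lborel. y \<in> ?B \<longrightarrow> m - \<delta> \<le> u y"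
    using w1 unfolding L_def by (auto elim!: eventually_mono)
  have up: "AE y in lborel. y \<in> ?B \<longrightarrow> u y \<le> m + \<delta>"
  proof (cases "m + \<delta> / 2 \<le> be")
    case True
    have "m + \<delta> / 2 \<notin> L"
      using cSup_upper[OF _ bdd, of "m + \<delta> / 2"] \<delta> by (auto simp: m_def)
    then have "\<not> (AE y in lborel. y \<in> ?B \<longrightarrow> \<not> u y < (m + \<delta> / 2) - \<delta> / 2)"
      using True m \<delta> unfolding L_def by auto
    then have "AE y in lborel. y \<in> ?B \<longrightarrow> \<not> (m + \<delta> / 2) + \<delta> / 2 < u y"
      using alt[of "m + \<delta> / 2"] True m \<delta> by auto
    then show ?thesis by (auto elim!: eventually_mono)
  next
    case False
    then have "u y \<le> m + \<delta>" for y using u[of y] \<delta> by auto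
    then show ?thesis by simp
  qed
  show ?thesis
  proof (rule that[of "r * (1 / 2)" m])
    show "AE y in lborel. y \<in> ?B \<longrightarrow> \<bar>u y - m\<bar> \<le> \<delta>"
      using low up by eventually_elim auto
  qed (use r in simp)
qed

end

subsection \<open>A continuous representative\<close>

lemma AE_open_contradiction:
  assumes "AE y in lborel. y \<in> S \<longrightarrow> False" "open S" "S \<noteq> {}"
  shows False
proof -
  have "emeasure lborel S = 0"
    using assms(1,2) by (subst (asm) AE_iff_measurable[of S]) auto
  then have "negligible S" using assms(2) by (simp add: negligible_iff_null_sets null_setsI)
  then show False using open_not_negligible assms(2,3) by blast
qed

text \<open>The candidate is the essential upper limit: the infimum of the essential upper bounds
  over small balls. It is defined at every point and inherits each local oscillation bound at every
  point of the ball, which yields both continuity and agreement with u.\<close>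

lemma continuous_representative:
  fixes u :: "'a::euclidean_space \<Rightarrow> real"
  assumes W: "open W" and [measurable]: "u \<in> borel_measurable borel" and u: "range u \<subseteq> {al..be}"
    and osc: "\<And>x \<delta>. x \<in> W \<Longrightarrow> 0 < \<delta> \<Longrightarrow> \<exists>r k. 0 < r \<and> (AE y in lborel. y \<in> ball x r \<longrightarrow> \<bar>u y - k\<bar> \<le> \<delta>)"
  obtains u' where "u' \<in> borel_measurable borel" "continuous_on W u'" "AE y in lborel. y \<in> W \<longrightarrow> u y = u' y"
proof -
  define S where "S x = {k. \<exists>r>0. AE y in lborel. y \<in> ball x r \<longrightarrow> u y \<le> k}" for x
  define v where "v x = Inf (S x)" for x
  have v: "\<bar>v x - k\<bar> \<le> \<delta>"
    if r: "AE y in lborel. y \<in> ball x0 r \<longrightarrow> \<bar>u y - k\<bar> \<le> \<delta>" and x: "x \<in> ball x0 r" for x x0 r k \<delta>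
  proof -
    obtain e where e: "0 < e" "ball x e \<subseteq> ball x0 r"
      by (rule openE[OF open_ball x]) (rule that; assumption)
    have "AE y in lborel. y \<in> ball x e \<longrightarrow> u y \<le> k + \<delta>"
      using r by eventually_elim (use e(2) in auto)
    then have up: "k + \<delta> \<in> S x" using e(1) by (auto simp: S_def)
    have low: "k - \<delta> \<le> m" if m: "m \<in> S x" for m
    proof (rule ccontr)
      assume "\<not> k - \<delta> \<le> m"
      obtain e' where e': "0 < e'" "AE y in lborel. y \<in> ball x e' \<longrightarrow> u y \<le> m" using m unfolding S_def by blast
      have "AE y in lborel. y \<in> ball x e \<inter> ball x e' \<longrightarrow> False"
        using r e'(2) by eventually_elim (use e(2) \<open>\<not> k - \<delta> \<le> m\<close> in auto)
      moreover have "x \<in> ball x e \<inter> ball x e'" using e e' by simp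
      ultimately show False using AE_open_contradiction[of "ball x e \<inter> ball x e'"] by (metis empty_iff open_Int open_ball)
    qed
    have "v x \<le> k + \<delta>" unfolding v_def by (rule cInf_lower[OF up bdd_belowI[OF low]])
    moreover have "k - \<delta> \<le> v x" unfolding v_def by (rule cInf_greatest) (use up low in auto)
    ultimately show ?thesis by auto
  qed
  have cont: "continuous_on W v"
    unfolding continuous_on_iff
  proof (intro ballI allI impI)
    fix x and \<epsilon> :: real assume x: "x \<in> W" and \<epsilon>: "0 < \<epsilon>"
    obtain r k where r: "0 < r" "AE y in lborel. y \<in> ball x r \<longrightarrow> \<bar>u y - k\<bar> \<le> \<epsilon> / 3"
      using osc[OF x, of "\<epsilon> / 3"] \<epsilon> by auto
    show "\<exists>d>0. \<forall>x'\<in>W. dist x' x < d \<longrightarrow> dist (v x') (v x) < \<epsilon>"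
    proof (intro exI conjI ballI impI)
      fix x' assume "dist x' x < r"
      then have "\<bar>v x' - k\<bar> \<le> \<epsilon> / 3" by (intro v[OF r(2)]) (simp add: dist_commute)
      moreover have "\<bar>v x - k\<bar> \<le> \<epsilon> / 3" using r(1) by (intro v[OF r(2)]) simp
      ultimately show "dist (v x') (v x) < \<epsilon>" unfolding dist_real_def using \<epsilon> by linarith
    qed (rule r(1))
  qed
  have close: "AE y in lborel. y \<in> W \<longrightarrow> \<bar>u y - v y\<bar> \<le> 2 * \<delta>" if \<delta>: "0 < \<delta>" for \<delta>
  proof -
    \<comment> \<open>The balls depend on the point and there are uncountably many of them; Lindelof
      leaves countably many exceptional null sets.\<close>
    define F where "F = {ball x r |x r. AE y in lborel. y \<in> ball x r \<longrightarrow> \<bar>u y - v y\<bar> \<le> 2 * \<delta>}"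
    obtain F' where F': "F' \<subseteq> F" "countable F'" "\<Union>F' = \<Union>F"
      by (rule Lindelof[of F]) (auto simp: F_def)
    have "W \<subseteq> \<Union>F"
    proof
      fix x assume x: "x \<in> W"
      obtain r k where r: "0 < r" "AE y in lborel. y \<in> ball x r \<longrightarrow> \<bar>u y - k\<bar> \<le> \<delta>"
        using osc[OF x \<delta>] by auto
      have "AE y in lborel. y \<in> ball x r \<longrightarrow> \<bar>u y - v y\<bar> \<le> 2 * \<delta>"
        using r(2)
      proof eventually_elim
        case (elim y)
        show ?case
        proof
          assume "y \<in> ball x r"
          then show "\<bar>u y - v y\<bar> \<le> 2 * \<delta>" using v[OF r(2), of y] elim by linarith
        qed
      qed
      then have "ball x r \<in> F" by (auto simp: F_def)
      then show "x \<in> \<Union>F" using r(1) by (intro UnionI[of "ball x r"]) auto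
    qed
    have "AE y in lborel. \<forall>B\<in>F'. y \<in> B \<longrightarrow> \<bar>u y - v y\<bar> \<le> 2 * \<delta>"
      using F' by (subst AE_ball_countable) (auto simp: F_def)
    then show ?thesis
      by eventually_elim (use \<open>W \<subseteq> \<Union>F\<close> F'(3) in blast)
  qed
  have "AE y in lborel. \<forall>n. y \<in> W \<longrightarrow> \<bar>u y - v y\<bar> \<le> 2 * inverse (real (Suc n))"
    by (subst AE_all_countable) (intro allI close, simp)
  then have eq: "AE y in lborel. y \<in> W \<longrightarrow> u y = v y"
  proof eventually_elim
    case (elim y)
    show ?case
    proof
      assume "y \<in> W"
      then have le: "\<bar>u y - v y\<bar> \<le> 2 * inverse (real (Suc n))" for n using elim by blast
      have "(\<lambda>n. 2 * inverse (real (Suc n))) \<longlonglongrightarrow> 2 * 0" by (intro tendsto_intros LIMSEQ_inverse_real_of_nat)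
      then have "\<bar>u y - v y\<bar> \<le> 2 * 0" by (rule LIMSEQ_le_const) (use le in auto)
      then show "u y = v y" by simp
    qed
  qed
  define u' where "u' x = (if x \<in> W then v x else 0)" for x
  show ?thesis
  proof (rule that[of u'])
    show "u' \<in> borel_measurable borel"
      unfolding u'_def[abs_def] by (rule borel_measurable_continuous_on_if) (use W cont in auto)
    show "continuous_on W u'" using cont by (rule continuous_on_eq) (simp add: u'_def)
    show "AE y in lborel. y \<in> W \<longrightarrow> u y = u' y" using eq by eventually_elim (simp add: u'_def)
  qed
qed

subsection \<open>Continuous solutions do not dissipate\<close>

text \<open>T stands for either half-line with endpoint v and q for the flux of the corresponding
  half entropy, which near v is |s - v| b to first order. Near the touching point p the gradient of
  a bump on a slightly enlarged inner ball points along x0 - p up to a positive factor. If b had a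
  negative product with x0 - p, the integrand of the entropy inequality would be negative on a
  nonempty open set and zero elsewhere.\<close>

lemma proximal_normal:
  fixes u :: "'a::euclidean_space \<Rightarrow> real" and q :: "real \<Rightarrow> 'a" and b :: 'a
  assumes W: "open W" and [measurable]: "u \<in> borel_measurable borel" and u: "continuous_on W u"
    and T: "open T" "closure T \<subseteq> insert v T"
    and q: "continuous_on UNIV q" "\<And>s. s \<notin> T \<Longrightarrow> q s = 0"
    and qd: "\<And>\<eta>. 0 < \<eta> \<Longrightarrow> \<exists>\<delta>>0. \<forall>s\<in>T. \<bar>s - v\<bar> < \<delta> \<longrightarrow> norm (q s - \<bar>s - v\<bar> *\<^sub>R b) \<le> \<eta> * \<bar>s - v\<bar>"
    and vT: "v \<notin> T"
    and ent: "\<And>\<psi>. test_function W \<psi> \<Longrightarrow> (\<And>x. 0 \<le> \<psi> x) \<Longrightarrow> 0 \<le> (LINT x|lborel. q (u x) \<bullet> grad \<psi> x)"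
    and E_def: "E = {x\<in>W. u x \<in> T}"
    and p: "p \<in> closure E" and d: "0 < d" "norm (x0 - p) = d" "cball x0 (2 * d) \<subseteq> W" and disj: "ball x0 d \<inter> E = {}"
  shows "0 \<le> b \<bullet> (x0 - p)"
proof (rule ccontr)
  assume "\<not> 0 \<le> b \<bullet> (x0 - p)"
  define \<beta> where "\<beta> = - (b \<bullet> (x0 - p)) / 2"
  have \<beta>: "0 < \<beta>" using \<open>\<not> 0 \<le> b \<bullet> (x0 - p)\<close> by (simp add: \<beta>_def)
  have pW: "p \<in> W" using d by (auto simp: dist_norm)
  have oE: "open E"
    unfolding E_def using continuous_open_preimage[OF u W T(1)] by (simp add: Int_def vimage_def)
  have up: "u p = v"
  proof -
    have "u p \<notin> T"
    proof
      assume "u p \<in> T"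
      then have "p \<in> E" using pW by (simp add: E_def)
      moreover have "p \<in> closure (ball x0 d)" using d by (simp add: dist_norm)
      ultimately show False using disj oE open_Int_closure_eq_empty[OF oE, of "ball x0 d"] by blast
    qed
    moreover have "u p \<in> closure T"
    proof (rule ccontr)
      assume n: "u p \<notin> closure T"
      let ?O = "W \<inter> u -` (- closure T)"
      have "open ?O" by (rule continuous_open_preimage[OF u W]) auto
      moreover have "p \<in> ?O" using n pW by simp
      moreover have "?O \<inter> E = {}" using closure_subset[of T] by (auto simp: E_def)
      ultimately show False using p open_Int_closure_eq_empty[of ?O E] by blast
    qed
    ultimately show ?thesis using T(2) by blast
  qed
  obtain \<delta>1 where \<delta>1: "0 < \<delta>1" "\<And>s. s \<in> T \<Longrightarrow> \<bar>s - v\<bar> < \<delta>1 \<Longrightarrow> norm (q s - \<bar>s - v\<bar> *\<^sub>R b) \<le> \<beta> / (4 * d) * \<bar>s - v\<bar>"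
    using qd[of "\<beta> / (4 * d)"] \<beta> d by auto
  obtain \<delta>2 where \<delta>2: "0 < \<delta>2" "\<And>y. y \<in> W \<Longrightarrow> dist y p < \<delta>2 \<Longrightarrow> \<bar>u y - v\<bar> < \<delta>1"
    using u[unfolded continuous_on_iff] pW \<delta>1(1) up unfolding dist_real_def by metis
  define \<epsilon> where "\<epsilon> = min (\<delta>2 / 2) (\<beta> / (2 * (norm b + 1)))"
  have "0 < \<beta> / (2 * (norm b + 1))" using \<beta> by (intro divide_pos_pos mult_pos_pos add_nonneg_pos) auto
  then have \<epsilon>: "0 < \<epsilon>" unfolding \<epsilon>_def min_less_iff_conj using \<delta>2(1) by simp
  have "\<epsilon> \<le> \<delta>2 / 2" unfolding \<epsilon>_def by (rule min.cobounded1)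
  then have \<epsilon>2: "\<epsilon> < \<delta>2" using \<delta>2(1) by linarith
  have \<epsilon>b: "norm b * \<epsilon> \<le> \<beta> / 2"
  proof -
    have nb: "0 < norm b + 1" by (simp add: add_nonneg_pos)
    have "\<epsilon> \<le> \<beta> / (2 * (norm b + 1))" unfolding \<epsilon>_def by (rule min.cobounded2)
    then have "\<epsilon> * (2 * (norm b + 1)) \<le> \<beta>" using nb by (simp add: pos_le_divide_eq)
    then have "2 * (norm b * \<epsilon>) + 2 * \<epsilon> \<le> \<beta>" by (simp add: algebra_simps)
    then show ?thesis using \<epsilon> by linarith
  qed
  \<comment> \<open>The excess of the radius over d / 2. It is so small that the part of the bump's
    ball outside the tangent ball lies within distance \<epsilon> of p.\<close>
  define h where "h = min (d / 2) (\<epsilon>\<^sup>2 / (4 * d))"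
  have h: "0 < h" "h \<le> d / 2" "h \<le> \<epsilon>\<^sup>2 / (4 * d)" using d \<epsilon> by (auto simp: h_def)
  \<comment> \<open>The bump is centred halfway between x0 and p. A ball of half the radius touches
    the sphere at p only, so that after a slight enlargement it leaves the tangent ball near p
    alone.\<close>
  define e where "e = (1 / 2) *\<^sub>R (x0 - p)"
  have ee2: "x0 - p = e + e" unfolding e_def by (simp flip: scaleR_add_left)
  define k where "k = p + e"
  define R where "R = d / 2 + h"
  have R: "0 < R" "R \<le> d" using d h by (auto simp: R_def)
  have kx: "norm (x0 - k) = d / 2" "norm (p - k) = d / 2"
  proof -
    have ne: "norm e = d / 2" using d by (simp add: e_def)
    have "x0 - k = (x0 - p) - e" by (simp add: k_def)
    also have "\<dots> = e" unfolding ee2 by simp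
    finally show "norm (x0 - k) = d / 2" using ne by simp
    have "p - k = - e" by (simp add: k_def)
    then show "norm (p - k) = d / 2" using ne by simp
  qed
  have sub: "cball k R \<subseteq> W"
  proof
    fix y assume "y \<in> cball k R"
    then have "norm (y - k) \<le> d" using R by (simp add: dist_norm norm_minus_commute)
    moreover have "norm (y - x0) \<le> norm (y - k) + norm (x0 - k)" using norm_triangle_ineq4[of "y - k" "x0 - k"] by simp
    ultimately show "y \<in> W" using kx d by (intro subsetD[OF d(3)]) (simp add: dist_norm norm_minus_commute)
  qed
  let ?\<psi> = "bump k R 1"
  have tf: "test_function W ?\<psi>" using R sub by (intro test_function_bump) auto
  let ?f = "\<lambda>x. q (u x) \<bullet> grad ?\<psi> x"
  have sign: "?f x < 0" if x: "x \<in> E" "x \<in> ball k R" for x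
  proof -
    have xW: "x \<in> W" "u x \<in> T" using x by (auto simp: E_def)
    have xd: "d \<le> norm (x - x0)" using disj x(1) by (force simp: dist_norm norm_minus_commute not_less)
    have xk: "norm (x - k) < R" using x(2) by (simp add: dist_norm norm_minus_commute)
    \<comment> \<open>Together with the next identity this is the parallelogram law around k: the
      squared distances to x0 and p add up to a constant plus twice the squared distance to k. Far
      from x0 and close to k therefore means close to p.\<close>
    have e1: "(x - x0) \<bullet> (x - x0) = (x - k) \<bullet> (x - k) - 2 * ((x - k) \<bullet> e) + e \<bullet> e"
    proof -
      have "x - x0 = (x - p) - (x0 - p)" by simp
      also have "\<dots> = (x - k) - e" unfolding ee2 k_def by simp
      finally have s: "x - x0 = (x - k) - e" .
      have *: "(y - z) \<bullet> (y - z) = y \<bullet> y - 2 * (y \<bullet> z) + z \<bullet> z" for y z :: 'a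
        by (simp add: inner_diff_left inner_diff_right inner_commute)
      show ?thesis unfolding s by (rule *)
    qed
    have e2: "(x - p) \<bullet> (x - p) = (x - k) \<bullet> (x - k) + 2 * ((x - k) \<bullet> e) + e \<bullet> e"
    proof -
      have "x - p = (x - k) + e" unfolding k_def by simp
      moreover have "(y + z) \<bullet> (y + z) = y \<bullet> y + 2 * (y \<bullet> z) + z \<bullet> z" for y z :: 'a
        by (simp add: inner_add_left inner_add_right inner_commute)
      ultimately show ?thesis by (simp only:)
    qed
    have ee: "e \<bullet> e = d\<^sup>2 / 4"
      using d(2) unfolding e_def by (simp add: dot_square_norm power2_eq_square)
    have "d\<^sup>2 \<le> (x - x0) \<bullet> (x - x0)" unfolding dot_square_norm using xd d by (intro power_mono) auto
    moreover have kk: "(x - k) \<bullet> (x - k) \<le> R\<^sup>2" unfolding dot_square_norm using xk by (intro power_mono) auto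
    ultimately have "(x - p) \<bullet> (x - p) \<le> 2 * R\<^sup>2 - d\<^sup>2 / 2"
      using e1 e2 ee by linarith
    also have "\<dots> = 2 * d * h + 2 * h * h" unfolding R_def by (simp add: power2_eq_square algebra_simps)
    also have "\<dots> \<le> 2 * d * h + 2 * h * (d / 2)" using h by (intro add_left_mono mult_left_mono) auto
    also have "\<dots> = 3 * d * h" by simp
    also have "\<dots> \<le> 3 * d * (\<epsilon>\<^sup>2 / (4 * d))" using h d by (intro mult_left_mono) auto
    also have "\<dots> \<le> \<epsilon>\<^sup>2" using d by simp
    finally have "(norm (x - p))\<^sup>2 \<le> \<epsilon>\<^sup>2" by (simp add: dot_square_norm)
    then have xp: "norm (x - p) \<le> \<epsilon>" using \<epsilon> by (simp add: power2_le_iff_abs_le)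
    let ?t = "\<bar>u x - v\<bar>"
    have t: "0 < ?t" using vT xW(2) by auto
    have "?t < \<delta>1" using \<delta>2(2)[OF xW(1)] xp \<epsilon>2 by (simp add: dist_norm)
    then have qx: "norm (q (u x) - ?t *\<^sub>R b) \<le> \<beta> / (4 * d) * ?t" using \<delta>1(2)[OF xW(2)] by blast
    have "q (u x) \<bullet> (k - x) = ?t * (b \<bullet> (k - x)) + (q (u x) - ?t *\<^sub>R b) \<bullet> (k - x)"
      by (simp add: inner_diff_left)
    also have "b \<bullet> (k - x) = - \<beta> + b \<bullet> (p - x)"
    proof -
      have "b \<bullet> e = - \<beta>" by (simp add: e_def \<beta>_def)
      then show ?thesis by (simp add: k_def inner_add_right inner_diff_right)
    qed
    also have "(q (u x) - ?t *\<^sub>R b) \<bullet> (k - x) \<le> \<beta> / 4 * ?t"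
    proof -
      have "(q (u x) - ?t *\<^sub>R b) \<bullet> (k - x) \<le> norm (q (u x) - ?t *\<^sub>R b) * norm (k - x)" by (rule norm_cauchy_schwarz)
      also have "\<dots> \<le> (\<beta> / (4 * d) * ?t) * d"
        using qx xk R \<beta> d by (intro mult_mono) (auto simp: norm_minus_commute)
      also have "\<dots> = \<beta> / 4 * ?t" using d by simp
      finally show ?thesis .
    qed
    also have "?t * (- \<beta> + b \<bullet> (p - x)) \<le> ?t * (- \<beta> + \<beta> / 2)"
    proof (intro mult_left_mono add_left_mono)
      have "b \<bullet> (p - x) \<le> norm b * norm (p - x)" by (rule norm_cauchy_schwarz)
      also have "\<dots> \<le> norm b * \<epsilon>" using xp by (intro mult_left_mono) (auto simp: norm_minus_commute)
      finally show "b \<bullet> (p - x) \<le> \<beta> / 2" using \<epsilon>b by linarith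
    qed simp
    finally have "q (u x) \<bullet> (k - x) \<le> - (\<beta> / 4) * ?t" by (simp add: algebra_simps)
    moreover have "- (\<beta> / 4) * ?t < 0" using \<beta> t by (simp add: mult_neg_pos)
    ultimately have neg: "q (u x) \<bullet> (k - x) < 0" by linarith
    have "0 < hh 2 ((R\<^sup>2 - (norm (x - k))\<^sup>2) / 1)" using xk by (intro hh_pos) (simp add: power_strict_mono)
    then have "2 * hh 2 ((R\<^sup>2 - (norm (x - k))\<^sup>2) / 1) * (q (u x) \<bullet> (k - x)) < 0" using neg by (simp add: mult_pos_neg)
    moreover have "?f x = 2 * hh 2 ((R\<^sup>2 - (norm (x - k))\<^sup>2) / 1) * (q (u x) \<bullet> (k - x))"
      unfolding grad_bump by (simp add: inner_diff_right algebra_simps)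
    ultimately show ?thesis by simp
  qed
  have zero: "?f x = 0" if "x \<notin> E \<or> x \<notin> ball k R" for x
  proof (cases "x \<in> ball k R")
    case True
    then have "x \<in> W" using sub by auto
    then have "u x \<notin> T" using that True by (simp add: E_def)
    then show ?thesis using q(2) by simp
  next
    case False
    then have "R \<le> norm (x - k)" by (simp add: dist_norm norm_minus_commute)
    then show ?thesis using grad_bump_eq_0[of 1 R x k] R by simp
  qed
  have le: "?f x \<le> 0" for x using sign[of x] zero[of x] by force
  have [measurable]: "q \<in> borel_measurable borel" by (rule borel_measurable_continuous_onI[OF q(1)])
  have [measurable]: "grad ?\<psi> \<in> borel_measurable borel" by (rule borel_measurable_grad[OF smooth_bump])
  have cf: "compact (?f ` cball k R)"
    using sub q(1) by (intro compact_continuous_image continuous_intros smooth_continuous_grad smooth_bump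
       continuous_on_compose2[OF q(1) continuous_on_subset[OF u]]) auto
  obtain B where Bi: "\<forall>z\<in>?f ` cball k R. norm z \<le> B"
    using compact_imp_bounded[OF cf] unfolding bounded_iff by blast
  have B: "norm (?f x) \<le> \<bar>B\<bar>" for x
  proof (cases "x \<in> ball k R")
    case True
    then have "norm (?f x) \<le> B" using Bi by auto
    then show ?thesis by linarith
  next
    case False
    then show ?thesis using zero[of x] by simp
  qed
  have I: "integrable lborel ?f"
    by (rule integrable_bounded_support[where B="\<bar>B\<bar>" and c=k and r=R]) (use B zero in auto)
  have "0 \<le> (LINT x|lborel. ?f x)" by (rule ent[OF tf bump_nonneg])
  then have "(LINT x|lborel. - ?f x) \<le> 0" by simp
  moreover have "0 \<le> (LINT x|lborel. - ?f x)" using le by (intro Bochner_Integration.integral_nonneg) simp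
  ultimately have "(LINT x|lborel. - ?f x) = 0" by simp
  then have "AE x in lborel. - ?f x = 0"
    using I le by (subst (asm) integral_nonneg_eq_0_iff_AE) auto
  then have "AE x in lborel. x \<in> E \<inter> ball k R \<longrightarrow> False"
    by eventually_elim (use sign in force)
  moreover have "p \<in> ball k R" using kx h by (simp add: R_def dist_norm norm_minus_commute)
  then have "E \<inter> ball k R \<noteq> {}"
    using p open_Int_closure_eq_empty[of "ball k R" E] by (auto simp: Int_commute)
  ultimately show False using AE_open_contradiction oE by blast
qed

lemma closure_preimage:
  fixes u :: "'a::euclidean_space \<Rightarrow> real"
  assumes W: "open W" and u: "continuous_on W u" and z: "z \<in> W" "z \<in> closure {x\<in>W. u x \<in> T}"
  shows "u z \<in> closure T"
proof (rule ccontr)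
  assume n: "u z \<notin> closure T"
  let ?O = "W \<inter> u -` (- closure T)"
  have "open ?O" by (rule continuous_open_preimage[OF u W]) auto
  moreover have "z \<in> ?O" using n z by simp
  moreover have "?O \<inter> {x\<in>W. u x \<in> T} = {}" using closure_subset[of T] by auto
  ultimately show False using z(2) open_Int_closure_eq_empty[of ?O "{x\<in>W. u x \<in> T}"] by blast
qed

text \<open>The squared distance of the moving point to the set is followed. At a nearest point
  \<open>proximal_normal\<close> gives the cross term the right sign, so a step h adds at most h^2
  |b|^2. With n steps of length t / n this totals t^2 |b|^2 / n, which tends to 0.\<close>

lemma flow_invariance:
  fixes u :: "'a::euclidean_space \<Rightarrow> real" and q :: "real \<Rightarrow> 'a" and b :: 'a
  assumes W: "open W" and um: "u \<in> borel_measurable borel" and u: "continuous_on W u"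
    and T: "open T" "closure T \<subseteq> insert v T"
    and q: "continuous_on UNIV q" "\<And>s. s \<notin> T \<Longrightarrow> q s = 0"
    and qd: "\<And>\<eta>. 0 < \<eta> \<Longrightarrow> \<exists>\<delta>>0. \<forall>s\<in>T. \<bar>s - v\<bar> < \<delta> \<longrightarrow> norm (q s - \<bar>s - v\<bar> *\<^sub>R b) \<le> \<eta> * \<bar>s - v\<bar>"
    and vT: "v \<notin> T"
    and ent: "\<And>\<psi>. test_function W \<psi> \<Longrightarrow> (\<And>x. 0 \<le> \<psi> x) \<Longrightarrow> 0 \<le> (LINT x|lborel. q (u x) \<bullet> grad \<psi> x)"
    and E_def: "E = {x\<in>W. u x \<in> T}"
    and x: "x \<in> E" and r: "0 < r" "cball x r \<subseteq> W" and t: "0 \<le> t" "4 * (t * norm b) \<le> r"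
  shows "x - t *\<^sub>R b \<in> closure E"
proof -
  \<comment> \<open>The intersection with the ball makes the argument local. As the distance d is at
    most s |b| and 4 s |b| \<le> r, the ball of radius 2 d around the moving point stays in
    \<open>cball x r\<close>, and a nearest point of K is nearest in the closure of E as
    well.\<close>
  define K where "K = closure E \<inter> cball x r"
  have K: "closed K" "x \<in> K" using x r closure_subset[of E] by (auto simp: K_def)
  define f where "f t = infdist (x - t *\<^sub>R b) K" for t
  have step: "(f (s + h))\<^sup>2 \<le> (f s)\<^sup>2 + h\<^sup>2 * (norm b)\<^sup>2" if s: "0 \<le> s" "4 * (s * norm b) \<le> r" and h: "0 \<le> h" for s h
  proof -
    let ?y = "x - s *\<^sub>R b"
    obtain p where p: "p \<in> K" "f s = dist ?y p"
      using infdist_attains_inf[OF K(1)] K(2) unfolding f_def by (metis empty_iff)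
    define d where "d = f s"
    have d0: "0 \<le> d" by (simp add: d_def f_def infdist_nonneg)
    have yx: "dist ?y x = s * norm b" using s by (simp add: dist_norm)
    have dle: "d \<le> s * norm b" unfolding d_def f_def using infdist_le[OF K(2), of ?y] yx by linarith
    have sb: "0 \<le> s * norm b" using s by simp
    have inn: "0 \<le> b \<bullet> (?y - p)"
    proof (cases "d = 0")
      case True
      then show ?thesis using p by (simp add: d_def)
    next
      case False
      show ?thesis
      proof (rule proximal_normal[OF W um u T q qd vT ent E_def])
        show "p \<in> closure E" using p by (simp add: K_def)
        show "0 < d" using False d0 by simp
        show "norm (?y - p) = d" using p by (simp add: d_def dist_norm)
        show "cball ?y (2 * d) \<subseteq> W"
        proof
          fix z assume "z \<in> cball ?y (2 * d)"
          then have "dist ?y z \<le> 2 * d" by simp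
          then have "dist x z \<le> r" using dist_triangle[of x z ?y] dist_commute[of x ?y] yx dle s(2) sb by linarith
          then show "z \<in> W" using r by auto
        qed
        show "ball ?y d \<inter> E = {}"
        proof (rule ccontr)
          assume "ball ?y d \<inter> E \<noteq> {}"
          then obtain z where z: "dist ?y z < d" "z \<in> E" by auto
          then have "dist x z \<le> r" using dist_triangle[of x z ?y] dist_commute[of x ?y] yx dle s(2) sb by linarith
          then have "z \<in> K" using z closure_subset[of E] by (auto simp: K_def)
          then show False using infdist_le[of z K ?y] z by (simp add: d_def f_def)
        qed
      qed
    qed
    have "f (s + h) \<le> dist (x - (s + h) *\<^sub>R b) p" unfolding f_def by (rule infdist_le[OF p(1)])
    also have "\<dots> = norm ((?y - p) - h *\<^sub>R b)" by (simp add: dist_norm algebra_simps)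
    finally have "(f (s + h))\<^sup>2 \<le> (norm ((?y - p) - h *\<^sub>R b))\<^sup>2"
      by (intro power_mono) (auto simp: f_def infdist_nonneg)
    also have "\<dots> = (norm (?y - p))\<^sup>2 - 2 * h * (b \<bullet> (?y - p)) + h\<^sup>2 * (norm b)\<^sup>2"
      unfolding power2_norm_eq_inner
      by (simp add: inner_diff_left inner_diff_right inner_commute algebra_simps power2_eq_square)
    also have "\<dots> \<le> (norm (?y - p))\<^sup>2 + h\<^sup>2 * (norm b)\<^sup>2" using inn h by simp
    finally show ?thesis using p by (simp add: dist_norm)
  qed
  have bound: "(f t)\<^sup>2 \<le> t\<^sup>2 * (norm b)\<^sup>2 * inverse (real (Suc n))" for n
  proof -
    define h where "h = t / real (Suc n)"
    have h: "0 \<le> h" using t by (simp add: h_def)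
    have "m \<le> Suc n \<Longrightarrow> (f (real m * h))\<^sup>2 \<le> real m * (h\<^sup>2 * (norm b)\<^sup>2)" for m
    proof (induction m)
      case 0
      then show ?case using K by (simp add: f_def)
    next
      case (Suc m)
      have "real m * h \<le> real (Suc n) * h" using Suc.prems h by (intro mult_right_mono) auto
      also have "\<dots> = t" by (simp add: h_def)
      finally have "real m * h * norm b \<le> t * norm b" by (intro mult_right_mono) auto
      then have "(f (real m * h + h))\<^sup>2 \<le> (f (real m * h))\<^sup>2 + h\<^sup>2 * (norm b)\<^sup>2"
        using t h by (intro step) auto
      then show ?case using Suc by (simp add: algebra_simps)
    qed
    from this[of "Suc n"] have "(f t)\<^sup>2 \<le> real (Suc n) * (h\<^sup>2 * (norm b)\<^sup>2)" by (simp add: h_def)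
    also have "\<dots> = t\<^sup>2 * (norm b)\<^sup>2 * inverse (real (Suc n))"
    proof -
      have *: "k * ((t / k)\<^sup>2 * B) = t\<^sup>2 * B * inverse k" if "k \<noteq> 0" for k B :: real
        using that by (simp add: power2_eq_square field_simps)
      show ?thesis unfolding h_def by (rule *) simp
    qed
    finally show ?thesis .
  qed
  have "(\<lambda>n. t\<^sup>2 * (norm b)\<^sup>2 * inverse (real (Suc n))) \<longlonglongrightarrow> t\<^sup>2 * (norm b)\<^sup>2 * 0"
    by (intro tendsto_intros LIMSEQ_inverse_real_of_nat)
  then have "(f t)\<^sup>2 \<le> t\<^sup>2 * (norm b)\<^sup>2 * 0" by (rule LIMSEQ_le_const) (use bound in auto)
  then have "f t = 0" by simp
  then have "x - t *\<^sub>R b \<in> K"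
    using K in_closed_iff_infdist_zero[of K "x - t *\<^sub>R b"] by (auto simp: f_def)
  then show ?thesis by (simp add: K_def)
qed

lemma AE_translate:
  fixes c :: "'a::euclidean_space"
  assumes N: "N \<in> sets borel" "emeasure lborel N = 0"
  shows "AE y in lborel. y - c \<notin> N"
proof -
  have [measurable]: "N \<in> sets borel" by (rule N)
  have "emeasure lborel {y. y - c \<in> N} = (\<integral>\<^sup>+y. indicator {y. y - c \<in> N} y \<partial>lborel)" by simp
  also have "\<dots> = (\<integral>\<^sup>+y. indicator N (y - c) \<partial>lborel)"
    by (intro nn_integral_cong) (simp add: indicator_def)
  also have "\<dots> = (\<integral>\<^sup>+y. indicator N y \<partial>lborel)"
    using nn_integral_plus[of "indicator N" "- c"] by simp
  also have "\<dots> = 0" using N by simp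
  finally show ?thesis
    by (subst AE_iff_measurable[of "{y. y - c \<in> N}"]) auto
qed

text \<open>Translation by - t b preserves each of {u > v} and {u < v} up to closure. As {u = v} is
  a null set, both together say that the indicator of {u > v} takes the same value at y and at y - t
  b for almost every y. Moving the translation onto \<phi> and letting t tend to 0 in the difference
  quotient gives the transport equation.\<close>

lemma level_invariant:
  fixes u :: "'a::euclidean_space \<Rightarrow> real" and A a :: "real \<Rightarrow> 'a"
  assumes W: "open W" and um [measurable]: "u \<in> borel_measurable borel" and u: "continuous_on W u"
    and A: "\<And>v. (A has_vector_derivative a v) (at v)"
    and up: "\<And>v \<psi>. test_function W \<psi> \<Longrightarrow> (\<And>x. 0 \<le> \<psi> x) \<Longrightarrow> 0 \<le> (LINT x|lborel. (if v < u x then A (u x) - A v else 0) \<bullet> grad \<psi> x)"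
    and lo: "\<And>v \<psi>. test_function W \<psi> \<Longrightarrow> (\<And>x. 0 \<le> \<psi> x) \<Longrightarrow> 0 \<le> (LINT x|lborel. (if u x < v then A v - A (u x) else 0) \<bullet> grad \<psi> x)"
    and null: "emeasure lborel {y\<in>W. u y = v} = 0" and \<phi>: "test_function W \<phi>"
  shows "(LINT y|lborel. indicator {y\<in>W. v < u y} y * (a v \<bullet> grad \<phi> y)) = 0"
proof -
  have [measurable]: "W \<in> sets borel" using W by simp
  let ?K = "closure {x. \<phi> x \<noteq> 0}" and ?E = "{y\<in>W. v < u y}" and ?b = "a v"
  have sm: "smooth \<phi>" and K: "compact ?K" "?K \<subseteq> W" using \<phi> by (auto simp: test_function_def)
  have [measurable]: "\<phi> \<in> borel_measurable borel" "grad \<phi> \<in> borel_measurable borel"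
    by (auto intro: borel_measurable_smooth borel_measurable_grad sm)
  obtain \<rho> B where \<rho>: "0 < \<rho>" and B0: "0 \<le> B" and out: "\<And>y. y \<notin> ball 0 \<rho> \<Longrightarrow> \<phi> y = 0" "\<And>y. y \<notin> ball 0 \<rho> \<Longrightarrow> grad \<phi> y = 0"
    and B: "\<And>y. \<bar>\<phi> y\<bar> \<le> B" "\<And>y. norm (grad \<phi> y) \<le> B"
    by (rule test_function_bounds[OF \<phi>]) (rule that; assumption)
  obtain r where r: "0 < r" "(\<Union>x\<in>?K. cball x r) \<subseteq> W"
    using compact_subset_open_imp_cball_epsilon_subset[OF K(1) W K(2)] by blast
  have Ac: "continuous_on UNIV A"
    using A by (intro continuous_at_imp_continuous_on ballI) (blast intro: has_vector_derivative_continuous)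
  have Ad: "\<exists>\<delta>>0. \<forall>s. \<bar>s - v\<bar> < \<delta> \<longrightarrow> norm (A s - A v - (s - v) *\<^sub>R ?b) \<le> \<eta> * \<bar>s - v\<bar>" if "0 < \<eta>" for \<eta>
    using A[of v, unfolded has_vector_derivative_def has_derivative_at_alt] that by (auto simp: real_norm_def)
  have qU: "continuous_on UNIV (\<lambda>s. if v < s then A s - A v else 0)"
  proof -
    have *: "(\<lambda>s. if v < s then A s - A v else 0) = (\<lambda>s. A (max s v) - A v)" by (auto simp: max_def)
    show ?thesis unfolding * by (intro continuous_intros continuous_on_compose2[OF Ac]) auto
  qed
  have qL: "continuous_on UNIV (\<lambda>s. if s < v then A v - A s else 0)"
  proof -
    have *: "(\<lambda>s. if s < v then A v - A s else 0) = (\<lambda>s. A v - A (min s v))" by (auto simp: min_def)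
    show ?thesis unfolding * by (intro continuous_intros continuous_on_compose2[OF Ac]) auto
  qed
  have dU: "\<exists>\<delta>>0. \<forall>s\<in>{v<..}. \<bar>s - v\<bar> < \<delta> \<longrightarrow> norm ((if v < s then A s - A v else 0) - \<bar>s - v\<bar> *\<^sub>R ?b) \<le> \<eta> * \<bar>s - v\<bar>"
    if \<eta>: "0 < \<eta>" for \<eta>
  proof -
    obtain \<delta> where \<delta>: "0 < \<delta>" "\<And>s. \<bar>s - v\<bar> < \<delta> \<Longrightarrow> norm (A s - A v - (s - v) *\<^sub>R ?b) \<le> \<eta> * \<bar>s - v\<bar>"
      using Ad[OF \<eta>] by blast
    have "norm ((if v < s then A s - A v else 0) - \<bar>s - v\<bar> *\<^sub>R ?b) \<le> \<eta> * \<bar>s - v\<bar>" if s: "v < s" "\<bar>s - v\<bar> < \<delta>" for s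
      using \<delta>(2)[OF s(2)] s(1) by simp
    then show ?thesis using \<delta>(1) by blast
  qed
  have dL: "\<exists>\<delta>>0. \<forall>s\<in>{..<v}. \<bar>s - v\<bar> < \<delta> \<longrightarrow> norm ((if s < v then A v - A s else 0) - \<bar>s - v\<bar> *\<^sub>R ?b) \<le> \<eta> * \<bar>s - v\<bar>"
    if \<eta>: "0 < \<eta>" for \<eta>
  proof -
    obtain \<delta> where \<delta>: "0 < \<delta>" "\<And>s. \<bar>s - v\<bar> < \<delta> \<Longrightarrow> norm (A s - A v - (s - v) *\<^sub>R ?b) \<le> \<eta> * \<bar>s - v\<bar>"
      using Ad[OF \<eta>] by blast
    have "norm ((if s < v then A v - A s else 0) - \<bar>s - v\<bar> *\<^sub>R ?b) \<le> \<eta> * \<bar>s - v\<bar>" if s: "s < v" "\<bar>s - v\<bar> < \<delta>" for s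
    proof -
      have "(if s < v then A v - A s else 0) - \<bar>s - v\<bar> *\<^sub>R ?b = - (A s - A v - (s - v) *\<^sub>R ?b)"
        using s by (simp add: algebra_simps)
      then show ?thesis using \<delta>(2)[OF s(2)] by (simp only: norm_minus_cancel)
    qed
    then show ?thesis using \<delta>(1) by blast
  qed
  define t0 where "t0 = r / (4 * (norm ?b + 1))"
  have nb: "0 < norm ?b + 1" by (simp add: add_nonneg_pos)
  have t0: "0 < t0" "4 * (t0 * norm ?b) \<le> r"
  proof -
    show "0 < t0" using r nb by (simp add: t0_def)
    have X: "0 < 4 * (norm ?b + 1)" using nb by simp
    have "t0 * (4 * (norm ?b + 1)) = r" using t0_def X by (metis less_irrefl nonzero_eq_divide_eq)
    then show "4 * (t0 * norm ?b) \<le> r" using \<open>0 < t0\<close> by (simp add: algebra_simps)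
  qed
  have inv: "AE y in lborel. y \<in> ?K \<longrightarrow> (indicator ?E (y - t *\<^sub>R ?b) :: real) = indicator ?E y"
    if t: "0 \<le> t" "t \<le> t0" for t
  proof -
    have tb: "4 * (t * norm ?b) \<le> r" using mult_right_mono[OF t(2), of "norm ?b"] t0(2) by simp
    have Nm: "{y\<in>W. u y = v} \<in> sets borel" by measurable
    have N1: "AE y in lborel. y - t *\<^sub>R ?b \<notin> {y\<in>W. u y = v}" and N2: "AE y in lborel. y - 0 \<notin> {y\<in>W. u y = v}"
      using AE_translate[OF Nm null] by blast+
    show ?thesis
      using N1 N2
    proof eventually_elim
      case (elim y)
      show ?case
      proof
        assume y: "y \<in> ?K"
        then have yW: "y \<in> W" and cb: "cball y r \<subseteq> W" using K r by auto
        have "norm (t *\<^sub>R ?b) \<le> r" using tb t r by simp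
        then have zW: "y - t *\<^sub>R ?b \<in> W" using cb by (auto simp: dist_norm)
        have uz: "u (y - t *\<^sub>R ?b) \<noteq> v" and uy: "u y \<noteq> v" using elim zW yW by auto
        show "(indicator ?E (y - t *\<^sub>R ?b) :: real) = indicator ?E y"
        proof (cases "v < u y")
          case True
          have "y - t *\<^sub>R ?b \<in> closure {x\<in>W. u x \<in> {v<..}}"
            by (rule flow_invariance[OF W um u _ _ qU _ dU _ up refl _ r(1) cb t(1) tb]) (use True yW in auto)
          then have "u (y - t *\<^sub>R ?b) \<in> closure {v<..}" by (rule closure_preimage[OF W u zW])
          then show ?thesis using uz True yW zW by (auto simp: indicator_def)
        next
          case False
          have "y - t *\<^sub>R ?b \<in> closure {x\<in>W. u x \<in> {..<v}}"
            by (rule flow_invariance[OF W um u _ _ qL _ dL _ lo refl _ r(1) cb t(1) tb]) (use False uy yW in auto)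
          then have "u (y - t *\<^sub>R ?b) \<in> closure {..<v}" by (rule closure_preimage[OF W u zW])
          then show ?thesis using False by (auto simp: indicator_def)
        qed
      qed
    qed
  qed
  have Em [measurable]: "?E \<in> sets borel" by measurable
  have I\<phi>: "integrable lborel \<phi>" by (rule integrable_bounded_support[where B=B and c=0 and r=\<rho>]) (use B out in auto)
  have diff0: "(LINT y|lborel. indicator ?E y * (\<phi> (y + t *\<^sub>R ?b) - \<phi> y)) = 0" if t: "0 \<le> t" "t \<le> t0" for t
  proof -
    have I1: "integrable lborel (\<lambda>y. indicator ?E y * \<phi> y)" and I2: "integrable lborel (\<lambda>y. indicator ?E (y - t *\<^sub>R ?b) * \<phi> y)"
      by (rule Bochner_Integration.integrable_bound[OF I\<phi>]; auto simp: indicator_def)+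
    have "integrable lborel (\<lambda>y. indicator ?E ((t *\<^sub>R ?b + 1 *\<^sub>R y) - t *\<^sub>R ?b) * \<phi> (t *\<^sub>R ?b + 1 *\<^sub>R y))"
      by (rule integrable_affine[OF I2]) simp
    then have I3: "integrable lborel (\<lambda>y. indicator ?E y * \<phi> (y + t *\<^sub>R ?b))" by (simp add: add.commute)
    have "(LINT y|lborel. indicator ?E y * (\<phi> (y + t *\<^sub>R ?b) - \<phi> y))
        = (LINT y|lborel. indicator ?E y * \<phi> (y + t *\<^sub>R ?b)) - (LINT y|lborel. indicator ?E y * \<phi> y)"
      using I1 I3 by (simp add: right_diff_distrib)
    also have "(LINT y|lborel. indicator ?E y * \<phi> (y + t *\<^sub>R ?b)) = (LINT y|lborel. indicator ?E (y - t *\<^sub>R ?b) * \<phi> y)"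
      using integral_affine[of "\<lambda>y. indicator ?E (y - t *\<^sub>R ?b) * \<phi> y" 1 "t *\<^sub>R ?b"] by (simp add: add.commute)
    also have "\<dots> = (LINT y|lborel. indicator ?E y * \<phi> y)"
    proof (rule integral_cong_AE)
      show "AE y in lborel. indicator ?E (y - t *\<^sub>R ?b) * \<phi> y = indicator ?E y * \<phi> y"
        using inv[OF t]
      proof eventually_elim
        case (elim y)
        then show ?case using closure_subset[of "{x. \<phi> x \<noteq> 0}"] by (cases "\<phi> y = 0") auto
      qed
    qed measurable
    finally show ?thesis by simp
  qed
  define t where "t n = t0 * inverse (real (Suc n))" for n
  have t: "0 < t n" "t n \<le> t0" for n
    using t0 by (auto simp: t_def field_simps)
  have tlim: "t \<longlonglongrightarrow> 0"
    using tendsto_mult_right_zero[OF LIMSEQ_inverse_real_of_nat, of t0] by (simp add: t_def[abs_def])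
  have lip: "\<bar>\<phi> x - \<phi> y\<bar> \<le> B * norm (x - y)" for x y
  proof -
    have "norm (\<phi> x - \<phi> y) \<le> B * norm (x - y)"
    proof (rule differentiable_bound[of UNIV])
      show "(\<phi> has_derivative (\<lambda>h. grad \<phi> z \<bullet> h)) (at z within UNIV)" for z using has_derivative_grad[OF sm] by simp
      show "onorm (\<lambda>h. grad \<phi> z \<bullet> h) \<le> B" for z
        using B0 order_trans[OF Cauchy_Schwarz_ineq2 mult_right_mono[OF B(2)[of z] norm_ge_zero]]
        by (intro onorm_bound) auto
    qed auto
    then show ?thesis by simp
  qed
  let ?s = "\<lambda>n y. indicator ?E y * ((\<phi> (y + t n *\<^sub>R ?b) - \<phi> y) / t n)"
  have L: "(\<lambda>n. LINT y|lborel. ?s n y) \<longlonglongrightarrow> (LINT y|lborel. indicator ?E y * (?b \<bullet> grad \<phi> y))"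
  proof (rule integral_dominated_convergence[where w="\<lambda>y. (B * norm ?b) * indicator (ball 0 (\<rho> + t0 * norm ?b)) y"])
    show "integrable lborel (\<lambda>y::'a. (B * norm ?b) * indicator (ball 0 (\<rho> + t0 * norm ?b)) y)"
      using emeasure_lborel_ball_finite by (intro integrable_mult_right integrable_real_indicator) auto
    show "AE y in lborel. (\<lambda>n. ?s n y) \<longlonglongrightarrow> indicator ?E y * (?b \<bullet> grad \<phi> y)"
    proof (intro AE_I2 tendsto_mult tendsto_const)
      fix y
      have d: "((\<lambda>\<tau>. y + \<tau> *\<^sub>R ?b) has_derivative (\<lambda>h. h *\<^sub>R ?b)) (at 0)"
        by (auto intro!: derivative_eq_intros)
      have "((\<lambda>\<tau>. \<phi> (y + \<tau> *\<^sub>R ?b)) has_derivative (\<lambda>h. grad \<phi> y \<bullet> (h *\<^sub>R ?b))) (at 0)"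
        using diff_chain_at[OF d, of \<phi> "\<lambda>h. grad \<phi> y \<bullet> h"] has_derivative_grad[OF sm, of y]
        by (simp add: o_def)
      moreover have "(\<lambda>h. grad \<phi> y \<bullet> (h *\<^sub>R ?b)) = (*) (?b \<bullet> grad \<phi> y)"
        by (auto simp: fun_eq_iff inner_commute)
      ultimately have "((\<lambda>\<tau>. \<phi> (y + \<tau> *\<^sub>R ?b)) has_real_derivative ?b \<bullet> grad \<phi> y) (at 0)"
        by (simp only: has_field_derivative_def)
      then have "((\<lambda>h. (\<phi> (y + h *\<^sub>R ?b) - \<phi> y) / h) \<longlongrightarrow> ?b \<bullet> grad \<phi> y) (at 0)"
        by (simp add: DERIV_def)
      moreover have "filterlim t (at 0) sequentially"
        using tlim t(1) by (auto simp: filterlim_at less_imp_neq[symmetric] intro!: always_eventually)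
      ultimately show "(\<lambda>n. (\<phi> (y + t n *\<^sub>R ?b) - \<phi> y) / t n) \<longlonglongrightarrow> ?b \<bullet> grad \<phi> y"
        by (rule filterlim_compose)
    qed
    show "AE y in lborel. norm (?s n y) \<le> (B * norm ?b) * indicator (ball 0 (\<rho> + t0 * norm ?b)) y" for n
    proof (intro AE_I2)
      fix y
      have tb: "norm (t n *\<^sub>R ?b) \<le> t0 * norm ?b" using t[of n] by (simp add: mult_right_mono)
      show "norm (?s n y) \<le> (B * norm ?b) * indicator (ball 0 (\<rho> + t0 * norm ?b)) y"
      proof (cases "y \<in> ball 0 (\<rho> + t0 * norm ?b)")
        case True
        have "\<bar>\<phi> (y + t n *\<^sub>R ?b) - \<phi> y\<bar> \<le> B * (t n * norm ?b)"
          using lip[of "y + t n *\<^sub>R ?b" y] t(1)[of n] by simp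
        then have "\<bar>(\<phi> (y + t n *\<^sub>R ?b) - \<phi> y) / t n\<bar> \<le> B * norm ?b"
          using t(1)[of n] by (simp add: pos_divide_le_eq mult_ac)
        then show ?thesis using True B0 by (simp add: abs_mult indicator_def)
      next
        case False
        have "norm y \<le> norm (y + t n *\<^sub>R ?b) + norm (t n *\<^sub>R ?b)"
          using norm_triangle_ineq4[of "y + t n *\<^sub>R ?b" "t n *\<^sub>R ?b"] by simp
        then have "y + t n *\<^sub>R ?b \<notin> ball 0 \<rho>" using False tb by simp
        moreover have "0 \<le> t0 * norm ?b" using t0 by simp
        then have "y \<notin> ball 0 \<rho>" using False by simp
        ultimately show ?thesis using out(1) False by simp
      qed
    qed
  qed measurable
  have Z: "(LINT y|lborel. ?s n y) = 0" for n
  proof -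
    have "(LINT y|lborel. ?s n y) = (LINT y|lborel. (indicator ?E y * (\<phi> (y + t n *\<^sub>R ?b) - \<phi> y)) / t n)"
      by simp
    also have "\<dots> = 0" using diff0[of "t n"] t[of n] by (simp add: less_imp_le del: times_divide_eq_right)
    finally show ?thesis .
  qed
  have "(\<lambda>n::nat. 0) \<longlonglongrightarrow> (LINT y|lborel. indicator ?E y * (?b \<bullet> grad \<phi> y))"
    using L unfolding Z .
  then show ?thesis using LIMSEQ_unique tendsto_const by blast
qed

section \<open>From level sets to the flux and the measure\<close>

text \<open>By Fubini, since for each y only the single level v = u y contributes.\<close>

lemma null_levels:
  fixes u :: "'a::euclidean_space \<Rightarrow> real"
  assumes [measurable]: "u \<in> borel_measurable borel" "W \<in> sets borel"
  shows "AE v in lborel. emeasure lborel {y\<in>W. u y = v} = 0"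
proof -
  let ?f = "\<lambda>y v. indicator {y\<in>W. u y = v} y :: ennreal"
  have "(\<integral>\<^sup>+v. \<integral>\<^sup>+y. ?f y v \<partial>lborel \<partial>lborel) = (\<integral>\<^sup>+y. \<integral>\<^sup>+v. ?f y v \<partial>lborel \<partial>lborel)"
    by (rule lborel_pair.Fubini') measurable
  also have "\<dots> = (\<integral>\<^sup>+y. (0::ennreal) \<partial>(lborel :: 'a measure))"
  proof (rule nn_integral_cong)
    fix y
    have "(\<integral>\<^sup>+v. ?f y v \<partial>lborel) \<le> (\<integral>\<^sup>+v. indicator {u y} v \<partial>lborel)"
      by (intro nn_integral_mono) (auto simp: indicator_def)
    then show "(\<integral>\<^sup>+v. ?f y v \<partial>lborel) = 0" by simp
  qed
  finally have "(\<integral>\<^sup>+v. \<integral>\<^sup>+y. ?f y v \<partial>lborel \<partial>lborel) = 0" by simp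
  then have "AE v in lborel. (\<integral>\<^sup>+y. ?f y v \<partial>lborel) = 0"
    by (subst (asm) nn_integral_0_iff_AE) measurable
  then show ?thesis by (subst (asm) nn_integral_indicator) measurable
qed

lemma integrable_flux_pair:
  fixes a :: "real \<Rightarrow> 'a::euclidean_space"
  assumes a: "continuous_on UNIV a" and [measurable]: "u \<in> borel_measurable borel"
    and \<phi>: "test_function W \<phi>" and \<zeta>: "test_function V \<zeta>"
  shows "integrable (lborel \<Otimes>\<^sub>M lborel) (\<lambda>(y, w). (if w < u y then \<zeta> w *\<^sub>R a w else 0) \<bullet> grad \<phi> y)"
proof -
  have [measurable]: "\<phi> \<in> borel_measurable borel" "grad \<phi> \<in> borel_measurable borel" "\<zeta> \<in> borel_measurable borel"
    by (auto intro: borel_measurable_smooth borel_measurable_grad test_function_smooth[OF \<phi>] test_function_smooth[OF \<zeta>])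
  have [measurable]: "a \<in> borel_measurable borel" by (rule borel_measurable_continuous_onI[OF a])
  obtain r B where r: "0 < r" and B0: "0 \<le> B" and out: "\<And>y. y \<notin> ball 0 r \<Longrightarrow> grad \<phi> y = 0" and B: "\<And>y. norm (grad \<phi> y) \<le> B"
    by (rule test_function_bounds[OF \<phi>]) (rule that; assumption)
  obtain \<rho> C where C0: "0 \<le> C" and zo: "\<And>w. w \<notin> ball 0 \<rho> \<Longrightarrow> \<zeta> w *\<^sub>R a w = 0" and C: "\<And>w. norm (\<zeta> w *\<^sub>R a w) \<le> C"
    by (rule test_scaleR_bound[OF \<zeta> a]) (rule that; assumption)
  show ?thesis unfolding lborel_prod
  proof (rule integrable_bounded_support[where B="C * B" and c=0 and r="r + \<bar>\<rho>\<bar>"])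
    show "norm (case p of (y, w) \<Rightarrow> (if w < u y then \<zeta> w *\<^sub>R a w else 0) \<bullet> grad \<phi> y) \<le> C * B" for p
    proof (cases p)
      case (Pair y w)
      have "\<bar>(\<zeta> w *\<^sub>R a w) \<bullet> grad \<phi> y\<bar> \<le> C * B"
        by (rule order_trans[OF Cauchy_Schwarz_ineq2]) (intro mult_mono C B C0 norm_ge_zero)
      then show ?thesis using Pair B0 C0 by auto
    qed
    show "(case p of (y, w) \<Rightarrow> (if w < u y then \<zeta> w *\<^sub>R a w else 0) \<bullet> grad \<phi> y) = 0" if "p \<notin> ball 0 (r + \<bar>\<rho>\<bar>)" for p
    proof (cases p)
      case (Pair y w)
      have "norm p \<le> norm y + \<bar>w\<bar>" using norm_Pair_le[of y w] by (simp add: Pair)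
      then have "y \<notin> ball 0 r \<or> w \<notin> ball 0 \<rho>" using that by (auto simp: dist_norm)
      then have "grad \<phi> y = 0 \<or> \<zeta> w *\<^sub>R a w = 0" using out[of y] zo[of w] by argo
      then show ?thesis unfolding Pair by (elim disjE) auto
    qed
  qed (unfold borel_prod[symmetric], measurable)
qed

lemma integral_flux_inner:
  fixes a :: "real \<Rightarrow> 'a::euclidean_space"
  assumes a: "continuous_on UNIV a" and \<zeta>: "test_function V \<zeta>"
  shows "flux a \<zeta> s \<bullet> g = (LINT w|lborel. (if w < s then \<zeta> w *\<^sub>R a w else 0) \<bullet> g)"
proof -
  have "integrable lborel (\<lambda>w. (if w < s then \<zeta> w *\<^sub>R a w else 0))"
    using integrable_test_scaleR[OF \<zeta> a] 
    by (intro Bochner_Integration.integrable_bound[OF integrable_test_scaleR[OF \<zeta> a]])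
       (use borel_measurable_integrable[OF integrable_test_scaleR[OF \<zeta> a]] in \<open>auto intro!: measurable_If\<close>)
  then show ?thesis by (simp add: flux_def)
qed

text \<open>Fubini writes the flux as a superposition over levels; almost every level has a null
  level set and falls under \<open>level_invariant\<close>.\<close>

lemma flux_zero:
  fixes u :: "'a::euclidean_space \<Rightarrow> real" and A a :: "real \<Rightarrow> 'a"
  assumes W: "open W" and um [measurable]: "u \<in> borel_measurable borel" and u: "continuous_on W u"
    and A: "\<And>v. (A has_vector_derivative a v) (at v)" and a: "continuous_on UNIV a"
    and up: "\<And>v \<psi>. test_function W \<psi> \<Longrightarrow> (\<And>x. 0 \<le> \<psi> x) \<Longrightarrow> 0 \<le> (LINT x|lborel. (if v < u x then A (u x) - A v else 0) \<bullet> grad \<psi> x)"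
    and lo: "\<And>v \<psi>. test_function W \<psi> \<Longrightarrow> (\<And>x. 0 \<le> \<psi> x) \<Longrightarrow> 0 \<le> (LINT x|lborel. (if u x < v then A v - A (u x) else 0) \<bullet> grad \<psi> x)"
    and \<phi>: "test_function W \<phi>" and \<zeta>: "test_function V \<zeta>"
  shows "(LINT y|lborel. flux a \<zeta> (u y) \<bullet> grad \<phi> y) = 0"
proof -
  have [measurable]: "W \<in> sets borel" using W by simp
  have gW: "grad \<phi> y = 0" if "y \<notin> W" for y by (rule grad_test_function_outside[OF \<phi> that])
  let ?f = "\<lambda>y w. (if w < u y then \<zeta> w *\<^sub>R a w else 0) \<bullet> grad \<phi> y"
  have "(LINT y|lborel. flux a \<zeta> (u y) \<bullet> grad \<phi> y) = (LINT y|lborel. LINT w|lborel. ?f y w)"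
    by (simp add: integral_flux_inner[OF a \<zeta>])
  also have "\<dots> = (LINT w|lborel. LINT y|lborel. ?f y w)"
    using lborel_pair.Fubini_integral[OF integrable_flux_pair[OF a um \<phi> \<zeta>]] by simp
  also have "\<dots> = 0"
  proof (rule integral_eq_zero_AE)
    from null_levels[OF um \<open>W \<in> sets borel\<close>]
    show "AE w in lborel. (LINT y|lborel. ?f y w) = 0"
    proof eventually_elim
      fix w assume n: "emeasure lborel {y \<in> W. u y = w} = 0"
      have "(LINT y|lborel. ?f y w) = (LINT y|lborel. \<zeta> w * (indicator {y\<in>W. w < u y} y * (a w \<bullet> grad \<phi> y)))"
        by (intro Bochner_Integration.integral_cong) (use gW in \<open>auto simp: indicator_def\<close>)
      also have "\<dots> = \<zeta> w * (LINT y|lborel. indicator {y\<in>W. w < u y} y * (a w \<bullet> grad \<phi> y))" by simp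
      also have "(LINT y|lborel. indicator {y\<in>W. w < u y} y * (a w \<bullet> grad \<phi> y)) = 0"
        by (rule level_invariant[where A=A, OF W um u A _ _ n \<phi>]) (fact up, fact lo)
      finally show "(LINT y|lborel. ?f y w) = 0" by simp
    qed
  qed
  finally show ?thesis .
qed

text \<open>The derivative of the ramp integrates to zero against the bump, is positive on the slab
  up to O(1 / T) and at least -2 / T elsewhere. Its negative part may be spread over all levels, so
  the finite mass of the whole cylinder is what lets it vanish as T grows.\<close>

lemma measure_zero:
  fixes \<mu> :: "('a::euclidean_space \<times> real) measure"
  assumes sets: "sets \<mu> = sets (restrict_space borel (\<Omega> \<times> UNIV))"
    and R: "0 < R" "cball x R \<subseteq> W" "W \<subseteq> \<Omega>" and fin: "emeasure \<mu> (ball x R \<times> UNIV) < \<infinity>"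
    and Z: "\<And>\<phi> \<zeta>. test_function W \<phi> \<Longrightarrow> test_function UNIV \<zeta> \<Longrightarrow> (LINT p|\<mu>. \<phi> (fst p) * deriv \<zeta> (snd p)) = 0"
  shows "emeasure \<mu> (ball x (R / 2) \<times> UNIV) = 0"
proof -
  have meas: "f \<in> \<mu> \<rightarrow>\<^sub>M N" if "f \<in> borel \<rightarrow>\<^sub>M N" for f and N :: "'b measure"
    using measurable_restrict_space1[OF that] measurable_cong_sets[OF sets refl] by blast
  have setsI: "S \<in> sets \<mu>" if "S \<in> sets borel" "S \<subseteq> ball x R \<times> UNIV" for S
  proof -
    have "S = (\<Omega> \<times> UNIV) \<inter> S" using that R by fastforce
    then show ?thesis unfolding sets sets_restrict_space using that(1) by blast
  qed
  define c0 where "c0 = hh 0 (R\<^sup>2 * (3/4))"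
  have c0: "0 < c0" unfolding c0_def using R by (intro hh_pos) auto
  have blow: "c0 \<le> bump x R 1 y" if "y \<in> ball x (R/2)" for y
  proof -
    have "(norm (y - x))\<^sup>2 \<le> (R/2)\<^sup>2" using that by (intro power_mono) (auto simp: dist_norm norm_minus_commute)
    then show ?thesis unfolding bump_def c0_def by (intro hh_0_mono) (simp add: power2_eq_square field_simps)
  qed
  let ?BB = "ball x R \<times> (UNIV::real set)"
  have BBm: "?BB \<in> sets \<mu>" by (rule setsI) (auto intro!: borel_open open_Times)
  let ?m = "measure \<mu> ?BB"
  have tb: "test_function W (bump x R 1)" by (rule test_function_bump) (use R in auto)
  have slab: "emeasure \<mu> (ball x (R/2) \<times> {w + h..w + m}) = 0" if h: "0 < h" and m: "0 < m" for w h m :: real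
  proof -
    let ?S = "ball x (R/2) \<times> {w + h..w + m}"
    have Sb: "?S \<subseteq> ?BB" using R by auto
    have Sm: "?S \<in> sets \<mu>" by (rule setsI[OF _ Sb]) (auto intro!: borel_Times) 
    have Sfin: "emeasure \<mu> ?S < \<infinity>" using emeasure_mono[OF Sb BBm] fin by (rule le_less_trans)
    let ?k = "c0 * (exp (-3) / m\<^sup>2 * h)"
    have k: "0 < ?k" using c0 h m by simp
    have *: "?k * measure \<mu> ?S \<le> 2 / T * ?m" if T: "2 * m \<le> T" for T
    proof -
      have T0: "0 < T" using T m by simp
      have tr: "test_function UNIV (ramp w h T)" by (rule test_function_ramp[OF h T0])
      let ?g = "\<lambda>p. ?k * indicator ?S p - 2 / T * indicator ?BB p"
      let ?f = "\<lambda>p. bump x R 1 (fst p) * deriv (ramp w h T) (snd p)"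
      obtain D where D: "\<And>v. \<bar>deriv (ramp w h T) v\<bar> \<le> D" using test_function_deriv_bounded[OF tr] by blast
      have dm: "deriv (ramp w h T) \<in> borel_measurable borel" by (rule borel_measurable_deriv_smooth[OF test_function_smooth[OF tr]])
      have fi: "integrable \<mu> ?f"
      proof (rule integrableI_bounded_set[where A="?BB" and B="\<bar>D\<bar>"])
        show "?f \<in> borel_measurable \<mu>"
          by (rule meas, unfold borel_prod[symmetric]) (use dm borel_measurable_smooth[OF smooth_bump[of x R 1]] in measurable)
        show "AE p in \<mu>. p \<in> ?BB \<longrightarrow> norm (?f p) \<le> \<bar>D\<bar>"
        proof (intro AE_I2 impI)
          fix p
          have "\<bar>bump x R 1 (fst p)\<bar> * \<bar>deriv (ramp w h T) (snd p)\<bar> \<le> 1 * \<bar>D\<bar>"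
            using bump_le_1[of x R 1] bump_nonneg[of x R 1] D[of "snd p"] by (intro mult_mono) auto
          then show "norm (?f p) \<le> \<bar>D\<bar>" by (simp add: abs_mult)
        qed
        show "AE p in \<mu>. p \<notin> ?BB \<longrightarrow> ?f p = 0"
        proof (intro AE_I2 impI)
          fix p assume "p \<notin> ?BB"
          then have "R \<le> norm (fst p - x)" by (cases p) (auto simp: dist_norm norm_minus_commute)
          then show "?f p = 0" using R by (simp add: bump_eq_0)
        qed
      qed (use BBm fin in auto)
      have gi: "integrable \<mu> ?g"
        using Sm BBm Sfin fin by (intro Bochner_Integration.integrable_diff integrable_mult_right) (auto simp: integrable_indicator_iff)
      have "(LINT p|\<mu>. ?g p) \<le> (LINT p|\<mu>. ?f p)"
      proof (rule integral_mono[OF gi fi])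
        fix p
        let ?d = "deriv (ramp w h T) (snd p)" and ?b = "bump x R 1 (fst p)"
        have b: "0 \<le> ?b" "?b \<le> 1" using bump_le_1[of x R 1] bump_nonneg[of x R 1] by auto
        have d: "-(2/T) \<le> ?d" by (rule deriv_ramp_ge(1)[OF h T0])
        have bT: "?b * (2/T) \<le> 2/T" using b T0 by (simp add: mult_left_le_one_le divide_right_mono)
        consider "p \<in> ?S" | "p \<notin> ?S" "p \<in> ?BB" | "p \<notin> ?BB" by blast
        then show "?g p \<le> ?f p"
        proof cases
          case 1
          then have "exp (-3) / m\<^sup>2 * h - 2/T \<le> ?d" by (intro deriv_ramp_ge(2)[OF h T0 _ _ T]) auto
          then have "?b * (exp (-3) / m\<^sup>2 * h - 2/T) \<le> ?f p" using b by (intro mult_left_mono) auto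
          moreover have "?k \<le> ?b * (exp (-3) / m\<^sup>2 * h)" using 1 blow[of "fst p"] h by (intro mult_right_mono) auto
          moreover have "p \<in> ?BB" using 1 Sb by blast
          ultimately show ?thesis using 1 bT by (simp add: right_diff_distrib)
        next
          case 2
          have "?b * (-(2/T)) \<le> ?f p" using b d by (intro mult_left_mono) auto
          then show ?thesis using 2 bT by simp
        next
          case 3
          then have "R \<le> norm (fst p - x)" by (cases p) (auto simp: dist_norm norm_minus_commute)
          then have "?b = 0" using R by (simp add: bump_eq_0)
          then show ?thesis using 3 Sb by (auto simp: indicator_def)
        qed
      qed
      also have "\<dots> = 0" by (rule Z[OF tb tr])
      finally show ?thesis using Sm BBm Sfin fin
        by (subst (asm) Bochner_Integration.integral_diff) (auto simp: integrable_indicator_iff intro!: integrable_mult_right)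
    qed
    have "?k * measure \<mu> ?S \<le> 0"
    proof (rule field_le_epsilon)
      fix e :: real assume e: "0 < e"
      define T where "T = 2 * m + 2 * ?m / e"
      have T: "2 * m \<le> T" "0 < T" "2 * ?m / e \<le> T" using m e by (auto simp: T_def add_pos_nonneg)
      have "2 / T * ?m \<le> e" using T e by (simp add: field_simps)
      then show "?k * measure \<mu> ?S \<le> 0 + e" using *[OF T(1)] by simp
    qed
    then have "measure \<mu> ?S = 0" using k by (smt (verit) measure_nonneg mult_pos_pos)
    then show ?thesis using Sfin emeasure_eq_ennreal_measure[of \<mu> ?S] by (simp add: top.not_eq_extremum)
  qed
  \<comment> \<open>The interval from -n to n in the form demanded by \<open>slab\<close>: w = - n -
    1, h = 1 and m = 2 n + 1.\<close>
  have "emeasure \<mu> (\<Union>n. ball x (R/2) \<times> {- real n - 1 + 1..- real n - 1 + (2 * real n + 1)}) = 0"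
  proof (rule emeasure_UN_eq_0)
    show "emeasure \<mu> (ball x (R/2) \<times> {- real n - 1 + 1..- real n - 1 + (2 * real n + 1)}) = 0" for n
      by (rule slab) auto
    show "range (\<lambda>n. ball x (R/2) \<times> {- real n - 1 + 1..- real n - 1 + (2 * real n + 1)}) \<subseteq> sets \<mu>"
      using R by (auto intro!: setsI borel_Times)
  qed
  moreover have "(\<Union>n. ball x (R/2) \<times> {- real n - 1 + 1..- real n - 1 + (2 * real n + 1)}) = ball x (R/2) \<times> UNIV"
  proof (intro equalityI subsetI)
    fix p assume p: "p \<in> ball x (R/2) \<times> (UNIV::real set)"
    obtain n where "\<bar>snd p\<bar> \<le> real n" using real_arch_simple by blast
    then show "p \<in> (\<Union>n. ball x (R/2) \<times> {- real n - 1 + 1..- real n - 1 + (2 * real n + 1)})"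
      using p by (cases p) (auto intro!: exI[of _ n])
  qed auto
  ultimately show ?thesis by simp
qed

subsection \<open>Entropy solutions and their Borel representatives\<close>

lemma C1_flux_bounds:
  fixes a :: "real \<Rightarrow> 'a::euclidean_space"
  assumes "a C1_differentiable_on UNIV"
  obtains L where "1 \<le> L" "\<And>v. v \<in> {x..y} \<Longrightarrow> norm (a v) \<le> L"
    "\<And>v w. v \<in> {x..y} \<Longrightarrow> w \<in> {x..y} \<Longrightarrow> norm (a v - a w) \<le> L * \<bar>v - w\<bar>"
proof -
  from assms obtain D where D: "\<And>v. (a has_vector_derivative D v) (at v)" and cD: "continuous_on UNIV D"
    unfolding C1_differentiable_on_def by blast
  have ca: "continuous_on UNIV a"
    using D by (intro continuous_at_imp_continuous_on ballI) (blast intro: has_vector_derivative_continuous)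
  have bdd: "\<exists>B. \<forall>v\<in>{x..y}. norm (f v) \<le> B" if "continuous_on UNIV f" for f :: "real \<Rightarrow> 'a"
  proof -
    have "bounded (f ` {x..y})"
      using that by (intro compact_imp_bounded compact_continuous_image) (auto intro: continuous_on_subset)
    then show ?thesis unfolding bounded_iff by simp
  qed
  obtain B1 B2 where B: "\<And>v. v \<in> {x..y} \<Longrightarrow> norm (a v) \<le> B1" "\<And>v. v \<in> {x..y} \<Longrightarrow> norm (D v) \<le> B2"
    using bdd[OF ca] bdd[OF cD] by blast
  let ?L = "1 + \<bar>B1\<bar> + \<bar>B2\<bar>"
  show ?thesis
  proof (rule that[of ?L])
    show "norm (a v) \<le> ?L" if "v \<in> {x..y}" for v using B(1)[OF that] by linarith
    show "norm (a v - a w) \<le> ?L * \<bar>v - w\<bar>" if vw: "v \<in> {x..y}" "w \<in> {x..y}" for v w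
    proof -
      have "norm (a v - a w) \<le> ?L * norm (v - w)"
      proof (rule differentiable_bound[where S="{x..y}" and f'="\<lambda>v h. h *\<^sub>R D v", OF _ _ _ vw])
        show "(a has_derivative (\<lambda>h. h *\<^sub>R D z)) (at z within {x..y})" for z
          using D[of z] has_derivative_at_withinI unfolding has_vector_derivative_def by blast
        show "onorm (\<lambda>h. h *\<^sub>R D z) \<le> ?L" if "z \<in> {x..y}" for z
        proof (rule onorm_bound)
          fix h :: real
          have "norm (D z) \<le> ?L" using B(2)[OF that] by linarith
          then have "\<bar>h\<bar> * norm (D z) \<le> \<bar>h\<bar> * ?L" by (rule mult_left_mono) simp
          then show "norm (h *\<^sub>R D z) \<le> ?L * norm h" by (simp add: mult.commute)
        qed simp
      qed simp
      then show ?thesis by simp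
    qed
  qed simp
qed

text \<open>If |a v . \<xi>| were below c s^P on a whole interval of length s, the measure bound
  would give s \<le> C (c s^P)^\<alpha>. The constant c makes C c^\<alpha> = 1/2, and P \<alpha>
  \<ge> 1 with s \<le> 1 bounds the right-hand side by s / 2.\<close>

lemma gn_flux_instance:
  fixes a :: "real \<Rightarrow> 'a::euclidean_space"
  assumes gn: "genuinely_nonlinear a I" and I: "{al..be} \<subseteq> I" "al \<le> be" and cl: "closed I"
  obtains La c P where "gn_flux a al be La c P"
proof -
  have C1: "a C1_differentiable_on UNIV" using gn by (simp add: genuinely_nonlinear_def)
  then have ca: "continuous_on UNIV a" by (rule C1_differentiable_imp_continuous_on)
  obtain L where L: "1 \<le> L" "\<And>v. v \<in> {al - 3..be + 3} \<Longrightarrow> norm (a v) \<le> L"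
    "\<And>v w. v \<in> {al - 3..be + 3} \<Longrightarrow> w \<in> {al - 3..be + 3} \<Longrightarrow> norm (a v - a w) \<le> L * \<bar>v - w\<bar>"
    by (rule C1_flux_bounds[OF C1]) (rule that; assumption)
  obtain \<alpha> C where \<alpha>: "0 < \<alpha>" "\<alpha> \<le> 1" and C: "0 < C" and bd:
    "\<And>\<xi> \<delta>. norm \<xi> = 1 \<Longrightarrow> 0 < \<delta> \<Longrightarrow> emeasure lborel {v\<in>I. \<bar>a v \<bullet> \<xi>\<bar> < \<delta>} \<le> ennreal (C * \<delta> powr \<alpha>)"
    using gn unfolding genuinely_nonlinear_def by blast
  define c where "c = (1 / (2 * C)) powr (1 / \<alpha>)"
  have c: "0 < c" "c powr \<alpha> = 1 / (2 * C)" using C \<alpha> by (auto simp: c_def powr_powr)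
  obtain P :: nat where P: "1 / \<alpha> \<le> real P" using real_arch_simple by blast
  have P1: "1 \<le> real P * \<alpha>" using P \<alpha> by (simp add: field_simps)
  show ?thesis
  proof (rule that[of L c P], unfold_locales)
    fix w s :: real and \<xi> :: 'a
    assume w: "al \<le> w" "w + s \<le> be" and s: "0 < s" "s \<le> 1" and \<xi>: "norm \<xi> = 1"
    show "\<exists>v\<in>{w..w + s}. c * s ^ P \<le> \<bar>a v \<bullet> \<xi>\<bar>"
    proof (rule ccontr)
      assume "\<not> ?thesis"
      then have sub: "{w..w + s} \<subseteq> {v\<in>I. \<bar>a v \<bullet> \<xi>\<bar> < c * s ^ P}" using I w by force
      have "open {v. \<bar>a v \<bullet> \<xi>\<bar> < c * s ^ P}" using ca by (intro open_Collect_less continuous_intros)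
      then have m: "{v\<in>I. \<bar>a v \<bullet> \<xi>\<bar> < c * s ^ P} \<in> sets lborel"
        using cl by (auto simp: Collect_conj_eq intro!: sets.Int borel_open borel_closed)
      have "ennreal s = emeasure lborel {w..w + s}" using s by simp
      also have "\<dots> \<le> ennreal (C * (c * s ^ P) powr \<alpha>)"
        using emeasure_mono[OF sub m] bd[OF \<xi>, of "c * s ^ P"] c s by (auto intro: order_trans)
      finally have "s \<le> C * (c * s ^ P) powr \<alpha>" using C by (subst (asm) ennreal_le_iff) auto
      also have "(c * s ^ P) powr \<alpha> = c powr \<alpha> * s powr (real P * \<alpha>)"
        using c s by (simp add: powr_mult powr_realpow[symmetric] powr_powr)
      also have "C * (c powr \<alpha> * s powr (real P * \<alpha>)) = s powr (real P * \<alpha>) / 2" using c C by simp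
      also have "\<dots> \<le> s powr 1 / 2" using P1 s by (intro divide_right_mono powr_mono') auto
      finally show False using s by simp
    qed
  qed (use L I c ca in auto)
qed

text \<open>Clamping a Borel version to a compact interval makes the range condition hold at every
  point. The interval is I cut off at the essential bound of |u|; it is nonempty because a nonempty
  open set is not null.\<close>

lemma borel_representative:
  fixes u :: "'a::euclidean_space \<Rightarrow> real"
  assumes u: "Linfty \<Omega> u" and \<Omega>: "open \<Omega>" "\<Omega> \<noteq> {}" and I: "is_interval I" "closed I" "AE x in lebesgue_on \<Omega>. u x \<in> I"
  obtains al be u0 where "al \<le> be" "{al..be} \<subseteq> I" "u0 \<in> borel_measurable borel" "range u0 \<subseteq> {al..be}"
    "AE x in lborel. x \<in> \<Omega> \<longrightarrow> u x = u0 x"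
proof -
  obtain M where M: "AE x in lebesgue_on \<Omega>. \<bar>u x\<bar> \<le> M" and um: "u \<in> borel_measurable (lebesgue_on \<Omega>)"
    using u by (auto simp: Linfty_def)
  have \<Omega>s: "\<Omega> \<in> sets lebesgue" using \<Omega>(1) by auto
  let ?J = "I \<inter> {- M..M}"
  have "AE x in lebesgue. x \<in> \<Omega> \<longrightarrow> u x \<in> ?J"
    using M I(3) \<Omega>s by (subst (asm) (1 2) AE_restrict_space_iff) auto
  then have J: "AE x in lborel. x \<in> \<Omega> \<longrightarrow> u x \<in> ?J" by (simp add: AE_completion_iff)
  have "?J \<noteq> {}"
  proof
    assume "?J = {}"
    then have "AE x in lborel. x \<in> \<Omega> \<longrightarrow> False" using J by simp
    then show False using AE_open_contradiction \<Omega> by blast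
  qed
  moreover have "is_interval ?J" "compact ?J"
    using I(1,2) by (auto intro!: is_interval_Int is_interval_cc closed_Int_compact)
  moreover obtain al be where "?J = cbox al be"
    using calculation(2,3) is_interval_compact[of ?J] by blast
  ultimately have ab: "?J = {al..be}" "al \<le> be" by auto
  have "(\<lambda>x. if x \<in> \<Omega> then u x else 0) \<in> borel_measurable lebesgue"
    using um by (simp add: borel_measurable_if[OF \<Omega>s])
  then obtain g where g: "g \<in> borel_measurable lborel" "AE x in lborel. (if x \<in> \<Omega> then u x else 0) = g x"
    using completion_ex_borel_measurable_real by blast
  show ?thesis
  proof (rule that[of al be "\<lambda>x. max al (min be (g x))"])
    show "(\<lambda>x. max al (min be (g x))) \<in> borel_measurable borel" using g(1) by simp
    show "AE x in lborel. x \<in> \<Omega> \<longrightarrow> u x = max al (min be (g x))"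
      using J g(2) by eventually_elim (auto simp: ab)
  qed (use ab in auto)
qed

text \<open>Almost everywhere the kinetic function is the indicator of v < u x minus that of v < 0.
  Tested with a product the equation thus contains the flux of u minus the flux of the constant 0,
  and the latter drops out against a test gradient. The remaining work is the passage from the
  completed measure and u to Borel measures and \<open>u0\<close>.\<close>

lemma kinetic_global_of_measure:
  fixes a :: "real \<Rightarrow> 'a::euclidean_space"
  assumes kin: "kinetic_measure a \<Omega> u \<mu>" and \<Omega>: "open \<Omega>" and a: "continuous_on UNIV a"
    and u0 [measurable]: "u0 \<in> borel_measurable borel" and ran: "range u0 \<subseteq> I"
    and eq: "AE x in lborel. x \<in> \<Omega> \<longrightarrow> u x = u0 x"
  shows "kinetic_global a I \<Omega> u0 \<mu>"
  unfolding kinetic_global_def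
proof (intro conjI allI impI)
  show "sets \<mu> = sets (restrict_space borel (\<Omega> \<times> UNIV))" using kin by (simp add: kinetic_measure_def)
  fix \<phi> :: "'a \<Rightarrow> real" and \<zeta> :: "real \<Rightarrow> real"
  assume \<phi>: "test_function \<Omega> \<phi>" and \<zeta>: "test_function UNIV \<zeta>"
  let ?\<Phi> = "\<lambda>p. \<phi> (fst p) * \<zeta> (snd p)"
  have sm: "smooth \<phi>" "smooth \<zeta>" using \<phi> \<zeta> by (auto simp: test_function_def)
  have t: "test_function (\<Omega> \<times> UNIV) ?\<Phi>"
  proof (rule test_functionI[where K="closure {x. \<phi> x \<noteq> 0} \<times> closure {v. \<zeta> v \<noteq> 0}"])
    show "smooth ?\<Phi>" by (intro smooth_mult smooth_fst smooth_snd sm)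
    show "p \<in> closure {x. \<phi> x \<noteq> 0} \<times> closure {v. \<zeta> v \<noteq> 0}" if "?\<Phi> p \<noteq> 0" for p
      using that by (auto simp: mem_Times_iff intro!: subsetD[OF closure_subset])
  qed (use \<phi> \<zeta> in \<open>auto simp: test_function_def intro!: compact_Times\<close>)
  have g: "grad (\<lambda>x. \<phi> x * \<zeta> v) x = \<zeta> v *\<^sub>R grad \<phi> x" for x v
    by (rule grad_eqI) (auto intro!: derivative_eq_intros has_derivative_grad[OF sm(1)] simp: mult.commute)
  have d: "deriv (\<lambda>v. \<phi> x * \<zeta> v) v = \<phi> x * deriv \<zeta> v" for x v
    by (intro DERIV_imp_deriv DERIV_cmult smooth_has_real_derivative sm)
  let ?H = "\<lambda>u (y, w). (if w < u y then \<zeta> w *\<^sub>R a w else 0) \<bullet> grad \<phi> y"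
  let ?Z = "\<lambda>y::'a. 0::real"
  let ?F = "\<lambda>p. kinetic_function u (fst p) (snd p) * (a (snd p) \<bullet> (\<zeta> (snd p) *\<^sub>R grad \<phi> (fst p)))"
  have [measurable]: "\<Omega> \<in> sets borel" using \<Omega> by simp
  have gW: "grad \<phi> y = 0" if "y \<notin> \<Omega>" for y by (rule grad_test_function_outside[OF \<phi> that])
  have I1: "integrable (lborel \<Otimes>\<^sub>M lborel) (?H u0)" by (rule integrable_flux_pair[OF a u0 \<phi> \<zeta>])
  have I0: "integrable (lborel \<Otimes>\<^sub>M lborel) (?H ?Z)" by (rule integrable_flux_pair[OF a _ \<phi> \<zeta>]) simp
  have F: "integral\<^sup>L (lborel \<Otimes>\<^sub>M lborel) (?H v) = (LINT y|lborel. flux a \<zeta> (v y) \<bullet> grad \<phi> y)"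
    if "integrable (lborel \<Otimes>\<^sub>M lborel) (?H v)" for v
    using lborel_pair.integral_fst'[OF that] by (simp add: integral_flux_inner[OF a \<zeta>])
  obtain N where N: "N \<in> null_sets lborel" "{x. \<not> (x \<in> \<Omega> \<longrightarrow> u x = u0 x)} \<subseteq> N"
    using eq unfolding eventually_ae_filter by auto
  have AE1: "AE p in lborel \<Otimes>\<^sub>M (lborel :: real measure). fst p \<notin> N"
  proof (rule AE_I')
    show "N \<times> (UNIV::real set) \<in> null_sets (lborel \<Otimes>\<^sub>M lborel)"
      using lborel.times_in_null_sets1[OF N(1), of UNIV] by simp
  qed auto
  have AE2: "AE p in lborel \<Otimes>\<^sub>M (lborel :: real measure). snd p \<noteq> u0 (fst p) \<and> snd p \<noteq> 0"
  proof (rule lborel_pair.AE_pair_measure)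
    show "AE x in lborel. AE y in lborel. snd (x, y) \<noteq> u0 (fst (x, y)) \<and> snd (x, y) \<noteq> 0"
      by (auto intro: AE_lborel_singleton)
  qed measurable
  have ae: "AE p in lborel \<Otimes>\<^sub>M lborel. indicator (\<Omega> \<times> UNIV) p *\<^sub>R ?F p = ?H u0 p - ?H ?Z p"
    using AE1 AE2
  proof eventually_elim
    case (elim p)
    obtain x v where p: "p = (x, v)" by fastforce
    show ?case
    proof (cases "x \<in> \<Omega>")
      case True
      then have "u x = u0 x" using elim(1) N(2) by (auto simp: p)
      then show ?thesis using elim(2) True by (auto simp: p kinetic_function_def inner_commute)
    qed (simp add: p gW)
  qed
  have Hm: "(\<lambda>p. ?H u0 p - ?H ?Z p) \<in> borel_measurable (lborel \<Otimes>\<^sub>M lborel)"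
    by (intro borel_measurable_diff borel_measurable_integrable I1 I0)
  note lp = lborel_prod[where 'a='a and 'b=real]
  have Hl: "(\<lambda>p. ?H u0 p - ?H ?Z p) \<in> borel_measurable lebesgue"
    by (rule measurable_completion) (use Hm in \<open>simp only: lp\<close>)
  have ael: "AE p in lebesgue. ?H u0 p - ?H ?Z p = indicator (\<Omega> \<times> UNIV) p *\<^sub>R ?F p"
    using ae unfolding lp AE_completion_iff by eventually_elim (rule sym)
  have "(LINT p|\<mu>. \<phi> (fst p) * deriv \<zeta> (snd p)) = (LINT p|lebesgue_on (\<Omega> \<times> UNIV). ?F p)"
    using kin t unfolding kinetic_measure_def by (auto simp: g d)
  also have "\<dots> = (LINT p|lebesgue. indicator (\<Omega> \<times> UNIV) p *\<^sub>R ?F p)"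
    by (rule integral_restrict_space) (simp add: sets_completionI_sets borel_open open_Times \<Omega>)
  also have "\<dots> = (LINT p|lebesgue. ?H u0 p - ?H ?Z p)"
    by (rule integral_cong_AE[symmetric, OF Hl borel_measurable_AE[OF Hl ael] ael])
  also have "\<dots> = (LINT p|(lborel \<Otimes>\<^sub>M lborel). ?H u0 p - ?H ?Z p)"
    unfolding lp by (rule integral_completion) (use Hm in \<open>simp only: lp\<close>)
  also have "\<dots> = (LINT y|lborel. flux a \<zeta> (u0 y) \<bullet> grad \<phi> y) - (LINT y|lborel. flux a \<zeta> 0 \<bullet> grad \<phi> y)"
    using Bochner_Integration.integral_diff[OF I1 I0] F[OF I1] F[OF I0] by simp
  also have "\<dots> = (LINT y|lborel. flux a \<zeta> (u0 y) \<bullet> grad \<phi> y)" by (simp add: integral_grad_test[OF \<phi>])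
  finally show "(LINT y|lborel. flux a \<zeta> (u0 y) \<bullet> grad \<phi> y) = (LINT p|\<mu>. \<phi> (fst p) * deriv \<zeta> (snd p))" ..
qed (use ran in simp_all)

section \<open>Kruzhkov half entropies for the continuous representative\<close>

text \<open>Slopes (0, 1) and (-1, 0) give the two half entropies with kink at v. At the kink the
  one-sided derivatives are different, so the case s = v contradicts differentiability.\<close>

lemma entropy_pair_kink:
  fixes A a :: "real \<Rightarrow> 'a::euclidean_space"
  assumes A: "\<And>v. (A has_vector_derivative a v) (at v)" and pm: "m < p"
  shows "entropy_pair a (\<lambda>s. max (p * (s - v)) (m * (s - v))) (\<lambda>s. (if v < s then p else m) *\<^sub>R (A s - A v))"
    (is "entropy_pair a ?\<eta> ?q")
  unfolding entropy_pair_def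
proof (intro conjI allI impI)
  have \<eta>: "?\<eta> s = (if v < s then p else m) * (s - v)" for s
    using mult_right_mono[of m p "s - v"] mult_right_mono_neg[of m p "s - v"] pm by (auto simp: max_def)
  show "convex_on UNIV ?\<eta>"
  proof (rule convex_onI)
    fix t x y :: real assume t: "0 < t" "t < 1"
    have lin: "k * ((1 - t) *\<^sub>R x + t *\<^sub>R y - v) = (1 - t) * (k * (x - v)) + t * (k * (y - v))" for k
      by (simp add: algebra_simps)
    show "?\<eta> ((1 - t) *\<^sub>R x + t *\<^sub>R y) \<le> (1 - t) * ?\<eta> x + t * ?\<eta> y"
      unfolding lin using t by (intro max.boundedI add_mono mult_left_mono) auto
  qed simp
  have Ac: "continuous_on S A" for S
    using A by (intro continuous_at_imp_continuous_on ballI) (blast intro: has_vector_derivative_continuous)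
  have "?q = (\<lambda>s. p *\<^sub>R (A (max s v) - A v) + m *\<^sub>R (A (min s v) - A v))"
    by (auto simp: max_def min_def)
  then show "continuous_on UNIV ?q"
    by (simp only:) (intro continuous_intros continuous_on_compose2[OF Ac[of UNIV]] subset_UNIV)
  fix s assume d: "?\<eta> differentiable (at s)"
  have off: "(?q has_vector_derivative deriv ?\<eta> s *\<^sub>R a s) (at s)"
    if S: "open S" "s \<in> S" and k: "\<And>x. x \<in> S \<Longrightarrow> (if v < x then p else m) = k" for S k
  proof -
    have "((\<lambda>x. k * (x - v)) has_real_derivative k) (at s)" by (auto intro!: derivative_eq_intros)
    then have "(?\<eta> has_real_derivative k) (at s)"
      by (rule has_field_derivative_transform_within_open[OF _ S]) (simp only: \<eta> k)
    then have "deriv ?\<eta> s = k" by (rule DERIV_imp_deriv)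
    moreover have "((\<lambda>x. k *\<^sub>R (A x - A v)) has_vector_derivative k *\<^sub>R a s) (at s)"
      by (auto intro!: derivative_eq_intros A)
    then have "(?q has_vector_derivative k *\<^sub>R a s) (at s)"
      by (rule has_vector_derivative_transform_within_open[OF _ S]) (simp only: k)
    ultimately show ?thesis by simp
  qed
  consider "v < s" | "s < v" | "s = v" by linarith
  then show "(?q has_vector_derivative deriv ?\<eta> s *\<^sub>R a s) (at s)"
  proof cases
    case 1 then show ?thesis by (intro off[of "{v<..}" p]) auto
  next
    case 2 then show ?thesis by (intro off[of "{..<v}" m]) auto
  next
    case 3
    obtain D where "(?\<eta> has_real_derivative D) (at v)" using d 3 real_differentiable_def by blast
    then have D: "((\<lambda>x. (?\<eta> x - ?\<eta> v) / (x - v)) \<longlongrightarrow> D) (at v)" by (simp only: has_field_derivative_iff)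
    have "((\<lambda>x. (?\<eta> x - ?\<eta> v) / (x - v)) \<longlongrightarrow> p) (at_right v)"
      by (rule tendsto_eventually) (auto simp: \<eta> eventually_at_filter)
    moreover have "((\<lambda>x. (?\<eta> x - ?\<eta> v) / (x - v)) \<longlongrightarrow> m) (at_left v)"
      by (rule tendsto_eventually) (auto simp: \<eta> eventually_at_filter)
    ultimately have "p = D" "m = D"
      using D tendsto_unique trivial_limit_at_right_real trivial_limit_at_left_real unfolding filterlim_at_split by blast+
    then show ?thesis using pm by simp
  qed
qed

lemma entropy_transfer:
  fixes a :: "real \<Rightarrow> 'a::euclidean_space"
  assumes u: "entropy_solution a \<Omega> u" and \<Omega>: "open \<Omega>" and W: "W \<subseteq> \<Omega>" and v [measurable]: "v \<in> borel_measurable borel"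
    and eq: "AE x in lborel. x \<in> W \<longrightarrow> u x = v x"
    and q: "entropy_pair a \<eta> q" and \<psi>: "test_function W \<psi>" "\<And>x. 0 \<le> \<psi> x"
  shows "0 \<le> (LINT x|lborel. q (v x) \<bullet> grad \<psi> x)"
proof -
  have [measurable]: "q \<in> borel_measurable borel"
    using q by (intro borel_measurable_continuous_onI) (simp add: entropy_pair_def)
  have [measurable]: "grad \<psi> \<in> borel_measurable borel" by (rule borel_measurable_grad[OF test_function_smooth[OF \<psi>(1)]])
  have gW: "grad \<psi> y = 0" if "y \<notin> W" for y by (rule grad_test_function_outside[OF \<psi>(1) that])
  have m: "(\<lambda>x. q (v x) \<bullet> grad \<psi> x) \<in> borel_measurable lborel" by measurable
  then have ml: "(\<lambda>x. q (v x) \<bullet> grad \<psi> x) \<in> borel_measurable lebesgue" by (rule measurable_completion)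
  have ae: "AE x in lebesgue. q (v x) \<bullet> grad \<psi> x = indicator \<Omega> x *\<^sub>R (q (u x) \<bullet> grad \<psi> x)"
    using eq unfolding AE_completion_iff
  proof eventually_elim
    case (elim x)
    then show ?case using W gW[of x] by (cases "x \<in> W") auto
  qed
  have "0 \<le> (LINT x|lebesgue_on \<Omega>. q (u x) \<bullet> grad \<psi> x)"
    using u q \<psi> test_function_mono[OF \<psi>(1) W] unfolding entropy_solution_def by blast
  also have "\<dots> = (LINT x|lebesgue. indicator \<Omega> x *\<^sub>R (q (u x) \<bullet> grad \<psi> x))"
    by (rule integral_restrict_space) (simp add: sets_completionI_sets borel_open \<Omega>)
  also have "\<dots> = (LINT x|lebesgue. q (v x) \<bullet> grad \<psi> x)"
    by (rule integral_cong_AE[symmetric, OF ml borel_measurable_AE[OF ml ae] ae])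
  also have "\<dots> = (LINT x|lborel. q (v x) \<bullet> grad \<psi> x)" by (rule integral_completion[OF m])
  finally show ?thesis .
qed

lemma small_ball_finite:
  fixes \<mu> :: "('a::euclidean_space \<times> real) measure"
  assumes lim: "\<not> Limsup (at_right 0) (\<lambda>r. emeasure \<mu> (ball x r \<times> UNIV) / ennreal (r ^ d)) > 0" and e: "0 < e"
  obtains r where "0 < r" "r < e" "emeasure \<mu> (ball x r \<times> UNIV) < \<infinity>"
proof -
  have "Limsup (at_right 0) (\<lambda>r. emeasure \<mu> (ball x r \<times> UNIV) / ennreal (r ^ d)) < ennreal 1"
    using lim by (simp add: not_less)
  then have "\<forall>\<^sub>F r in at_right 0. emeasure \<mu> (ball x r \<times> UNIV) / ennreal (r ^ d) < ennreal 1"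
    by (rule Limsup_lessD)
  from eventually_happens'[OF _ eventually_conj[OF this eventually_at_right_real[OF e]]]
  obtain r where r: "emeasure \<mu> (ball x r \<times> UNIV) / ennreal (r ^ d) < ennreal 1" "r < e" "0 < r" by auto
  show ?thesis
  proof (rule that[OF r(3,2)], rule ccontr)
    assume "\<not> emeasure \<mu> (ball x r \<times> UNIV) < \<infinity>"
    then have "emeasure \<mu> (ball x r \<times> UNIV) = \<infinity>" by (simp add: less_top[symmetric])
    then show False using r by (simp add: ennreal_top_divide)
  qed
qed

section \<open>Assembly over a countable cover\<close>

theorem theorem1p3:
  fixes A a :: "real \<Rightarrow> 'a::euclidean_space"
    and \<Omega> :: "'a set" and u :: "'a \<Rightarrow> real" and I :: "real set"
    and \<mu> :: "('a \<times> real) measure"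
  assumes "\<And>v. (A has_vector_derivative a v) (at v)"
    and "open \<Omega>"
    and "entropy_solution a \<Omega> u"
    and "is_interval I" and "closed I"
    and "AE x in lebesgue_on \<Omega>. u x \<in> I"
    and "genuinely_nonlinear a I"
    and "kinetic_measure a \<Omega> u \<mu>"
  shows "emeasure \<mu> ((\<Omega> - closure (jump_set \<Omega> \<mu>)) \<times> UNIV) = 0"
proof (cases "\<Omega> = {}")
  case False
  let ?W = "\<Omega> - closure (jump_set \<Omega> \<mu>)"
  have W: "open ?W" "?W \<subseteq> \<Omega>" using assms(2) by auto
  have lim: "\<not> Limsup (at_right 0) (\<lambda>r. emeasure \<mu> (ball x r \<times> UNIV) / ennreal (r ^ (DIM('a) - 1))) > 0"
    if "x \<in> ?W" for x
  proof -
    have "x \<in> \<Omega>" "x \<notin> jump_set \<Omega> \<mu>" using that closure_subset[of "jump_set \<Omega> \<mu>"] by auto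
    then show ?thesis unfolding jump_set_def by blast
  qed
  have a: "continuous_on UNIV a"
    using assms(7) C1_differentiable_imp_continuous_on unfolding genuinely_nonlinear_def by blast
  have "Linfty \<Omega> u" using assms(3) by (simp add: entropy_solution_def)
  \<comment> \<open>Here \<Omega> must be nonempty: otherwise I might be empty and there would be no
    range of levels.\<close>
  from borel_representative[OF this assms(2) False assms(4-6)]
  obtain al be u0 where ab: "al \<le> be" "{al..be} \<subseteq> I" and u0: "u0 \<in> borel_measurable borel" "range u0 \<subseteq> {al..be}"
    and eq0: "AE x in lborel. x \<in> \<Omega> \<longrightarrow> u x = u0 x" by metis
  from gn_flux_instance[OF assms(7) ab(2,1) assms(5)] obtain La c P where "gn_flux a al be La c P" by metis
  then interpret gn_flux a al be La c P .
  have kin: "kinetic_global a {al..be} \<Omega> u0 \<mu>"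
    by (rule kinetic_global_of_measure[OF assms(8,2) a u0 eq0])
  have osc: "\<exists>r k. 0 < r \<and> (AE y in lborel. y \<in> ball x r \<longrightarrow> \<bar>u0 y - k\<bar> \<le> \<delta>)" if x: "x \<in> ?W" and \<delta>: "0 < \<delta>" for x \<delta>
  proof -
    have "x \<in> \<Omega>" using x by simp
    from small_oscillation[OF kin assms(2) this lim[OF x] \<delta>] show ?thesis by metis
  qed
  obtain v where v: "v \<in> borel_measurable borel" "continuous_on ?W v" "AE y in lborel. y \<in> ?W \<longrightarrow> u0 y = v y"
    by (rule continuous_representative[OF W(1) u0 osc]) (assumption, assumption, (rule that; assumption))
  have eq: "AE y in lborel. y \<in> ?W \<longrightarrow> u y = v y"
    using eq0 v(3) by eventually_elim auto
  have up: "0 \<le> (LINT x|lborel. (if k < v x then A (v x) - A k else 0) \<bullet> grad \<psi> x)"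
    if \<psi>: "test_function ?W \<psi>" "\<And>x. 0 \<le> \<psi> x" for k \<psi>
  proof -
    have *: "(if k < s then 1 else 0 :: real) *\<^sub>R (A s - A k) = (if k < s then A s - A k else 0)" for s by auto
    show ?thesis
      using entropy_transfer[OF assms(3,2) W(2) v(1) eq entropy_pair_kink[OF assms(1), of 0 1 k] \<psi>] by (simp only: * zero_less_one)
  qed
  have lo: "0 \<le> (LINT x|lborel. (if v x < k then A k - A (v x) else 0) \<bullet> grad \<psi> x)"
    if \<psi>: "test_function ?W \<psi>" "\<And>x. 0 \<le> \<psi> x" for k \<psi>
  proof -
    have *: "(if k < s then 0 else - 1 :: real) *\<^sub>R (A s - A k) = (if s < k then A k - A s else 0)" for s by auto
    have "- 1 < (0::real)" by simp
    from entropy_transfer[OF assms(3,2) W(2) v(1) eq entropy_pair_kink[OF assms(1) this, of k] \<psi>]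
    show ?thesis by (simp only: *)
  qed
  have Z: "(LINT p|\<mu>. \<phi> (fst p) * deriv \<zeta> (snd p)) = 0" if \<phi>: "test_function ?W \<phi>" and \<zeta>: "test_function UNIV \<zeta>" for \<phi> \<zeta>
  proof -
    have gW: "grad \<phi> y = 0" if "y \<notin> ?W" for y by (rule grad_test_function_outside[OF \<phi> that])
    have int: "integrable lborel (\<lambda>y. flux a \<zeta> (w y) \<bullet> grad \<phi> y)" if "w \<in> borel_measurable borel" for w
      using lborel_pair.integrable_fst'[OF integrable_flux_pair[OF a that \<phi> \<zeta>]] by (simp add: integral_flux_inner[OF a \<zeta>])
    have "(LINT p|\<mu>. \<phi> (fst p) * deriv \<zeta> (snd p)) = (LINT y|lborel. flux a \<zeta> (u0 y) \<bullet> grad \<phi> y)"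
      using kin test_function_mono[OF \<phi> W(2)] \<zeta> unfolding kinetic_global_def by simp
    also have "\<dots> = (LINT y|lborel. flux a \<zeta> (v y) \<bullet> grad \<phi> y)"
    proof (rule integral_cong_AE)
      show "AE y in lborel. flux a \<zeta> (u0 y) \<bullet> grad \<phi> y = flux a \<zeta> (v y) \<bullet> grad \<phi> y"
        using v(3) by eventually_elim (use gW in force)
    qed (use int[OF u0(1)] int[OF v(1)] in \<open>auto intro: borel_measurable_integrable\<close>)
    also have "\<dots> = 0"
      by (rule flux_zero[where A=A, OF W(1) v(1,2) assms(1) a _ _ \<phi> \<zeta>]) (rule up, assumption+, rule lo, assumption+)
    finally show ?thesis .
  qed
  have sets: "sets \<mu> = sets (restrict_space borel (\<Omega> \<times> UNIV))" using assms(8) by (simp add: kinetic_measure_def)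
  have "\<exists>\<rho>>0. ball x \<rho> \<subseteq> ?W \<and> emeasure \<mu> (ball x \<rho> \<times> UNIV) = 0" if x: "x \<in> ?W" for x
  proof -
    obtain e where e: "0 < e" "ball x e \<subseteq> ?W" using W(1) x open_contains_ball by blast
    obtain r where r: "0 < r" "r < e" "emeasure \<mu> (ball x r \<times> UNIV) < \<infinity>"
      by (rule small_ball_finite[OF lim[OF x] e(1)]) (rule that; assumption)
    have cb: "cball x r \<subseteq> ball x e" "ball x (r / 2) \<subseteq> ball x e" using r by auto
    have "emeasure \<mu> (ball x (r / 2) \<times> UNIV) = 0"
      by (rule measure_zero[OF sets r(1) subset_trans[OF cb(1) e(2)] W(2) r(3) Z])
    then show ?thesis using r(1) cb(2) e(2) by (intro exI[of _ "r / 2"]) auto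
  qed
  then obtain \<rho> where \<rho>: "\<And>x. x \<in> ?W \<Longrightarrow> 0 < \<rho> x" "\<And>x. x \<in> ?W \<Longrightarrow> ball x (\<rho> x) \<subseteq> ?W"
    "\<And>x. x \<in> ?W \<Longrightarrow> emeasure \<mu> (ball x (\<rho> x) \<times> UNIV) = 0" by metis
  have Un: "\<Union> ((\<lambda>x. ball x (\<rho> x)) ` ?W) = ?W" using \<rho>(1,2) by force
  \<comment> \<open>The null balls form an uncountable family; their union with the level axis is
    null only after the reduction to a countable subcover.\<close>
  obtain F where F: "F \<subseteq> (\<lambda>x. ball x (\<rho> x)) ` ?W" "countable F" "\<Union>F = \<Union> ((\<lambda>x. ball x (\<rho> x)) ` ?W)"
    using Lindelof[of "(\<lambda>x. ball x (\<rho> x)) ` ?W"] by blast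
  have "(\<Union>B\<in>F. B \<times> UNIV) \<in> null_sets \<mu>"
  proof (rule null_sets_UN'[OF F(2)])
    fix B assume "B \<in> F"
    then obtain x where x: "x \<in> ?W" "B = ball x (\<rho> x)" using F(1) by blast
    have "B \<times> UNIV = (\<Omega> \<times> UNIV) \<inter> (B \<times> UNIV)" using x \<rho>(2)[of x] by auto
    moreover have "B \<times> (UNIV::real set) \<in> sets borel" using x by (auto intro!: borel_open open_Times)
    ultimately have "B \<times> (UNIV::real set) \<in> sets \<mu>" unfolding sets sets_restrict_space by blast
    then show "B \<times> UNIV \<in> null_sets \<mu>" using \<rho>(3)[OF x(1)] x(2) by (intro null_setsI) auto
  qed
  moreover have "(\<Union>B\<in>F. B \<times> UNIV) = ?W \<times> (UNIV::real set)" using F(3) Un by (auto simp flip: UN_simps)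
  ultimately show ?thesis by (simp add: null_setsD1)
qed simp

end
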